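(* Let $m$ be an odd positive integer, let $\mathbb{F}_q$ be a finite field with $q$ elements, $v=\sqrt{q}$, and let $\mathcal{A}$ be an essentially small, finitary, hereditary abelian $\mathbb{F}_q$-category. Let $\mathcal{DH}_m(\mathcal{A})$ be the $m$-periodic derived Hall algebra of $\mathcal{A}$ and let $\mathcal{DH}_m^{\rm e}(\mathcal{A})$ be the $m$-periodic extended derived Hall algebra of $\mathcal{A}$ (both as defined in the context). Then there exists an embedding of algebras (an injective homomorphism of $\mathbb{C}$-algebras) $\varphi_m:\mathcal{DH}_m(\mathcal{A})\to\mathcal{DH}_m^{\rm e}(\mathcal{A})$ defined on basis elements as follows, for any $M_i\in\mathcal{A}$ with $i\in\mathbb{Z}_m$ (all indices of the $M_j$ being read modulo $m$): if $m=1$, $$u_{M_0}\mapsto u_{M_0}K_{-\frac12\hat M_0};$$ if $m>1$, $$u_{\bigoplus_{i\in\mathbb{Z}_m}M_i[i]}\mapsto v^{e(M)}\,u_{\bigoplus_{i\in\mathbb{Z}_m}M_i[i]}\prod_{i\in\mathbb{Z}_m}K_{-\frac12\sum_{k=0}^{m-1}(-1)^k\hat M_{i+1+k},\,i},$$ where $$e(M)=\frac14\sum_{i=1}^{m-1}\Big\langle\sum_{k=0}^{m-1}(-1)^k\hat M_{i+k},\sum_{k=0}^{m-1}(-1)^k\hat M_{i+1+k}\Big\rangle-\frac14\Big\langle\sum_{k=0}^{m-1}(-1)^k\hat M_{1+k},\sum_{k=0}^{m-1}(-1)^k\hat M_{k}\Big\rangle+\sum_{i=0}^{m-1}\Big\langle\hat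 M_i,\sum_{k=1}^{m-1}(-1)^k\hat M_{i+k}\Big\rangle .$$
   Context: **Standing notation.** $\mathcal{A}$ is hereditary ($\mathrm{Ext}^2_{\mathcal{A}}(-,-)=0$) and finitary: $\mathrm{Hom}_{\mathcal{A}}(M,N)$ and $\mathrm{Ext}^1_{\mathcal{A}}(M,N)$ are finite dimensional over $\mathbb{F}_q$ for all $M,N\in\mathcal{A}$. $D^b(\mathcal{A})$ is the bounded derived category with shift functor $[1]$. $\mathrm{Iso}(\mathcal{A})$ is the set of isomorphism classes $[M]$ of objects of $\mathcal{A}$, and $a_M:=|\mathrm{Aut}_{\mathcal{A}}(M)|$. $K(\mathcal{A})$ is the Grothendieck group of $\mathcal{A}$, $\hat M$ is the class of $M$ in $K(\mathcal{A})$, and $\frac12K(\mathcal{A}):=\{\frac12\alpha\mid\alpha\in K(\mathcal{A})\}$ is the abelian group of (formal) halves of elements of $K(\mathcal{A})$, with $\frac12\alpha+\frac12\beta=\frac12(\alpha+\beta)$; an element $\alpha\in K(\mathcal{A})$ is regarded as the element $\frac12(2\alpha)$ of $\frac12K(\mathcal{A})$. $\mathbb{Z}_m=\mathbb{Z}/m\mathbb{Z}=\{0,1,\dots,m-1\}$; subscripts $i\in\mathbb{Z}_m$ are read modulo $m$. The number $v=\sqrt q$ is the positive square root, and fractional powers of $v$ are positive real. **Euler forms.** $\langle M,N\rangle:=\dim_{\mathbb{F}_q}\mathrm{Hom}_{\mathcal{A}}(M,N)-\dim_{\mathbb{F}_q}\mathrm{Ext}^1_{\mathcal{A}}(M,N)$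 descends to a bilinear form $\langle\cdot,\cdot\rangle$ on $K(\mathcal{A})$; $(\alpha,\beta):=\langle\alpha,\beta\rangle+\langle\beta,\alpha\rangle$. Both forms are extended bilinearly to $\frac12K(\mathcal{A})$ (with rational values). **Dual derived Hall numbers.** For $X,Y,L\in D^b(\mathcal{A})$ put $\{X,Y\}:=\prod_{i>0}|\mathrm{Hom}_{D^b(\mathcal{A})}(X[i],Y)|^{(-1)^i}$ and $$H_{X,Y}^L:=\frac{|\mathrm{Ext}^1_{D^b(\mathcal{A})}(X,Y)_L|}{|\mathrm{Hom}_{D^b(\mathcal{A})}(X,Y)|}\cdot\frac1{\{X,Y\}},$$ where $\mathrm{Ext}^1_{D^b(\mathcal{A})}(X,Y)_L\subseteq\mathrm{Hom}_{D^b(\mathcal{A})}(X,Y[1])$ is the subset of morphisms $X\to Y[1]$ whose cone is isomorphic to $L[1]$. **The algebra $\mathcal{DH}_m(\mathcal{A})$ ($m$ odd).** It is the $\mathbb{C}$-vector space with basis $\{u_{\bigoplus_{i\in\mathbb{Z}_m}M_i[i]}\mid[M_i]\in\mathrm{Iso}(\mathcal{A})\text{ for all }i\in\mathbb{Z}_m\}$ (basis elements indexed by tuples $([M_i])_{i\in\mathbb{Z}_m}$) and multiplication $$u_{\bigoplus_iA_i[i]}\,u_{\bigoplus_iB_i[i]}=v^{\sum_{i\in\mathbb{Z}_m}\langle\sum_{k=0}^{m-1}(-1)^k\hat A_{i+k},\hat B_i\rangle}\sum_{[I_i],[M_i]\in\mathrm{Iso}(\mathcal{A}),\,i\in\mathbb{Z}_m}\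 \prod_{i\in\mathbb{Z}_m}\frac{H_{I_i[1]\oplus A_i,\,B_i\oplus I_{i-1}[-1]}^{M_i}}{a_{I_i}}\;u_{\bigoplus_iM_i[i]}.$$ It is known that this is an associative algebra, and that it coincides with the dual derived Hall algebra of the $m$-periodic derived category $D_m(\mathcal{A})$ defined by Xu–Chen. **The algebra $\mathcal{DH}_m^{\rm e}(\mathcal{A})$.** It is the $\mathbb{C}$-vector space with basis $$\Big\{u_{\bigoplus_{i\in\mathbb{Z}_m}M_i[i]}\prod_{i\in\mathbb{Z}_m}K_{\alpha_i,i}\ \Big|\ [M_i]\in\mathrm{Iso}(\mathcal{A}),\ \alpha_i\in\tfrac12K(\mathcal{A})\text{ for all }i\in\mathbb{Z}_m\Big\}$$ (basis elements indexed by tuples $([M_i],\alpha_i)_{i\in\mathbb{Z}_m}$) and multiplication $$\Big(u_{\bigoplus_iA_i[i]}\prod_iK_{\alpha_i,i}\Big)\Big(u_{\bigoplus_iB_i[i]}\prod_iK_{\beta_i,i}\Big)=v^{a_0}\sum_{[I_i],[M_i]\in\mathrm{Iso}(\mathcal{A}),\,i\in\mathbb{Z}_m}v^{c(I,M)}\prod_{i\in\mathbb{Z}_m}\frac{H_{I_i[1]\oplus A_i,\,B_i\oplus I_{i-1}[-1]}^{M_i}}{a_{I_i}}\;u_{\bigoplus_iM_i[i]}\prod_{i\in\mathbb{Z}_m}K_{\hat I_i+\alpha_i+\beta_i,\,i},$$ where $$a_0=\sum_{i\in\mathbb{Z}_m}\langle\hat A_i,\hat B_i\rangle+\sum_{i\in\mathbb{Z}_m}(\alpha_i,\hat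 B_i-\hat B_{i+1})+\sum_{i=1}^{m-1}(\alpha_i,\beta_{i-1})-(\alpha_{m-1},\beta_0),$$ $$c(I,M)=-(\hat I_{m-1},\alpha_0+\beta_0)+\sum_{i=1}^{m-1}(\hat I_i,\alpha_{i-1}+\beta_{i-1})+\sum_{i\in\mathbb{Z}_m}\langle\hat M_i-\hat M_{i+1},\hat I_i\rangle+\sum_{i=1}^{m-1}\langle\hat I_{i-1},\hat I_i\rangle-\langle\hat I_0,\hat I_{m-1}\rangle.$$ In these two formulas, by convention, $\sum_{i=1}^{m-1}x_i$ means $x_1$ if $m=1$ (with the index of all objects read modulo $1$). It is known that $\mathcal{DH}_m^{\rm e}(\mathcal{A})$ is an associative algebra. When $m=1$ one writes $K_\alpha$ for $K_{\alpha,0}$ and $u_{M_0}$ for $u_{M_0[0]}$. *)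

theory Defs
  imports
    Complex_Main
    "HOL-Library.FuncSet"
    "HOL-Library.Groups_Big_Fun"
    "HOL-Algebra.Module"
    "HOL-Algebra.Free_Abelian_Groups"
    "Jordan_Normal_Form.Missing_VectorSpace"
begin

section \<open>Linear and abelian categories\<close>

text \<open>A category is small by construction: its objects form a set \<open>Ob\<close> of elements of a type, so
  an essentially small category is represented by a small category equivalent to it. The hom-sets
  are vector spaces in the sense of HOL-Algebra (the ring fields \<open>mult\<close> and \<open>one\<close> of
  \<^typ>\<open>('k,'a) module\<close> are unused). Hom-sets are not required to be disjoint, so every notion
  below names the source and target of the morphisms it speaks about.\<close>

record ('o, 'a, 'k) lincat =
  Ob :: "'o set"
  Hom :: "'o \<Rightarrow> 'o \<Rightarrow> ('k, 'a) module"
  Idn :: "'o \<Rightarrow> 'a"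
  Comp :: "'a \<Rightarrow> 'a \<Rightarrow> 'a"  (infixl \<open>\<bullet>\<index>\<close> 75)

definition linear_category :: "'k ring \<Rightarrow> ('o, 'a, 'k) lincat \<Rightarrow> bool" where
  "linear_category F C \<longleftrightarrow>
    (\<forall>X\<in>Ob C. \<forall>Y\<in>Ob C. vectorspace F (Hom C X Y)) \<and>
    (\<forall>X\<in>Ob C. Idn C X \<in> carrier (Hom C X X)) \<and>
    (\<forall>X\<in>Ob C. \<forall>Y\<in>Ob C. \<forall>f\<in>carrier (Hom C X Y).
       f \<bullet>\<^bsub>C\<^esub> Idn C X = f \<and> Idn C Y \<bullet>\<^bsub>C\<^esub> f = f) \<and>
    (\<forall>X\<in>Ob C. \<forall>Y\<in>Ob C. \<forall>Z\<in>Ob C.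
       \<forall>f\<in>carrier (Hom C X Y). \<forall>g\<in>carrier (Hom C Y Z). g \<bullet>\<^bsub>C\<^esub> f \<in> carrier (Hom C X Z)) \<and>
    (\<forall>W\<in>Ob C. \<forall>X\<in>Ob C. \<forall>Y\<in>Ob C. \<forall>Z\<in>Ob C.
       \<forall>f\<in>carrier (Hom C W X). \<forall>g\<in>carrier (Hom C X Y). \<forall>h\<in>carrier (Hom C Y Z).
         h \<bullet>\<^bsub>C\<^esub> (g \<bullet>\<^bsub>C\<^esub> f) = (h \<bullet>\<^bsub>C\<^esub> g) \<bullet>\<^bsub>C\<^esub> f) \<and>
    (\<forall>X\<in>Ob C. \<forall>Y\<in>Ob C. \<forall>Z\<in>Ob C.
       \<forall>f\<in>carrier (Hom C X Y). \<forall>f'\<in>carrier (Hom C X Y).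
       \<forall>g\<in>carrier (Hom C Y Z). \<forall>g'\<in>carrier (Hom C Y Z).
         g \<bullet>\<^bsub>C\<^esub> (f \<oplus>\<^bsub>Hom C X Y\<^esub> f') = (g \<bullet>\<^bsub>C\<^esub> f) \<oplus>\<^bsub>Hom C X Z\<^esub> (g \<bullet>\<^bsub>C\<^esub> f') \<and>
         (g \<oplus>\<^bsub>Hom C Y Z\<^esub> g') \<bullet>\<^bsub>C\<^esub> f = (g \<bullet>\<^bsub>C\<^esub> f) \<oplus>\<^bsub>Hom C X Z\<^esub> (g' \<bullet>\<^bsub>C\<^esub> f)) \<and>
    (\<forall>X\<in>Ob C. \<forall>Y\<in>Ob C. \<forall>Z\<in>Ob C. \<forall>c\<in>carrier F.
       \<forall>f\<in>carrier (Hom C X Y). \<forall>g\<in>carrier (Hom C Y Z).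
         g \<bullet>\<^bsub>C\<^esub> (c \<odot>\<^bsub>Hom C X Y\<^esub> f) = c \<odot>\<^bsub>Hom C X Z\<^esub> (g \<bullet>\<^bsub>C\<^esub> f) \<and>
         (c \<odot>\<^bsub>Hom C Y Z\<^esub> g) \<bullet>\<^bsub>C\<^esub> f = c \<odot>\<^bsub>Hom C X Z\<^esub> (g \<bullet>\<^bsub>C\<^esub> f))"

definition iso_arrow :: "('o, 'a, 'k) lincat \<Rightarrow> 'o \<Rightarrow> 'o \<Rightarrow> 'a \<Rightarrow> bool" where
  "iso_arrow C X Y f \<longleftrightarrow> f \<in> carrier (Hom C X Y) \<and>
    (\<exists>g\<in>carrier (Hom C Y X). g \<bullet>\<^bsub>C\<^esub> f = Idn C X \<and> f \<bullet>\<^bsub>C\<^esub> g = Idn C Y)"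

definition isomorphic :: "('o, 'a, 'k) lincat \<Rightarrow> 'o \<Rightarrow> 'o \<Rightarrow> bool" where
  "isomorphic C X Y \<longleftrightarrow> X \<in> Ob C \<and> Y \<in> Ob C \<and> (\<exists>f. iso_arrow C X Y f)"

definition zero_object :: "('o, 'a, 'k) lincat \<Rightarrow> 'o \<Rightarrow> bool" where
  "zero_object C Z \<longleftrightarrow> Z \<in> Ob C \<and>
    (\<forall>X\<in>Ob C. (\<exists>!f. f \<in> carrier (Hom C Z X)) \<and> (\<exists>!f. f \<in> carrier (Hom C X Z)))"

definition biproduct_of ::
    "('o, 'a, 'k) lincat \<Rightarrow> 'o \<Rightarrow> 'o \<Rightarrow> 'o \<times> 'a \<times> 'a \<times> 'a \<times> 'a \<Rightarrow> bool" where
  "biproduct_of C X Y = (\<lambda>(S, i, j, p, r). S \<in> Ob C \<and>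
    i \<in> carrier (Hom C X S) \<and> j \<in> carrier (Hom C Y S) \<and>
    p \<in> carrier (Hom C S X) \<and> r \<in> carrier (Hom C S Y) \<and>
    p \<bullet>\<^bsub>C\<^esub> i = Idn C X \<and> r \<bullet>\<^bsub>C\<^esub> j = Idn C Y \<and>
    p \<bullet>\<^bsub>C\<^esub> j = \<zero>\<^bsub>Hom C Y X\<^esub> \<and> r \<bullet>\<^bsub>C\<^esub> i = \<zero>\<^bsub>Hom C X Y\<^esub> \<and>
    (i \<bullet>\<^bsub>C\<^esub> p) \<oplus>\<^bsub>Hom C S S\<^esub> (j \<bullet>\<^bsub>C\<^esub> r) = Idn C S)"

definition mono_arrow :: "('o, 'a, 'k) lincat \<Rightarrow> 'o \<Rightarrow> 'o \<Rightarrow> 'a \<Rightarrow> bool" where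
  "mono_arrow C X Y f \<longleftrightarrow> f \<in> carrier (Hom C X Y) \<and>
    (\<forall>W\<in>Ob C. \<forall>g\<in>carrier (Hom C W X). \<forall>h\<in>carrier (Hom C W X). f \<bullet>\<^bsub>C\<^esub> g = f \<bullet>\<^bsub>C\<^esub> h \<longrightarrow> g = h)"

definition epi_arrow :: "('o, 'a, 'k) lincat \<Rightarrow> 'o \<Rightarrow> 'o \<Rightarrow> 'a \<Rightarrow> bool" where
  "epi_arrow C X Y f \<longleftrightarrow> f \<in> carrier (Hom C X Y) \<and>
    (\<forall>W\<in>Ob C. \<forall>g\<in>carrier (Hom C Y W). \<forall>h\<in>carrier (Hom C Y W). g \<bullet>\<^bsub>C\<^esub> f = h \<bullet>\<^bsub>C\<^esub> f \<longrightarrow> g = h)"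

text \<open>\<open>kernel_of C X Y f K k\<close>: the arrow \<open>k : K \<rightarrow> X\<close> is a kernel of \<open>f : X \<rightarrow> Y\<close>;
  \<open>cokernel_of C X Y f Q c\<close>: the arrow \<open>c : Y \<rightarrow> Q\<close> is a cokernel of \<open>f : X \<rightarrow> Y\<close>.\<close>

definition kernel_of :: "('o, 'a, 'k) lincat \<Rightarrow> 'o \<Rightarrow> 'o \<Rightarrow> 'a \<Rightarrow> 'o \<Rightarrow> 'a \<Rightarrow> bool" where
  "kernel_of C X Y f K k \<longleftrightarrow> X \<in> Ob C \<and> Y \<in> Ob C \<and> K \<in> Ob C \<and>
    f \<in> carrier (Hom C X Y) \<and> k \<in> carrier (Hom C K X) \<and> f \<bullet>\<^bsub>C\<^esub> k = \<zero>\<^bsub>Hom C K Y\<^esub> \<and>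
    (\<forall>W\<in>Ob C. \<forall>g\<in>carrier (Hom C W X). f \<bullet>\<^bsub>C\<^esub> g = \<zero>\<^bsub>Hom C W Y\<^esub> \<longrightarrow>
       (\<exists>!t. t \<in> carrier (Hom C W K) \<and> k \<bullet>\<^bsub>C\<^esub> t = g))"

definition cokernel_of :: "('o, 'a, 'k) lincat \<Rightarrow> 'o \<Rightarrow> 'o \<Rightarrow> 'a \<Rightarrow> 'o \<Rightarrow> 'a \<Rightarrow> bool" where
  "cokernel_of C X Y f Q c \<longleftrightarrow> X \<in> Ob C \<and> Y \<in> Ob C \<and> Q \<in> Ob C \<and>
    f \<in> carrier (Hom C X Y) \<and> c \<in> carrier (Hom C Y Q) \<and> c \<bullet>\<^bsub>C\<^esub> f = \<zero>\<^bsub>Hom C X Q\<^esub> \<and>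
    (\<forall>W\<in>Ob C. \<forall>g\<in>carrier (Hom C Y W). g \<bullet>\<^bsub>C\<^esub> f = \<zero>\<^bsub>Hom C X W\<^esub> \<longrightarrow>
       (\<exists>!t. t \<in> carrier (Hom C Q W) \<and> t \<bullet>\<^bsub>C\<^esub> c = g))"

definition abelian_category :: "('o, 'a, 'k) lincat \<Rightarrow> bool" where
  "abelian_category C \<longleftrightarrow>
    (\<exists>Z. zero_object C Z) \<and>
    (\<forall>X\<in>Ob C. \<forall>Y\<in>Ob C. \<exists>b. biproduct_of C X Y b) \<and>
    (\<forall>X\<in>Ob C. \<forall>Y\<in>Ob C. \<forall>f\<in>carrier (Hom C X Y).
       (\<exists>K k. kernel_of C X Y f K k) \<and> (\<exists>Q c. cokernel_of C X Y f Q c)) \<and>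
    (\<forall>X\<in>Ob C. \<forall>Y\<in>Ob C. \<forall>f. mono_arrow C X Y f \<longrightarrow> (\<exists>Z g. kernel_of C Y Z g X f)) \<and>
    (\<forall>X\<in>Ob C. \<forall>Y\<in>Ob C. \<forall>f. epi_arrow C X Y f \<longrightarrow> (\<exists>Z g. cokernel_of C Z X g Y f))"

definition short_exact :: "('o, 'a, 'k) lincat \<Rightarrow> 'o \<Rightarrow> 'o \<Rightarrow> 'o \<Rightarrow> 'a \<Rightarrow> 'a \<Rightarrow> bool" where
  "short_exact C X Y Z f g \<longleftrightarrow> kernel_of C Y Z g X f \<and> cokernel_of C X Y f Z g"

definition zero_ob :: "('o, 'a, 'k) lincat \<Rightarrow> 'o" where
  "zero_ob C = (SOME Z. zero_object C Z)"

definition biprod :: "('o, 'a, 'k) lincat \<Rightarrow> 'o \<Rightarrow> 'o \<Rightarrow> 'o \<times> 'a \<times> 'a \<times> 'a \<times> 'a" where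
  "biprod C X Y = (SOME b. biproduct_of C X Y b)"

definition dsum :: "('o, 'a, 'k) lincat \<Rightarrow> 'o \<Rightarrow> 'o \<Rightarrow> 'o" where
  "dsum C X Y = (case biprod C X Y of (S, i, j, p, r) \<Rightarrow> S)"

definition in1 :: "('o, 'a, 'k) lincat \<Rightarrow> 'o \<Rightarrow> 'o \<Rightarrow> 'a" where
  "in1 C X Y = (case biprod C X Y of (S, i, j, p, r) \<Rightarrow> i)"

definition in2 :: "('o, 'a, 'k) lincat \<Rightarrow> 'o \<Rightarrow> 'o \<Rightarrow> 'a" where
  "in2 C X Y = (case biprod C X Y of (S, i, j, p, r) \<Rightarrow> j)"

definition pr1 :: "('o, 'a, 'k) lincat \<Rightarrow> 'o \<Rightarrow> 'o \<Rightarrow> 'a" where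
  "pr1 C X Y = (case biprod C X Y of (S, i, j, p, r) \<Rightarrow> p)"

definition pr2 :: "('o, 'a, 'k) lincat \<Rightarrow> 'o \<Rightarrow> 'o \<Rightarrow> 'a" where
  "pr2 C X Y = (case biprod C X Y of (S, i, j, p, r) \<Rightarrow> r)"


section \<open>The bounded derived category\<close>

text \<open>Cochain complexes, with differential \<open>diff X n : X\<^sup>n \<rightarrow> X\<^sup>n\<^sup>+\<^sup>1\<close>.\<close>

record ('o, 'a) cochain =
  cobj :: "int \<Rightarrow> 'o"
  diff :: "int \<Rightarrow> 'a"

definition bounded_complex :: "('o, 'a, 'k) lincat \<Rightarrow> ('o, 'a) cochain \<Rightarrow> bool" where
  "bounded_complex C X \<longleftrightarrow>
    (\<forall>n. cobj X n \<in> Ob C) \<and>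
    (\<forall>n. diff X n \<in> carrier (Hom C (cobj X n) (cobj X (n + 1)))) \<and>
    (\<forall>n. diff X (n + 1) \<bullet>\<^bsub>C\<^esub> diff X n = \<zero>\<^bsub>Hom C (cobj X n) (cobj X (n + 2))\<^esub>) \<and>
    finite {n. \<not> zero_object C (cobj X n)}"

definition stalk :: "('o, 'a, 'k) lincat \<Rightarrow> 'o \<Rightarrow> ('o, 'a) cochain" where
  "stalk C M = (let S = (\<lambda>n::int. if n = 0 then M else zero_ob C) in
    \<lparr>cobj = S, diff = (\<lambda>n. \<zero>\<^bsub>Hom C (S n) (S (n + 1))\<^esub>)\<rparr>)"

text \<open>\<open>shift C k X\<close> is \<open>X[k]\<close>: \<open>X[k]\<^sup>n = X\<^sup>n\<^sup>+\<^sup>k\<close> with differential \<open>(-1)\<^sup>k d\<close>.\<close>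

definition shift :: "('o, 'a, 'k) lincat \<Rightarrow> int \<Rightarrow> ('o, 'a) cochain \<Rightarrow> ('o, 'a) cochain" where
  "shift C k X =
    \<lparr>cobj = (\<lambda>n. cobj X (n + k)),
     diff = (\<lambda>n. if even k then diff X (n + k)
                 else \<ominus>\<^bsub>Hom C (cobj X (n + k)) (cobj X (n + k + 1))\<^esub> diff X (n + k))\<rparr>"

definition csum :: "('o, 'a, 'k) lincat \<Rightarrow> ('o, 'a) cochain \<Rightarrow> ('o, 'a) cochain \<Rightarrow> ('o, 'a) cochain" where
  "csum C X Y = (let S = (\<lambda>n. dsum C (cobj X n) (cobj Y n)) in
    \<lparr>cobj = S,
     diff = (\<lambda>n.
       (in1 C (cobj X (n + 1)) (cobj Y (n + 1)) \<bullet>\<^bsub>C\<^esub> (diff X n \<bullet>\<^bsub>C\<^esub> pr1 C (cobj X n) (cobj Y n)))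
       \<oplus>\<^bsub>Hom C (S n) (S (n + 1))\<^esub>
       (in2 C (cobj X (n + 1)) (cobj Y (n + 1)) \<bullet>\<^bsub>C\<^esub> (diff Y n \<bullet>\<^bsub>C\<^esub> pr2 C (cobj X n) (cobj Y n))))\<rparr>)"

definition chain_map ::
    "('o, 'a, 'k) lincat \<Rightarrow> ('o, 'a) cochain \<Rightarrow> ('o, 'a) cochain \<Rightarrow> (int \<Rightarrow> 'a) \<Rightarrow> bool" where
  "chain_map C X Y f \<longleftrightarrow> (\<forall>n. f n \<in> carrier (Hom C (cobj X n) (cobj Y n)) \<and>
    f (n + 1) \<bullet>\<^bsub>C\<^esub> diff X n = diff Y n \<bullet>\<^bsub>C\<^esub> f n)"

definition homotopic ::
    "('o, 'a, 'k) lincat \<Rightarrow> ('o, 'a) cochain \<Rightarrow> ('o, 'a) cochain \<Rightarrow> (int \<Rightarrow> 'a) \<Rightarrow> (int \<Rightarrow> 'a) \<Rightarrow> bool" where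
  "homotopic C X Y f g \<longleftrightarrow> (\<exists>h. \<forall>n. h n \<in> carrier (Hom C (cobj X n) (cobj Y (n - 1))) \<and>
    f n \<ominus>\<^bsub>Hom C (cobj X n) (cobj Y n)\<^esub> g n =
      (diff Y (n - 1) \<bullet>\<^bsub>C\<^esub> h n) \<oplus>\<^bsub>Hom C (cobj X n) (cobj Y n)\<^esub> (h (n + 1) \<bullet>\<^bsub>C\<^esub> diff X n))"

text \<open>\<open>H\<^sup>n(X)\<close> is the cokernel of the map \<open>X\<^sup>n\<^sup>-\<^sup>1 \<rightarrow> ker d\<^sup>n\<close> through which \<open>d\<^sup>n\<^sup>-\<^sup>1\<close> factors. It is
  presented by the kernel inclusion \<open>k : K \<rightarrow> X\<^sup>n\<close> and the projection \<open>c : K \<rightarrow> H\<close>.\<close>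

definition cohomology_of ::
    "('o, 'a, 'k) lincat \<Rightarrow> ('o, 'a) cochain \<Rightarrow> int \<Rightarrow> 'o \<Rightarrow> 'a \<Rightarrow> 'o \<Rightarrow> 'a \<Rightarrow> bool" where
  "cohomology_of C X n K k H c \<longleftrightarrow>
    kernel_of C (cobj X n) (cobj X (n + 1)) (diff X n) K k \<and>
    (\<exists>t\<in>carrier (Hom C (cobj X (n - 1)) K). k \<bullet>\<^bsub>C\<^esub> t = diff X (n - 1) \<and>
       cokernel_of C (cobj X (n - 1)) K t H c)"

definition quasi_iso ::
    "('o, 'a, 'k) lincat \<Rightarrow> ('o, 'a) cochain \<Rightarrow> ('o, 'a) cochain \<Rightarrow> (int \<Rightarrow> 'a) \<Rightarrow> bool" where
  "quasi_iso C X Y f \<longleftrightarrow> chain_map C X Y f \<and>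
    (\<forall>n. \<exists>K k H c K' k' H' c'. cohomology_of C X n K k H c \<and> cohomology_of C Y n K' k' H' c' \<and>
       (\<exists>a\<in>carrier (Hom C K K'). k' \<bullet>\<^bsub>C\<^esub> a = f n \<bullet>\<^bsub>C\<^esub> k \<and>
          (\<exists>h. iso_arrow C H H' h \<and> h \<bullet>\<^bsub>C\<^esub> c = c' \<bullet>\<^bsub>C\<^esub> a)))"

text \<open>\<open>D\<^sup>b\<close> is the localisation of the bounded homotopy category at the quasi-isomorphisms; its
  morphisms \<open>X \<rightarrow> Y\<close> are classes of roofs \<open>X \<leftarrow> Z \<rightarrow> Y\<close> with \<open>rden : Z \<rightarrow> X\<close> a quasi-isomorphism.\<close>

record ('o, 'a) roof =
  rsrc :: "('o, 'a) cochain"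
  rmid :: "('o, 'a) cochain"
  rtgt :: "('o, 'a) cochain"
  rden :: "int \<Rightarrow> 'a"
  rnum :: "int \<Rightarrow> 'a"

definition is_roof :: "('o, 'a, 'k) lincat \<Rightarrow> ('o, 'a) roof \<Rightarrow> bool" where
  "is_roof C r \<longleftrightarrow>
    bounded_complex C (rsrc r) \<and> bounded_complex C (rmid r) \<and> bounded_complex C (rtgt r) \<and>
    quasi_iso C (rmid r) (rsrc r) (rden r) \<and> chain_map C (rmid r) (rtgt r) (rnum r)"

definition ccomp :: "('o, 'a, 'k) lincat \<Rightarrow> (int \<Rightarrow> 'a) \<Rightarrow> (int \<Rightarrow> 'a) \<Rightarrow> int \<Rightarrow> 'a" where
  "ccomp C g f = (\<lambda>n. g n \<bullet>\<^bsub>C\<^esub> f n)"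

definition roof_eq :: "('o, 'a, 'k) lincat \<Rightarrow> ('o, 'a) roof \<Rightarrow> ('o, 'a) roof \<Rightarrow> bool" where
  "roof_eq C r s \<longleftrightarrow> is_roof C r \<and> is_roof C s \<and> rsrc r = rsrc s \<and> rtgt r = rtgt s \<and>
    (\<exists>W u w. bounded_complex C W \<and> chain_map C W (rmid r) u \<and> chain_map C W (rmid s) w \<and>
       quasi_iso C W (rsrc r) (ccomp C (rden r) u) \<and>
       homotopic C W (rsrc r) (ccomp C (rden r) u) (ccomp C (rden s) w) \<and>
       homotopic C W (rtgt r) (ccomp C (rnum r) u) (ccomp C (rnum s) w))"

definition roof_class :: "('o, 'a, 'k) lincat \<Rightarrow> ('o, 'a) roof \<Rightarrow> ('o, 'a) roof set" where
  "roof_class C r = {s. roof_eq C r s}"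

text \<open>Two roof classes are added after bringing them to a common denominator, and composed by
  completing the middle of \<open>X \<leftarrow> Z \<rightarrow> Y \<leftarrow> Z' \<rightarrow> Y'\<close> to a square, commutative up to homotopy,
  with a quasi-isomorphism \<open>W \<rightarrow> Z\<close>. The results are written as unions of roof classes over all
  such choices; as the class does not depend on the choice, they are single classes.\<close>

definition roof_add ::
    "('o, 'a, 'k) lincat \<Rightarrow> ('o, 'a) roof set \<Rightarrow> ('o, 'a) roof set \<Rightarrow> ('o, 'a) roof set" where
  "roof_add C \<phi> \<psi> = (\<Union>{roof_class C
       (r\<lparr>rnum := (\<lambda>n. rnum r n \<oplus>\<^bsub>Hom C (cobj (rmid r) n) (cobj (rtgt r) n)\<^esub> rnum s n)\<rparr>) | r s.
     r \<in> \<phi> \<and> s \<in> \<psi> \<and> rmid r = rmid s \<and> rden r = rden s})"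

definition roof_smult ::
    "('o, 'a, 'k) lincat \<Rightarrow> 'k \<Rightarrow> ('o, 'a) roof set \<Rightarrow> ('o, 'a) roof set" where
  "roof_smult C c \<phi> = (\<Union>{roof_class C
       (r\<lparr>rnum := (\<lambda>n. c \<odot>\<^bsub>Hom C (cobj (rmid r) n) (cobj (rtgt r) n)\<^esub> rnum r n)\<rparr>) | r. r \<in> \<phi>})"

definition roof_comp ::
    "('o, 'a, 'k) lincat \<Rightarrow> ('o, 'a) roof set \<Rightarrow> ('o, 'a) roof set \<Rightarrow> ('o, 'a) roof set" where
  "roof_comp C \<psi> \<phi> = (\<Union>{roof_class C
       \<lparr>rsrc = rsrc r, rmid = W, rtgt = rtgt s,
        rden = ccomp C (rden r) t, rnum = ccomp C (rnum s) h\<rparr> | r s W t h.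
     r \<in> \<phi> \<and> s \<in> \<psi> \<and> bounded_complex C W \<and>
     quasi_iso C W (rmid r) t \<and> chain_map C W (rmid s) h \<and>
     homotopic C W (rtgt r) (ccomp C (rnum r) t) (ccomp C (rden s) h)})"

definition Db :: "('o, 'a, 'k) lincat \<Rightarrow> (('o, 'a) cochain, ('o, 'a) roof set, 'k) lincat" where
  "Db C =
    \<lparr>Ob = {X. bounded_complex C X},
     Hom = (\<lambda>X Y.
       \<lparr>carrier = {roof_class C r | r. is_roof C r \<and> rsrc r = X \<and> rtgt r = Y},
        monoid.mult = undefined,
        one = undefined,
        zero = roof_class C \<lparr>rsrc = X, rmid = X, rtgt = Y, rden = (\<lambda>n. Idn C (cobj X n)),
                             rnum = (\<lambda>n. \<zero>\<^bsub>Hom C (cobj X n) (cobj Y n)\<^esub>)\<rparr>,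
        add = roof_add C,
        smult = roof_smult C\<rparr>),
     Idn = (\<lambda>X. roof_class C \<lparr>rsrc = X, rmid = X, rtgt = X, rden = (\<lambda>n. Idn C (cobj X n)),
                              rnum = (\<lambda>n. Idn C (cobj X n))\<rparr>),
     Comp = roof_comp C\<rparr>"

text \<open>The mapping cone of \<open>f : X \<rightarrow> Y\<close>: \<open>X\<^sup>n\<^sup>+\<^sup>1 \<oplus> Y\<^sup>n\<close> with differential \<open>(x, y) \<mapsto> (-dx, fx + dy)\<close>.\<close>

definition cone ::
    "('o, 'a, 'k) lincat \<Rightarrow> ('o, 'a) cochain \<Rightarrow> ('o, 'a) cochain \<Rightarrow> (int \<Rightarrow> 'a) \<Rightarrow> ('o, 'a) cochain" where
  "cone C X Y f =
    (let S = (\<lambda>n. dsum C (cobj X (n + 1)) (cobj Y n));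
         i = (\<lambda>n. in1 C (cobj X (n + 1)) (cobj Y n));
         j = (\<lambda>n. in2 C (cobj X (n + 1)) (cobj Y n));
         p = (\<lambda>n. pr1 C (cobj X (n + 1)) (cobj Y n));
         r = (\<lambda>n. pr2 C (cobj X (n + 1)) (cobj Y n))
     in \<lparr>cobj = S,
         diff = (\<lambda>n.
           (i (n + 1) \<bullet>\<^bsub>C\<^esub> ((\<ominus>\<^bsub>Hom C (cobj X (n + 1)) (cobj X (n + 2))\<^esub> diff X (n + 1)) \<bullet>\<^bsub>C\<^esub> p n))
           \<oplus>\<^bsub>Hom C (S n) (S (n + 1))\<^esub> (j (n + 1) \<bullet>\<^bsub>C\<^esub> (f (n + 1) \<bullet>\<^bsub>C\<^esub> p n))
           \<oplus>\<^bsub>Hom C (S n) (S (n + 1))\<^esub> (j (n + 1) \<bullet>\<^bsub>C\<^esub> (diff Y n \<bullet>\<^bsub>C\<^esub> r n)))\<rparr>)"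

text \<open>A distinguished triangle on the class of a roof \<open>X \<leftarrow> Z \<rightarrow> Y\<close> is obtained from the mapping
  cone of its numerator \<open>Z \<rightarrow> Y\<close>.\<close>

definition cone_is_iso_to ::
    "('o, 'a, 'k) lincat \<Rightarrow> ('o, 'a) roof set \<Rightarrow> ('o, 'a) cochain \<Rightarrow> bool" where
  "cone_is_iso_to C \<phi> N \<longleftrightarrow> (\<exists>r\<in>\<phi>. isomorphic (Db C) (cone C (rmid r) (rtgt r) (rnum r)) N)"

definition Ext :: "('o, 'a, 'k) lincat \<Rightarrow> nat \<Rightarrow> 'o \<Rightarrow> 'o \<Rightarrow> ('k, ('o, 'a) roof set) module" where
  "Ext C n M N = Hom (Db C) (stalk C M) (shift C (int n) (stalk C N))"

definition finitary :: "'k ring \<Rightarrow> ('o, 'a, 'k) lincat \<Rightarrow> bool" where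
  "finitary F C \<longleftrightarrow> (\<forall>M\<in>Ob C. \<forall>N\<in>Ob C.
    vectorspace.fin_dim F (Hom C M N) \<and> vectorspace.fin_dim F (Ext C 1 M N))"

definition hereditary :: "('o, 'a, 'k) lincat \<Rightarrow> bool" where
  "hereditary C \<longleftrightarrow> (\<forall>M\<in>Ob C. \<forall>N\<in>Ob C. carrier (Ext C 2 M N) = {\<zero>\<^bsub>Ext C 2 M N\<^esub>})"


section \<open>Isomorphism classes and the Grothendieck group\<close>

definition iso_class :: "('o, 'a, 'k) lincat \<Rightarrow> 'o \<Rightarrow> 'o set" where
  "iso_class C M = {N. isomorphic C M N}"

definition Iso :: "('o, 'a, 'k) lincat \<Rightarrow> 'o set set" where
  "Iso C = iso_class C ` Ob C"

definition rep :: "'o set \<Rightarrow> 'o" where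
  "rep c = (SOME M. M \<in> c)"

definition aut_card :: "('o, 'a, 'k) lincat \<Rightarrow> 'o \<Rightarrow> nat" where
  "aut_card C M = card {f. iso_arrow C M M f}"

definition K_relations :: "('o, 'a, 'k) lincat \<Rightarrow> ('o \<Rightarrow>\<^sub>0 int) set" where
  "K_relations C = {Poly_Mapping.single Y 1 - Poly_Mapping.single X 1 - Poly_Mapping.single Z 1
                    | X Y Z. \<exists>f g. short_exact C X Y Z f g}"

definition K_quot :: "('o, 'a, 'k) lincat \<Rightarrow> ('o \<Rightarrow>\<^sub>0 int) set monoid" where
  "K_quot C = free_Abelian_group (Ob C) Mod generate (free_Abelian_group (Ob C)) (K_relations C)"

text \<open>The Grothendieck group, written additively as a \<open>\<int>\<close>-module.\<close>

definition K0 :: "('o, 'a, 'k) lincat \<Rightarrow> (int, ('o \<Rightarrow>\<^sub>0 int) set) module" where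
  "K0 C = \<lparr>carrier = carrier (K_quot C), monoid.mult = undefined, one = undefined,
           zero = \<one>\<^bsub>K_quot C\<^esub>, add = monoid.mult (K_quot C),
           smult = (\<lambda>n x. x [^]\<^bsub>K_quot C\<^esub> n)\<rparr>"

definition hat :: "('o, 'a, 'k) lincat \<Rightarrow> 'o \<Rightarrow> ('o \<Rightarrow>\<^sub>0 int) set" where
  "hat C M = generate (free_Abelian_group (Ob C)) (K_relations C)
               #>\<^bsub>free_Abelian_group (Ob C)\<^esub> Poly_Mapping.single M 1"

text \<open>\<open>Half \<alpha>\<close> is the formal half of \<open>\<alpha>\<close>; \<open>K0\<close> may have 2-torsion, so \<open>emb\<close> need not be injective.\<close>

datatype 'x half = Half (unhalf: 'x)

definition halfK0 :: "('o, 'a, 'k) lincat \<Rightarrow> (int, ('o \<Rightarrow>\<^sub>0 int) set half) module" where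
  "halfK0 C = \<lparr>carrier = Half ` carrier (K0 C), monoid.mult = undefined, one = undefined,
               zero = Half \<zero>\<^bsub>K0 C\<^esub>,
               add = (\<lambda>x y. Half (unhalf x \<oplus>\<^bsub>K0 C\<^esub> unhalf y)),
               smult = (\<lambda>n x. Half (n \<odot>\<^bsub>K0 C\<^esub> unhalf x))\<rparr>"

definition emb :: "('o, 'a, 'k) lincat \<Rightarrow> ('o \<Rightarrow>\<^sub>0 int) set \<Rightarrow> ('o \<Rightarrow>\<^sub>0 int) set half" where
  "emb C \<alpha> = Half (2 \<odot>\<^bsub>K0 C\<^esub> \<alpha>)"

definition euler :: "'k ring \<Rightarrow> ('o, 'a, 'k) lincat \<Rightarrow> 'o \<Rightarrow> 'o \<Rightarrow> int" where
  "euler F C M N = int (vectorspace.dim F (Hom C M N)) - int (vectorspace.dim F (Ext C 1 M N))"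

definition euler_free :: "'k ring \<Rightarrow> ('o, 'a, 'k) lincat \<Rightarrow> ('o \<Rightarrow>\<^sub>0 int) \<Rightarrow> ('o \<Rightarrow>\<^sub>0 int) \<Rightarrow> int" where
  "euler_free F C x y = (\<Sum>M\<in>Poly_Mapping.keys x. \<Sum>N\<in>Poly_Mapping.keys y.
     Poly_Mapping.lookup x M * Poly_Mapping.lookup y N * euler F C M N)"

text \<open>The form induced on \<open>K0\<close>: the common value of \<open>euler_free\<close> on all representatives.\<close>

definition eulerK :: "'k ring \<Rightarrow> ('o, 'a, 'k) lincat \<Rightarrow> ('o \<Rightarrow>\<^sub>0 int) set \<Rightarrow> ('o \<Rightarrow>\<^sub>0 int) set \<Rightarrow> int" where
  "eulerK F C \<alpha> \<beta> = (THE n. \<forall>x\<in>\<alpha>. \<forall>y\<in>\<beta>. euler_free F C x y = n)"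

definition euler_half ::
    "'k ring \<Rightarrow> ('o, 'a, 'k) lincat \<Rightarrow> ('o \<Rightarrow>\<^sub>0 int) set half \<Rightarrow> ('o \<Rightarrow>\<^sub>0 int) set half \<Rightarrow> real" where
  "euler_half F C x y = real_of_int (eulerK F C (unhalf x) (unhalf y)) / 4"

definition sym_half ::
    "'k ring \<Rightarrow> ('o, 'a, 'k) lincat \<Rightarrow> ('o \<Rightarrow>\<^sub>0 int) set half \<Rightarrow> ('o \<Rightarrow>\<^sub>0 int) set half \<Rightarrow> real" where
  "sym_half F C x y = euler_half F C x y + euler_half F C y x"


section \<open>Dual derived Hall numbers\<close>

definition brace :: "('o, 'a, 'k) lincat \<Rightarrow> ('o, 'a) cochain \<Rightarrow> ('o, 'a) cochain \<Rightarrow> real" where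
  "brace C X Y = Prod_any (\<lambda>i::nat. if i > 0
     then real (card (carrier (Hom (Db C) (shift C (int i) X) Y))) powi ((-1) ^ i) else 1)"

definition ext1_cone ::
    "('o, 'a, 'k) lincat \<Rightarrow> ('o, 'a) cochain \<Rightarrow> ('o, 'a) cochain \<Rightarrow> ('o, 'a) cochain \<Rightarrow> ('o, 'a) roof set set" where
  "ext1_cone C X Y L =
     {\<phi> \<in> carrier (Hom (Db C) X (shift C 1 Y)). cone_is_iso_to C \<phi> (shift C 1 L)}"

definition hall ::
    "('o, 'a, 'k) lincat \<Rightarrow> ('o, 'a) cochain \<Rightarrow> ('o, 'a) cochain \<Rightarrow> ('o, 'a) cochain \<Rightarrow> real" where
  "hall C X Y L =
     real (card (ext1_cone C X Y L)) / real (card (carrier (Hom (Db C) X Y))) * (1 / brace C X Y)"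


section \<open>The derived Hall algebras\<close>

text \<open>The complex vector space with basis \<open>B\<close> (finitely supported functions on \<open>B\<close>), with the
  product of the basis vectors \<open>b\<close> and \<open>b'\<close> having coefficient \<open>s b b' d\<close> at \<open>d\<close>, and with the
  basis vector \<open>e\<close> as unit.\<close>

definition basis_vec :: "'b \<Rightarrow> 'b \<Rightarrow> complex" where
  "basis_vec b = (\<lambda>d. if d = b then 1 else 0)"

definition based_algebra ::
    "'b set \<Rightarrow> ('b \<Rightarrow> 'b \<Rightarrow> 'b \<Rightarrow> complex) \<Rightarrow> 'b \<Rightarrow> (complex, 'b \<Rightarrow> complex) module" where
  "based_algebra B s e =
    \<lparr>carrier = {f. finite {b. f b \<noteq> 0} \<and> {b. f b \<noteq> 0} \<subseteq> B},
     monoid.mult = (\<lambda>f g d. if d \<in> B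
        then (\<Sum>b\<in>{b. f b \<noteq> 0}. \<Sum>b'\<in>{b'. g b' \<noteq> 0}. f b * g b' * s b b' d) else 0),
     one = basis_vec e,
     zero = (\<lambda>d. 0),
     add = (\<lambda>f g d. f d + g d),
     smult = (\<lambda>c f d. c * f d)\<rparr>"

text \<open>Elements of \<open>\<int>/m\<close> are the numbers below \<open>m\<close>.\<close>

definition iso_tuples :: "('o, 'a, 'k) lincat \<Rightarrow> nat \<Rightarrow> (nat \<Rightarrow> 'o set) set" where
  "iso_tuples C m = (\<Pi>\<^sub>E i\<in>{..<m}. Iso C)"

definition class_tuple :: "('o, 'a, 'k) lincat \<Rightarrow> nat \<Rightarrow> (nat \<Rightarrow> 'o) \<Rightarrow> nat \<Rightarrow> 'o set" where
  "class_tuple C m M = (\<lambda>i\<in>{..<m}. iso_class C (M i))"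

definition vv :: "'k ring \<Rightarrow> real" where
  "vv F = sqrt (real (card (carrier F)))"

text \<open>\<open>alt_sum C m M i k0\<close> is the sum of \<open>(-1)\<^sup>k\<close> times the class of \<open>M\<^sub>i\<^sub>+\<^sub>k\<close> over \<open>k0 \<le> k \<le> m - 1\<close>.\<close>

definition alt_sum ::
    "('o, 'a, 'k) lincat \<Rightarrow> nat \<Rightarrow> (nat \<Rightarrow> 'o) \<Rightarrow> nat \<Rightarrow> nat \<Rightarrow> ('o \<Rightarrow>\<^sub>0 int) set" where
  "alt_sum C m M i k0 = (\<Oplus>\<^bsub>K0 C\<^esub>k\<in>{k0..<m}. ((-1) ^ k) \<odot>\<^bsub>K0 C\<^esub> hat C (M ((i + k) mod m)))"

definition hall_weight ::
    "('o, 'a, 'k) lincat \<Rightarrow> nat \<Rightarrow> (nat \<Rightarrow> 'o) \<Rightarrow> (nat \<Rightarrow> 'o) \<Rightarrow> (nat \<Rightarrow> 'o) \<Rightarrow> (nat \<Rightarrow> 'o) \<Rightarrow> real" where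
  "hall_weight C m A B I M = (\<Prod>i<m.
     hall C (csum C (shift C 1 (stalk C (I i))) (stalk C (A i)))
            (csum C (stalk C (B i)) (shift C (-1) (stalk C (I ((i + m - 1) mod m)))))
            (stalk C (M i))
     / real (aut_card C (I i)))"

definition DH_coeff ::
    "'k ring \<Rightarrow> ('o, 'a, 'k) lincat \<Rightarrow> nat \<Rightarrow> (nat \<Rightarrow> 'o set) \<Rightarrow> (nat \<Rightarrow> 'o set) \<Rightarrow> (nat \<Rightarrow> 'o set) \<Rightarrow> real" where
  "DH_coeff F C m A B M =
     vv F powr real_of_int (\<Sum>i<m. eulerK F C (alt_sum C m (rep \<circ> A) i 0) (hat C (rep (B i)))) *
     Sum_any (\<lambda>I. if I \<in> iso_tuples C m
        then hall_weight C m (rep \<circ> A) (rep \<circ> B) (rep \<circ> I) (rep \<circ> M) else 0)"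

definition DH :: "'k ring \<Rightarrow> ('o, 'a, 'k) lincat \<Rightarrow> nat \<Rightarrow> (complex, (nat \<Rightarrow> 'o set) \<Rightarrow> complex) module" where
  "DH F C m = based_algebra (iso_tuples C m)
     (\<lambda>A B M. complex_of_real (DH_coeff F C m A B M)) (class_tuple C m (\<lambda>_. zero_ob C))"

text \<open>The sum of \<open>x 1, \<dots>, x (m - 1)\<close>, with the convention that it is \<open>x 1\<close> for \<open>m = 1\<close>.\<close>

definition conv_sum :: "nat \<Rightarrow> (nat \<Rightarrow> real) \<Rightarrow> real" where
  "conv_sum m x = (if m = 1 then x 1 else (\<Sum>i=1..m-1. x i))"

definition a0_exp ::
    "'k ring \<Rightarrow> ('o, 'a, 'k) lincat \<Rightarrow> nat \<Rightarrow> (nat \<Rightarrow> 'o) \<Rightarrow> (nat \<Rightarrow> ('o \<Rightarrow>\<^sub>0 int) set half) \<Rightarrow>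
     (nat \<Rightarrow> 'o) \<Rightarrow> (nat \<Rightarrow> ('o \<Rightarrow>\<^sub>0 int) set half) \<Rightarrow> real" where
  "a0_exp F C m A \<alpha> B \<beta> =
     (\<Sum>i<m. real_of_int (eulerK F C (hat C (A i)) (hat C (B i))))
     + (\<Sum>i<m. sym_half F C (\<alpha> i) (emb C (hat C (B i) \<ominus>\<^bsub>K0 C\<^esub> hat C (B ((i + 1) mod m)))))
     + conv_sum m (\<lambda>i. sym_half F C (\<alpha> (i mod m)) (\<beta> ((i - 1) mod m)))
     - sym_half F C (\<alpha> (m - 1)) (\<beta> 0)"

definition c_exp ::
    "'k ring \<Rightarrow> ('o, 'a, 'k) lincat \<Rightarrow> nat \<Rightarrow> (nat \<Rightarrow> ('o \<Rightarrow>\<^sub>0 int) set half) \<Rightarrow>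
     (nat \<Rightarrow> ('o \<Rightarrow>\<^sub>0 int) set half) \<Rightarrow> (nat \<Rightarrow> 'o) \<Rightarrow> (nat \<Rightarrow> 'o) \<Rightarrow> real" where
  "c_exp F C m \<alpha> \<beta> I M =
     - sym_half F C (emb C (hat C (I (m - 1)))) (\<alpha> 0 \<oplus>\<^bsub>halfK0 C\<^esub> \<beta> 0)
     + conv_sum m (\<lambda>i. sym_half F C (emb C (hat C (I (i mod m))))
                         (\<alpha> ((i - 1) mod m) \<oplus>\<^bsub>halfK0 C\<^esub> \<beta> ((i - 1) mod m)))
     + (\<Sum>i<m. real_of_int
          (eulerK F C (hat C (M i) \<ominus>\<^bsub>K0 C\<^esub> hat C (M ((i + 1) mod m))) (hat C (I i))))
     + conv_sum m (\<lambda>i. real_of_int (eulerK F C (hat C (I ((i - 1) mod m))) (hat C (I (i mod m)))))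
     - real_of_int (eulerK F C (hat C (I 0)) (hat C (I (m - 1))))"

definition DHe_coeff ::
    "'k ring \<Rightarrow> ('o, 'a, 'k) lincat \<Rightarrow> nat \<Rightarrow>
     (nat \<Rightarrow> 'o set) \<times> (nat \<Rightarrow> ('o \<Rightarrow>\<^sub>0 int) set half) \<Rightarrow>
     (nat \<Rightarrow> 'o set) \<times> (nat \<Rightarrow> ('o \<Rightarrow>\<^sub>0 int) set half) \<Rightarrow>
     (nat \<Rightarrow> 'o set) \<times> (nat \<Rightarrow> ('o \<Rightarrow>\<^sub>0 int) set half) \<Rightarrow> real" where
  "DHe_coeff F C m = (\<lambda>(A, \<alpha>) (B, \<beta>) (M, \<gamma>).
     vv F powr a0_exp F C m (rep \<circ> A) \<alpha> (rep \<circ> B) \<beta> *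
     Sum_any (\<lambda>I. if I \<in> iso_tuples C m \<and>
          (\<forall>i<m. \<gamma> i = emb C (hat C (rep (I i))) \<oplus>\<^bsub>halfK0 C\<^esub> \<alpha> i \<oplus>\<^bsub>halfK0 C\<^esub> \<beta> i)
        then vv F powr c_exp F C m \<alpha> \<beta> (rep \<circ> I) (rep \<circ> M) *
             hall_weight C m (rep \<circ> A) (rep \<circ> B) (rep \<circ> I) (rep \<circ> M)
        else 0))"

definition DHe :: "'k ring \<Rightarrow> ('o, 'a, 'k) lincat \<Rightarrow> nat \<Rightarrow>
    (complex, (nat \<Rightarrow> 'o set) \<times> (nat \<Rightarrow> ('o \<Rightarrow>\<^sub>0 int) set half) \<Rightarrow> complex) module" where
  "DHe F C m = based_algebra (iso_tuples C m \<times> (\<Pi>\<^sub>E i\<in>{..<m}. carrier (halfK0 C)))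
     (\<lambda>a b d. complex_of_real (DHe_coeff F C m a b d))
     (class_tuple C m (\<lambda>_. zero_ob C), \<lambda>i\<in>{..<m}. \<zero>\<^bsub>halfK0 C\<^esub>)"

definition u_basis :: "('o, 'a, 'k) lincat \<Rightarrow> nat \<Rightarrow> (nat \<Rightarrow> 'o) \<Rightarrow> (nat \<Rightarrow> 'o set) \<Rightarrow> complex" where
  "u_basis C m M = basis_vec (class_tuple C m M)"

definition uK_basis :: "('o, 'a, 'k) lincat \<Rightarrow> nat \<Rightarrow> (nat \<Rightarrow> 'o) \<Rightarrow> (nat \<Rightarrow> ('o \<Rightarrow>\<^sub>0 int) set half) \<Rightarrow>
    (nat \<Rightarrow> 'o set) \<times> (nat \<Rightarrow> ('o \<Rightarrow>\<^sub>0 int) set half) \<Rightarrow> complex" where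
  "uK_basis C m M \<alpha> = basis_vec (class_tuple C m M, \<lambda>i\<in>{..<m}. \<alpha> i)"

definition e_exp :: "'k ring \<Rightarrow> ('o, 'a, 'k) lincat \<Rightarrow> nat \<Rightarrow> (nat \<Rightarrow> 'o) \<Rightarrow> real" where
  "e_exp F C m M =
     1 / 4 * (\<Sum>i=1..m-1. real_of_int (eulerK F C (alt_sum C m M i 0) (alt_sum C m M (i + 1) 0)))
     - 1 / 4 * real_of_int (eulerK F C (alt_sum C m M 1 0) (alt_sum C m M 0 0))
     + (\<Sum>i=0..m-1. real_of_int (eulerK F C (hat C (M i)) (alt_sum C m M i 1)))"

definition algebra_embedding ::
    "(complex, 'x) module \<Rightarrow> (complex, 'y) module \<Rightarrow> ('x \<Rightarrow> 'y) \<Rightarrow> bool" where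
  "algebra_embedding R S \<phi> \<longleftrightarrow> \<phi> \<in> ring_hom R S \<and>
    (\<forall>c. \<forall>x\<in>carrier R. \<phi> (c \<odot>\<^bsub>R\<^esub> x) = c \<odot>\<^bsub>S\<^esub> \<phi> x) \<and> inj_on \<phi> (carrier R)"

end

(*
  The image of a basis vector u_M is v^e(M) u_M K_g(M), with g(M)_i = -1/2 sum_k (-1)^k M_(i+1+k).
  Since m is odd, the alternating sums a_i = sum_k (-1)^k M_(i+k) satisfy a_i + a_(i+1) = 2 M_i.

  A nonvanishing Hall number H for the i-th factor yields a triangle in the derived category, hence
  M_i = A_i + B_i - I_i - I_(i-1) in the Grothendieck group, because the Euler characteristic of
  complexes is an invariant of the derived category. Taking alternating sums,
  g(M)_i = I_i + g(A)_i + g(B)_i: every term of the product of the images of u_A and u_B lies in the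
  image. Multiplicativity is then, term by term, an identity between exponents of v, which only
  uses that the Euler form is bilinear on the Grothendieck group.

  Bilinearity of the Euler form is where Ext^2 = 0 enters. By truncation every element of
  Ext^1(M,N) is represented by a roof over a two-term complex, that is, by a short exact sequence
  B -> P -> M and an arrow B -> N. As Ext^1(M,N) is finite, one sequence serves for all of its
  elements, and then q^<M,N> = |Hom(P,N)| / |Hom(B,N)|; Ext^2 = 0 allows to refine such sequences
  compatibly with an epimorphism onto B, so that the quotients are multiplicative in M and N.
*)

theory Submission
  imports Defs
begin

section \<open>Abelian categories with arrows in a ring\<close>

text \<open>The category need not have enough projectives or injectives, so Ext^1 is not computed
  from one fixed resolution: an epimorphism onto M is chosen depending on the second argument and
  refined whenever two choices must be compared. The Euler form is therefore reached by counting
  Hom-sets over exchangeable resolutions rather than through long exact sequences. There are no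
  elements to chase either: equations are tested on generalized elements x : T -> X, and each lift
  along an epimorphism costs an epimorphism T' -> T.

  No triangulated structure is set up. Beyond the vector space Ext^1, two facts about the derived
  category carry the argument: equality of roofs is an equivalence relation (by homotopy fibre
  products), and an isomorphism is represented by a roof whose numerator is a quasi-isomorphism. The
  second makes the Euler characteristic invariant.

  Additivity of the form is a matter of meaning, not only of computation: \<open>eulerK\<close> is a
  definite description, with a usable value only once the form is constant on classes. The quarters
  in e(M) arise from evaluating the form on two halves.\<close>

locale abcat =
  fixes Obj :: "'o set" and H :: "'o \<Rightarrow> 'o \<Rightarrow> 'r::ring set" and I :: "'o \<Rightarrow> 'r"
  assumes H_obj: "f \<in> H X Y \<Longrightarrow> X \<in> Obj \<and> Y \<in> Obj"
    and zero_in: "X \<in> Obj \<Longrightarrow> Y \<in> Obj \<Longrightarrow> 0 \<in> H X Y"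
    and add_in: "f \<in> H X Y \<Longrightarrow> g \<in> H X Y \<Longrightarrow> f + g \<in> H X Y"
    and minus_in: "f \<in> H X Y \<Longrightarrow> - f \<in> H X Y"
    and comp_in: "g \<in> H Y Z \<Longrightarrow> f \<in> H X Y \<Longrightarrow> g * f \<in> H X Z"
    and id_in: "X \<in> Obj \<Longrightarrow> I X \<in> H X X"
    and idl: "f \<in> H X Y \<Longrightarrow> I Y * f = f"
    and idr: "f \<in> H X Y \<Longrightarrow> f * I X = f"
    and ex_zero: "\<exists>Z\<in>Obj. I Z = 0"
    and ex_biprod: "X \<in> Obj \<Longrightarrow> Y \<in> Obj \<Longrightarrow> \<exists>S i j p r. i \<in> H X S \<and> j \<in> H Y S \<and> p \<in> H S X \<and> r \<in> H S Y \<and>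
      p * i = I X \<and> r * j = I Y \<and> p * j = 0 \<and> r * i = 0 \<and> i * p + j * r = I S"
    and ex_ker: "f \<in> H X Y \<Longrightarrow> \<exists>K k. k \<in> H K X \<and> f * k = 0 \<and>
      (\<forall>W. \<forall>g\<in>H W X. f * g = 0 \<longrightarrow> (\<exists>t\<in>H W K. k * t = g)) \<and> (\<forall>W. \<forall>g\<in>H W K. k * g = 0 \<longrightarrow> g = 0)"
    and ex_coker: "f \<in> H X Y \<Longrightarrow> \<exists>Q c. c \<in> H Y Q \<and> c * f = 0 \<and>
      (\<forall>W. \<forall>g\<in>H Y W. g * f = 0 \<longrightarrow> (\<exists>t\<in>H Q W. t * c = g)) \<and> (\<forall>W. \<forall>g\<in>H Q W. g * c = 0 \<longrightarrow> g = 0)"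
    and mono_ker: "f \<in> H X Y \<Longrightarrow> \<forall>W. \<forall>g\<in>H W X. f * g = 0 \<longrightarrow> g = 0 \<Longrightarrow>
      \<exists>Z g. g \<in> H Y Z \<and> g * f = 0 \<and> (\<forall>W. \<forall>x\<in>H W Y. g * x = 0 \<longrightarrow> (\<exists>t\<in>H W X. f * t = x))"
    and epi_coker: "f \<in> H X Y \<Longrightarrow> \<forall>W. \<forall>g\<in>H Y W. g * f = 0 \<longrightarrow> g = 0 \<Longrightarrow>
      \<exists>Z g. g \<in> H Z X \<and> f * g = 0 \<and> (\<forall>W. \<forall>x\<in>H X W. x * g = 0 \<longrightarrow> (\<exists>t\<in>H Y W. t * f = x))"
begin

lemma dom_obj: "f \<in> H X Y \<Longrightarrow> X \<in> Obj" and cod_obj: "f \<in> H X Y \<Longrightarrow> Y \<in> Obj"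
  using H_obj by auto

lemma diff_in: "f \<in> H X Y \<Longrightarrow> g \<in> H X Y \<Longrightarrow> f - g \<in> H X Y"
  using add_in[of f X Y "- g"] minus_in by simp

lemmas hom = comp_in diff_in add_in minus_in zero_in id_in

text \<open>Cancellation is stated as a vanishing condition; \<open>mono_cancel\<close> recovers it
  by subtraction. The source is a parameter because a ring element does not determine where it
  starts, and ring products exist also for arrows that do not compose.\<close>

definition mono :: "'o \<Rightarrow> 'r \<Rightarrow> bool" where
  "mono X f \<longleftrightarrow> (\<forall>W. \<forall>g\<in>H W X. f * g = 0 \<longrightarrow> g = 0)"

definition epi :: "'o \<Rightarrow> 'r \<Rightarrow> bool" where
  "epi Y f \<longleftrightarrow> (\<forall>W. \<forall>g\<in>H Y W. g * f = 0 \<longrightarrow> g = 0)"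

lemma monoD: "mono X f \<Longrightarrow> g \<in> H W X \<Longrightarrow> f * g = 0 \<Longrightarrow> g = 0"
  unfolding mono_def by blast

lemma epiD: "epi Y f \<Longrightarrow> g \<in> H Y W \<Longrightarrow> g * f = 0 \<Longrightarrow> g = 0"
  unfolding epi_def by blast

lemma mono_cancel: "mono X f \<Longrightarrow> g \<in> H W X \<Longrightarrow> h \<in> H W X \<Longrightarrow> f * g = f * h \<Longrightarrow> g = h"
  using monoD[of X f "g - h" W] diff_in[of g W X h] by (simp add: algebra_simps)

lemma epi_cancel: "epi Y f \<Longrightarrow> g \<in> H Y W \<Longrightarrow> h \<in> H Y W \<Longrightarrow> g * f = h * f \<Longrightarrow> g = h"
  using epiD[of Y f "g - h" W] diff_in[of g Y W h] by (simp add: algebra_simps)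

lemma epi_comp: "epi Y f \<Longrightarrow> f \<in> H X Y \<Longrightarrow> epi X g \<Longrightarrow> epi Y (f * g)"
  unfolding epi_def by (metis comp_in mult.assoc)

lemma mono_comp: "mono Y f \<Longrightarrow> g \<in> H X Y \<Longrightarrow> mono X g \<Longrightarrow> mono X (f * g)"
  unfolding mono_def by (metis comp_in mult.assoc)

lemma epi_id: "X \<in> Obj \<Longrightarrow> epi X (I X)"
  unfolding epi_def using idr by metis

lemma mono_id: "X \<in> Obj \<Longrightarrow> mono X (I X)"
  unfolding mono_def using idl by metis

lemma epi_right_factor: "epi Y e \<Longrightarrow> e = f * x \<Longrightarrow> epi Y f"
  unfolding epi_def by (metis mult.assoc mult_zero_left)

lemma mono_left_factor: "mono X m \<Longrightarrow> m = x * f \<Longrightarrow> mono X f"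
  unfolding mono_def by (metis mult.assoc mult_zero_right)

lemma null_source: "I X = 0 \<Longrightarrow> f \<in> H X Y \<Longrightarrow> f = 0"
  using idr by fastforce

lemma null_target: "I Y = 0 \<Longrightarrow> f \<in> H X Y \<Longrightarrow> f = 0"
  using idl by fastforce

lemma ker_obtain:
  assumes "f \<in> H X Y"
  obtains K k where "k \<in> H K X" "f * k = 0" "mono K k"
    "\<And>W g. g \<in> H W X \<Longrightarrow> f * g = 0 \<Longrightarrow> \<exists>t\<in>H W K. k * t = g"
proof -
  from ex_ker[OF assms] obtain K k where "k \<in> H K X" "f * k = 0"
    "\<forall>W. \<forall>g\<in>H W X. f * g = 0 \<longrightarrow> (\<exists>t\<in>H W K. k * t = g)" "\<forall>W. \<forall>g\<in>H W K. k * g = 0 \<longrightarrow> g = 0"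
    by blast
  then show ?thesis using that[of k K] by (auto simp: mono_def)
qed

lemma coker_obtain:
  assumes "f \<in> H X Y"
  obtains Q c where "c \<in> H Y Q" "c * f = 0" "epi Q c"
    "\<And>W g. g \<in> H Y W \<Longrightarrow> g * f = 0 \<Longrightarrow> \<exists>t\<in>H Q W. t * c = g"
proof -
  from ex_coker[OF assms] obtain Q c where "c \<in> H Y Q" "c * f = 0"
    "\<forall>W. \<forall>g\<in>H Y W. g * f = 0 \<longrightarrow> (\<exists>t\<in>H Q W. t * c = g)" "\<forall>W. \<forall>g\<in>H Q W. g * c = 0 \<longrightarrow> g = 0"
    by blast
  then show ?thesis using that[of c Q] by (auto simp: epi_def)
qed

text \<open>By \<open>epi_coker\<close> the epimorphism f is a cokernel of some g. Since f kills g,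
  the hypothesis makes x kill g, so x factors through f. Arrows out of a quotient are built this way
  throughout.\<close>

lemma descend:
  assumes f: "f \<in> H X Z" "epi Z f" and x: "x \<in> H X V"
    and van: "\<And>U u. u \<in> H U X \<Longrightarrow> f * u = 0 \<Longrightarrow> x * u = 0"
  shows "\<exists>y\<in>H Z V. y * f = x"
proof -
  from epi_coker[OF f(1)] f(2) obtain U g where "g \<in> H U X" "f * g = 0"
      "\<forall>W. \<forall>x\<in>H X W. x * g = 0 \<longrightarrow> (\<exists>t\<in>H Z W. t * f = x)"
    unfolding epi_def by blast
  then show ?thesis using van x by blast
qed

text \<open>m is cut out by some g', and g' f vanishes because it vanishes after the epimorphism e.
  So a factorization through a subobject can be tested on a cover.\<close>

lemma mono_lift:
  assumes m: "m \<in> H X Y" "mono X m" and f: "f \<in> H T Y"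
    and e: "epi T e" "f * e = m * g"
  shows "\<exists>t\<in>H T X. m * t = f"
proof -
  from mono_ker[OF m(1)] m(2) obtain Z g' where g': "g' \<in> H Y Z" "g' * m = 0"
      "\<forall>W. \<forall>x\<in>H W Y. g' * x = 0 \<longrightarrow> (\<exists>t\<in>H W X. m * t = x)"
    unfolding mono_def by blast
  have "g' * f * e = 0" by (metis e(2) g'(2) mult.assoc mult_zero_left)
  then have "g' * f = 0" using epiD[OF e(1) comp_in[OF g'(1) f]] by simp
  then show ?thesis using g'(3) f by blast
qed

text \<open>The identity of Y lifts along the monomorphism f, since it does so after precomposition
  with the epimorphism f itself; cancellation makes the lift a two-sided inverse.\<close>

lemma mono_epi_iso:
  assumes f: "f \<in> H X Y" "mono X f" "epi Y f"
  shows "\<exists>g\<in>H Y X. f * g = I Y \<and> g * f = I X"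
proof -
  have "I Y * f = f * I X" using f idl idr by simp
  from mono_lift[OF f(1,2) id_in[OF cod_obj[OF f(1)]] f(3) this] obtain g where g: "g \<in> H Y X" "f * g = I Y"
    by blast
  have "f * (g * f) = f * I X" using g f idl idr by (metis mult.assoc)
  then have "g * f = I X"
    using mono_cancel[OF f(2) comp_in[OF g(1) f(1)] id_in[OF dom_obj[OF f(1)]]] by simp
  then show ?thesis using g by blast
qed

text \<open>P is the kernel of the difference map on the biproduct. The last two conclusions,
  stability of epimorphisms under pullback, are what makes covers usable.\<close>

lemma pullback:
  assumes f: "f \<in> H X Z" and g: "g \<in> H Y Z"
  obtains P p r where "p \<in> H P X" "r \<in> H P Y" "f * p = g * r"
    "\<And>W a b. a \<in> H W X \<Longrightarrow> b \<in> H W Y \<Longrightarrow> f * a = g * b \<Longrightarrow> \<exists>t\<in>H W P. p * t = a \<and> r * t = b"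
    "\<And>W t. t \<in> H W P \<Longrightarrow> p * t = 0 \<Longrightarrow> r * t = 0 \<Longrightarrow> t = 0"
    "epi Z f \<Longrightarrow> epi Y r" "epi Z g \<Longrightarrow> epi X p"
proof -
  obtain S i j p r where S: "i \<in> H X S" "j \<in> H Y S" "p \<in> H S X" "r \<in> H S Y"
      "p * i = I X" "r * j = I Y" "p * j = 0" "r * i = 0" "i * p + j * r = I S"
    using ex_biprod f g dom_obj by metis
  let ?d = "f * p - g * r"
  have d: "?d \<in> H S Z" using f g S by (blast intro: hom)
  have di: "?d * i = f" using S f by (simp add: algebra_simps idr)
  have dj: "?d * j = - g" using S g by (simp add: algebra_simps idr)
  obtain P k where k: "k \<in> H P S" "?d * k = 0" "mono P k"
      "\<And>W t. t \<in> H W S \<Longrightarrow> ?d * t = 0 \<Longrightarrow> \<exists>u\<in>H W P. k * u = t"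
    using ker_obtain[OF d] by metis
  have split: "i * (p * t) + j * (r * t) = t" if "t \<in> H W S" for t W
    using S(9) idl[OF that] by (metis distrib_right mult.assoc)
  have univ: "\<exists>t\<in>H W P. p * k * t = a \<and> r * k * t = b"
    if ab: "a \<in> H W X" "b \<in> H W Y" "f * a = g * b" for W a b
  proof -
    have pa: "p * (i * a + j * b) = a" "r * (i * a + j * b) = b"
      using S ab idl by (simp_all add: algebra_simps flip: mult.assoc)
    have "?d * (i * a + j * b) = 0" using pa ab(3) by (metis left_diff_distrib mult.assoc diff_self)
    moreover have "i * a + j * b \<in> H W S" using S ab by (blast intro: hom)
    ultimately obtain u where "u \<in> H W P" "k * u = i * a + j * b" using k(4) by blast
    then show ?thesis using pa by (metis mult.assoc)
  qed
  have jm: "t = 0" if t: "t \<in> H W P" "p * k * t = 0" "r * k * t = 0" for W t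
  proof -
    have "k * t = 0" using split[of "k * t" W] t k(1) by (simp add: mult.assoc comp_in)
    then show ?thesis using monoD[OF k(3) t(1)] by simp
  qed
  \<comment> \<open>If the difference map is epi, it is the cokernel of its kernel k, so whatever
    kills k factors through it.\<close>
  have fac: "\<exists>s\<in>H Z W. s * ?d = w" if ep: "epi Z ?d" and w: "w \<in> H S W" "w * k = 0" for w W
  proof (rule descend[OF d ep w(1)])
    fix U u assume u: "u \<in> H U S" "?d * u = 0"
    then obtain t where "k * t = u" using k(4) by blast
    then show "w * u = 0" using w(2) by (metis mult.assoc mult_zero_left)
  qed
  have e1: "epi Y (r * k)" if "epi Z f"
    unfolding epi_def
  proof (intro allI ballI impI)
    fix W w assume w: "w \<in> H Y W" "w * (r * k) = 0"
    have ep: "epi Z ?d" using that di epi_right_factor by metis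
    obtain s where s: "s \<in> H Z W" "s * ?d = w * r"
      using fac[OF ep comp_in[OF w(1) S(4)]] w(2) by (auto simp: mult.assoc)
    \<comment> \<open>Restrict \<open>s * ?d = w * r\<close> along i, where ?d becomes f and r
      becomes 0.\<close>
    have "s * f = 0" using s(2) di S(8) by (metis mult.assoc mult_zero_right)
    then have "s = 0" using epiD[OF that s(1)] by simp
    then have "w * r = 0" using s by simp
    then show "w = 0" using S(6) idr[OF w(1)] by (metis mult.assoc mult_zero_left)
  qed
  have e2: "epi X (p * k)" if "epi Z g"
    unfolding epi_def
  proof (intro allI ballI impI)
    fix W w assume w: "w \<in> H X W" "w * (p * k) = 0"
    have ep: "epi Z ?d" using that dj epi_right_factor[of Z g ?d "- j"] by simp
    obtain s where s: "s \<in> H Z W" "s * ?d = w * p"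
      using fac[OF ep comp_in[OF w(1) S(3)]] w(2) by (auto simp: mult.assoc)
    have "s * g = 0" using s(2) dj S(7) by (metis mult.assoc mult_zero_right minus_zero mult_minus_right minus_equation_iff)
    then have "s = 0" using epiD[OF that s(1)] by simp
    then have "w * p = 0" using s by simp
    then show "w = 0" using S(5) idr[OF w(1)] by (metis mult.assoc mult_zero_left)
  qed
  have "f * (p * k) = g * (r * k)" using k(2) by (simp add: algebra_simps)
  then show ?thesis
    by (rule that[OF comp_in[OF S(3) k(1)] comp_in[OF S(4) k(1)]]) (fact univ jm e1 e2)+
qed

text \<open>The basic move of every diagram chase below: a generalized element g of Z lifts along an
  epimorphism once its domain Y is replaced by a cover P.\<close>

lemma cover_lift:
  assumes "f \<in> H X Z" "epi Z f" "g \<in> H Y Z"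
  obtains P e x where "e \<in> H P Y" "epi Y e" "x \<in> H P X" "f * x = g * e"
  using pullback[OF assms(1,3)] assms(2) by metis

text \<open>J is the kernel of the cokernel of f. The point is that q is epi, which rests on
  monomorphisms being kernels.\<close>

lemma image:
  assumes f: "f \<in> H X Y"
  obtains J q k where "q \<in> H X J" "epi J q" "k \<in> H J Y" "mono J k" "f = k * q"
proof -
  obtain Q c where c: "c \<in> H Y Q" "c * f = 0"
      "\<And>W g. g \<in> H Y W \<Longrightarrow> g * f = 0 \<Longrightarrow> \<exists>t\<in>H Q W. t * c = g"
    using coker_obtain[OF f] by metis
  obtain J k where k: "k \<in> H J Y" "c * k = 0" "mono J k"
      "\<And>W g. g \<in> H W Y \<Longrightarrow> c * g = 0 \<Longrightarrow> \<exists>t\<in>H W J. k * t = g"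
    using ker_obtain[OF c(1)] by metis
  obtain q where q: "q \<in> H X J" "k * q = f" using k(4) f c(2) by blast
  have "epi J q" unfolding epi_def
  proof (intro allI ballI impI)
    fix W w assume w: "w \<in> H J W" "w * q = 0"
    obtain N n where n: "n \<in> H N J" "w * n = 0" "mono N n"
        "\<And>U g. g \<in> H U J \<Longrightarrow> w * g = 0 \<Longrightarrow> \<exists>t\<in>H U N. n * t = g"
      using ker_obtain[OF w(1)] by metis
    obtain q' where q': "q' \<in> H X N" "n * q' = q" using n(4) q w by blast
    have kn: "k * n \<in> H N Y" "mono N (k * n)" using k n mono_comp comp_in by blast+
    \<comment> \<open>The smaller subobject \<open>k * n\<close> is itself cut out by some h. As h
      kills f, it factors through the cokernel c and kills k, so k factors through
      \<open>k * n\<close>; hence n is split epi and w = 0.\<close>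
    obtain Z h where h: "h \<in> H Y Z" "h * (k * n) = 0"
        "\<forall>W. \<forall>x\<in>H W Y. h * x = 0 \<longrightarrow> (\<exists>t\<in>H W N. k * n * t = x)"
      using mono_ker[OF kn(1)] kn(2) unfolding mono_def by blast
    have "h * f = 0" using h(2) q(2) q'(2) by (metis mult.assoc mult_zero_left)
    then obtain s where "s * c = h" using c(3) h(1) by blast
    then have "h * k = 0" using k(2) by (metis mult.assoc mult_zero_right)
    then obtain t where t: "t \<in> H J N" "k * n * t = k" using h(3) k(1) by blast
    have "k * (n * t) = k * I J" using t(2) idr[OF k(1)] by (simp add: mult.assoc)
    then have "n * t = I J"
      using mono_cancel[OF k(3) comp_in[OF n(1) t(1)] id_in[OF dom_obj[OF k(1)]]] by simp
    then show "w = 0" using n(2) idr[OF w(1)] by (metis mult.assoc mult_zero_left)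
  qed
  then show ?thesis using that q k by metis
qed


subsection \<open>Short exact sequences\<close>

definition ses :: "'o \<Rightarrow> 'o \<Rightarrow> 'o \<Rightarrow> 'r \<Rightarrow> 'r \<Rightarrow> bool" where
  "ses B P M i \<pi> \<longleftrightarrow> i \<in> H B P \<and> \<pi> \<in> H P M \<and> mono B i \<and> epi M \<pi> \<and> \<pi> * i = 0 \<and>
     (\<forall>W. \<forall>g\<in>H W P. \<pi> * g = 0 \<longrightarrow> (\<exists>t\<in>H W B. i * t = g))"

lemma sesD:
  assumes "ses B P M i \<pi>"
  shows "i \<in> H B P" "\<pi> \<in> H P M" "mono B i" "epi M \<pi>" "\<pi> * i = 0"
    "B \<in> Obj" "P \<in> Obj" "M \<in> Obj" "g \<in> H W P \<Longrightarrow> \<pi> * g = 0 \<Longrightarrow> \<exists>t\<in>H W B. i * t = g"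
  using assms H_obj unfolding ses_def by blast+

lemma ses_of_epi:
  assumes "\<pi> \<in> H P M" "epi M \<pi>"
  obtains B i where "ses B P M i \<pi>"
  using ker_obtain[OF assms(1)] assms unfolding ses_def by metis

text \<open>Whatever \<pi> kills factors through i, so killing i suffices to descend along
  \<pi>.\<close>

lemma ses_descend:
  assumes s: "ses B P M i \<pi>" and x: "x \<in> H P V" "x * i = 0"
  shows "\<exists>y\<in>H M V. y * \<pi> = x"
proof (rule descend[OF sesD(2,4)[OF s] x(1)])
  fix U u assume "u \<in> H U P" "\<pi> * u = 0"
  then obtain t where "i * t = u" using sesD(9)[OF s] by blast
  then show "x * u = 0" using x(2) by (metis mult.assoc mult_zero_left)
qed

text \<open>A morphism of short exact sequences over the identity of M. For a mono i, c is
  determined by a; it is carried along because composition with c transports extension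
  classes.\<close>

definition refines :: "'o \<Rightarrow> 'o \<Rightarrow> 'r \<Rightarrow> 'r \<Rightarrow> 'o \<Rightarrow> 'o \<Rightarrow> 'r \<Rightarrow> 'r \<Rightarrow> 'r \<Rightarrow> 'r \<Rightarrow> bool" where
  "refines B P i \<pi> B2 P2 i2 \<pi>2 a c \<longleftrightarrow> a \<in> H P2 P \<and> c \<in> H B2 B \<and> \<pi> * a = \<pi>2 \<and> i * c = a * i2"

lemma refinesD:
  assumes "refines B P i \<pi> B2 P2 i2 \<pi>2 a c"
  shows "a \<in> H P2 P" "c \<in> H B2 B" "\<pi> * a = \<pi>2" "i * c = a * i2"
  using assms unfolding refines_def by auto

lemma ses_map:
  assumes "ses B P M i \<pi>" "a \<in> H P2 P" "b \<in> H B2 P2" "\<pi> * a * b = 0"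
  obtains c where "c \<in> H B2 B" "i * c = a * b"
  using sesD(9)[OF assms(1) comp_in[OF assms(2,3)]] assms(4) by (auto simp: mult.assoc)

lemma refines_ex:
  assumes "ses B P M i \<pi>" "ses B2 P2 M i2 \<pi>2" "a \<in> H P2 P" "\<pi> * a = \<pi>2"
  obtains c where "refines B P i \<pi> B2 P2 i2 \<pi>2 a c"
  using ses_map[OF assms(1,3) sesD(1)[OF assms(2)]] sesD(5)[OF assms(2)] assms(3,4)
  unfolding refines_def by metis

lemma refines_trans:
  assumes "refines B P i \<pi> B2 P2 i2 \<pi>2 a c" "refines B2 P2 i2 \<pi>2 B3 P3 i3 \<pi>3 a' c'"
  shows "refines B P i \<pi> B3 P3 i3 \<pi>3 (a * a') (c * c')"
  using assms unfolding refines_def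
  by (metis comp_in mult.assoc)

text \<open>The fibre product of P and P' over M maps onto M. It replaces the comparison map that
  projectivity would provide.\<close>

lemma common_refinement:
  assumes s: "ses B P M i \<pi>" "ses B' P' M i' \<pi>'"
  obtains B2 P2 i2 \<pi>2 a c a' c' where "ses B2 P2 M i2 \<pi>2"
    "refines B P i \<pi> B2 P2 i2 \<pi>2 a c" "refines B' P' i' \<pi>' B2 P2 i2 \<pi>2 a' c'"
proof -
  note t = sesD[OF s(1)] and t' = sesD[OF s(2)]
  obtain Q p r where Q: "p \<in> H Q P" "r \<in> H Q P'" "\<pi> * p = \<pi>' * r" "epi P' r"
    using pullback[OF t(2) t'(2)] t(4) by metis
  have "\<pi> * p \<in> H Q M" "epi M (\<pi> * p)" using Q t t' epi_comp comp_in by metis+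
  then obtain B2 i2 where s2: "ses B2 Q M i2 (\<pi> * p)" using ses_of_epi by blast
  from refines_ex[OF s(1) s2 Q(1) refl] obtain c where "refines B P i \<pi> B2 Q i2 (\<pi> * p) p c" .
  moreover from refines_ex[OF s(2) s2 Q(2) Q(3)[symmetric]]
  obtain c' where "refines B' P' i' \<pi>' B2 Q i2 (\<pi> * p) r c'" .
  ultimately show ?thesis using that s2 by blast
qed

end


section \<open>Complexes, quasi-isomorphisms and roofs\<close>

abbreviation cmul :: "(int \<Rightarrow> 'r::ring) \<Rightarrow> (int \<Rightarrow> 'r) \<Rightarrow> int \<Rightarrow> 'r"  (infixl \<open>\<star>\<close> 70) where
  "f \<star> g \<equiv> \<lambda>n. f n * g n"

context abcat
begin

section \<open>Bounded complexes, chain maps and homotopies with arrows in a ring\<close>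

definition abs_complex :: "('o, 'r) cochain \<Rightarrow> bool" where
  "abs_complex X \<longleftrightarrow> (\<forall>n. diff X n \<in> H (cobj X n) (cobj X (n + 1))) \<and> (\<forall>n. diff X (n + 1) * diff X n = 0) \<and>
     finite {n. I (cobj X n) \<noteq> 0}"

lemma cxD:
  assumes "abs_complex X"
  shows "diff X n \<in> H (cobj X n) (cobj X (n + 1))" "diff X (n - 1) \<in> H (cobj X (n - 1)) (cobj X n)"
    "diff X (n + 1) * diff X n = 0" "diff X n * diff X (n - 1) = 0" "cobj X n \<in> Obj"
    "diff X n * (diff X (n - 1) * t) = 0"
proof -
  from assms have *: "\<And>n. diff X n \<in> H (cobj X n) (cobj X (n + 1))" "\<And>n. diff X (n + 1) * diff X n = 0"
    unfolding abs_complex_def by auto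
  show "diff X n \<in> H (cobj X n) (cobj X (n + 1))" "diff X (n + 1) * diff X n = 0" using * by auto
  show "diff X (n - 1) \<in> H (cobj X (n - 1)) (cobj X n)" "diff X n * diff X (n - 1) = 0"
    using *(1)[of "n - 1"] *(2)[of "n - 1"] by auto
  then show "diff X n * (diff X (n - 1) * t) = 0" by (metis mult.assoc mult_zero_left)
  show "cobj X n \<in> Obj" using *(1) dom_obj by blast
qed

definition abs_chain_map :: "('o, 'r) cochain \<Rightarrow> ('o, 'r) cochain \<Rightarrow> (int \<Rightarrow> 'r) \<Rightarrow> bool" where
  "abs_chain_map X Y f \<longleftrightarrow> (\<forall>n. f n \<in> H (cobj X n) (cobj Y n) \<and> f (n + 1) * diff X n = diff Y n * f n)"

lemma cmD:
  assumes "abs_chain_map X Y f"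
  shows "f n \<in> H (cobj X n) (cobj Y n)" "f (n + 1) * diff X n = diff Y n * f n"
    "f n * diff X (n - 1) = diff Y (n - 1) * f (n - 1)"
    "diff Y n * (f n * t) = f (n + 1) * (diff X n * t)"
    "f n * (diff X (n - 1) * t) = diff Y (n - 1) * (f (n - 1) * t)"
proof -
  from assms have *: "\<And>n. f (n + 1) * diff X n = diff Y n * f n" unfolding abs_chain_map_def by auto
  show "f n \<in> H (cobj X n) (cobj Y n)" "f (n + 1) * diff X n = diff Y n * f n"
    using assms unfolding abs_chain_map_def by auto
  then show "diff Y n * (f n * t) = f (n + 1) * (diff X n * t)" by (metis mult.assoc)
  show "f n * diff X (n - 1) = diff Y (n - 1) * f (n - 1)" using *[of "n - 1"] by auto
  then show "f n * (diff X (n - 1) * t) = diff Y (n - 1) * (f (n - 1) * t)" by (metis mult.assoc)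
qed

lemma abs_chain_map_comp: "abs_chain_map X Y f \<Longrightarrow> abs_chain_map Y Z g \<Longrightarrow> abs_chain_map X Z (g \<star> f)"
  unfolding abs_chain_map_def by (metis comp_in mult.assoc)

lemma abs_chain_map_id: "abs_complex X \<Longrightarrow> abs_chain_map X X (\<lambda>n. I (cobj X n))"
  unfolding abs_chain_map_def using cxD id_in idl idr by metis

definition abs_homotopic :: "('o, 'r) cochain \<Rightarrow> ('o, 'r) cochain \<Rightarrow> (int \<Rightarrow> 'r) \<Rightarrow> (int \<Rightarrow> 'r) \<Rightarrow> bool" where
  "abs_homotopic X Y f g \<longleftrightarrow> (\<exists>h. \<forall>n. h n \<in> H (cobj X n) (cobj Y (n - 1)) \<and>
     f n - g n = diff Y (n - 1) * h n + h (n + 1) * diff X n)"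

lemma abs_homotopic_refl: "abs_complex X \<Longrightarrow> abs_complex Y \<Longrightarrow> abs_homotopic X Y f f"
  unfolding abs_homotopic_def by (rule exI[of _ "\<lambda>_. 0"]) (auto intro!: zero_in cxD(5))

lemma abs_homotopic_sym:
  assumes "abs_homotopic X Y f g" shows "abs_homotopic X Y g f"
proof -
  from assms obtain h where "\<forall>n. h n \<in> H (cobj X n) (cobj Y (n - 1)) \<and>
     f n - g n = diff Y (n - 1) * h n + h (n + 1) * diff X n" unfolding abs_homotopic_def by blast
  then show ?thesis unfolding abs_homotopic_def
    by (intro exI[of _ "\<lambda>n. - h n"]) (auto intro: minus_in simp: algebra_simps)
qed

lemma abs_homotopic_trans:
  assumes "abs_homotopic X Y f g" "abs_homotopic X Y g k" shows "abs_homotopic X Y f k"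
proof -
  from assms obtain h h' where
    "\<forall>n. h n \<in> H (cobj X n) (cobj Y (n - 1)) \<and> f n - g n = diff Y (n - 1) * h n + h (n + 1) * diff X n"
    "\<forall>n. h' n \<in> H (cobj X n) (cobj Y (n - 1)) \<and> g n - k n = diff Y (n - 1) * h' n + h' (n + 1) * diff X n"
    unfolding abs_homotopic_def by blast
  then show ?thesis unfolding abs_homotopic_def
    by (intro exI[of _ "\<lambda>n. h n + h' n"]) (auto intro: add_in simp: algebra_simps)
qed

lemma abs_homotopic_comp_left:
  assumes "abs_homotopic X Y f g" "abs_chain_map Y Z k" shows "abs_homotopic X Z (k \<star> f) (k \<star> g)"
proof -
  from assms obtain h where h: "\<And>n. h n \<in> H (cobj X n) (cobj Y (n - 1))"
     "\<And>n. f n - g n = diff Y (n - 1) * h n + h (n + 1) * diff X n" unfolding abs_homotopic_def by blast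
  have "k n * f n - k n * g n = diff Z (n - 1) * (k (n - 1) * h n) + k n * h (n + 1) * diff X n" for n
    using h(2)[of n] cmD(5)[OF assms(2)] by (metis distrib_left mult.assoc right_diff_distrib)
  moreover have "k (n - 1) * h n \<in> H (cobj X n) (cobj Z (n - 1))" for n
    using comp_in[OF cmD(1)[OF assms(2)] h(1)] .
  ultimately show ?thesis unfolding abs_homotopic_def by (intro exI[of _ "\<lambda>n. k (n - 1) * h n"]) auto
qed

lemma abs_homotopic_comp_right:
  assumes "abs_homotopic X Y f g" "abs_chain_map W X u" shows "abs_homotopic W Y (f \<star> u) (g \<star> u)"
proof -
  from assms obtain h where h: "\<And>n. h n \<in> H (cobj X n) (cobj Y (n - 1))"
     "\<And>n. f n - g n = diff Y (n - 1) * h n + h (n + 1) * diff X n" unfolding abs_homotopic_def by blast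
  have "f n * u n - g n * u n = diff Y (n - 1) * (h n * u n) + h (n + 1) * u (n + 1) * diff W n" for n
    using h(2)[of n] cmD(2)[OF assms(2)] by (metis distrib_right mult.assoc left_diff_distrib)
  moreover have "h n * u n \<in> H (cobj W n) (cobj Y (n - 1))" for n
    using comp_in[OF h(1) cmD(1)[OF assms(2)]] .
  ultimately show ?thesis unfolding abs_homotopic_def by (intro exI[of _ "h \<star> u"]) auto
qed

text \<open>Surjectivity and injectivity on cohomology, for generalized elements and up to passing to a
  cover of the domain of definition.\<close>

definition Hsurj :: "('o, 'r) cochain \<Rightarrow> ('o, 'r) cochain \<Rightarrow> (int \<Rightarrow> 'r) \<Rightarrow> bool" where
  "Hsurj X Y f \<longleftrightarrow> (\<forall>n T y. y \<in> H T (cobj Y n) \<longrightarrow> diff Y n * y = 0 \<longrightarrow>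
     (\<exists>T' e x z. e \<in> H T' T \<and> epi T e \<and> x \<in> H T' (cobj X n) \<and> diff X n * x = 0 \<and>
        z \<in> H T' (cobj Y (n - 1)) \<and> y * e = f n * x + diff Y (n - 1) * z))"

definition Hinj :: "('o, 'r) cochain \<Rightarrow> ('o, 'r) cochain \<Rightarrow> (int \<Rightarrow> 'r) \<Rightarrow> bool" where
  "Hinj X Y f \<longleftrightarrow> (\<forall>n T x y. x \<in> H T (cobj X n) \<longrightarrow> diff X n * x = 0 \<longrightarrow> y \<in> H T (cobj Y (n - 1)) \<longrightarrow>
     f n * x = diff Y (n - 1) * y \<longrightarrow>
     (\<exists>T' e x'. e \<in> H T' T \<and> epi T e \<and> x' \<in> H T' (cobj X (n - 1)) \<and> x * e = diff X (n - 1) * x'))"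

lemma HsurjD:
  assumes "Hsurj X Y f" "y \<in> H T (cobj Y n)" "diff Y n * y = 0"
  obtains T' e x z where "e \<in> H T' T" "epi T e" "x \<in> H T' (cobj X n)" "diff X n * x = 0"
    "z \<in> H T' (cobj Y (n - 1))" "y * e = f n * x + diff Y (n - 1) * z"
  using assms unfolding Hsurj_def by blast

lemma HinjD:
  assumes "Hinj X Y f" "x \<in> H T (cobj X n)" "diff X n * x = 0" "y \<in> H T (cobj Y (n - 1))"
    "f n * x = diff Y (n - 1) * y"
  obtains T' e x' where "e \<in> H T' T" "epi T e" "x' \<in> H T' (cobj X (n - 1))" "x * e = diff X (n - 1) * x'"
  using assms unfolding Hinj_def by blast

text \<open>Phrasing the isomorphism on cohomology through \<open>Hsurj\<close> and
  \<open>Hinj\<close> avoids choosing cohomology objects. Agreement with \<open>quasi_iso\<close> is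
  shown in \<open>quasi_isoD\<close> and \<open>quasi_isoI\<close>.\<close>

definition abs_qis :: "('o, 'r) cochain \<Rightarrow> ('o, 'r) cochain \<Rightarrow> (int \<Rightarrow> 'r) \<Rightarrow> bool" where
  "abs_qis X Y f \<longleftrightarrow> abs_chain_map X Y f \<and> Hsurj X Y f \<and> Hinj X Y f"

lemma qiD: "abs_qis X Y f \<Longrightarrow> abs_chain_map X Y f" "abs_qis X Y f \<Longrightarrow> Hsurj X Y f" "abs_qis X Y f \<Longrightarrow> Hinj X Y f"
  unfolding abs_qis_def by auto

section \<open>Homotopy invariance and two-out-of-three for quasi-isomorphisms\<close>

lemma Hsurj_hty:
  assumes s: "Hsurj X Y f" and h: "abs_homotopic X Y f g"
  shows "Hsurj X Y g"
  unfolding Hsurj_def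
proof (intro allI impI)
  fix n T y assume y: "y \<in> H T (cobj Y n)" "diff Y n * y = 0"
  from h obtain h where h: "\<And>n. h n \<in> H (cobj X n) (cobj Y (n - 1))"
     "\<And>n. f n - g n = diff Y (n - 1) * h n + h (n + 1) * diff X n" unfolding abs_homotopic_def by blast
  from HsurjD[OF s y] obtain T' e x z where a: "e \<in> H T' T" "epi T e" "x \<in> H T' (cobj X n)" "diff X n * x = 0"
    "z \<in> H T' (cobj Y (n - 1))" "y * e = f n * x + diff Y (n - 1) * z" .
  \<comment> \<open>On a cycle x the second term of the homotopy drops out, so the two images differ
    by the boundary of \<open>h n * x\<close>.\<close>
  have "f n * x - g n * x = diff Y (n - 1) * (h n * x)"
    using arg_cong[OF h(2)[of n], of "\<lambda>t. t * x"] a(4) by (simp add: algebra_simps)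
  then have "y * e = g n * x + diff Y (n - 1) * (z + h n * x)" using a(6) by (simp add: algebra_simps)
  moreover have "z + h n * x \<in> H T' (cobj Y (n - 1))" using a h(1) by (blast intro: hom)
  ultimately show "\<exists>T' e x z. e \<in> H T' T \<and> epi T e \<and> x \<in> H T' (cobj X n) \<and> diff X n * x = 0 \<and>
        z \<in> H T' (cobj Y (n - 1)) \<and> y * e = g n * x + diff Y (n - 1) * z" using a by metis
qed

lemma Hinj_hty:
  assumes s: "Hinj X Y f" and h: "abs_homotopic X Y f g"
  shows "Hinj X Y g"
  unfolding Hinj_def
proof (intro allI impI)
  fix n T x y assume y: "x \<in> H T (cobj X n)" "diff X n * x = 0" "y \<in> H T (cobj Y (n - 1))"
    "g n * x = diff Y (n - 1) * y"
  from h obtain h where h: "\<And>n. h n \<in> H (cobj X n) (cobj Y (n - 1))"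
     "\<And>n. f n - g n = diff Y (n - 1) * h n + h (n + 1) * diff X n" unfolding abs_homotopic_def by blast
  have "f n * x - g n * x = diff Y (n - 1) * (h n * x)"
    using arg_cong[OF h(2)[of n], of "\<lambda>t. t * x"] y(2) by (simp add: algebra_simps)
  then have e: "f n * x = diff Y (n - 1) * (y + h n * x)" using y(4) by (simp add: algebra_simps)
  have "y + h n * x \<in> H T (cobj Y (n - 1))" using y h(1) by (blast intro: hom)
  from HinjD[OF s y(1,2) this e] show "\<exists>T' e x'. e \<in> H T' T \<and> epi T e \<and>
      x' \<in> H T' (cobj X (n - 1)) \<and> x * e = diff X (n - 1) * x'" by metis
qed

lemma Hsurj_comp:
  assumes f: "abs_chain_map X Y f" "Hsurj X Y f" and g: "abs_chain_map Y Z g" "Hsurj Y Z g"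
  shows "Hsurj X Z (g \<star> f)"
  unfolding Hsurj_def
proof (intro allI impI)
  fix n T z assume z: "z \<in> H T (cobj Z n)" "diff Z n * z = 0"
  from HsurjD[OF g(2) z] obtain T1 e1 y z1 where a: "e1 \<in> H T1 T" "epi T e1" "y \<in> H T1 (cobj Y n)" "diff Y n * y = 0"
    "z1 \<in> H T1 (cobj Z (n - 1))" "z * e1 = g n * y + diff Z (n - 1) * z1" .
  from HsurjD[OF f(2) a(3,4)] obtain T2 e2 x y1 where b: "e2 \<in> H T2 T1" "epi T1 e2" "x \<in> H T2 (cobj X n)" "diff X n * x = 0"
    "y1 \<in> H T2 (cobj Y (n - 1))" "y * e2 = f n * x + diff Y (n - 1) * y1" .
  have "z * e1 * e2 = g n * (y * e2) + diff Z (n - 1) * (z1 * e2)"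
    using arg_cong[OF a(6), of "\<lambda>t. t * e2"] by (simp add: algebra_simps)
  then have "z * (e1 * e2) = g n * f n * x + diff Z (n - 1) * (g (n - 1) * y1 + z1 * e2)"
    unfolding b(6) using cmD(5)[OF g(1)] by (simp add: algebra_simps)
  moreover have "g (n - 1) * y1 + z1 * e2 \<in> H T2 (cobj Z (n - 1))" "e1 * e2 \<in> H T2 T"
    using a b cmD(1)[OF g(1)] by (blast intro: hom)+
  moreover have "epi T (e1 * e2)" using epi_comp a b by blast
  ultimately show "\<exists>T' e x u. e \<in> H T' T \<and> epi T e \<and> x \<in> H T' (cobj X n) \<and> diff X n * x = 0 \<and>
        u \<in> H T' (cobj Z (n - 1)) \<and> z * e = g n * f n * x + diff Z (n - 1) * u" using b by metis
qed

lemma Hinj_comp: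
  assumes f: "abs_chain_map X Y f" "Hinj X Y f" and g: "abs_chain_map Y Z g" "Hinj Y Z g"
  shows "Hinj X Z (g \<star> f)"
  unfolding Hinj_def
proof (intro allI impI)
  fix n T x z assume z: "x \<in> H T (cobj X n)" "diff X n * x = 0" "z \<in> H T (cobj Z (n - 1))"
    "g n * f n * x = diff Z (n - 1) * z"
  have "f n * x \<in> H T (cobj Y n)" "diff Y n * (f n * x) = 0" "g n * (f n * x) = diff Z (n - 1) * z"
    using z cmD[OF f(1)] by (auto intro: hom simp: mult.assoc)
  from HinjD[OF g(2) this(1,2) z(3) this(3)] obtain T1 e1 y where a:
    "e1 \<in> H T1 T" "epi T e1" "y \<in> H T1 (cobj Y (n - 1))" "f n * x * e1 = diff Y (n - 1) * y" .
  have "x * e1 \<in> H T1 (cobj X n)" "diff X n * (x * e1) = 0" "f n * (x * e1) = diff Y (n - 1) * y"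
    using a z by (auto intro: hom simp: mult.assoc simp flip: mult.assoc[of "diff X n"])
  from HinjD[OF f(2) this(1,2) a(3) this(3)] obtain T2 e2 x' where b:
    "e2 \<in> H T2 T1" "epi T1 e2" "x' \<in> H T2 (cobj X (n - 1))" "x * e1 * e2 = diff X (n - 1) * x'" .
  have "epi T (e1 * e2)" "e1 * e2 \<in> H T2 T" using epi_comp a b comp_in by blast+
  then show "\<exists>T' e x'. e \<in> H T' T \<and> epi T e \<and> x' \<in> H T' (cobj X (n - 1)) \<and> x * e = diff X (n - 1) * x'"
    using b by (metis mult.assoc)
qed

lemma Hinj_right_factor:
  assumes g: "abs_chain_map Y Z g" and i: "Hinj X Z (g \<star> f)"
  shows "Hinj X Y f"
  unfolding Hinj_def
proof (intro allI impI)
  fix n T x y assume y: "x \<in> H T (cobj X n)" "diff X n * x = 0" "y \<in> H T (cobj Y (n - 1))"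
    "f n * x = diff Y (n - 1) * y"
  have e: "g n * f n * x = diff Z (n - 1) * (g (n - 1) * y)" using y(4) cmD(5)[OF g] by (simp add: mult.assoc)
  have "g (n - 1) * y \<in> H T (cobj Z (n - 1))" using y cmD(1)[OF g] by (blast intro: hom)
  from HinjD[OF i y(1,2) this e] show "\<exists>T' e x'. e \<in> H T' T \<and> epi T e \<and>
      x' \<in> H T' (cobj X (n - 1)) \<and> x * e = diff X (n - 1) * x'" by metis
qed

lemma Hsurj_left_factor:
  assumes f: "abs_chain_map X Y f" and s: "Hsurj X Z (g \<star> f)"
  shows "Hsurj Y Z g"
  unfolding Hsurj_def
proof (intro allI impI)
  fix n T z assume z: "z \<in> H T (cobj Z n)" "diff Z n * z = 0"
  from HsurjD[OF s z] obtain T' e x u where a: "e \<in> H T' T" "epi T e" "x \<in> H T' (cobj X n)" "diff X n * x = 0"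
    "u \<in> H T' (cobj Z (n - 1))" "z * e = g n * f n * x + diff Z (n - 1) * u" .
  have "f n * x \<in> H T' (cobj Y n)" "diff Y n * (f n * x) = 0"
    using a cmD[OF f] by (auto intro: hom)
  then show "\<exists>T' e x u. e \<in> H T' T \<and> epi T e \<and> x \<in> H T' (cobj Y n) \<and> diff Y n * x = 0 \<and>
        u \<in> H T' (cobj Z (n - 1)) \<and> z * e = g n * x + diff Z (n - 1) * u" using a by (metis mult.assoc)
qed

text \<open>A cycle that f sends to a boundary is, on a cover and modulo a boundary, the image of a
  cycle of W. The composite sends that cycle to a boundary, so it is a boundary itself.\<close>

lemma Hinj_left_factor:
  assumes f: "abs_chain_map X Y f" and w: "abs_chain_map W X w" "Hsurj W X w" and i: "Hinj W Y (f \<star> w)"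
  shows "Hinj X Y f"
  unfolding Hinj_def
proof (intro allI impI)
  fix n T x y assume y: "x \<in> H T (cobj X n)" "diff X n * x = 0" "y \<in> H T (cobj Y (n - 1))"
    "f n * x = diff Y (n - 1) * y"
  from HsurjD[OF w(2) y(1,2)] obtain T1 e1 x1 z where a: "e1 \<in> H T1 T" "epi T e1" "x1 \<in> H T1 (cobj W n)"
    "diff W n * x1 = 0" "z \<in> H T1 (cobj X (n - 1))" "x * e1 = w n * x1 + diff X (n - 1) * z" .
  have "f n * (x * e1) = diff Y (n - 1) * (y * e1)" using y(4) by (metis mult.assoc)
  then have e: "f n * w n * x1 = diff Y (n - 1) * (y * e1 - f (n - 1) * z)"
    unfolding a(6) using cmD(5)[OF f] by (simp add: algebra_simps)
  have "y * e1 - f (n - 1) * z \<in> H T1 (cobj Y (n - 1))" using y a cmD(1)[OF f] by (blast intro: hom)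
  from HinjD[OF i a(3,4) this e] obtain T2 e2 x2 where b: "e2 \<in> H T2 T1" "epi T1 e2"
      "x2 \<in> H T2 (cobj W (n - 1))" "x1 * e2 = diff W (n - 1) * x2" .
  have "x * (e1 * e2) = w n * (x1 * e2) + diff X (n - 1) * (z * e2)"
    using arg_cong[OF a(6), of "\<lambda>t. t * e2"] by (simp add: algebra_simps)
  then have "x * (e1 * e2) = diff X (n - 1) * (w (n - 1) * x2 + z * e2)"
    unfolding b(4) using cmD(5)[OF w(1)] by (simp add: algebra_simps)
  moreover have "w (n - 1) * x2 + z * e2 \<in> H T2 (cobj X (n - 1))" "e1 * e2 \<in> H T2 T"
    using a b cmD(1)[OF w(1)] by (blast intro: hom)+
  moreover have "epi T (e1 * e2)" using epi_comp a b by blast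
  ultimately show "\<exists>T' e x'. e \<in> H T' T \<and> epi T e \<and>
      x' \<in> H T' (cobj X (n - 1)) \<and> x * e = diff X (n - 1) * x'" by metis
qed

text \<open>Surjectivity of the composite matches g y with g f x modulo a boundary; injectivity of g
  turns this into a match of y with f x modulo a boundary.\<close>

lemma Hsurj_right_factor:
  assumes f: "abs_chain_map X Y f" and g: "abs_chain_map Y Z g" "Hinj Y Z g" and s: "Hsurj X Z (g \<star> f)"
  shows "Hsurj X Y f"
  unfolding Hsurj_def
proof (intro allI impI)
  fix n T y assume y: "y \<in> H T (cobj Y n)" "diff Y n * y = 0"
  have gy: "g n * y \<in> H T (cobj Z n)" "diff Z n * (g n * y) = 0"
    using y cmD[OF g(1)] by (auto intro: hom)
  from HsurjD[OF s gy] obtain T1 e1 x z where a: "e1 \<in> H T1 T" "epi T e1" "x \<in> H T1 (cobj X n)" "diff X n * x = 0"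
    "z \<in> H T1 (cobj Z (n - 1))" "g n * y * e1 = g n * f n * x + diff Z (n - 1) * z" .
  have t: "y * e1 - f n * x \<in> H T1 (cobj Y n)" using a y cmD(1)[OF f] by (blast intro: hom)
  have c: "diff Y n * (y * e1 - f n * x) = 0"
    using a(4) y(2) cmD(4)[OF f] by (simp add: algebra_simps flip: mult.assoc[of "diff Y n" y])
  have "g n * (y * e1 - f n * x) = diff Z (n - 1) * z" using a(6) by (simp add: algebra_simps)
  from HinjD[OF g(2) t c a(5) this] obtain T2 e2 y' where b: "e2 \<in> H T2 T1" "epi T1 e2"
      "y' \<in> H T2 (cobj Y (n - 1))" "(y * e1 - f n * x) * e2 = diff Y (n - 1) * y'" .
  have "y * (e1 * e2) = f n * (x * e2) + diff Y (n - 1) * y'" using b(4) by (simp add: algebra_simps)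
  moreover have "x * e2 \<in> H T2 (cobj X n)" "e1 * e2 \<in> H T2 T" using a b by (blast intro: hom)+
  moreover have "diff X n * (x * e2) = 0" using a(4) by (metis mult.assoc mult_zero_left)
  moreover have "epi T (e1 * e2)" using epi_comp a b by blast
  ultimately show "\<exists>T' e x z. e \<in> H T' T \<and> epi T e \<and> x \<in> H T' (cobj X n) \<and> diff X n * x = 0 \<and>
        z \<in> H T' (cobj Y (n - 1)) \<and> y * e = f n * x + diff Y (n - 1) * z" using b by metis
qed

lemma abs_qis_comp: "abs_qis X Y f \<Longrightarrow> abs_qis Y Z g \<Longrightarrow> abs_qis X Z (g \<star> f)"
  unfolding abs_qis_def using abs_chain_map_comp Hsurj_comp Hinj_comp by auto

lemma abs_qis_hty: "abs_qis X Y f \<Longrightarrow> abs_chain_map X Y g \<Longrightarrow> abs_homotopic X Y f g \<Longrightarrow> abs_qis X Y g"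
  unfolding abs_qis_def using Hsurj_hty Hinj_hty by auto

lemma abs_qis_right_factor: "abs_chain_map X Y f \<Longrightarrow> abs_qis Y Z g \<Longrightarrow> abs_qis X Z (g \<star> f) \<Longrightarrow> abs_qis X Y f"
  unfolding abs_qis_def using Hsurj_right_factor Hinj_right_factor by blast

lemma abs_qis_id:
  assumes X: "abs_complex X" shows "abs_qis X X (\<lambda>n. I (cobj X n))"
  unfolding abs_qis_def
proof (intro conjI)
  show "abs_chain_map X X (\<lambda>n. I (cobj X n))" using abs_chain_map_id[OF X] .
  show "Hsurj X X (\<lambda>n. I (cobj X n))" unfolding Hsurj_def
  proof (intro allI impI)
    fix n T y assume y: "y \<in> H T (cobj X n)" "diff X n * y = 0"
    have "y * I T = I (cobj X n) * y + diff X (n - 1) * 0" using y(1) idl idr by simp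
    then show "\<exists>T' e x z. e \<in> H T' T \<and> epi T e \<and> x \<in> H T' (cobj X n) \<and> diff X n * x = 0 \<and>
        z \<in> H T' (cobj X (n - 1)) \<and> y * e = I (cobj X n) * x + diff X (n - 1) * z"
      using y epi_id id_in zero_in cxD(5)[OF X] dom_obj[OF y(1)] by metis
  qed
  show "Hinj X X (\<lambda>n. I (cobj X n))" unfolding Hinj_def
    using epi_id id_in idl idr dom_obj by metis
qed

definition is_product3 :: "'o \<Rightarrow> 'o \<Rightarrow> 'o \<Rightarrow> 'o \<Rightarrow> 'r \<Rightarrow> 'r \<Rightarrow> 'r \<Rightarrow> bool" where
  "is_product3 A B C S a b c \<longleftrightarrow> a \<in> H S A \<and> b \<in> H S B \<and> c \<in> H S C \<and>
    (\<forall>T x y z. x \<in> H T A \<longrightarrow> y \<in> H T B \<longrightarrow> z \<in> H T C \<longrightarrow> (\<exists>t\<in>H T S. a * t = x \<and> b * t = y \<and> c * t = z)) \<and>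
    (\<forall>T. \<forall>t\<in>H T S. a * t = 0 \<longrightarrow> b * t = 0 \<longrightarrow> c * t = 0 \<longrightarrow> t = 0)"

text \<open>Iterated fibre products over a zero object.\<close>

lemma product3:
  assumes "A \<in> Obj" "B \<in> Obj" "C \<in> Obj"
  shows "\<exists>S a b c. is_product3 A B C S a b c"
proof -
  obtain N where N: "N \<in> Obj" "I N = 0" using ex_zero by blast
  obtain S1 b1 c1 where 1: "b1 \<in> H S1 B" "c1 \<in> H S1 C"
    "\<And>W a b. a \<in> H W B \<Longrightarrow> b \<in> H W C \<Longrightarrow> 0 * a = 0 * b \<Longrightarrow> \<exists>t\<in>H W S1. b1 * t = a \<and> c1 * t = b"
    "\<And>W t. t \<in> H W S1 \<Longrightarrow> b1 * t = 0 \<Longrightarrow> c1 * t = 0 \<Longrightarrow> t = 0"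
    using pullback[OF zero_in[OF assms(2) N(1)] zero_in[OF assms(3) N(1)]] by metis
  obtain S a s where 2: "a \<in> H S A" "s \<in> H S S1"
    "\<And>W x b. x \<in> H W A \<Longrightarrow> b \<in> H W S1 \<Longrightarrow> 0 * x = 0 * b \<Longrightarrow> \<exists>t\<in>H W S. a * t = x \<and> s * t = b"
    "\<And>W t. t \<in> H W S \<Longrightarrow> a * t = 0 \<Longrightarrow> s * t = 0 \<Longrightarrow> t = 0"
    using pullback[OF zero_in[OF assms(1) N(1)] zero_in[OF dom_obj[OF 1(1)] N(1)]] by metis
  have "\<exists>t\<in>H T S. a * t = x \<and> b1 * s * t = y \<and> c1 * s * t = z"
    if xyz: "x \<in> H T A" "y \<in> H T B" "z \<in> H T C" for T x y z
  proof -
    obtain u where u: "u \<in> H T S1" "b1 * u = y" "c1 * u = z" using 1(3)[OF xyz(2,3)] by auto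
    obtain t where "t \<in> H T S" "a * t = x" "s * t = u" using 2(3)[OF xyz(1) u(1)] by auto
    then show ?thesis using u by (metis mult.assoc)
  qed
  moreover have "t = 0" if "t \<in> H T S" "a * t = 0" "b1 * s * t = 0" "c1 * s * t = 0" for T t
    using 1(4)[OF comp_in[OF 2(2) that(1)]] 2(4)[OF that(1)] that by (simp add: mult.assoc)
  moreover have "b1 * s \<in> H S B" "c1 * s \<in> H S C" using 1 2 comp_in by auto
  ultimately show ?thesis using 2(1) unfolding is_product3_def by blast
qed

text \<open>The homotopy fibre product of \<open>f\<close> and \<open>g\<close>.\<close>

lemma ore:
  assumes X: "abs_complex X" and Y: "abs_complex Y" and Z: "abs_complex Z" and f: "abs_qis X Y f" and g: "abs_chain_map Z Y g"
  obtains W p r where "abs_complex W" "abs_chain_map W X p" "abs_qis W Z r" "abs_homotopic W Y (f \<star> p) (g \<star> r)"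
proof -
  note x = cxD[OF X] and y = cxD[OF Y] and z = cxD[OF Z]
  note fm = cmD[OF qiD(1)[OF f]] and gm = cmD[OF g]
  have "\<forall>n. \<exists>S a b c. is_product3 (cobj X n) (cobj Y (n - 1)) (cobj Z n) S a b c"
    using product3 x(5) y(5) z(5) by blast
  then obtain S a b c where v: "\<And>n. is_product3 (cobj X n) (cobj Y (n - 1)) (cobj Z n) (S n) (a n) (b n) (c n)"
    by metis
  have pr: "a n \<in> H (S n) (cobj X n)" "b n \<in> H (S n) (cobj Y (n - 1))" "c n \<in> H (S n) (cobj Z n)"
    "S n \<in> Obj" for n
    using v[of n] dom_obj unfolding is_product3_def by blast+
  have tup: "\<exists>t\<in>H T (S n). a n * t = x \<and> b n * t = y \<and> c n * t = z"
    if "x \<in> H T (cobj X n)" "y \<in> H T (cobj Y (n - 1))" "z \<in> H T (cobj Z n)" for n T x y z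
    using v[of n] that unfolding is_product3_def by blast
  have jm: "t = 0" if "t \<in> H T (S n)" "a n * t = 0" "b n * t = 0" "c n * t = 0" for n T t
    using v[of n] that unfolding is_product3_def by blast
  have jm2: "t = t'" if "t \<in> H T (S n)" "t' \<in> H T (S n)" "a n * t = a n * t'" "b n * t = b n * t'" "c n * t = c n * t'"
    for n T t t'
    using jm[OF diff_in[OF that(1,2)]] that(3-) by (simp add: algebra_simps)
  \<comment> \<open>Differential of the homotopy fibre on X^n, Y^(n-1), Z^n: (x, y, z) goes to (d x,
    f x - g z - d y, d z). With these signs the middle projection b is itself a homotopy from f a to
    g c.\<close>
  have "\<forall>n. \<exists>t. t \<in> H (S n) (S (n + 1)) \<and> a (n + 1) * t = diff X n * a n \<and>
      b (n + 1) * t = f n * a n - g n * c n - diff Y (n - 1) * b n \<and> c (n + 1) * t = diff Z n * c n"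
  proof
    fix n
    have "diff X n * a n \<in> H (S n) (cobj X (n + 1))" "diff Z n * c n \<in> H (S n) (cobj Z (n + 1))"
      using pr x z by (blast intro: hom)+
    moreover have "f n * a n - g n * c n - diff Y (n - 1) * b n \<in> H (S n) (cobj Y n)"
      using pr fm(1) gm(1) y(2) by (blast intro: hom)
    ultimately show "\<exists>t. t \<in> H (S n) (S (n + 1)) \<and> a (n + 1) * t = diff X n * a n \<and>
      b (n + 1) * t = f n * a n - g n * c n - diff Y (n - 1) * b n \<and> c (n + 1) * t = diff Z n * c n"
      using tup[where n = "n + 1"] by fastforce
  qed
  then obtain D where D: "\<And>n. D n \<in> H (S n) (S (n + 1))" "\<And>n. a (n + 1) * D n = diff X n * a n"
      "\<And>n. b (n + 1) * D n = f n * a n - g n * c n - diff Y (n - 1) * b n" "\<And>n. c (n + 1) * D n = diff Z n * c n"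
    by metis
  have D': "a (n + 1) * (D n * t) = diff X n * (a n * t)"
      "b (n + 1) * (D n * t) = f n * (a n * t) - g n * (c n * t) - diff Y (n - 1) * (b n * t)"
      "c (n + 1) * (D n * t) = diff Z n * (c n * t)" for n t
    using arg_cong[OF D(2)[of n], of "\<lambda>u. u * t"] arg_cong[OF D(3)[of n], of "\<lambda>u. u * t"]
      arg_cong[OF D(4)[of n], of "\<lambda>u. u * t"] by (simp_all add: algebra_simps)
  define W where "W = \<lparr>cobj = S, diff = D\<rparr>"
  have W: "cobj W = S" "diff W = D" by (simp_all add: W_def)
  have DD: "D (n + 1) * D n = 0" for n
  proof (rule jm[of _ "S n" "n + 1 + 1"])
    show "D (n + 1) * D n \<in> H (S n) (S (n + 1 + 1))" using comp_in[OF D(1) D(1)] .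
    show "a (n + 1 + 1) * (D (n + 1) * D n) = 0" "c (n + 1 + 1) * (D (n + 1) * D n) = 0"
      unfolding D' D using x(3)[of n] z(3)[of n] by (simp_all flip: mult.assoc)
    show "b (n + 1 + 1) * (D (n + 1) * D n) = 0"
      unfolding D' D using fm(2)[of n] gm(2)[of n] y(4)[of n]
      by (simp add: algebra_simps) (simp flip: mult.assoc)
  qed
  have "I (S n) = 0" if "I (cobj X n) = 0" "I (cobj Y (n - 1)) = 0" "I (cobj Z n) = 0" for n
    using jm[OF id_in[OF pr(4)[of n]]] pr[of n] that null_target comp_in id_in by metis
  then have "{n. I (S n) \<noteq> 0} \<subseteq> {n. I (cobj X n) \<noteq> 0} \<union> ((\<lambda>n. n + 1) ` {n. I (cobj Y n) \<noteq> 0}) \<union> {n. I (cobj Z n) \<noteq> 0}"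
    by (auto simp: image_iff) (metis diff_add_cancel)
  moreover have "finite {n. I (cobj X n) \<noteq> 0}" "finite {n. I (cobj Y n) \<noteq> 0}" "finite {n. I (cobj Z n) \<noteq> 0}"
    using X Y Z unfolding abs_complex_def by auto
  ultimately have cW: "abs_complex W" unfolding abs_complex_def W using D(1) DD
    by (simp add: finite_subset)
  have ca: "abs_chain_map W X a" and cc: "abs_chain_map W Z c" unfolding abs_chain_map_def W using pr D by auto
  have h: "abs_homotopic W Y (f \<star> a) (g \<star> c)" unfolding abs_homotopic_def W
    using pr D(3) by (intro exI[of _ b]) simp
  have s: "Hsurj W Z c" unfolding Hsurj_def W
  proof (intro allI impI)
    fix n T u assume u: "u \<in> H T (cobj Z n)" "diff Z n * u = 0"
    have gu: "g n * u \<in> H T (cobj Y n)" "diff Y n * (g n * u) = 0" using u gm by (auto intro: hom)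
    from HsurjD[OF qiD(2)[OF f] gu] obtain T' e xx yy where q: "e \<in> H T' T" "epi T e" "xx \<in> H T' (cobj X n)"
      "diff X n * xx = 0" "yy \<in> H T' (cobj Y (n - 1))" "g n * u * e = f n * xx + diff Y (n - 1) * yy" .
    \<comment> \<open>The sign of \<open>yy\<close> makes the middle component of the differential
      vanish.\<close>
    obtain t where t: "t \<in> H T' (S n)" "a n * t = xx" "b n * t = - yy" "c n * t = u * e"
      using tup[OF q(3) minus_in[OF q(5)] comp_in[OF u(1) q(1)]] by blast
    have "D n * t = 0"
    proof (rule jm[of _ T' "n + 1"])
      show "D n * t \<in> H T' (S (n + 1))" using comp_in[OF D(1) t(1)] .
      show "a (n + 1) * (D n * t) = 0" "b (n + 1) * (D n * t) = 0" "c (n + 1) * (D n * t) = 0"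
        unfolding D' t using q(4,6) u(2) by (simp_all add: algebra_simps) (simp flip: mult.assoc)
    qed
    moreover have "u * e = c n * t + diff Z (n - 1) * 0" using t by simp
    ultimately show "\<exists>T' e x z. e \<in> H T' T \<and> epi T e \<and> x \<in> H T' (S n) \<and> D n * x = 0 \<and>
        z \<in> H T' (cobj Z (n - 1)) \<and> u * e = c n * x + diff Z (n - 1) * z"
      using q t(1) zero_in[OF dom_obj[OF q(1)] z(5)] by blast
  qed
  have i: "Hinj W Z c" unfolding Hinj_def W
  proof (intro allI impI)
    fix n T w u assume w: "w \<in> H T (S n)" "D n * w = 0" "u \<in> H T (cobj Z (n - 1))" "c n * w = diff Z (n - 1) * u"
    have k: "diff X n * (a n * w) = 0" "f n * (a n * w) - g n * (c n * w) - diff Y (n - 1) * (b n * w) = 0"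
      using D'(1,2)[of n w] w(2) by simp_all
    have aw: "a n * w \<in> H T (cobj X n)" and bw: "b n * w \<in> H T (cobj Y (n - 1))" using pr w by (blast intro: hom)+
    \<comment> \<open>The middle component of \<open>D n * w = 0\<close> exhibits f (a w) as the
      boundary of this element.\<close>
    let ?y = "g (n - 1) * u + b n * w"
    have yy: "?y \<in> H T (cobj Y (n - 1))" using gm(1) w bw by (blast intro: hom)
    have "f n * (a n * w) = diff Y (n - 1) * ?y" using k(2) w(4) gm(5)[of n u] by (simp add: algebra_simps)
    from HinjD[OF qiD(3)[OF f] aw k(1) yy this] obtain T1 e1 x1 where q: "e1 \<in> H T1 T" "epi T e1"
      "x1 \<in> H T1 (cobj X (n - 1))" "a n * w * e1 = diff X (n - 1) * x1" .
    \<comment> \<open>A primitive x1 of a w need not be compatible with ?y: the discrepancy is a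
      cycle of Y. Surjectivity of f writes it as f x2 plus a boundary, and x1 is corrected by
      x2.\<close>
    let ?k = "f (n - 1) * x1 - ?y * e1"
    have kt: "?k \<in> H T1 (cobj Y (n - 1))" using fm(1) q yy by (blast intro: hom)
    have "diff Y (n - 1) * (f (n - 1) * x1) = f n * (a n * w * e1)" using fm(5)[of n x1] q(4) by simp
    also have "\<dots> = diff Y (n - 1) * (?y * e1)" using \<open>f n * (a n * w) = diff Y (n - 1) * ?y\<close> by (metis mult.assoc)
    finally have "diff Y (n - 1) * ?k = 0" by (simp add: algebra_simps)
    from HsurjD[OF qiD(2)[OF f] kt this] obtain T2 e2 x2 y2 where r: "e2 \<in> H T2 T1" "epi T1 e2"
      "x2 \<in> H T2 (cobj X (n - 1))" "diff X (n - 1) * x2 = 0" "y2 \<in> H T2 (cobj Y (n - 1 - 1))"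
      "?k * e2 = f (n - 1) * x2 + diff Y (n - 1 - 1) * y2" .
    have "x1 * e2 - x2 \<in> H T2 (cobj X (n - 1))" "u * (e1 * e2) \<in> H T2 (cobj Z (n - 1))"
      using q r w by (blast intro: hom)+
    then obtain t where t: "t \<in> H T2 (S (n - 1))" "a (n - 1) * t = x1 * e2 - x2" "b (n - 1) * t = y2"
        "c (n - 1) * t = u * (e1 * e2)"
      using tup[where n = "n - 1"] r(5) by blast
    have E': "a n * (D (n - 1) * t) = diff X (n - 1) * (x1 * e2 - x2)"
        "b n * (D (n - 1) * t) = f (n - 1) * (x1 * e2 - x2) - g (n - 1) * (u * (e1 * e2)) - diff Y (n - 1 - 1) * y2"
        "c n * (D (n - 1) * t) = diff Z (n - 1) * (u * (e1 * e2))"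
      using D'[of "n - 1" t] unfolding t diff_add_cancel by auto
    have "w * (e1 * e2) = D (n - 1) * t"
    proof (rule jm2[of _ T2 n])
      show "w * (e1 * e2) \<in> H T2 (S n)" using w q r by (blast intro: hom)
      show "D (n - 1) * t \<in> H T2 (S n)" using comp_in[OF D(1)[of "n - 1", unfolded diff_add_cancel] t(1)] .
      show "a n * (w * (e1 * e2)) = a n * (D (n - 1) * t)"
        unfolding E' using q(4) r(4) by (simp add: algebra_simps) (simp flip: mult.assoc)
      show "b n * (w * (e1 * e2)) = b n * (D (n - 1) * t)"
        unfolding E' using r(6) by (simp add: algebra_simps)
      show "c n * (w * (e1 * e2)) = c n * (D (n - 1) * t)"
        unfolding E' using w(4) by (simp flip: mult.assoc)
    qed
    moreover have "e1 * e2 \<in> H T2 T" "epi T (e1 * e2)" using q r epi_comp comp_in by blast+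
    ultimately show "\<exists>T' e x'. e \<in> H T' T \<and> epi T e \<and> x' \<in> H T' (S (n - 1)) \<and> w * e = D (n - 1) * x'"
      using t(1) by blast
  qed
  show ?thesis using that[OF cW ca _ h] cc s i unfolding abs_qis_def by blast
qed

section \<open>Roofs up to common refinement\<close>

definition roof_data :: "('o, 'r) cochain \<Rightarrow> ('o, 'r) cochain \<Rightarrow> ('o, 'r) cochain \<Rightarrow> (int \<Rightarrow> 'r) \<Rightarrow> (int \<Rightarrow> 'r) \<Rightarrow> bool" where
  "roof_data X Y Z s f \<longleftrightarrow> abs_complex X \<and> abs_complex Y \<and> abs_complex Z \<and> abs_qis Z X s \<and> abs_chain_map Z Y f"

text \<open>The condition on s u carries over to s' w, which is homotopic to it; hence the relation
  is symmetric although its definition is not.\<close>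

definition roof_equiv :: "('o, 'r) cochain \<Rightarrow> ('o, 'r) cochain \<Rightarrow> ('o, 'r) cochain \<Rightarrow> (int \<Rightarrow> 'r) \<Rightarrow> (int \<Rightarrow> 'r) \<Rightarrow>
    ('o, 'r) cochain \<Rightarrow> (int \<Rightarrow> 'r) \<Rightarrow> (int \<Rightarrow> 'r) \<Rightarrow> bool" where
  "roof_equiv X Y Z s f Z' s' f' \<longleftrightarrow> (\<exists>W u w. abs_complex W \<and> abs_chain_map W Z u \<and> abs_chain_map W Z' w \<and> abs_qis W X (s \<star> u) \<and>
     abs_homotopic W X (s \<star> u) (s' \<star> w) \<and> abs_homotopic W Y (f \<star> u) (f' \<star> w))"

lemma roof_equiv_refl:
  assumes "roof_data X Y Z s f" shows "roof_equiv X Y Z s f Z s f"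
proof -
  have "abs_qis Z X (s \<star> (\<lambda>n. I (cobj Z n)))" using assms abs_qis_comp[OF abs_qis_id] unfolding roof_data_def by blast
  then show ?thesis unfolding roof_equiv_def
    using assms abs_chain_map_id abs_homotopic_refl unfolding roof_data_def by blast
qed

lemma roof_equiv_of_map:
  assumes r: "roof_data X Y Z s f" and W: "abs_complex W" "abs_chain_map W Z u" "abs_qis W X (s \<star> u)"
  shows "roof_equiv X Y Z s f W (s \<star> u) (f \<star> u)"
proof -
  have "abs_homotopic W X (s \<star> u) ((s \<star> u) \<star> (\<lambda>n. I (cobj W n)))" "abs_homotopic W Y (f \<star> u) ((f \<star> u) \<star> (\<lambda>n. I (cobj W n)))"
    using abs_homotopic_refl[OF W(1)] r idr[OF cmD(1)[OF W(2)]] unfolding roof_data_def by (simp_all add: mult.assoc)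
  then show ?thesis unfolding roof_equiv_def using W abs_chain_map_id by blast
qed

lemma roof_equiv_sym:
  assumes "roof_data X Y Z' s' f'" and e: "roof_equiv X Y Z s f Z' s' f'"
  shows "roof_equiv X Y Z' s' f' Z s f"
proof -
  from e obtain W u w where w: "abs_complex W" "abs_chain_map W Z u" "abs_chain_map W Z' w" "abs_qis W X (s \<star> u)"
     "abs_homotopic W X (s \<star> u) (s' \<star> w)" "abs_homotopic W Y (f \<star> u) (f' \<star> w)" unfolding roof_equiv_def by blast
  have "abs_qis W X (s' \<star> w)" using abs_qis_hty[OF w(4) _ w(5)] abs_chain_map_comp[OF w(3)] assms qiD(1) unfolding roof_data_def by blast
  then show ?thesis unfolding roof_equiv_def using w abs_homotopic_sym by blast
qed

text \<open>Both refinements map to Z2, one of them by a quasi-isomorphism (two-out-of-three), so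
  their homotopy fibre product exists and refines both up to homotopy.\<close>

lemma roof_equiv_trans:
  assumes r2: "roof_data X Y Z2 s2 f2" and r1: "roof_data X Y Z1 s1 f1" and r3: "roof_data X Y Z3 s3 f3"
    and e1: "roof_equiv X Y Z1 s1 f1 Z2 s2 f2" and e2: "roof_equiv X Y Z2 s2 f2 Z3 s3 f3"
  shows "roof_equiv X Y Z1 s1 f1 Z3 s3 f3"
proof -
  from e1 obtain W u w where w: "abs_complex W" "abs_chain_map W Z1 u" "abs_chain_map W Z2 w" "abs_qis W X (s1 \<star> u)"
     "abs_homotopic W X (s1 \<star> u) (s2 \<star> w)" "abs_homotopic W Y (f1 \<star> u) (f2 \<star> w)" unfolding roof_equiv_def by blast
  from e2 obtain V u' w' where v: "abs_complex V" "abs_chain_map V Z2 u'" "abs_chain_map V Z3 w'" "abs_qis V X (s2 \<star> u')"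
     "abs_homotopic V X (s2 \<star> u') (s3 \<star> w')" "abs_homotopic V Y (f2 \<star> u') (f3 \<star> w')" unfolding roof_equiv_def by blast
  note r = r1[unfolded roof_data_def] r2[unfolded roof_data_def] r3[unfolded roof_data_def]
  have s2: "abs_chain_map Z2 X s2" and Z2: "abs_complex Z2" "abs_chain_map Z2 Y f2" "abs_qis Z2 X s2" using r qiD(1) by blast+
  have "abs_qis V Z2 u'" using abs_qis_right_factor[OF v(2) Z2(3) v(4)] .
  then obtain Q p t where q: "abs_complex Q" "abs_chain_map Q V p" "abs_qis Q W t" "abs_homotopic Q Z2 (u' \<star> p) (w \<star> t)"
    using ore[OF v(1) Z2(1) w(1) _ w(3)] by blast
  note t = qiD(1)[OF q(3)]
  have 1: "abs_qis Q X (s1 \<star> (u \<star> t))" using abs_qis_comp[OF q(3) w(4)] by (simp add: mult.assoc)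
  have "abs_homotopic Q X (s2 \<star> (u' \<star> p)) (s2 \<star> (w \<star> t))" by (rule abs_homotopic_comp_left[OF q(4) s2])
  then have x: "abs_homotopic Q X (s2 \<star> w \<star> t) (s2 \<star> u' \<star> p)" using abs_homotopic_sym by (simp add: mult.assoc)
  have 2: "abs_homotopic Q X (s1 \<star> (u \<star> t)) (s3 \<star> (w' \<star> p))"
    using abs_homotopic_trans[OF abs_homotopic_trans[OF abs_homotopic_comp_right[OF w(5) t] x] abs_homotopic_comp_right[OF v(5) q(2)]]
    by (simp add: mult.assoc)
  have "abs_homotopic Q Y (f2 \<star> (u' \<star> p)) (f2 \<star> (w \<star> t))" by (rule abs_homotopic_comp_left[OF q(4) Z2(2)])
  then have x: "abs_homotopic Q Y (f2 \<star> w \<star> t) (f2 \<star> u' \<star> p)" using abs_homotopic_sym by (simp add: mult.assoc)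
  have 3: "abs_homotopic Q Y (f1 \<star> (u \<star> t)) (f3 \<star> (w' \<star> p))"
    using abs_homotopic_trans[OF abs_homotopic_trans[OF abs_homotopic_comp_right[OF w(6) t] x] abs_homotopic_comp_right[OF v(6) q(2)]]
    by (simp add: mult.assoc)
  show ?thesis unfolding roof_equiv_def
    by (rule exI[of _ Q], rule exI[of _ "u \<star> t"], rule exI[of _ "w' \<star> p"], intro conjI)
      (fact q(1) abs_chain_map_comp[OF t w(2)] abs_chain_map_comp[OF q(2) v(3)] 1 2 3)+
qed

text \<open>The maps from a common refinement to both middles are quasi-isomorphisms, so injectivity
  on cohomology passes up along one and down along the other. It is a property of the class of the
  roof.\<close>

lemma roof_equiv_Hinj:
  assumes r: "roof_data X Y Z s f" and r': "roof_data X Y Z' s' f'" and e: "roof_equiv X Y Z s f Z' s' f'"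
    and i: "Hinj Z Y f"
  shows "Hinj Z' Y f'"
proof -
  have R: "abs_complex X" "abs_complex Y" "abs_qis Z X s" "abs_chain_map Z Y f" "abs_qis Z' X s'" "abs_chain_map Z' Y f'" "abs_chain_map Z' X s'"
    using r r' qiD(1) unfolding roof_data_def by auto
  from e obtain W u w where w: "abs_complex W" "abs_chain_map W Z u" "abs_chain_map W Z' w" "abs_qis W X (s \<star> u)"
     "abs_homotopic W X (s \<star> u) (s' \<star> w)" "abs_homotopic W Y (f \<star> u) (f' \<star> w)" unfolding roof_equiv_def by blast
  have u: "abs_qis W Z u" by (rule abs_qis_right_factor[OF w(2) R(3) w(4)])
  have "abs_qis W X (s' \<star> w)" by (rule abs_qis_hty[OF w(4) abs_chain_map_comp[OF w(3) R(7)] w(5)])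
  then have v: "abs_qis W Z' w" by (rule abs_qis_right_factor[OF w(3) R(5)])
  have "Hinj W Y (f \<star> u)" by (rule Hinj_comp[OF w(2) qiD(3)[OF u] R(4) i])
  then have "Hinj W Y (f' \<star> w)" by (rule Hinj_hty[OF _ w(6)])
  then show ?thesis by (rule Hinj_left_factor[OF R(6) w(3) qiD(2)[OF v]])
qed

lemma roof_equiv_Hsurj:
  assumes r: "roof_data X Y Z s f" and r': "roof_data X Y Z' s' f'" and e: "roof_equiv X Y Z s f Z' s' f'"
    and i: "Hsurj Z Y f"
  shows "Hsurj Z' Y f'"
proof -
  have R: "abs_complex X" "abs_complex Y" "abs_qis Z X s" "abs_chain_map Z Y f" "abs_qis Z' X s'" "abs_chain_map Z' Y f'" "abs_chain_map Z' X s'"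
    using r r' qiD(1) unfolding roof_data_def by auto
  from e obtain W u w where w: "abs_complex W" "abs_chain_map W Z u" "abs_chain_map W Z' w" "abs_qis W X (s \<star> u)"
     "abs_homotopic W X (s \<star> u) (s' \<star> w)" "abs_homotopic W Y (f \<star> u) (f' \<star> w)" unfolding roof_equiv_def by blast
  have u: "abs_qis W Z u" by (rule abs_qis_right_factor[OF w(2) R(3) w(4)])
  have "Hsurj W Y (f \<star> u)" by (rule Hsurj_comp[OF w(2) qiD(2)[OF u] R(4) i])
  then have "Hsurj W Y (f' \<star> w)" by (rule Hsurj_hty[OF _ w(6)])
  then show ?thesis by (rule Hsurj_left_factor[OF w(3)])
qed

end


section \<open>First extension classes as two-term roofs\<close>

definition supported_at :: "int \<Rightarrow> 'r::zero \<Rightarrow> int \<Rightarrow> 'r" where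
  "supported_at k b = (\<lambda>n. if n = k then b else 0)"

lemma supported_at_simps [simp]: "supported_at k b k = b" "n \<noteq> k \<Longrightarrow> supported_at k b n = 0"
  by (auto simp: supported_at_def)

context abcat
begin

text \<open>The same choice as \<open>zero_ob\<close> (see \<open>zero_ob_null\<close>), so that
  \<open>stalk\<close> and \<open>stalk_at\<close> correspond exactly rather than up to
  isomorphism.\<close>

definition null :: 'o where
  "null = (SOME Z. Z \<in> Obj \<and> I Z = 0)"

lemma null: "null \<in> Obj" "I null = 0"
  using someI_ex[of "\<lambda>Z. Z \<in> Obj \<and> I Z = 0"] ex_zero unfolding null_def by blast+

lemma into_null: "f \<in> H X null \<Longrightarrow> f = 0"
  using null_target[OF null(2)] .

definition stalk_at :: "int \<Rightarrow> 'o \<Rightarrow> ('o, 'r) cochain" where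
  "stalk_at k M = \<lparr>cobj = (\<lambda>n. if n = k then M else null), diff = (\<lambda>_. 0)\<rparr>"

lemma stalk_at_simps [simp]: "diff (stalk_at k M) n = 0" "cobj (stalk_at k M) k = M" "n \<noteq> k \<Longrightarrow> cobj (stalk_at k M) n = null"
  by (auto simp: stalk_at_def)

lemma stalk_at_cx:
  assumes "M \<in> Obj" shows "abs_complex (stalk_at k M)"
proof -
  have "finite {n. I (cobj (stalk_at k M) n) \<noteq> 0}"
    by (rule finite_subset[of _ "{k}"]) (auto simp: stalk_at_def null)
  then show ?thesis unfolding abs_complex_def using assms null by (auto simp: stalk_at_def intro: zero_in)
qed

lemma abs_chain_map_st:
  assumes "abs_complex Z" "N \<in> Obj"
  shows "abs_chain_map Z (stalk_at k N) f \<longleftrightarrow> f k \<in> H (cobj Z k) N \<and> f k * diff Z (k - 1) = 0 \<and> (\<forall>n. n \<noteq> k \<longrightarrow> f n = 0)"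
    (is "?l \<longleftrightarrow> ?r")
proof
  assume l: ?l
  have "f n = 0" if "n \<noteq> k" for n using cmD(1)[OF l, of n] that into_null by simp
  then show ?r using cmD(1,3)[OF l, of k] by auto
next
  assume r: ?r
  have "f (n + 1) * diff Z n = 0" for n
    using r by (cases "n + 1 = k") auto
  moreover have "f n \<in> H (cobj Z n) (cobj (stalk_at k N) n)" for n
    using r zero_in[OF cxD(5)[OF assms(1)] null(1)] by (cases "n = k") auto
  ultimately show ?l unfolding abs_chain_map_def by simp
qed

lemma abs_chain_map_sg:
  assumes "abs_complex Z" "b \<in> H (cobj Z k) N" "b * diff Z (k - 1) = 0"
  shows "abs_chain_map Z (stalk_at k N) (supported_at k b)"
  using abs_chain_map_st[OF assms(1) cod_obj[OF assms(2)]] assms by simp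

text \<open>Outside degree 0 the target is zero: surjectivity is then trivial and injectivity means
  exactness of Z. The two conditions are what remains of \<open>Hsurj\<close> and
  \<open>Hinj\<close>.\<close>

lemma abs_qis_stI:
  assumes "abs_chain_map Z (stalk_at 0 M) s"
    and a: "\<And>T y. y \<in> H T M \<Longrightarrow>
      \<exists>T' e x. e \<in> H T' T \<and> epi T e \<and> x \<in> H T' (cobj Z 0) \<and> diff Z 0 * x = 0 \<and> y * e = s 0 * x"
    and b: "\<And>T x n. x \<in> H T (cobj Z n) \<Longrightarrow> diff Z n * x = 0 \<Longrightarrow> (n = 0 \<Longrightarrow> s 0 * x = 0) \<Longrightarrow>
      \<exists>T' e x'. e \<in> H T' T \<and> epi T e \<and> x' \<in> H T' (cobj Z (n - 1)) \<and> x * e = diff Z (n - 1) * x'"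
    and Z: "abs_complex Z"
  shows "abs_qis Z (stalk_at 0 M) s"
  unfolding abs_qis_def
proof (intro conjI)
  show "Hsurj Z (stalk_at 0 M) s" unfolding Hsurj_def
  proof (intro allI impI)
    fix n T y assume y: "y \<in> H T (cobj (stalk_at 0 M) n)"
    show "\<exists>T' e x z. e \<in> H T' T \<and> epi T e \<and> x \<in> H T' (cobj Z n) \<and> diff Z n * x = 0 \<and>
        z \<in> H T' (cobj (stalk_at 0 M) (n - 1)) \<and> y * e = s n * x + diff (stalk_at 0 M) (n - 1) * z"
    proof (cases "n = 0")
      case True
      then have "y \<in> H T M" using y by simp
      from a[OF this] obtain T' e x where
        "e \<in> H T' T" "epi T e" "x \<in> H T' (cobj Z 0)" "diff Z 0 * x = 0" "y * e = s 0 * x"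
        by blast
      moreover have "0 \<in> H T' null" using \<open>e \<in> H T' T\<close> dom_obj null by (blast intro: zero_in)
      ultimately show ?thesis using True by auto
    next
      case False
      then have "y = 0" using y into_null by simp
      moreover have "T \<in> Obj" using y dom_obj by blast
      moreover have "cobj (stalk_at 0 M) (n - 1) \<in> Obj" using y cxD(5)[OF stalk_at_cx] cmD(1)[OF assms(1), of 0] cod_obj by simp
      ultimately show ?thesis
        using epi_id id_in zero_in cxD(5)[OF Z] by (intro exI[of _ T] exI[of _ "I T"] exI[of _ 0]) auto
    qed
  qed
  show "Hinj Z (stalk_at 0 M) s" unfolding Hinj_def
  proof (intro allI impI)
    fix n T x y assume x: "x \<in> H T (cobj Z n)" "diff Z n * x = 0" "s n * x = diff (stalk_at 0 M) (n - 1) * y"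
    then have "n = 0 \<Longrightarrow> s 0 * x = 0" by simp
    from b[OF x(1,2) this] show "\<exists>T' e x'. e \<in> H T' T \<and> epi T e \<and> x' \<in> H T' (cobj Z (n - 1)) \<and>
      x * e = diff Z (n - 1) * x'" .
  qed
qed (fact assms(1))

text \<open>In the third conclusion k is any arrow through which all 0-cycles factor; it says that
  the 0-cycles of Z map onto M.\<close>

lemma abs_qis_stD:
  assumes q: "abs_qis Z (stalk_at 0 M) s" and Z: "abs_complex Z"
  shows "\<And>T x. x \<in> H T (cobj Z 0) \<Longrightarrow> diff Z 0 * x = 0 \<Longrightarrow> s 0 * x = 0 \<Longrightarrow>
      \<exists>T' e x'. e \<in> H T' T \<and> epi T e \<and> x' \<in> H T' (cobj Z (-1)) \<and> x * e = diff Z (-1) * x'"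
    and "\<And>n T x. n \<noteq> 0 \<Longrightarrow> x \<in> H T (cobj Z n) \<Longrightarrow> diff Z n * x = 0 \<Longrightarrow>
      \<exists>T' e x'. e \<in> H T' T \<and> epi T e \<and> x' \<in> H T' (cobj Z (n - 1)) \<and> x * e = diff Z (n - 1) * x'"
    and "\<And>K k. k \<in> H K (cobj Z 0) \<Longrightarrow>
      (\<And>W g. g \<in> H W (cobj Z 0) \<Longrightarrow> diff Z 0 * g = 0 \<Longrightarrow> \<exists>t\<in>H W K. k * t = g) \<Longrightarrow> epi M (s 0 * k)"
proof -
  have M: "M \<in> Obj" using cmD(1)[OF qiD(1)[OF q], of 0] cod_obj by simp
  have sn: "s n = 0" if "n \<noteq> 0" for n using cmD(1)[OF qiD(1)[OF q], of n] that into_null by simp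
  fix T x assume x: "x \<in> H T (cobj Z 0)" "diff Z 0 * x = 0" "s 0 * x = 0"
  have "0 \<in> H T (cobj (stalk_at 0 M) (0 - 1))" "s 0 * x = diff (stalk_at 0 M) (0 - 1) * 0"
    using x null zero_in dom_obj by auto
  from HinjD[OF qiD(3)[OF q] x(1,2) this] show "\<exists>T' e x'. e \<in> H T' T \<and> epi T e \<and> x' \<in> H T' (cobj Z (-1)) \<and> x * e = diff Z (-1) * x'"
    by (metis diff_0)
next
  fix n T x assume x: "n \<noteq> 0" "x \<in> H T (cobj Z n)" "diff Z n * x = 0"
  have M: "M \<in> Obj" using cmD(1)[OF qiD(1)[OF q], of 0] cod_obj by simp
  have sn: "s n = 0" using cmD(1)[OF qiD(1)[OF q], of n] x into_null by simp
  have "0 \<in> H T (cobj (stalk_at 0 M) (n - 1))" "s n * x = diff (stalk_at 0 M) (n - 1) * 0"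
    using x zero_in[OF dom_obj cxD(5)[OF stalk_at_cx[OF M]]] sn by auto
  from HinjD[OF qiD(3)[OF q] x(2,3) this] show "\<exists>T' e x'. e \<in> H T' T \<and> epi T e \<and> x' \<in> H T' (cobj Z (n - 1)) \<and> x * e = diff Z (n - 1) * x'"
    by metis
next
  fix K k assume k: "k \<in> H K (cobj Z 0)"
     "\<And>W g. g \<in> H W (cobj Z 0) \<Longrightarrow> diff Z 0 * g = 0 \<Longrightarrow> \<exists>t\<in>H W K. k * t = g"
  have M: "M \<in> Obj" using cmD(1)[OF qiD(1)[OF q], of 0] cod_obj by simp
  \<comment> \<open>The identity is the universal generalized element of M; lifting it on a cover is
    already surjectivity.\<close>
  have "I M \<in> H M (cobj (stalk_at 0 M) 0)" "diff (stalk_at 0 M) 0 * I M = 0" using M id_in by simp_all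
  from HsurjD[OF qiD(2)[OF q] this] obtain T' e x where e: "e \<in> H T' M" "epi M e" "x \<in> H T' (cobj Z 0)"
    "diff Z 0 * x = 0" "I M * e = s 0 * x" by (metis add.right_neutral mult_zero_left stalk_at_simps(1))
  then obtain t where "k * t = x" using k(2) by blast
  then have "e = s 0 * k * t" using e idl by (simp add: mult.assoc)
  then show "epi M (s 0 * k)" using epi_right_factor[OF e(2)] by blast
qed

section \<open>Short resolutions as three-term and two-term complexes\<close>

definition three_term :: "'o \<Rightarrow> 'o \<Rightarrow> 'o \<Rightarrow> 'r \<Rightarrow> 'r \<Rightarrow> ('o, 'r) cochain" where
  "three_term A B P j i = \<lparr>cobj = (\<lambda>n. if n = -2 then A else if n = -1 then B else if n = 0 then P else null),
     diff = (\<lambda>n. if n = -2 then j else if n = -1 then i else 0)\<rparr>"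

lemma three_term_simps [simp]:
  "cobj (three_term A B P j i) (-2) = A" "cobj (three_term A B P j i) (-1) = B" "cobj (three_term A B P j i) 0 = P"
  "n \<noteq> -2 \<Longrightarrow> n \<noteq> -1 \<Longrightarrow> n \<noteq> 0 \<Longrightarrow> cobj (three_term A B P j i) n = null"
  "diff (three_term A B P j i) (-2) = j" "diff (three_term A B P j i) (-1) = i"
  "n \<noteq> -2 \<Longrightarrow> n \<noteq> -1 \<Longrightarrow> diff (three_term A B P j i) n = 0"
  by (auto simp: three_term_def)

lemma three_term_cx:
  assumes "j \<in> H A B" "i \<in> H B P" "i * j = 0"
  shows "abs_complex (three_term A B P j i)"
proof -
  have ob: "cobj (three_term A B P j i) n \<in> Obj" for n
    using H_obj[OF assms(1)] H_obj[OF assms(2)] null by (simp add: three_term_def)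
  have "finite {n. I (cobj (three_term A B P j i) n) \<noteq> 0}"
    by (rule finite_subset[of _ "{-2,-1,0}"]) (auto simp: three_term_def null split: if_splits)
  moreover have "diff (three_term A B P j i) n \<in> H (cobj (three_term A B P j i) n) (cobj (three_term A B P j i) (n + 1))" for n
  proof -
    consider "n = -2" | "n = -1" | "n \<noteq> -2" "n \<noteq> -1" by blast
    then show ?thesis
    proof cases
      case 3
      then show ?thesis using zero_in[OF ob[of n] ob[of "n + 1"]] by simp
    qed (use assms in simp_all)
  qed
  moreover have "diff (three_term A B P j i) (n + 1) * diff (three_term A B P j i) n = 0" for n
  proof (cases "n = -2")
    case True
    then show ?thesis using assms by simp
  next
    case False
    then show ?thesis by (cases "n = -1") simp_all
  qed
  ultimately show ?thesis unfolding abs_complex_def by auto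
qed

text \<open>An exact sequence 0 -> A -> B -> P -> M -> 0 makes its first three terms a resolution of
  M. Exactness at B and P is given up to covers, in the form that \<open>Hinj\<close> uses.\<close>

lemma three_term_qi:
  assumes j: "j \<in> H A B" "mono A j" and i: "i \<in> H B P" "i * j = 0" and p: "\<pi> \<in> H P M" "epi M \<pi>" "\<pi> * i = 0"
    and b: "\<And>T x. x \<in> H T B \<Longrightarrow> i * x = 0 \<Longrightarrow> \<exists>T' e x'. e \<in> H T' T \<and> epi T e \<and> x' \<in> H T' A \<and> x * e = j * x'"
    and c: "\<And>T x. x \<in> H T P \<Longrightarrow> \<pi> * x = 0 \<Longrightarrow> \<exists>T' e x'. e \<in> H T' T \<and> epi T e \<and> x' \<in> H T' B \<and> x * e = i * x'"
  shows "abs_qis (three_term A B P j i) (stalk_at 0 M) (supported_at 0 \<pi>)"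
proof (rule abs_qis_stI)
  let ?T = "three_term A B P j i"
  show Z: "abs_complex ?T" using three_term_cx j i by blast
  show "abs_chain_map ?T (stalk_at 0 M) (supported_at 0 \<pi>)" by (rule abs_chain_map_sg[OF Z]) (use p in auto)
  fix T y assume y: "y \<in> H T M"
  obtain T' e x where "e \<in> H T' T" "epi T e" "x \<in> H T' P" "\<pi> * x = y * e" using cover_lift[OF p(1,2) y] .
  then show "\<exists>T' e x. e \<in> H T' T \<and> epi T e \<and> x \<in> H T' (cobj ?T 0) \<and> diff ?T 0 * x = 0 \<and> y * e = supported_at 0 \<pi> 0 * x"
    by (intro exI[of _ T'] exI[of _ e] exI[of _ x]) auto
next
  let ?T = "three_term A B P j i"
  fix T x n assume x: "x \<in> H T (cobj ?T n)" "diff ?T n * x = 0" "n = 0 \<Longrightarrow> supported_at 0 \<pi> 0 * x = 0"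
  consider "n = -2" | "n = -1" | "n = 0" | "n \<noteq> -2" "n \<noteq> -1" "n \<noteq> 0" by blast
  then show "\<exists>T' e x'. e \<in> H T' T \<and> epi T e \<and> x' \<in> H T' (cobj ?T (n - 1)) \<and> x * e = diff ?T (n - 1) * x'"
  proof cases
    case 1
    then have "x = 0" using x monoD[OF j(2)] by simp
    then show ?thesis using 1 x epi_id id_in zero_in dom_obj null
      by (intro exI[of _ T] exI[of _ "I T"] exI[of _ 0]) auto
  next
    case 2
    then show ?thesis using x b by simp
  next
    case 3
    then show ?thesis using x c by simp
  next
    case 4
    then have "x = 0" using x into_null by simp
    then show ?thesis using x epi_id id_in zero_in dom_obj cxD(5)[OF three_term_cx[OF j(1) i]]
      by (intro exI[of _ T] exI[of _ "I T"] exI[of _ 0]) auto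
  qed
qed

abbreviation two_term :: "'o \<Rightarrow> 'o \<Rightarrow> 'r \<Rightarrow> ('o, 'r) cochain" where
  "two_term B P i \<equiv> three_term null B P 0 i"

lemma two_term_qi:
  assumes s: "ses B P M i \<pi>"
  shows "abs_complex (two_term B P i)" "abs_qis (two_term B P i) (stalk_at 0 M) (supported_at 0 \<pi>)"
proof -
  note t = sesD[OF s]
  have z: "0 \<in> H null B" using null t zero_in by blast
  show "abs_complex (two_term B P i)" using three_term_cx[OF z t(1)] by simp
  have zz: "\<exists>T' e x'. e \<in> H T' T \<and> epi T e \<and> x' \<in> H T' null \<and> x * e = 0 * x'" if "x \<in> H T B" "i * x = 0" for T x
    using monoD[OF t(3) that] epi_id id_in zero_in null dom_obj[OF that(1)]
    by (intro exI[of _ T] exI[of _ "I T"] exI[of _ 0]) auto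
  have b: "\<exists>T' e x'. e \<in> H T' T \<and> epi T e \<and> x' \<in> H T' B \<and> x * e = i * x'" if "x \<in> H T P" "\<pi> * x = 0" for T x
    using t(9)[OF that] epi_id id_in dom_obj[OF that(1)] idr[OF that(1)] by metis
  show "abs_qis (two_term B P i) (stalk_at 0 M) (supported_at 0 \<pi>)"
    by (rule three_term_qi[OF z _ t(1) _ t(2,4,5) zz b]) (auto simp: mono_def dest: into_null)
qed

lemma two_term_cm:
  assumes s: "ses B P M i \<pi>" and b: "b \<in> H B N"
  shows "abs_chain_map (two_term B P i) (stalk_at (-1) N) (supported_at (-1) b)"
  by (rule abs_chain_map_sg[OF two_term_qi(1)[OF s]]) (use b in auto)

lemma two_term_isr:
  assumes s: "ses B P M i \<pi>" and b: "b \<in> H B N"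
  shows "roof_data (stalk_at 0 M) (stalk_at (-1) N) (two_term B P i) (supported_at 0 \<pi>) (supported_at (-1) b)"
  unfolding roof_data_def using two_term_qi[OF s] two_term_cm[OF s b] stalk_at_cx sesD(8)[OF s] cod_obj[OF b] by blast

text \<open>The roofs \<open>M \<leftarrow> (B \<rightarrow> P) \<rightarrow> N[1]\<close> given by arrows \<open>b : B \<rightarrow> N\<close> from resolutions \<open>B \<rightarrow> P\<close> of \<open>M\<close>
  represent all of \<open>Ext\<^sup>1 M N\<close>; the relation below is equality of their classes.\<close>

definition same_ext_class :: "'o \<Rightarrow> 'o \<Rightarrow> 'o \<Rightarrow> 'o \<Rightarrow> 'r \<Rightarrow> 'r \<Rightarrow> 'r \<Rightarrow> 'o \<Rightarrow> 'o \<Rightarrow> 'r \<Rightarrow> 'r \<Rightarrow> 'r \<Rightarrow> bool" where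
  "same_ext_class M N B P i \<pi> b B' P' i' \<pi>' b' \<longleftrightarrow>
     roof_equiv (stalk_at 0 M) (stalk_at (-1) N) (two_term B P i) (supported_at 0 \<pi>) (supported_at (-1) b) (two_term B' P' i') (supported_at 0 \<pi>') (supported_at (-1) b')"

text \<open>A morphism of resolutions over the identity of M is a chain map of two-term complexes.
  Pulling the roof back along it stays in the class and turns the numerator b into b c.\<close>

lemma same_ext_class_refines:
  assumes s: "ses B P M i \<pi>" and s2: "ses B2 P2 M i2 \<pi>2" and r: "refines B P i \<pi> B2 P2 i2 \<pi>2 a c"
    and b: "b \<in> H B N"
  shows "same_ext_class M N B P i \<pi> b B2 P2 i2 \<pi>2 (b * c)"
proof -
  note R = refinesD[OF r]
  define u where "u = (\<lambda>n::int. if n = 0 then a else if n = -1 then c else 0)"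
  have u: "abs_chain_map (two_term B2 P2 i2) (two_term B P i) u"
    unfolding abs_chain_map_def
  proof (intro allI conjI)
    fix n
    show "u n \<in> H (cobj (two_term B2 P2 i2) n) (cobj (two_term B P i) n)"
      using R null by (auto simp: u_def three_term_def intro: zero_in)
    consider "n = -2" | "n = -1" | "n \<noteq> -2" "n \<noteq> -1" by blast
    then show "u (n + 1) * diff (two_term B2 P2 i2) n = diff (two_term B P i) n * u n"
      using R by cases (auto simp: u_def)
  qed
  have 1: "supported_at 0 \<pi> \<star> u = supported_at 0 \<pi>2" "supported_at (-1) b \<star> u = supported_at (-1) (b * c)"
    using R by (auto simp: fun_eq_iff u_def supported_at_def)
  show ?thesis unfolding same_ext_class_def
    using roof_equiv_of_map[OF two_term_isr[OF s b] two_term_qi(1)[OF s2] u] two_term_qi(2)[OF s2] unfolding 1 by blast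
qed

lemma same_ext_class_trans:
  assumes "ses B1 P1 M i1 \<pi>1" "b1 \<in> H B1 N" "ses B2 P2 M i2 \<pi>2" "b2 \<in> H B2 N" "ses B3 P3 M i3 \<pi>3" "b3 \<in> H B3 N"
    and "same_ext_class M N B1 P1 i1 \<pi>1 b1 B2 P2 i2 \<pi>2 b2" "same_ext_class M N B2 P2 i2 \<pi>2 b2 B3 P3 i3 \<pi>3 b3"
  shows "same_ext_class M N B1 P1 i1 \<pi>1 b1 B3 P3 i3 \<pi>3 b3"
  using roof_equiv_trans[OF two_term_isr[OF assms(3,4)] two_term_isr[OF assms(1,2)] two_term_isr[OF assms(5,6)]] assms(7,8)
  unfolding same_ext_class_def by blast

lemma same_ext_class_sym:
  assumes "ses B1 P1 M i1 \<pi>1" "b1 \<in> H B1 N" "ses B2 P2 M i2 \<pi>2" "b2 \<in> H B2 N"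
    and "same_ext_class M N B1 P1 i1 \<pi>1 b1 B2 P2 i2 \<pi>2 b2"
  shows "same_ext_class M N B2 P2 i2 \<pi>2 b2 B1 P1 i1 \<pi>1 b1"
  using roof_equiv_sym[OF two_term_isr[OF assms(3,4)]] assms(5) unfolding same_ext_class_def by blast

text \<open>The arrow e, placed in degree 0, is a homotopy between the two numerators.\<close>

lemma same_ext_class_of_extension:
  assumes s: "ses B P M i \<pi>" and b: "b \<in> H B N" "b' \<in> H B N" and e: "e \<in> H P N" "b - b' = e * i"
  shows "same_ext_class M N B P i \<pi> b B P i \<pi> b'"
proof -
  let ?T = "two_term B P i"
  define j where "j = (\<lambda>n. I (cobj ?T n))"
  note T = two_term_qi[OF s]
  have 1: "f \<star> j = f" if "abs_chain_map ?T Y f" for f Y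
    using idr[OF cmD(1)[OF that]] by (simp add: j_def)
  have ob: "N \<in> Obj" "B \<in> Obj" "P \<in> Obj" using cod_obj b sesD[OF s] by auto
  have "abs_homotopic ?T (stalk_at (-1) N) (supported_at (-1) b) (supported_at (-1) b')"
    unfolding abs_homotopic_def
  proof (intro exI[of _ "supported_at 0 e"] allI conjI)
    fix n :: int
    show "supported_at 0 e n \<in> H (cobj ?T n) (cobj (stalk_at (-1) N) (n - 1))"
      using e null ob by (cases "n = 0") (auto simp: three_term_def stalk_at_def intro: zero_in)
    show "supported_at (-1) b n - supported_at (-1) b' n = diff (stalk_at (-1) N) (n - 1) * supported_at 0 e n + supported_at 0 e (n + 1) * diff ?T n"
      using e by (cases "n = -1") auto
  qed
  then have "abs_homotopic ?T (stalk_at (-1) N) (supported_at (-1) b \<star> j) (supported_at (-1) b' \<star> j)"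
    using 1[OF two_term_cm[OF s b(1)]] 1[OF two_term_cm[OF s b(2)]] by simp
  moreover have "abs_qis ?T (stalk_at 0 M) (supported_at 0 \<pi> \<star> j)" "abs_homotopic ?T (stalk_at 0 M) (supported_at 0 \<pi> \<star> j) (supported_at 0 \<pi> \<star> j)"
    using 1[OF qiD(1)[OF T(2)]] T(2) abs_homotopic_refl[OF T(1) stalk_at_cx] sesD(8)[OF s] by simp_all
  moreover have "abs_chain_map ?T ?T j" unfolding j_def by (rule abs_chain_map_id[OF T(1)])
  ultimately show ?thesis unfolding same_ext_class_def roof_equiv_def using T(1) by blast
qed

text \<open>Exactness of Hom(P,N) -> Hom(B,N) -> Ext^1(M,N) in the middle. A common refinement W
  only sees b - b' pulled back to W. The difference is therefore glued with an arrow on the 0-cycles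
  K of W; B and K together cover P, and the glued arrow descends.\<close>

lemma same_ext_class_extension:
  assumes s: "ses B P M i \<pi>" and b: "b \<in> H B N" "b' \<in> H B N" and e: "same_ext_class M N B P i \<pi> b B P i \<pi> b'"
  shows "\<exists>e\<in>H P N. b - b' = e * i"
proof -
  let ?T = "two_term B P i" and ?s = "supported_at 0 \<pi>"
  note t = sesD[OF s]
  from e obtain W u w where W: "abs_complex W" "abs_chain_map W ?T u" "abs_chain_map W ?T w" "abs_qis W (stalk_at 0 M) (?s \<star> u)"
     "abs_homotopic W (stalk_at 0 M) (?s \<star> u) (?s \<star> w)" "abs_homotopic W (stalk_at (-1) N) (supported_at (-1) b \<star> u) (supported_at (-1) b' \<star> w)"
    unfolding same_ext_class_def roof_equiv_def by blast
  note x = cxD[OF W(1)]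
  have u: "u 0 \<in> H (cobj W 0) P" "u (-1) \<in> H (cobj W (-1)) B" "u 0 * diff W (-1) = i * u (-1)"
    and w: "w 0 \<in> H (cobj W 0) P" "w (-1) \<in> H (cobj W (-1)) B" "w 0 * diff W (-1) = i * w (-1)"
    using cmD(1)[OF W(2), of 0] cmD(1)[OF W(2), of "-1"] cmD(2)[OF W(2), of "-1"]
      cmD(1)[OF W(3), of 0] cmD(1)[OF W(3), of "-1"] cmD(2)[OF W(3), of "-1"] by simp_all
  obtain h1 where h1: "\<And>n. (?s \<star> u) n - (?s \<star> w) n = h1 (n + 1) * diff W n"
    using W(5) unfolding abs_homotopic_def by auto
  obtain h2 where h2: "\<And>n. h2 n \<in> H (cobj W n) (cobj (stalk_at (-1) N) (n - 1))"
     "\<And>n. (supported_at (-1) b \<star> u) n - (supported_at (-1) b' \<star> w) n = h2 (n + 1) * diff W n"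
    using W(6) unfolding abs_homotopic_def by auto
  have h: "\<pi> * u 0 - \<pi> * w 0 = h1 1 * diff W 0" "b * u (-1) - b' * w (-1) = h2 0 * diff W (-1)" "h2 0 \<in> H (cobj W 0) N"
    using h1[of 0] h2(2)[of "-1"] h2(1)[of 0] by simp_all
  obtain K k where k: "k \<in> H K (cobj W 0)" "diff W 0 * k = 0" "mono K k"
      "\<And>V g. g \<in> H V (cobj W 0) \<Longrightarrow> diff W 0 * g = 0 \<Longrightarrow> \<exists>t\<in>H V K. k * t = g"
    using ker_obtain[OF x(1)[of 0]] by metis
  have ep: "epi M (\<pi> * u 0 * k)" using abs_qis_stD(3)[OF W(4,1) k(1,4)] by simp
  have d1: "diff W (-1) \<in> H (cobj W (-1)) (cobj W 0)" "diff W 0 * diff W (-1) = 0"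
    using x(2,4)[of 0] by simp_all
  obtain t0 where t0: "t0 \<in> H (cobj W (-1)) K" "k * t0 = diff W (-1)" using k(4)[OF d1] by blast
  have "\<pi> * (u 0 * k - w 0 * k) = (\<pi> * u 0 - \<pi> * w 0) * k" by (simp add: algebra_simps)
  also have "\<dots> = 0" unfolding h(1) mult.assoc k(2) by simp
  finally have "\<pi> * (u 0 * k - w 0 * k) = 0" .
  \<comment> \<open>After \<pi>, the maps u and w differ by a homotopy term that vanishes on cycles,
    so on K their difference lies in B; s records it.\<close>
  then obtain s where s': "s \<in> H K B" "i * s = u 0 * k - w 0 * k"
    using t(9)[OF diff_in[OF comp_in[OF u(1) k(1)] comp_in[OF w(1) k(1)]]] by blast
  have "i * (u (-1) - w (-1)) = (u 0 - w 0) * diff W (-1)" using u(3) w(3) by (simp add: algebra_simps)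
  also have "\<dots> = i * (s * t0)" unfolding t0(2)[symmetric] mult.assoc[symmetric] s'(2) by (simp add: algebra_simps)
  finally have uw: "u (-1) - w (-1) = s * t0"
    using mono_cancel[OF t(3) diff_in[OF u(2) w(2)] comp_in[OF s'(1) t0(1)]] by blast
  \<comment> \<open>The value that the sought extension must take along u0 k: h2 accounts for b u -
    b' w, and b' s for the difference of u and w.\<close>
  define g where "g = h2 0 * k - b' * s"
  have g: "g \<in> H K N" unfolding g_def using h k s' b by (blast intro: hom)
  have "(b - b') * u (-1) = (b * u (-1) - b' * w (-1)) - b' * (u (-1) - w (-1))" by (simp add: algebra_simps)
  also have "\<dots> = g * t0" unfolding h(2) uw g_def t0(2)[symmetric] by (simp add: algebra_simps)
  finally have bg: "(b - b') * u (-1) = g * t0" .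
  obtain S i1 i2 p1 p2 where S: "i1 \<in> H B S" "i2 \<in> H K S" "p1 \<in> H S B" "p2 \<in> H S K"
      "p1 * i1 = I B" "p2 * i2 = I K" "p1 * i2 = 0" "p2 * i1 = 0"
    using ex_biprod[OF t(6) dom_obj[OF k(1)]] by blast
  define \<phi> where "\<phi> = i * p1 + u 0 * k * p2"
  have f: "\<phi> \<in> H S P" unfolding \<phi>_def using t(1) S u k by (blast intro: hom)
  have fi: "\<phi> * i1 = i" "\<phi> * i2 = u 0 * k"
    using S(5-8) idr[OF t(1)] idr[OF comp_in[OF u(1) k(1)]] by (simp_all add: \<phi>_def distrib_right mult.assoc)
  \<comment> \<open>An arrow killing i descends to M, and there \<pi> u0 k is epi.\<close>
  have "epi P \<phi>" unfolding epi_def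
  proof (intro allI ballI impI)
    fix V v assume v: "v \<in> H P V" "v * \<phi> = 0"
    have "v * i = 0" "v * (u 0 * k) = 0" using v(2) fi by (metis mult.assoc mult_zero_left)+
    then obtain v' where v': "v' \<in> H M V" "v' * \<pi> = v" using ses_descend[OF s v(1)] by blast
    then have "v' * (\<pi> * u 0 * k) = 0" using \<open>v * (u 0 * k) = 0\<close> by (metis mult.assoc)
    then show "v = 0" using epiD[OF ep v'(1)] v' by simp
  qed
  moreover define y where "y = (b - b') * p1 + g * p2"
  have y: "y \<in> H S N" unfolding y_def using b g S by (blast intro: hom)
  have yi: "y * i1 = b - b'" using S(5,8) idr[OF diff_in[OF b]] by (simp add: y_def distrib_right mult.assoc)
  \<comment> \<open>On a cover the kernel of \<phi> consists of the pairs (- u x', t0 x') with x' in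
    W^-1, and y vanishes on these by \<open>bg\<close>.\<close>
  have van: "y * z = 0" if z: "z \<in> H U S" "\<phi> * z = 0" for U z
  proof -
    have p1z: "p1 * z \<in> H U B" and p2z: "p2 * z \<in> H U K" using z S comp_in by blast+
    have *: "i * (p1 * z) = - (u 0 * k * (p2 * z))" using z(2) unfolding \<phi>_def by (simp add: distrib_right mult.assoc add_eq_0_iff)
    have "\<pi> * (u 0 * k * (p2 * z)) = - (\<pi> * i * (p1 * z))" using * by (simp add: mult.assoc)
    then have "(?s \<star> u) 0 * (k * (p2 * z)) = 0" using t(5) by (simp add: mult.assoc)
    moreover have "diff W 0 * (k * (p2 * z)) = 0" using k(2) by (metis mult.assoc mult_zero_left)
    ultimately obtain T' e' x' where e': "e' \<in> H T' U" "epi U e'" "x' \<in> H T' (cobj W (-1))"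
        "k * (p2 * z) * e' = diff W (-1) * x'"
      using abs_qis_stD(1)[OF W(4,1) comp_in[OF k(1) p2z]] by metis
    have "k * (p2 * z * e') = k * (t0 * x')" using e'(4) t0(2) by (metis mult.assoc)
    then have pt: "p2 * z * e' = t0 * x'"
      using mono_cancel[OF k(3) comp_in[OF p2z e'(1)] comp_in[OF t0(1) e'(3)]] by blast
    have "i * (p1 * z * e') = - (u 0 * (k * (p2 * z * e')))" using * by (metis mult.assoc minus_mult_left)
    also have "\<dots> = i * (- u (-1) * x')" unfolding pt using u(3) t0(2)
      by (simp add: mult.assoc[symmetric])
    finally have "p1 * z * e' = - u (-1) * x'"
      using mono_cancel[OF t(3) comp_in[OF p1z e'(1)] comp_in[OF minus_in[OF u(2)] e'(3)]] by blast
    then have "y * z * e' = - ((b - b') * u (-1)) * x' + g * t0 * x'"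
      using pt unfolding y_def by (simp add: distrib_right mult.assoc)
    then have "y * z * e' = 0" unfolding bg by simp
    then show ?thesis using epiD[OF e'(2) comp_in[OF y z(1)]] by blast
  qed
  ultimately obtain r where r: "r \<in> H P N" "r * \<phi> = y" using descend[OF f _ y] by blast
  have "r * i = b - b'" using r(2) fi(1) yi by (metis mult.assoc)
  then show ?thesis using r(1) by metis
qed

text \<open>Every roof over a stalk complex is equivalent to a two-term one, obtained from
  \<open>\<tau>\<^sub>\<le>\<^sub>0 Z\<close> by dividing out the degrees below \<open>-1\<close>.\<close>

lemma truncate:
  assumes Z: "abs_complex Z" and s: "abs_qis Z (stalk_at 0 M) s"
  obtains B P i \<pi> q where "ses B P M i \<pi>" "q \<in> H (cobj Z (-1)) B" "epi B q"
    "\<And>N f. N \<in> Obj \<Longrightarrow> abs_chain_map Z (stalk_at (-1) N) f \<Longrightarrow> \<exists>b\<in>H B N. b * q = f (-1)"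
    "\<And>N f b. abs_chain_map Z (stalk_at (-1) N) f \<Longrightarrow> b \<in> H B N \<Longrightarrow> b * q = f (-1) \<Longrightarrow>
      roof_equiv (stalk_at 0 M) (stalk_at (-1) N) Z s f (two_term B P i) (supported_at 0 \<pi>) (supported_at (-1) b)"
proof -
  note x = cxD[OF Z]
  have s0: "s 0 \<in> H (cobj Z 0) M" "s 0 * diff Z (-1) = 0"
    using cmD(1)[OF qiD(1)[OF s], of 0] cmD(3)[OF qiD(1)[OF s], of 0] by simp_all
  have sn: "s n = 0" if "n \<noteq> 0" for n using cmD(1)[OF qiD(1)[OF s], of n] that into_null by simp
  \<comment> \<open>P is the object of 0-cycles of Z. The kernel B of P -> M found below is the
    image of Z^-1, by injectivity on H^0.\<close>
  obtain P k where k: "k \<in> H P (cobj Z 0)" "diff Z 0 * k = 0" "mono P k"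
      "\<And>V g. g \<in> H V (cobj Z 0) \<Longrightarrow> diff Z 0 * g = 0 \<Longrightarrow> \<exists>t\<in>H V P. k * t = g"
    using ker_obtain[OF x(1)[of 0]] by metis
  define \<pi> where "\<pi> = s 0 * k"
  have p: "\<pi> \<in> H P M" "epi M \<pi>" unfolding \<pi>_def
    using comp_in[OF s0(1) k(1)] abs_qis_stD(3)[OF s Z k(1,4)] by auto
  obtain B i where ss: "ses B P M i \<pi>" using ses_of_epi[OF p] by blast
  note t = sesD[OF ss]
  have d1: "diff Z (-1) \<in> H (cobj Z (-1)) (cobj Z 0)" "diff Z 0 * diff Z (-1) = 0"
    and d2: "diff Z (-2) \<in> H (cobj Z (-2)) (cobj Z (-1))" "diff Z (-1) * diff Z (-2) = 0"
    using x(2,4)[of 0] x(2,4)[of "-1"] by simp_all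
  obtain t0 where t0: "t0 \<in> H (cobj Z (-1)) P" "k * t0 = diff Z (-1)" using k(4)[OF d1] by blast
  have "\<pi> * t0 = 0" unfolding \<pi>_def using t0 s0 by (simp add: mult.assoc)
  then obtain q where q: "q \<in> H (cobj Z (-1)) B" "i * q = t0" using t(9)[OF t0(1)] by blast
  have kiq: "k * (i * q) = diff Z (-1)" using q t0 by simp
  have "diff Z 0 * (k * i) = 0" "s 0 * (k * i) = 0"
    using k(2) t(5) by (simp_all flip: mult.assoc add: \<pi>_def)
  \<comment> \<open>The inclusion of B is a cycle killed by s, hence a boundary on a cover; this
    says that q is onto B.\<close>
  then obtain T e y where e: "e \<in> H T B" "epi B e" "y \<in> H T (cobj Z (-1))" "k * i * e = diff Z (-1) * y"
    using abs_qis_stD(1)[OF s Z comp_in[OF k(1) t(1)]] by metis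
  have "k * i * e = k * i * (q * y)" using e(4) kiq by (simp add: mult.assoc[symmetric])
  then have "e = q * y" using mono_cancel[OF mono_comp[OF k(3) t(1,3)] e(1) comp_in[OF q(1) e(3)]] by blast
  then have qe: "epi B q" using epi_right_factor[OF e(2)] by blast
  have qker: "\<exists>T' e x'. e \<in> H T' T \<and> epi T e \<and> x' \<in> H T' (cobj Z (-2)) \<and> x * e = diff Z (-2) * x'"
    if xx: "x \<in> H T (cobj Z (-1))" "q * x = 0" for x T
  proof -
    have "diff Z (-1) * x = 0" using xx(2) kiq by (metis mult.assoc mult_zero_right)
    from abs_qis_stD(2)[OF s Z _ xx(1) this] show ?thesis by simp
  qed
  have b: "\<exists>b\<in>H B N. b * q = f (-1)" if N: "N \<in> Obj" and f: "abs_chain_map Z (stalk_at (-1) N) f" for N f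
  proof -
    have f1: "f (-1) \<in> H (cobj Z (-1)) N" "f (-1) * diff Z (-2) = 0"
      using f abs_chain_map_st[OF Z N] by simp_all
    show ?thesis
    proof (rule descend[OF q(1) qe f1(1)])
      fix U u assume u: "u \<in> H U (cobj Z (-1))" "q * u = 0"
      from qker[OF this] obtain T' e x' where e: "e \<in> H T' U" "epi U e" "u * e = diff Z (-2) * x'" by blast
      have "f (-1) * u * e = 0" using e(3) f1(2) by (metis mult.assoc mult_zero_left)
      then show "f (-1) * u = 0" using epiD[OF e(2) comp_in[OF f1(1) u(1)]] by blast
    qed
  qed
  \<comment> \<open>W is the truncation of Z to degrees at most 0, with Z^0 replaced by its cycles
    P. It maps to Z by inclusion and to the two-term complex by q, and so compares the two
    roofs.\<close>
  define W where "W = \<lparr>cobj = (\<lambda>n. if n > 0 then null else if n = 0 then P else cobj Z n),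
      diff = (\<lambda>n. if n \<ge> 0 then 0 else if n = -1 then t0 else diff Z n)\<rparr>"
  have W: "cobj W n = (if n > 0 then null else if n = 0 then P else cobj Z n)"
     "diff W n = (if n \<ge> 0 then 0 else if n = -1 then t0 else diff Z n)" for n by (simp_all add: W_def)
  have td: "t0 * diff Z (-2) = 0"
  proof -
    have "k * (t0 * diff Z (-2)) = 0" using t0(2) d2(2) by (metis mult.assoc)
    then show ?thesis using monoD[OF k(3) comp_in[OF t0(1) d2(1)]] by blast
  qed
  have Wo: "cobj W n \<in> Obj" for n using x(5) null t(7) by (simp add: W)
  have Wc: "abs_complex W"
  proof -
    have "{n. I (cobj W n) \<noteq> 0} \<subseteq> insert 0 {n. I (cobj Z n) \<noteq> 0}" by (auto simp: W null)
    then have "finite {n. I (cobj W n) \<noteq> 0}" using Z finite_subset unfolding abs_complex_def by blast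
    moreover have "diff W n \<in> H (cobj W n) (cobj W (n + 1))" for n
    proof (cases "n \<ge> -1")
      case True
      then consider "n = -1" | "n \<ge> 0" by linarith
      then show ?thesis
      proof cases
        case 2
        then show ?thesis using zero_in[OF Wo[of n] Wo[of "n + 1"]] by (simp add: W(2))
      qed (use t0 in \<open>simp add: W\<close>)
    next
      case False
      then show ?thesis using x(1)[of n] by (simp add: W)
    qed
    moreover have "diff W (n + 1) * diff W n = 0" for n
    proof -
      consider "n \<ge> -1" | "n = -2" | "n < -2" by linarith
      then show ?thesis by cases (use td x(3)[of n] in \<open>simp_all add: W\<close>)
    qed
    ultimately show ?thesis unfolding abs_complex_def by blast
  qed
  define u where "u = (\<lambda>n. if n > 0 then 0 else if n = 0 then k else I (cobj Z n))"
  define w where "w = (\<lambda>n::int. if n = 0 then I P else if n = -1 then q else 0)"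
  have cu: "abs_chain_map W Z u" unfolding abs_chain_map_def
  proof (intro allI conjI)
    fix n
    show "u n \<in> H (cobj W n) (cobj Z n)" using x(5) null k by (auto simp: u_def W intro: zero_in id_in)
    consider "n > 0" | "n = 0" | "n = -1" | "n < -1" by linarith
    then show "u (n + 1) * diff W n = diff Z n * u n"
      by cases (use k t0 idr[OF d1(1)] idl[OF x(1)[of n]] idr[OF x(1)[of n]] in \<open>simp_all add: u_def W\<close>)
  qed
  have qd: "q * diff Z (-2) = 0"
    using monoD[OF t(3) comp_in[OF q(1) d2(1)]] td q(2) by (simp add: mult.assoc[symmetric])
  have cw: "abs_chain_map W (two_term B P i) w" unfolding abs_chain_map_def
  proof (intro allI conjI)
    fix n
    show "w n \<in> H (cobj W n) (cobj (two_term B P i) n)"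
      using q(1) id_in[OF t(7)] zero_in[OF Wo[of n] cxD(5)[OF two_term_qi(1)[OF ss], of n]] by (auto simp: w_def W)
    consider "n = 0" | "n = -1" | "n = -2" | "n > 0 \<or> n < -2" by linarith
    then show "w (n + 1) * diff W n = diff (two_term B P i) n * w n"
      by cases (use q qd idl[OF t0(1)] in \<open>auto simp: w_def W\<close>)
  qed
  have su: "(s \<star> u) = supported_at 0 \<pi>" using sn by (auto simp: fun_eq_iff u_def \<pi>_def supported_at_def)
  have qW: "abs_qis W (stalk_at 0 M) (supported_at 0 \<pi>)"
  proof (rule abs_qis_stI)
    show "abs_chain_map W (stalk_at 0 M) (supported_at 0 \<pi>)" using abs_chain_map_comp[OF cu qiD(1)[OF s]] unfolding su .
    show "abs_complex W" by fact
  next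
    fix T y assume y: "y \<in> H T M"
    from cover_lift[OF p this] obtain T' e x where "e \<in> H T' T" "epi T e" "x \<in> H T' P" "\<pi> * x = y * e" .
    then show "\<exists>T' e x. e \<in> H T' T \<and> epi T e \<and> x \<in> H T' (cobj W 0) \<and> diff W 0 * x = 0 \<and> y * e = supported_at 0 \<pi> 0 * x"
      by (intro exI[of _ T'] exI[of _ e] exI[of _ x]) (auto simp: W)
  next
    fix T y n assume y: "y \<in> H T (cobj W n)" "diff W n * y = 0" "n = 0 \<Longrightarrow> supported_at 0 \<pi> 0 * y = 0"
    consider "n > 0" | "n = 0" | "n = -1" | "n < -1" by linarith
    then show "\<exists>T' e x'. e \<in> H T' T \<and> epi T e \<and> x' \<in> H T' (cobj W (n - 1)) \<and> y * e = diff W (n - 1) * x'"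
    proof cases
      case 1
      then have "y = 0" using y into_null by (simp add: W)
      then show ?thesis using epi_id id_in zero_in dom_obj[OF y(1)] Wo
        by (intro exI[of _ T] exI[of _ "I T"] exI[of _ 0]) auto
    next
      case 2
      then have "y \<in> H T P" "\<pi> * y = 0" using y by (auto simp: W)
      then obtain v where v: "v \<in> H T B" "i * v = y" using t(9) by blast
      obtain T' e z where e: "e \<in> H T' T" "epi T e" "z \<in> H T' (cobj Z (-1))" "q * z = v * e"
        using cover_lift[OF q(1) qe v(1)] .
      have "y * e = t0 * z" using e(4) v(2) q(2) by (metis mult.assoc)
      then show ?thesis using 2 e by (auto simp: W)
    next
      case 3
      then have "y \<in> H T (cobj Z (-1))" "i * (q * y) = 0" using y q by (auto simp: W mult.assoc[symmetric])
      then have "q * y = 0" using monoD[OF t(3) comp_in[OF q(1)]] by blast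
      from qker[OF \<open>y \<in> H T (cobj Z (-1))\<close> this] show ?thesis using 3 by (auto simp: W)
    next
      case 4
      then have "y \<in> H T (cobj Z n)" "diff Z n * y = 0" "n \<noteq> 0" using y by (auto simp: W)
      from abs_qis_stD(2)[OF s Z this(3,1,2)] 4 show ?thesis by (auto simp: W)
    qed
  qed
  have roof_rel: "roof_equiv (stalk_at 0 M) (stalk_at (-1) N) Z s f (two_term B P i) (supported_at 0 \<pi>) (supported_at (-1) b)"
    if f: "abs_chain_map Z (stalk_at (-1) N) f" and b: "b \<in> H B N" "b * q = f (-1)" for N f b
  proof -
    have fn: "f n = 0" if "n \<noteq> -1" for n using cmD(1)[OF f, of n] that into_null by simp
    have f1: "f (-1) \<in> H (cobj Z (-1)) N" using cmD(1)[OF f, of "-1"] by simp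
    have 1: "f \<star> u = supported_at (-1) b \<star> w" using fn b idr[OF f1] by (auto simp: fun_eq_iff u_def w_def supported_at_def)
    have 2: "supported_at 0 \<pi> \<star> w = supported_at 0 \<pi>" using idr[OF p(1)] by (auto simp: fun_eq_iff w_def supported_at_def)
    have "abs_homotopic W (stalk_at 0 M) (s \<star> u) (supported_at 0 \<pi> \<star> w)" unfolding su 2 using abs_homotopic_refl[OF Wc stalk_at_cx[OF t(8)]] .
    moreover have "abs_homotopic W (stalk_at (-1) N) (f \<star> u) (supported_at (-1) b \<star> w)"
      unfolding 1 using abs_homotopic_refl[OF Wc stalk_at_cx[OF cod_obj[OF b(1)]]] .
    moreover have "abs_qis W (stalk_at 0 M) (s \<star> u)" unfolding su by (rule qW)
    ultimately show ?thesis unfolding roof_equiv_def using Wc cu cw by blast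
  qed
  show ?thesis by (rule that[OF ss q(1) qe]) (fact b roof_rel)+
qed

section \<open>Vanishing of Ext^2 as a lifting property\<close>

definition ext2_zero :: bool where
  "ext2_zero \<longleftrightarrow> (\<forall>M N Z s f. M \<in> Obj \<longrightarrow> N \<in> Obj \<longrightarrow> roof_data (stalk_at 0 M) (stalk_at (-2) N) Z s f \<longrightarrow>
     roof_equiv (stalk_at 0 M) (stalk_at (-2) N) Z s f (stalk_at 0 M) (\<lambda>n. I (cobj (stalk_at 0 M) n)) (\<lambda>_. 0))"

text \<open>Let A be the kernel of e. Splicing A -> B' -> B with B -> P -> M gives a class in
  Ext^2(M,A). Its vanishing means that, over some other resolution mapping to the given one, the
  arrow between the kernels lifts along e. Heredity enters the additivity proofs through this
  lemma.\<close>

lemma ext2_zero_lift: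
  assumes ext2_zero: ext2_zero and s: "ses B P M i \<pi>" and e: "e \<in> H B' B" "epi B e"
  obtains B2 P2 i2 \<pi>2 a c where "ses B2 P2 M i2 \<pi>2" "a \<in> H P2 P" "\<pi> * a = \<pi>2" "c \<in> H B2 B'" "i * (e * c) = a * i2"
proof -
  note t = sesD[OF s]
  obtain A j where A: "ses A B' B j e" using ses_of_epi[OF e] by blast
  note a = sesD[OF A]
  let ?Z = "three_term A B' P j (i * e)"
  have ie: "i * e \<in> H B' P" "i * e * j = 0" using comp_in[OF t(1) e(1)] a(5) by (simp_all add: mult.assoc)
  have Z: "abs_complex ?Z" using three_term_cx[OF a(1) ie] .
  have q: "abs_qis ?Z (stalk_at 0 M) (supported_at 0 \<pi>)"
  proof (rule three_term_qi[OF a(1,3) ie t(2,4)])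
    show "\<pi> * (i * e) = 0" using t(5) by (simp add: mult.assoc[symmetric])
  next
    fix T x assume x: "x \<in> H T B'" "i * e * x = 0"
    then have "e * x = 0" using monoD[OF t(3) comp_in[OF e(1) x(1)]] by (simp add: mult.assoc)
    then obtain y where "y \<in> H T A" "j * y = x" using a(9)[OF x(1)] by blast
    then show "\<exists>T' e x'. e \<in> H T' T \<and> epi T e \<and> x' \<in> H T' A \<and> x * e = j * x'"
      using epi_id id_in dom_obj[OF x(1)] idr[OF x(1)] by metis
  next
    fix T x assume x: "x \<in> H T P" "\<pi> * x = 0"
    then obtain y where y: "y \<in> H T B" "i * y = x" using t(9)[OF x(1)] by blast
    obtain T' e' z where "e' \<in> H T' T" "epi T e'" "z \<in> H T' B'" "e * z = y * e'" using cover_lift[OF e y(1)] .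
    then show "\<exists>T' e' x'. e' \<in> H T' T \<and> epi T e' \<and> x' \<in> H T' B' \<and> x * e' = i * e * x'"
      using y(2) by (metis mult.assoc)
  qed
  \<comment> \<open>The class of the spliced sequence; its numerator is the identity of A in degree
    -2.\<close>
  have "roof_data (stalk_at 0 M) (stalk_at (-2) A) ?Z (supported_at 0 \<pi>) (supported_at (-2) (I A))"
    unfolding roof_data_def using stalk_at_cx a(6) t(8) Z q abs_chain_map_sg[OF Z, of "I A" "-2" A] id_in[OF a(6)] by auto
  then have "roof_equiv (stalk_at 0 M) (stalk_at (-2) A) ?Z (supported_at 0 \<pi>) (supported_at (-2) (I A)) (stalk_at 0 M) (\<lambda>n. I (cobj (stalk_at 0 M) n)) (\<lambda>_. 0)"
    using ext2_zero t(8) a(6) unfolding ext2_zero_def by blast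
  then obtain W u w where W: "abs_complex W" "abs_chain_map W ?Z u" "abs_qis W (stalk_at 0 M) (supported_at 0 \<pi> \<star> u)"
     "abs_homotopic W (stalk_at (-2) A) (supported_at (-2) (I A) \<star> u) ((\<lambda>_. 0) \<star> w)"
    unfolding roof_equiv_def by blast
  note x = cxD[OF W(1)]
  have u: "u 0 \<in> H (cobj W 0) P" "u (-1) \<in> H (cobj W (-1)) B'" "u (-2) \<in> H (cobj W (-2)) A"
      "u 0 * diff W (-1) = i * e * u (-1)" "u (-1) * diff W (-2) = j * u (-2)"
    using cmD(1)[OF W(2), of 0] cmD(1)[OF W(2), of "-1"] cmD(1)[OF W(2), of "-2"]
      cmD(2)[OF W(2), of "-1"] cmD(2)[OF W(2), of "-2"] by simp_all
  obtain h where h: "\<And>n. h n \<in> H (cobj W n) (cobj (stalk_at (-2) A) (n - 1))"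
     "\<And>n. (supported_at (-2) (I A) \<star> u) n = h (n + 1) * diff W n"
    using W(4) unfolding abs_homotopic_def by auto
  have h1: "h (-1) \<in> H (cobj W (-1)) A" "u (-2) = h (-1) * diff W (-2)"
    using h(1)[of "-1"] h(2)[of "-2"] idl[OF u(3)] by simp_all
  \<comment> \<open>The null homotopy corrects u in degree -1 by an arrow into A: v vanishes on the
    image of d^-2, while e v is still e u.\<close>
  define v where "v = u (-1) - j * h (-1)"
  have v: "v \<in> H (cobj W (-1)) B'" unfolding v_def using u a(1) h1 by (blast intro: hom)
  have vd: "v * diff W (-2) = 0" unfolding v_def using u(5) h1(2) by (simp add: algebra_simps)
  have ev: "i * (e * v) = u 0 * diff W (-1)" unfolding v_def using u(4) a(5)
    by (simp add: algebra_simps) (simp flip: mult.assoc)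
  obtain K k where k: "k \<in> H K (cobj W 0)" "diff W 0 * k = 0" "mono K k"
      "\<And>V g. g \<in> H V (cobj W 0) \<Longrightarrow> diff W 0 * g = 0 \<Longrightarrow> \<exists>t\<in>H V K. k * t = g"
    using ker_obtain[OF x(1)[of 0]] by metis
  have p2: "\<pi> * (u 0 * k) \<in> H K M" "epi M (\<pi> * (u 0 * k))"
    using abs_qis_stD(3)[OF W(3,1) k(1,4)] comp_in[OF t(2) comp_in[OF u(1) k(1)]] by (simp_all add: mult.assoc)
  have d1: "diff W (-1) \<in> H (cobj W (-1)) (cobj W 0)" "diff W 0 * diff W (-1) = 0"
    and d2: "diff W (-2) \<in> H (cobj W (-2)) (cobj W (-1))"
    using x(2,4)[of 0] x(2)[of "-1"] by simp_all
  obtain t0 where t0: "t0 \<in> H (cobj W (-1)) K" "k * t0 = diff W (-1)" using k(4)[OF d1] by blast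
  obtain B2 i2 where s2: "ses B2 K M i2 (\<pi> * (u 0 * k))" using ses_of_epi[OF p2] by blast
  note r = sesD[OF s2]
  have "\<pi> * (u 0 * k) * t0 = \<pi> * (u 0 * diff W (-1))" using t0 by (simp add: mult.assoc)
  also have "\<dots> = 0" unfolding u(4) using t(5) by (simp flip: mult.assoc)
  finally obtain q where q: "q \<in> H (cobj W (-1)) B2" "i2 * q = t0" using r(9)[OF t0(1)] by blast
  have "diff W 0 * (k * i2) = 0" "(supported_at 0 \<pi> \<star> u) 0 * (k * i2) = 0"
    using k(2) r(5) by (simp_all add: mult.assoc) (simp flip: mult.assoc)
  then obtain T e1 y where e1: "e1 \<in> H T B2" "epi B2 e1" "y \<in> H T (cobj W (-1))" "k * i2 * e1 = diff W (-1) * y"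
    using abs_qis_stD(1)[OF W(3,1) comp_in[OF k(1) r(1)]] by metis
  have "k * i2 * e1 = k * i2 * (q * y)" using e1(4) q(2) t0(2) by (metis mult.assoc)
  then have "e1 = q * y" using mono_cancel[OF mono_comp[OF k(3) r(1,3)] e1(1) comp_in[OF q(1) e1(3)]] by blast
  then have qe: "epi B2 q" using epi_right_factor[OF e1(2)] by blast
  \<comment> \<open>v descends along q, because what q kills comes from W^-2 on a cover.\<close>
  obtain c where c: "c \<in> H B2 B'" "c * q = v"
  proof -
    have "v * y = 0" if y: "y \<in> H U (cobj W (-1))" "q * y = 0" for U y
    proof -
      have "diff W (-1) * y = 0" using y(2) q(2) t0(2) by (metis mult.assoc mult_zero_right)
      from abs_qis_stD(2)[OF W(3,1) _ y(1) this] obtain T' e' x' where e': "e' \<in> H T' U" "epi U e'" "y * e' = diff W (-2) * x'"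
        by auto
      have "v * y * e' = 0" using e'(3) vd by (metis mult.assoc mult_zero_left)
      then show ?thesis using epiD[OF e'(2) comp_in[OF v y(1)]] by blast
    qed
    then show ?thesis using descend[OF q(1) qe v] that by blast
  qed
  have "i * (e * c) * q = u 0 * k * i2 * q" using c(2) q(2) t0(2) ev by (simp add: mult.assoc)
  then have "i * (e * c) = u 0 * k * i2"
    using epi_cancel[OF qe comp_in[OF t(1) comp_in[OF e(1) c(1)]] comp_in[OF comp_in[OF u(1) k(1)] r(1)]] by blast
  then show ?thesis using that[OF s2 comp_in[OF u(1) k(1)] refl c(1)] by blast
qed

end


section \<open>Additivity of the Euler form on short exact sequences\<close>

lemma card_fibres:
  assumes "finite A" "\<And>y. y \<in> f ` A \<Longrightarrow> card {x \<in> A. f x = y} = k"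
  shows "card A = card (f ` A) * k"
proof -
  have "card A = (\<Sum>y\<in>f ` A. card {x \<in> A. f x = y})"
    using sum.image_gen[OF assms(1), of "\<lambda>_. 1 :: nat" f] by simp
  also have "\<dots> = (\<Sum>y\<in>f ` A. k)" using assms(2) by (rule sum.cong[OF refl])
  finally show ?thesis by simp
qed

context abcat
begin

text \<open>A resolution of \<open>M\<close> over which every class in \<open>Ext\<^sup>1 M N\<close> is visible. Over it,
  \<open>Hom M N \<rightarrow> Hom P N \<rightarrow> Hom B N \<rightarrow> Ext\<^sup>1 M N\<close> is exact with surjective last map, so that
  \<open>q\<^bsup>\<langle>M,N\<rangle>\<^esup> = |Hom P N| / |Hom B N|\<close>.\<close>

definition fine :: "'o \<Rightarrow> 'o \<Rightarrow> 'o \<Rightarrow> 'o \<Rightarrow> 'r \<Rightarrow> 'r \<Rightarrow> bool" where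
  "fine M N B P i \<pi> \<longleftrightarrow> ses B P M i \<pi> \<and> (\<forall>B' P' i' \<pi>' b'. ses B' P' M i' \<pi>' \<longrightarrow> b' \<in> H B' N \<longrightarrow>
     (\<exists>b\<in>H B N. same_ext_class M N B P i \<pi> b B' P' i' \<pi>' b'))"

lemma fineD:
  assumes "fine M N B P i \<pi>"
  shows "ses B P M i \<pi>"
    and "ses B' P' M i' \<pi>' \<Longrightarrow> b' \<in> H B' N \<Longrightarrow> \<exists>b\<in>H B N. same_ext_class M N B P i \<pi> b B' P' i' \<pi>' b'"
  using assms unfolding fine_def by blast+

section \<open>Extension classes under change of resolution\<close>

lemma same_ext_class_refine_left:
  assumes "ses B P M i \<pi>" "ses B2 P2 M i2 \<pi>2" "refines B P i \<pi> B2 P2 i2 \<pi>2 a c"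
    and "ses B' P' M i' \<pi>'" "b \<in> H B N" "b' \<in> H B' N" "same_ext_class M N B P i \<pi> b B' P' i' \<pi>' b'"
  shows "same_ext_class M N B2 P2 i2 \<pi>2 (b * c) B' P' i' \<pi>' b'"
  using same_ext_class_trans[OF assms(2) _ assms(1,5,4,6) same_ext_class_sym[OF assms(1,5,2) _ same_ext_class_refines[OF assms(1-3,5)]] assms(7)]
    comp_in[OF assms(5) refinesD(2)[OF assms(3)]] by blast

lemma fine_refines:
  assumes f: "fine M N B P i \<pi>" and s: "ses B2 P2 M i2 \<pi>2" and r: "refines B P i \<pi> B2 P2 i2 \<pi>2 a c"
  shows "fine M N B2 P2 i2 \<pi>2"
  unfolding fine_def
proof (intro conjI allI impI)
  fix B' P' i' \<pi>' b' assume b': "ses B' P' M i' \<pi>'" "b' \<in> H B' N"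
  obtain b where b: "b \<in> H B N" "same_ext_class M N B P i \<pi> b B' P' i' \<pi>' b'" using fineD(2)[OF f b'] by blast
  have "same_ext_class M N B2 P2 i2 \<pi>2 (b * c) B' P' i' \<pi>' b'"
    by (rule same_ext_class_refine_left[OF fineD(1)[OF f] s r b'(1) b(1) b'(2) b(2)])
  then show "\<exists>b\<in>H B2 N. same_ext_class M N B2 P2 i2 \<pi>2 b B' P' i' \<pi>' b'"
    using comp_in[OF b(1) refinesD(2)[OF r]] by blast
qed (fact s)

text \<open>The class of b is visible over the coarser resolution, say as b1. Over the finer one b1
  c and b have the same class, so they differ by an arrow that extends to P2.\<close>

lemma fine_decompose:
  assumes f: "fine M N B P i \<pi>" and s: "ses B2 P2 M i2 \<pi>2" and r: "refines B P i \<pi> B2 P2 i2 \<pi>2 a c"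
    and b: "b \<in> H B2 N"
  obtains b1 e where "b1 \<in> H B N" "e \<in> H P2 N" "b = b1 * c + e * i2"
proof -
  obtain b1 where b1: "b1 \<in> H B N" "same_ext_class M N B P i \<pi> b1 B2 P2 i2 \<pi>2 b" using fineD(2)[OF f s b] by blast
  have "same_ext_class M N B2 P2 i2 \<pi>2 (b1 * c) B2 P2 i2 \<pi>2 b"
    by (rule same_ext_class_refine_left[OF fineD(1)[OF f] s r s b1(1) b b1(2)])
  then obtain e where e: "e \<in> H P2 N" "b1 * c - b = e * i2"
    using same_ext_class_extension[OF s comp_in[OF b1(1) refinesD(2)[OF r]] b] by blast
  have "b = b1 * c + (- e) * i2" using e(2) by (simp add: algebra_simps)
  then show ?thesis using that[OF b1(1) minus_in[OF e(1)]] by blast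
qed

text \<open>Refinement does not change classes: if the pullbacks of b and b' define the same class,
  so do b and b', and \<open>same_ext_class_extension\<close> gives the extension over P.\<close>

lemma extension_descends:
  assumes s: "ses B P M i \<pi>" and s2: "ses B2 P2 M i2 \<pi>2" and r: "refines B P i \<pi> B2 P2 i2 \<pi>2 a c"
    and b: "b \<in> H B N" "b' \<in> H B N" and e: "e \<in> H P2 N" "b * c - b' * c = e * i2"
  shows "\<exists>e\<in>H P N. b - b' = e * i"
proof -
  note c = refinesD(2)[OF r]
  have "same_ext_class M N B2 P2 i2 \<pi>2 (b * c) B2 P2 i2 \<pi>2 (b' * c)"
    by (rule same_ext_class_of_extension[OF s2 comp_in[OF b(1) c] comp_in[OF b(2) c] e])
  from same_ext_class_trans[OF s b(1) s2 comp_in[OF b(1) c] s2 comp_in[OF b(2) c] same_ext_class_refines[OF s s2 r b(1)] this]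
  have "same_ext_class M N B P i \<pi> b B2 P2 i2 \<pi>2 (b' * c)" .
  from same_ext_class_trans[OF s b(1) s2 comp_in[OF b(2) c] s b(2) this
    same_ext_class_sym[OF s b(2) s2 comp_in[OF b(2) c] same_ext_class_refines[OF s s2 r b(2)]]]
  show ?thesis by (rule same_ext_class_extension[OF s b])
qed

lemma same_ext_class_common_refinement:
  assumes s: "ses B P M i \<pi>" "ses B' P' M i' \<pi>'" and b: "b \<in> H B N" "b' \<in> H B' N"
    and q: "same_ext_class M N B P i \<pi> b B' P' i' \<pi>' b'"
    and s2: "ses B2 P2 M i2 \<pi>2" and r: "refines B P i \<pi> B2 P2 i2 \<pi>2 a c" "refines B' P' i' \<pi>' B2 P2 i2 \<pi>2 a' c'"
  shows "\<exists>e\<in>H P2 N. b * c - b' * c' = e * i2"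
proof (rule same_ext_class_extension[OF s2])
  show bc: "b * c \<in> H B2 N" "b' * c' \<in> H B2 N" 
    using comp_in[OF b(1) refinesD(2)[OF r(1)]] comp_in[OF b(2) refinesD(2)[OF r(2)]] .
  have "same_ext_class M N B2 P2 i2 \<pi>2 (b * c) B' P' i' \<pi>' b'"
    by (rule same_ext_class_refine_left[OF s(1) s2 r(1) s(2) b q])
  from same_ext_class_trans[OF s2 bc(1) s(2) b(2) s2 bc(2) this same_ext_class_refines[OF s(2) s2 r(2) b(2)]]
  show "same_ext_class M N B2 P2 i2 \<pi>2 (b * c) B2 P2 i2 \<pi>2 (b' * c')" .
qed

text \<open>Surjectivity of Ext^1(M,N) -> Ext^1(M,N''), whose obstruction lies in Ext^2(M,N'). The
  pullback of n along b is an epimorphism onto B, and \<open>ext2_zero_lift\<close> gives a finer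
  resolution over which b lifts to N; fineness brings the lift back to B.\<close>

lemma lift_boundary:
  assumes ext2_zero and s: "ses B P M i \<pi>" and n: "ses N' N N'' \<nu> n" and f: "fine M N B P i \<pi>"
    and b: "b \<in> H B N''"
  shows "\<exists>b1\<in>H B N. \<exists>p\<in>H P N''. b = n * b1 + p * i"
proof -
  note m = sesD[OF n]
  obtain Q p r where Q: "p \<in> H Q B" "r \<in> H Q N" "b * p = n * r" "epi B p"
    using pullback[OF b m(2)] m(4) by metis
  obtain B2 P2 i2 \<pi>2 a c where l: "ses B2 P2 M i2 \<pi>2" "a \<in> H P2 P" "\<pi> * a = \<pi>2" "c \<in> H B2 Q"
      "i * (p * c) = a * i2"
    using ext2_zero_lift[OF assms(1) s Q(1,4)] by metis
  have r: "refines B P i \<pi> B2 P2 i2 \<pi>2 a (p * c)" unfolding refines_def using l Q comp_in by auto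
  obtain b1 e where e: "b1 \<in> H B N" "e \<in> H P2 N" "r * c = b1 * (p * c) + e * i2"
    using fine_decompose[OF f l(1) r comp_in[OF Q(2) l(4)]] by metis
  have "b * (p * c) = n * (r * c)" using Q(3) by (metis mult.assoc)
  then have "b * (p * c) - n * b1 * (p * c) = n * e * i2" unfolding e(3) by (simp add: algebra_simps)
  from extension_descends[OF s l(1) r b comp_in[OF m(2) e(1)] comp_in[OF m(2) e(2)] this]
  obtain p' where "p' \<in> H P N''" "b - n * b1 = p' * i" by blast
  then show ?thesis using e(1) by (metis add_diff_cancel_left' diff_add_cancel add.commute)
qed

text \<open>The obstruction to lifting p lies in Ext^1(P,N') and dies in Ext^1(B,N'), so it comes
  from Ext^1(M,N'). Every class there comes from an arrow B -> N' and therefore dies in Ext^1(P,N').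
  The proof spells this out on a cover Q of P.\<close>

lemma lift_from_boundary:
  assumes s: "ses B P M i \<pi>" and n: "ses N' N N'' \<nu> n" and f: "fine M N' B P i \<pi>"
    and p: "p \<in> H P N''" and b: "b \<in> H B N" "p * i = n * b"
  shows "\<exists>e\<in>H P N. n * e = p"
proof -
  note m = sesD[OF n] and t = sesD[OF s]
  obtain Q x y where Q: "x \<in> H Q P" "y \<in> H Q N" "p * x = n * y" "epi P x"
    using pullback[OF p m(2)] m(4) by metis
  have "\<pi> * x \<in> H Q M" "epi M (\<pi> * x)" using comp_in[OF t(2) Q(1)] epi_comp[OF t(4,2) Q(4)] by auto
  then obtain B' i' where s': "ses B' Q M i' (\<pi> * x)" using ses_of_epi by blast
  obtain c where r: "refines B P i \<pi> B' Q i' (\<pi> * x) x c" using refines_ex[OF s s' Q(1) refl] .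
  note c = refinesD[OF r] and u = sesD[OF s']
  have "n * (y * i' - b * c) = p * (x * i') - p * (i * c)"
    using Q(3) b(2) by (simp add: right_diff_distrib flip: mult.assoc)
  then have "n * (y * i' - b * c) = 0" using c(4) by simp
  moreover have "y * i' - b * c \<in> H B' N" using Q u b c by (blast intro: hom)
  \<comment> \<open>\<beta> compares the two lifts to N available on B': the one coming from Q and
    the prescribed b.\<close>
  ultimately obtain \<beta> where \<beta>: "\<beta> \<in> H B' N'" "\<nu> * \<beta> = y * i' - b * c" using m(9) by blast
  obtain b1 e where e: "b1 \<in> H B N'" "e \<in> H Q N'" "\<beta> = b1 * c + e * i'"
    using fine_decompose[OF f s' r \<beta>(1)] by metis
  \<comment> \<open>Subtracting \<nu> e leaves a lift of p on Q that kills the kernel of x, so it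
    descends to P.\<close>
  have ye: "y - \<nu> * e \<in> H Q N" using Q m e by (blast intro: hom)
  have "(y - \<nu> * e) * z = 0" if z: "z \<in> H U Q" "x * z = 0" for U z
  proof -
    have "\<pi> * x * z = 0" using z(2) by (simp add: mult.assoc)
    then obtain z' where z': "z' \<in> H U B'" "i' * z' = z" using u(9)[OF z(1)] by blast
    have "i * (c * z') = 0" using c(4) z'(2) z(2) by (metis mult.assoc)
    then have cz: "c * z' = 0" using monoD[OF t(3) comp_in[OF c(2) z'(1)]] by blast
    have "\<nu> * (\<beta> * z') = y * z - b * (c * z')" using \<beta>(2) z'(2) by (metis left_diff_distrib mult.assoc)
    moreover have "\<beta> * z' = e * z" unfolding e(3) using cz z'(2) by (simp add: distrib_right mult.assoc)
    ultimately show ?thesis using cz by (simp add: left_diff_distrib mult.assoc)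
  qed
  then obtain e1 where e1: "e1 \<in> H P N" "e1 * x = y - \<nu> * e" using descend[OF Q(1,4) ye] by blast
  have "n * e1 * x = p * x" using e1(2) Q(3) m(5) by (simp add: mult.assoc right_diff_distrib) (simp flip: mult.assoc)
  then have "n * e1 = p" using epi_cancel[OF Q(4) comp_in[OF m(2) e1(1)] p] by blast
  then show ?thesis using e1(1) by blast
qed

text \<open>By left exactness the fibres of composition with n are cosets of Hom(P,N').\<close>

lemma card_Hom_ses:
  assumes n: "ses N' N N'' \<nu> n" and fin: "finite (H P N)"
  shows "card (H P N) = card ((\<lambda>x. n * x) ` H P N) * card (H P N')"
    and "y \<in> (\<lambda>x. n * x) ` H P N \<Longrightarrow> card {x \<in> H P N. n * x = y} = card (H P N')"
proof -
  note m = sesD[OF n]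
  show *: "card {x \<in> H P N. n * x = y} = card (H P N')" if y: "y \<in> (\<lambda>x. n * x) ` H P N" for y
  proof -
    obtain x0 where x0: "x0 \<in> H P N" "y = n * x0" using y by blast
    have "bij_betw (\<lambda>z. x0 + \<nu> * z) (H P N') {x \<in> H P N. n * x = y}"
    proof (rule bij_betw_imageI)
      show "inj_on (\<lambda>z. x0 + \<nu> * z) (H P N')"
        using mono_cancel[OF m(3)] by (auto simp: inj_on_def)
      show "(\<lambda>z. x0 + \<nu> * z) ` H P N' = {x \<in> H P N. n * x = y}"
      proof (intro equalityI subsetI)
        fix x assume "x \<in> (\<lambda>z. x0 + \<nu> * z) ` H P N'"
        then obtain z where "z \<in> H P N'" "x = x0 + \<nu> * z" by blast
        moreover have "n * (\<nu> * z) = 0" using m(5) by (metis mult.assoc mult_zero_left)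
        ultimately show "x \<in> {x \<in> H P N. n * x = y}" using x0 m(1) by (auto simp: distrib_left intro!: add_in comp_in)
      next
        fix x assume x: "x \<in> {x \<in> H P N. n * x = y}"
        then have "n * (x - x0) = 0" "x - x0 \<in> H P N" using x0 by (auto simp: right_diff_distrib intro: diff_in)
        then obtain z where "z \<in> H P N'" "\<nu> * z = x - x0" using m(9) by blast
        then show "x \<in> (\<lambda>z. x0 + \<nu> * z) ` H P N'" by (intro image_eqI[of _ _ z]) auto
      qed
    qed
    then show ?thesis using bij_betw_same_card by metis
  qed
  show "card (H P N) = card ((\<lambda>x. n * x) ` H P N) * card (H P N')"
    using card_fibres[OF fin, of "\<lambda>x. n * x"] * by blast
qed

text \<open>Counts the fibres of (b, p) |-> n b + p i, which is onto Hom(B,N'') by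
  \<open>lift_boundary\<close>. Within a fibre the second components form a coset of the image of
  Hom(P,N) in Hom(P,N''), by \<open>lift_from_boundary\<close>, and each occurs with |Hom(B,N')|
  first components.\<close>

lemma additive_right:
  assumes ext2_zero and n: "ses N' N N'' \<nu> n" and f: "fine M N' B P i \<pi>" "fine M N B P i \<pi>"
    and fin: "\<And>X Y. finite (H X Y)"
  shows "card (H P N) * card (H B N') * card (H B N'') = card (H B N) * card (H P N') * card (H P N'')"
proof -
  note m = sesD[OF n] and s = fineD(1)[OF f(1)] and t = sesD[OF fineD(1)[OF f(1)]]
  let ?A = "H B N \<times> H P N''" and ?f = "\<lambda>(b, p). n * b + p * i"
  let ?J = "(\<lambda>x. n * x) ` H P N"
  have im: "?f ` ?A = H B N''"
  proof (intro equalityI subsetI)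
    fix x assume "x \<in> ?f ` ?A"
    then show "x \<in> H B N''" using m(2) t(1) by (auto intro!: add_in comp_in)
  next
    fix x assume "x \<in> H B N''"
    from lift_boundary[OF assms(1) s n f(2) this] show "x \<in> ?f ` ?A" by force
  qed
  have "card {x \<in> ?A. ?f x = y} = card ?J * card (H B N')" if "y \<in> ?f ` ?A" for y
  proof -
    obtain b0 p0 where 0: "b0 \<in> H B N" "p0 \<in> H P N''" "y = n * b0 + p0 * i" using \<open>y \<in> ?f ` ?A\<close> by auto
    let ?F = "{x \<in> ?A. ?f x = y}"
    have J: "snd ` ?F = (\<lambda>p. p0 + p) ` ?J"
    proof (intro equalityI subsetI)
      fix p assume "p \<in> snd ` ?F"
      then obtain b where b: "b \<in> H B N" "p \<in> H P N''" "n * b + p * i = y" by auto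
      have "(p - p0) * i = n * (b0 - b)" using b(3) 0(3) by (simp add: algebra_simps)
      then obtain e where e: "e \<in> H P N" "n * e = p - p0"
        using lift_from_boundary[OF s n f(1) diff_in[OF b(2) 0(2)] diff_in[OF 0(1) b(1)]] by blast
      have "p0 + n * e \<in> (\<lambda>p. p0 + p) ` ?J" by (intro imageI e(1))
      then show "p \<in> (\<lambda>p. p0 + p) ` ?J" unfolding e(2) by simp
    next
      fix p assume "p \<in> (\<lambda>p. p0 + p) ` ?J"
      then obtain e where e: "e \<in> H P N" "p = p0 + n * e" by auto
      have "b0 - e * i \<in> H B N" "p \<in> H P N''" using 0 e m(2) t(1) by (auto intro!: add_in diff_in comp_in)
      moreover have "n * (b0 - e * i) + p * i = y" using e 0(3) by (simp add: algebra_simps)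
      ultimately have "(b0 - e * i, p) \<in> ?F" by auto
      then show "p \<in> snd ` ?F" by force
    qed
    have "finite ?F" by (rule finite_subset[of _ ?A]) (use fin in auto)
    moreover have "card {x \<in> ?F. snd x = p} = card (H B N')" if p: "p \<in> snd ` ?F" for p
    proof -
      obtain b where b: "b \<in> H B N" "p \<in> H P N''" "n * b + p * i = y" using p by auto
      have "{x \<in> ?F. snd x = p} = (\<lambda>x. (x, p)) ` {x \<in> H B N. n * x = n * b}" using b by auto
      then have "card {x \<in> ?F. snd x = p} = card {x \<in> H B N. n * x = n * b}"
        by (simp add: card_image inj_on_def)
      then show ?thesis using card_Hom_ses(2)[OF n fin imageI[OF b(1)]] by simp
    qed
    ultimately have "card ?F = card (snd ` ?F) * card (H B N')" by (rule card_fibres)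
    moreover have "card (snd ` ?F) = card ?J" unfolding J by (rule card_image) (auto simp: inj_on_def)
    ultimately show ?thesis by simp
  qed
  from card_fibres[OF _ this] have "card ?A = card (H B N'') * (card ?J * card (H B N'))"
    using fin im by simp
  then have "card (H B N) * card (H P N'') = card (H B N'') * card ?J * card (H B N')"
    by (simp add: card_cartesian_product)
  then show ?thesis using card_Hom_ses(1)[OF n fin, of P] by (simp add: algebra_simps)
qed

text \<open>P' is the preimage of M' in P. It is the middle term of a resolution of M' and at the
  same time the kernel term of one of M'', which makes the ratios |Hom(P,N)| / |Hom(B,N)|
  telescope.\<close>

lemma restrict:
  assumes s: "ses B P M i \<pi>" and m: "ses M' M M'' \<mu> \<rho>"
  obtains P' k i' \<pi>' where "ses P' P M'' k (\<rho> * \<pi>)" "ses B P' M' i' \<pi>'" "\<mu> * \<pi>' = \<pi> * k" "k * i' = i"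
proof -
  note t = sesD[OF s] and r = sesD[OF m]
  have "\<rho> * \<pi> \<in> H P M''" "epi M'' (\<rho> * \<pi>)" using comp_in[OF r(2) t(2)] epi_comp[OF r(4,2) t(4)] by auto
  then obtain P' k where k: "ses P' P M'' k (\<rho> * \<pi>)" using ses_of_epi by blast
  note u = sesD[OF k]
  obtain \<pi>' where p: "\<pi>' \<in> H P' M'" "\<mu> * \<pi>' = \<pi> * k" using ses_map[OF m t(2) u(1) u(5)] .
  have "\<rho> * \<pi> * i = 0" using t(5) by (simp add: mult.assoc)
  then obtain i' where i': "i' \<in> H B P'" "k * i' = i" using u(9)[OF t(1)] by blast
  have "mono B i'" using mono_left_factor[OF t(3)] i'(2) by metis
  moreover have "\<pi>' * i' = 0"
    using monoD[OF r(3) comp_in[OF p(1) i'(1)]] p(2) i'(2) t(5) by (metis mult.assoc)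
  moreover have "epi M' \<pi>'"
  proof -
    obtain T e x where e: "e \<in> H T M'" "epi M' e" "x \<in> H T P" "\<pi> * x = \<mu> * e" using cover_lift[OF t(2,4) r(1)] .
    have "\<rho> * \<pi> * x = 0" using e(4) r(5) by (metis mult.assoc mult_zero_left)
    then obtain y where y: "y \<in> H T P'" "k * y = x" using u(9)[OF e(3)] by blast
    have "\<mu> * (\<pi>' * y) = \<mu> * e" using p(2) y(2) e(4) by (metis mult.assoc)
    then have "\<pi>' * y = e" using mono_cancel[OF r(3) comp_in[OF p(1) y(1)] e(1)] by blast
    then show ?thesis using epi_right_factor[OF e(2)] by metis
  qed
  moreover have "\<exists>t\<in>H W B. i' * t = g" if g: "g \<in> H W P'" "\<pi>' * g = 0" for W g
  proof -
    have "\<pi> * (k * g) = 0" using p(2) g(2) by (metis mult.assoc mult_zero_right)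
    then obtain v where v: "v \<in> H W B" "i * v = k * g" using t(9)[OF comp_in[OF u(1) g(1)]] by blast
    have "k * (i' * v) = k * g" using v(2) i'(2) by (metis mult.assoc)
    then have "i' * v = g" using mono_cancel[OF u(3) comp_in[OF i'(1) v(1)] g(1)] by blast
    then show ?thesis using v(1) by blast
  qed
  ultimately have "ses B P' M' i' \<pi>'" unfolding ses_def using p(1) i'(1) by blast
  then show ?thesis using that[OF k _ p(2) i'(2)] by blast
qed

text \<open>An arrow into P that lands in M' after \<pi> factors through P', the kernel of P -> M'';
  the remaining equations are checked after the monomorphisms \<mu> and k.\<close>

lemma restrict_refines:
  assumes m: "ses M' M M'' \<mu> \<rho>" and s: "ses B P M i \<pi>" "ses P' P M'' k (\<rho> * \<pi>)" "\<mu> * \<pi>' = \<pi> * k" "k * i' = i"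
       "ses B P' M' i' \<pi>'"
    and a: "a \<in> H Q P" "\<pi> * a = \<mu> * \<tau>" and q: "ses C Q M' j \<tau>" and c: "c \<in> H C B" "i * c = a * j"
  obtains a' where "refines B P' i' \<pi>' C Q j \<tau> a' c"
proof -
  note r = sesD[OF m] and u = sesD[OF s(2)] and v = sesD[OF s(5)] and w = sesD[OF q]
  have "\<rho> * \<pi> * a = 0" using a(2) r(5) by (metis mult.assoc mult_zero_left)
  then obtain a' where a': "a' \<in> H Q P'" "k * a' = a" using u(9)[OF a(1)] by blast
  have "\<mu> * (\<pi>' * a') = \<mu> * \<tau>" using s(3) a'(2) a(2) by (metis mult.assoc)
  then have 1: "\<pi>' * a' = \<tau>" using mono_cancel[OF r(3) comp_in[OF v(2) a'(1)] w(2)] by blast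
  have "k * (i' * c) = k * (a' * j)" using s(4) a'(2) c(2) by (metis mult.assoc)
  then have "i' * c = a' * j" using mono_cancel[OF u(3) comp_in[OF v(1) c(1)] comp_in[OF a'(1) w(1)]] by blast
  then show ?thesis using that 1 a'(1) c(1) unfolding refines_def by blast
qed

text \<open>Classes of \<open>M'\<close> extend to \<open>M\<close>, since the obstruction lies in \<open>Ext\<^sup>2\<close> of \<open>M''\<close>.\<close>

lemma fine_restrict:
  assumes ext2_zero and m: "ses M' M M'' \<mu> \<rho>" and f: "fine M N B P i \<pi>"
    and k: "ses P' P M'' k (\<rho> * \<pi>)" and s': "ses B P' M' i' \<pi>'" and c: "\<mu> * \<pi>' = \<pi> * k" "k * i' = i"
  shows "fine M' N B P' i' \<pi>'"
  unfolding fine_def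
proof (intro conjI allI impI)
  note s = fineD(1)[OF f] and r = sesD[OF m]
  fix B1 P1 i1 \<pi>1 b1 assume s1: "ses B1 P1 M' i1 \<pi>1" and b1: "b1 \<in> H B1 N"
  note t1 = sesD[OF s1]
  \<comment> \<open>The lifting property is applied to M' -> M -> M'' itself, with the cover P1 of
    M'. It yields a resolution of M'' whose kernel maps to P1.\<close>
  obtain B2 P2 i2 \<pi>2 a d where l: "ses B2 P2 M'' i2 \<pi>2" "a \<in> H P2 M" "\<rho> * a = \<pi>2" "d \<in> H B2 P1"
      "\<mu> * (\<pi>1 * d) = a * i2"
    using ext2_zero_lift[OF assms(1) m t1(2,4)] by metis
  note t2 = sesD[OF l(1)]
  \<comment> \<open>The sum P3 of P2 and P1 covers M, and its kernel B3 receives B1. The aim is a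
    retraction z of B3 onto B1, so that b1 z is a class on M restricting to the class of b1.\<close>
  obtain P3 j1 j2 p1 p2 where S: "j1 \<in> H P2 P3" "j2 \<in> H P1 P3" "p1 \<in> H P3 P2" "p2 \<in> H P3 P1"
      "p1 * j1 = I P2" "p2 * j2 = I P1" "p1 * j2 = 0" "p2 * j1 = 0"
    using ex_biprod[OF t2(7) t1(7)] by blast
  define \<phi> where "\<phi> = a * p1 + \<mu> * \<pi>1 * p2"
  have p: "\<phi> \<in> H P3 M" unfolding \<phi>_def using l S r t1 by (blast intro: hom)
  have pj: "\<phi> * j1 = a" "\<phi> * j2 = \<mu> * \<pi>1"
    using S(5-8) idr[OF l(2)] idr[OF comp_in[OF r(1) t1(2)]] by (simp_all add: \<phi>_def distrib_right mult.assoc)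
  have "epi M \<phi>" unfolding epi_def
  proof (intro allI ballI impI)
    fix V v assume v: "v \<in> H M V" "v * \<phi> = 0"
    have va: "v * a = 0" "v * \<mu> * \<pi>1 = 0" using v(2) pj by (metis mult.assoc mult_zero_left)+
    then have "v * \<mu> = 0" using epiD[OF t1(4) comp_in[OF v(1) r(1)]] by blast
    then obtain v' where v': "v' \<in> H M'' V" "v' * \<rho> = v" using ses_descend[OF m v(1)] by blast
    have "v' * \<pi>2 = 0" using va(1) v'(2) l(3) by (metis mult.assoc)
    then show "v = 0" using epiD[OF t2(4) v'(1)] v'(2) by simp
  qed
  then obtain B3 i3 where s3: "ses B3 P3 M i3 \<phi>" using ses_of_epi[OF p] by blast
  note t3 = sesD[OF s3]
  have y: "p1 * i3 \<in> H B3 P2" and x: "p2 * i3 \<in> H B3 P1" using S t3 comp_in by blast+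
  have yx: "a * (p1 * i3) + \<mu> * (\<pi>1 * (p2 * i3)) = 0" using t3(5) by (simp add: \<phi>_def distrib_right mult.assoc)
  have "\<pi>2 * (p1 * i3) = \<rho> * (a * (p1 * i3) + \<mu> * (\<pi>1 * (p2 * i3)))"
    using l(3) r(5) by (simp add: distrib_left flip: mult.assoc)
  then obtain y' where y': "y' \<in> H B3 B2" "i2 * y' = p1 * i3" using t2(9)[OF y] yx by auto
  have "\<mu> * (\<pi>1 * (d * y' + p2 * i3)) = \<mu> * (\<pi>1 * d) * y' + \<mu> * (\<pi>1 * (p2 * i3))"
    by (simp add: distrib_left mult.assoc)
  also have "\<dots> = 0" unfolding l(5) mult.assoc y'(2) by (rule yx)
  finally have "\<mu> * (\<pi>1 * (d * y' + p2 * i3)) = 0" .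
  moreover have dy: "d * y' + p2 * i3 \<in> H B3 P1" using l y' x by (blast intro: hom)
  ultimately have "\<pi>1 * (d * y' + p2 * i3) = 0" using monoD[OF r(3) comp_in[OF t1(2) dy]] by blast
  \<comment> \<open>On B3 the P2-component comes from B2, and d carries it to P1. Added to the
    P1-component it lies over zero in M', hence in B1.\<close>
  then obtain z where z: "z \<in> H B3 B1" "i1 * z = d * y' + p2 * i3" using t1(9)[OF dy] by blast
  have bz: "b1 * z \<in> H B3 N" using comp_in[OF b1 z(1)] .
  \<comment> \<open>Fineness for M realizes the extended class on B. The refinements that follow
    bring this equality of classes back to M'.\<close>
  obtain b where b: "b \<in> H B N" "same_ext_class M N B P i \<pi> b B3 P3 i3 \<phi> (b1 * z)" using fineD(2)[OF f s3 bz] by blast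
  obtain B4 P4 i4 \<pi>4 a4 c4 a4' c4' where q: "ses B4 P4 M i4 \<pi>4"
    "refines B P i \<pi> B4 P4 i4 \<pi>4 a4 c4" "refines B3 P3 i3 \<phi> B4 P4 i4 \<pi>4 a4' c4'"
    using common_refinement[OF s s3] by metis
  obtain e where e: "e \<in> H P4 N" "b * c4 - b1 * z * c4' = e * i4"
    using same_ext_class_common_refinement[OF s s3 b(1) bz b(2) q] by blast
  obtain P4' k4 i4' \<pi>4' where w: "ses P4' P4 M'' k4 (\<rho> * \<pi>4)" "ses B4 P4' M' i4' \<pi>4'" "\<mu> * \<pi>4' = \<pi>4 * k4" "k4 * i4' = i4"
    using restrict[OF q(1) m] by metis
  obtain P3' k3 i3' \<pi>3' where w3: "ses P3' P3 M'' k3 (\<rho> * \<phi>)" "ses B3 P3' M' i3' \<pi>3'" "\<mu> * \<pi>3' = \<phi> * k3" "k3 * i3' = i3"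
    using restrict[OF s3 m] by metis
  note R = refinesD[OF q(2)] and R' = refinesD[OF q(3)] and three_term = sesD[OF w(1)]
  have "a4 * k4 \<in> H P4' P" "\<pi> * (a4 * k4) = \<mu> * \<pi>4'" "i * c4 = a4 * k4 * i4'"
    subgoal using comp_in[OF R(1) three_term(1)] .
    subgoal unfolding mult.assoc[symmetric] R(3) using w(3) by simp
    subgoal unfolding mult.assoc w(4) by (rule R(4))
    done
  from restrict_refines[OF m s k c s' this(1,2) w(2) R(2) this(3)]
  obtain x1 where 1: "refines B P' i' \<pi>' B4 P4' i4' \<pi>4' x1 c4" .
  have "a4' * k4 \<in> H P4' P3" "\<phi> * (a4' * k4) = \<mu> * \<pi>4'" "i3 * c4' = a4' * k4 * i4'"
    subgoal using comp_in[OF R'(1) three_term(1)] .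
    subgoal unfolding mult.assoc[symmetric] R'(3) using w(3) by simp
    subgoal unfolding mult.assoc w(4) by (rule R'(4))
    done
  from restrict_refines[OF m s3 w3(1,3,4,2) this(1,2) w(2) R'(2) this(3)]
  obtain x2 where 2: "refines B3 P3' i3' \<pi>3' B4 P4' i4' \<pi>4' x2 c4'" .
  have "\<phi> * j2 * i1 = 0" unfolding pj using t1(5) by (simp add: mult.assoc)
  \<comment> \<open>c5 is the map B1 -> B3 induced by the summand P1 of P3; below, z c5 is the
    identity.\<close>
  then obtain c5 where c5: "c5 \<in> H B1 B3" "i3 * c5 = j2 * i1" using ses_map[OF s3 S(2) t1(1)] by metis
  from restrict_refines[OF m s3 w3(1,3,4,2) S(2) pj(2) s1 c5]
  obtain x3 where 3: "refines B3 P3' i3' \<pi>3' B1 P1 i1 \<pi>1 x3 c5" .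
  have "i2 * (y' * c5) = p1 * (i3 * c5)" using y'(2) by (metis mult.assoc)
  also have "\<dots> = 0" unfolding c5(2) using S(7) by (metis mult.assoc mult_zero_left)
  finally have yc: "y' * c5 = 0" using monoD[OF t2(3) comp_in[OF y'(1) c5(1)]] by blast
  have "i1 * (z * c5) = d * (y' * c5) + p2 * (i3 * c5)" using z(2) by (metis distrib_right mult.assoc)
  also have "\<dots> = i1 * I B1" unfolding yc c5(2) using S(6) idl[OF t1(1)] idr[OF t1(1)] by (metis add_0 mult.assoc mult_zero_right)
  finally have zc: "z * c5 = I B1" using mono_cancel[OF t1(3) comp_in[OF z(1) c5(1)] id_in[OF t1(6)]] by blast
  have bc: "b1 * z * c5 = b1" using zc idr[OF b1] by (simp add: mult.assoc)
  have 4: "b * c4 \<in> H B4 N" "b1 * z * c4' \<in> H B4 N" using comp_in[OF b(1) R(2)] comp_in[OF bz R'(2)] .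
  have A: "same_ext_class M' N B P' i' \<pi>' b B4 P4' i4' \<pi>4' (b * c4)" by (rule same_ext_class_refines[OF s' w(2) 1 b(1)])
  have "e * k4 \<in> H P4' N" "b * c4 - b1 * z * c4' = e * k4 * i4'"
    using comp_in[OF e(1) three_term(1)] e(2) w(4) by (simp_all add: mult.assoc)
  from same_ext_class_of_extension[OF w(2) 4 this]
  have B: "same_ext_class M' N B4 P4' i4' \<pi>4' (b * c4) B4 P4' i4' \<pi>4' (b1 * z * c4')" .
  have C: "same_ext_class M' N B3 P3' i3' \<pi>3' (b1 * z) B4 P4' i4' \<pi>4' (b1 * z * c4')" by (rule same_ext_class_refines[OF w3(2) w(2) 2 bz])
  have D: "same_ext_class M' N B3 P3' i3' \<pi>3' (b1 * z) B1 P1 i1 \<pi>1 b1" using same_ext_class_refines[OF w3(2) s1 3 bz] unfolding bc .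
  have "same_ext_class M' N B4 P4' i4' \<pi>4' (b1 * z * c4') B1 P1 i1 \<pi>1 b1"
    by (rule same_ext_class_trans[OF w(2) 4(2) w3(2) bz s1 b1 same_ext_class_sym[OF w3(2) bz w(2) 4(2) C] D])
  from same_ext_class_trans[OF w(2) 4(1) w(2) 4(2) s1 b1 B this]
  have "same_ext_class M' N B4 P4' i4' \<pi>4' (b * c4) B1 P1 i1 \<pi>1 b1" .
  from same_ext_class_trans[OF s' b(1) w(2) 4(1) s1 b1 A this] b(1)
  show "\<exists>b\<in>H B N. same_ext_class M' N B P' i' \<pi>' b B1 P1 i1 \<pi>1 b1" by blast
qed (fact s')

text \<open>One P must serve M and M'' at once: it is the fibre product of their two covers over
  M''. Fineness for M' is then inherited by restriction.\<close>

lemma additive_left: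
  assumes ext2_zero and m: "ses M' M M'' \<mu> \<rho>" and f: "fine M N B1 P1 i1 \<pi>1" and f'': "fine M'' N B2 P2 i2 \<pi>2"
  obtains B P P' i \<pi> k i' \<pi>' where "fine M N B P i \<pi>" "fine M'' N P' P k (\<rho> * \<pi>)" "fine M' N B P' i' \<pi>'"
proof -
  note r = sesD[OF m] and t = sesD[OF fineD(1)[OF f]] and t2 = sesD[OF fineD(1)[OF f'']]
  obtain P x y where P: "x \<in> H P P1" "y \<in> H P P2" "\<rho> * \<pi>1 * x = \<pi>2 * y" "epi P1 x"
    using pullback[OF comp_in[OF r(2) t(2)] t2(2)] t2(4) by metis
  have "\<pi>1 * x \<in> H P M" "epi M (\<pi>1 * x)" using comp_in[OF t(2) P(1)] epi_comp[OF t(4,2) P(4)] by auto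
  then obtain B i where s: "ses B P M i (\<pi>1 * x)" using ses_of_epi by blast
  obtain c where "refines B1 P1 i1 \<pi>1 B P i (\<pi>1 * x) x c" using refines_ex[OF fineD(1)[OF f] s P(1) refl] .
  then have F: "fine M N B P i (\<pi>1 * x)" using fine_refines[OF f s] by blast
  obtain P' k i' \<pi>' where k: "ses P' P M'' k (\<rho> * (\<pi>1 * x))" "ses B P' M' i' \<pi>'" "\<mu> * \<pi>' = \<pi>1 * x * k" "k * i' = i"
    using restrict[OF s m] .
  have "\<pi>2 * y = \<rho> * (\<pi>1 * x)" using P(3) by (simp add: mult.assoc)
  then obtain c' where "refines B2 P2 i2 \<pi>2 P' P k (\<rho> * (\<pi>1 * x)) y c'"
    using refines_ex[OF fineD(1)[OF f''] k(1) P(2)] by blast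
  then have "fine M'' N P' P k (\<rho> * (\<pi>1 * x))" using fine_refines[OF f'' k(1)] by blast
  from that[OF F this fine_restrict[OF assms(1) m F k]] show ?thesis .
qed

text \<open>The last conclusion keeps fineness for every further second argument, so the
  construction can be iterated.\<close>

lemma fine_common:
  assumes f: "fine M N B P i \<pi>" and f': "fine M N' B' P' i' \<pi>'"
  obtains B2 P2 i2 \<pi>2 where "fine M N B2 P2 i2 \<pi>2" "fine M N' B2 P2 i2 \<pi>2"
    "\<And>L. fine M L B P i \<pi> \<Longrightarrow> fine M L B2 P2 i2 \<pi>2"
proof -
  obtain B2 P2 i2 \<pi>2 a c a' c' where q: "ses B2 P2 M i2 \<pi>2"
    "refines B P i \<pi> B2 P2 i2 \<pi>2 a c" "refines B' P' i' \<pi>' B2 P2 i2 \<pi>2 a' c'"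
    using common_refinement[OF fineD(1)[OF f] fineD(1)[OF f']] .
  show ?thesis
  proof (rule that)
    show "fine M N B2 P2 i2 \<pi>2" by (rule fine_refines[OF f q(1,2)])
    show "fine M N' B2 P2 i2 \<pi>2" by (rule fine_refines[OF f' q(1,3)])
    show "fine M L B2 P2 i2 \<pi>2" if "fine M L B P i \<pi>" for L by (rule fine_refines[OF that q(1,2)])
  qed
qed

text \<open>The finitely many classes are made visible one after the other, by common refinement
  with the resolution found so far.\<close>

lemma fine_exists:
  assumes "finite S" and M: "M \<in> Obj"
    and S: "\<And>B P i \<pi> b. (B, P, i, \<pi>, b) \<in> S \<Longrightarrow> ses B P M i \<pi> \<and> b \<in> H B N"
    and all: "\<And>B P i \<pi> b. ses B P M i \<pi> \<Longrightarrow> b \<in> H B N \<Longrightarrow>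
       \<exists>B' P' i' \<pi>' b'. (B', P', i', \<pi>', b') \<in> S \<and> same_ext_class M N B P i \<pi> b B' P' i' \<pi>' b'"
  obtains B P i \<pi> where "fine M N B P i \<pi>"
proof -
  have "\<exists>B P i \<pi>. ses B P M i \<pi> \<and> (\<forall>(B', P', i', \<pi>', b')\<in>S. \<exists>b\<in>H B N. same_ext_class M N B P i \<pi> b B' P' i' \<pi>' b')"
    using assms(1) S
  proof (induction S rule: finite_induct)
    case empty
    obtain B i where "ses B M M i (I M)" using ses_of_epi[OF id_in[OF M] epi_id[OF M]] .
    then show ?case by auto
  next
    case (insert x S)
    obtain B1 P1 i1 \<pi>1 b1 where x: "x = (B1, P1, i1, \<pi>1, b1)" by (cases x)
    have s1: "ses B1 P1 M i1 \<pi>1" and b1: "b1 \<in> H B1 N" using insert.prems[of B1 P1 i1 \<pi>1 b1] x by auto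
    obtain B P i \<pi> where s: "ses B P M i \<pi>"
      and al: "\<forall>(B', P', i', \<pi>', b')\<in>S. \<exists>b\<in>H B N. same_ext_class M N B P i \<pi> b B' P' i' \<pi>' b'"
      using insert.IH[OF insert.prems] by auto
    obtain B2 P2 i2 \<pi>2 a c a' c' where q: "ses B2 P2 M i2 \<pi>2"
      "refines B P i \<pi> B2 P2 i2 \<pi>2 a c" "refines B1 P1 i1 \<pi>1 B2 P2 i2 \<pi>2 a' c'"
      using common_refinement[OF s s1] .
    have "\<exists>b\<in>H B2 N. same_ext_class M N B2 P2 i2 \<pi>2 b B' P' i' \<pi>' b'" if y: "(B', P', i', \<pi>', b') \<in> insert x S" for B' P' i' \<pi>' b'
    proof (cases "(B', P', i', \<pi>', b') = x")
      case True
      then have X: "B' = B1" "P' = P1" "i' = i1" "\<pi>' = \<pi>1" "b' = b1" unfolding x by auto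
      have "b1 * c' \<in> H B2 N" using comp_in[OF b1 refinesD(2)[OF q(3)]] .
      moreover from same_ext_class_sym[OF s1 b1 q(1) this same_ext_class_refines[OF s1 q(1,3) b1]]
      have "same_ext_class M N B2 P2 i2 \<pi>2 (b1 * c') B1 P1 i1 \<pi>1 b1" .
      ultimately show ?thesis unfolding X by blast
    next
      case False
      then have y: "(B', P', i', \<pi>', b') \<in> S" using y by blast
      then obtain b where b: "b \<in> H B N" "same_ext_class M N B P i \<pi> b B' P' i' \<pi>' b'" using al by blast
      have "ses B' P' M i' \<pi>'" "b' \<in> H B' N" using insert.prems[of B' P' i' \<pi>' b'] y by auto
      from same_ext_class_refine_left[OF s q(1,2) this(1) b(1) this(2) b(2)]
      show ?thesis using comp_in[OF b(1) refinesD(2)[OF q(2)]] by blast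
    qed
    then show ?case using q(1) by (intro exI[of _ B2] exI[of _ P2] exI[of _ i2] exI[of _ \<pi>2]) auto
  qed
  then obtain B P i \<pi> where s: "ses B P M i \<pi>"
    and al: "\<And>B' P' i' \<pi>' b'. (B', P', i', \<pi>', b') \<in> S \<Longrightarrow> \<exists>b\<in>H B N. same_ext_class M N B P i \<pi> b B' P' i' \<pi>' b'" by fast
  have "fine M N B P i \<pi>" unfolding fine_def
  proof (intro conjI allI impI)
    fix B' P' i' \<pi>' b' assume b': "ses B' P' M i' \<pi>'" "b' \<in> H B' N"
    then obtain B1 P1 i1 \<pi>1 b1 where y: "(B1, P1, i1, \<pi>1, b1) \<in> S" "same_ext_class M N B' P' i' \<pi>' b' B1 P1 i1 \<pi>1 b1"
      using all[OF b'] by blast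
    have 1: "ses B1 P1 M i1 \<pi>1" "b1 \<in> H B1 N" using S[OF y(1)] by auto
    obtain b where b: "b \<in> H B N" "same_ext_class M N B P i \<pi> b B1 P1 i1 \<pi>1 b1" using al[OF y(1)] by blast
    from same_ext_class_trans[OF s b(1) 1 b' b(2) same_ext_class_sym[OF b' 1 y(2)]] b(1)
    show "\<exists>b\<in>H B N. same_ext_class M N B P i \<pi> b B' P' i' \<pi>' b'" by blast
  qed (fact s)
  then show ?thesis by (rule that)
qed

end


section \<open>Embedding the arrows of a linear category into a ring\<close>

text \<open>The arrows of a linear category are made elements of one type of class \<open>ring\<close>, so that sums of
  composites become ring expressions. An arrow \<open>X \<rightarrow> Y\<close> acts by composition on the product of all
  groups \<open>Hom W Z\<close>, and is determined by this action (Yoneda). A type cannot depend on the category,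
  so the ring below consists of simultaneous choices of an endomorphism of every abelian group
  structure on the type \<open>'g\<close>.\<close>

typedef 'g endo = "{e :: 'g monoid \<Rightarrow> 'g \<Rightarrow> 'g. \<forall>G. (comm_group G \<longrightarrow> e G \<in> hom G G \<inter> extensional (carrier G)) \<and>
    (\<not> comm_group G \<longrightarrow> e G = undefined)}"
  morphisms act Abs_endo
proof
  show "(\<lambda>G. if comm_group G then (\<lambda>x\<in>carrier G. \<one>\<^bsub>G\<^esub>) else undefined) \<in> {e :: 'g monoid \<Rightarrow> 'g \<Rightarrow> 'g.
    \<forall>G. (comm_group G \<longrightarrow> e G \<in> hom G G \<inter> extensional (carrier G)) \<and> (\<not> comm_group G \<longrightarrow> e G = undefined)}"
    by (auto intro!: homI simp: comm_group_def comm_monoid_def monoid.m_closed group.is_monoid monoid.r_one)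
qed

lemma act_closed [simp]: "comm_group G \<Longrightarrow> x \<in> carrier G \<Longrightarrow> act e G x \<in> carrier G"
  using act[of e] by (auto simp: hom_def)

lemma act_mult: "comm_group G \<Longrightarrow> x \<in> carrier G \<Longrightarrow> y \<in> carrier G \<Longrightarrow>
    act e G (x \<otimes>\<^bsub>G\<^esub> y) = act e G x \<otimes>\<^bsub>G\<^esub> act e G y"
  using act[of e] by (auto simp: hom_def)

lemma endo_eqI:
  assumes "\<And>G x. comm_group G \<Longrightarrow> x \<in> carrier G \<Longrightarrow> act e G x = act f G x"
  shows "e = f"
proof -
  have "act e G = act f G" for G
  proof (cases "comm_group G")
    case True
    then have "act e G \<in> extensional (carrier G)" "act f G \<in> extensional (carrier G)" using act[of e] act[of f] by auto
    then show ?thesis using assms[OF True] by (metis extensionalityI)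
  next
    case False
    then show ?thesis using act[of e] act[of f] by auto
  qed
  then show ?thesis by (metis act_inject ext)
qed

text \<open>Restriction to the carrier and the value \<open>undefined\<close> away from abelian
  groups keep representations canonical, as \<open>endo_eqI\<close> requires.\<close>

definition mk_endo :: "('g monoid \<Rightarrow> 'g \<Rightarrow> 'g) \<Rightarrow> 'g endo" where
  "mk_endo e = Abs_endo (\<lambda>G. if comm_group G then restrict (e G) (carrier G) else undefined)"

lemma act_mk_endo:
  assumes "\<And>G. comm_group G \<Longrightarrow> e G \<in> hom G G" and G: "comm_group G" "x \<in> carrier G"
  shows "act (mk_endo e) G x = e G x"
proof -
  have "restrict (e G) (carrier G) \<in> hom G G" if "comm_group G" for G
  proof -
    have m: "monoid G" using that by (simp add: comm_group_def comm_monoid_def)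
    show ?thesis using assms(1)[OF that] monoid.m_closed[OF m] by (auto simp: hom_def)
  qed
  then have "act (mk_endo e) = (\<lambda>G. if comm_group G then restrict (e G) (carrier G) else undefined)"
    unfolding mk_endo_def by (subst Abs_endo_inverse) auto
  then show ?thesis using G by simp
qed

instantiation endo :: (type) ring
begin

definition zero_endo :: "'a endo" where
  "0 = mk_endo (\<lambda>G x. \<one>\<^bsub>G\<^esub>)"

definition plus_endo :: "'a endo \<Rightarrow> 'a endo \<Rightarrow> 'a endo" where
  "e + f = mk_endo (\<lambda>G x. act e G x \<otimes>\<^bsub>G\<^esub> act f G x)"

definition uminus_endo :: "'a endo \<Rightarrow> 'a endo" where
  "- e = mk_endo (\<lambda>G x. inv\<^bsub>G\<^esub> act e G x)"

definition minus_endo :: "'a endo \<Rightarrow> 'a endo \<Rightarrow> 'a endo" where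
  "e - f = e + - (f :: 'a endo)"

definition times_endo :: "'a endo \<Rightarrow> 'a endo \<Rightarrow> 'a endo" where
  "e * f = mk_endo (\<lambda>G x. act e G (act f G x))"

lemma act_zero: "comm_group G \<Longrightarrow> x \<in> carrier G \<Longrightarrow> act 0 G x = \<one>\<^bsub>G\<^esub>"
  unfolding zero_endo_def by (rule act_mk_endo)
    (auto intro!: homI simp: comm_group_def comm_monoid_def monoid.r_one)

lemma act_plus: "comm_group G \<Longrightarrow> x \<in> carrier G \<Longrightarrow> act (e + f) G x = act e G x \<otimes>\<^bsub>G\<^esub> act f G x"
  unfolding plus_endo_def
proof (rule act_mk_endo)
  fix G :: "'a monoid" assume G: "comm_group G"
  then interpret comm_group G .
  show "(\<lambda>x. act e G x \<otimes>\<^bsub>G\<^esub> act f G x) \<in> hom G G"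
    by (rule homI) (use G in \<open>simp_all add: act_mult m_ac\<close>)
qed

lemma act_uminus: "comm_group G \<Longrightarrow> x \<in> carrier G \<Longrightarrow> act (- e) G x = inv\<^bsub>G\<^esub> act e G x"
  unfolding uminus_endo_def
proof (rule act_mk_endo)
  fix G :: "'a monoid" assume G: "comm_group G"
  then interpret comm_group G .
  show "(\<lambda>x. inv\<^bsub>G\<^esub> act e G x) \<in> hom G G"
    by (rule homI) (use G in \<open>simp_all add: act_mult inv_mult\<close>)
qed

lemma act_times: "comm_group G \<Longrightarrow> x \<in> carrier G \<Longrightarrow> act (e * f) G x = act e G (act f G x)"
  unfolding times_endo_def
  by (rule act_mk_endo) (auto intro!: homI simp: act_mult)

instance
proof
  fix a b c :: "'a endo"
  show "a + b + c = a + (b + c)"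
    by (rule endo_eqI) (simp add: act_plus comm_group_def comm_monoid_def monoid.m_assoc)
  show "a + b = b + a"
    by (rule endo_eqI) (simp add: act_plus comm_group_def comm_monoid.m_comm)
  show "0 + a = a"
    by (rule endo_eqI) (simp add: act_plus act_zero comm_group_def comm_monoid_def monoid.l_one)
  show "- a + a = 0"
    by (rule endo_eqI) (simp add: act_plus act_zero act_uminus comm_group_def group.l_inv)
  show "a - b = a + - b" by (simp add: minus_endo_def)
  show "a * b * c = a * (b * c)"
    by (rule endo_eqI) (simp add: act_times)
  show "(a + b) * c = a * c + b * c"
    by (rule endo_eqI) (simp add: act_times act_plus)
  show "a * (b + c) = a * b + a * c"
    by (rule endo_eqI) (simp add: act_times act_plus act_mult)
qed

end

definition arrow_group :: "('o, 'a, 'k) lincat \<Rightarrow> ('o \<times> 'o \<Rightarrow> 'a) monoid" where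
  "arrow_group C = product_group (Ob C \<times> Ob C) (\<lambda>(W, X). add_monoid (Hom C W X))"

text \<open>A matrix unit acting on families by composition. The ends X and Y are arguments because
  Hom-sets may overlap. The zero action on all other groups makes sums and products of arrows behave
  trivially there.\<close>

definition marr :: "('o, 'a, 'k) lincat \<Rightarrow> 'o \<Rightarrow> 'o \<Rightarrow> 'a \<Rightarrow> ('o \<times> 'o \<Rightarrow> 'a) endo" where
  "marr C X Y f = mk_endo (\<lambda>G \<phi>. if G = arrow_group C
     then (\<lambda>(W, Z)\<in>Ob C \<times> Ob C. if Z = Y then f \<bullet>\<^bsub>C\<^esub> \<phi> (W, X) else \<zero>\<^bsub>Hom C W Z\<^esub>) else \<one>\<^bsub>G\<^esub>)"

locale lin_abelian =
  fixes F :: "'k ring" and C :: "('o, 'a, 'k) lincat"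
  assumes fieldF: "field F" and lin: "linear_category F C" and abelian: "abelian_category C"
begin

lemma vs: "X \<in> Ob C \<Longrightarrow> Y \<in> Ob C \<Longrightarrow> vectorspace F (Hom C X Y)"
  using lin unfolding linear_category_def by simp

lemma ab: "X \<in> Ob C \<Longrightarrow> Y \<in> Ob C \<Longrightarrow> abelian_group (Hom C X Y)"
  using vs unfolding vectorspace_def module_def by blast

lemma cg: "X \<in> Ob C \<Longrightarrow> Y \<in> Ob C \<Longrightarrow> comm_group (add_monoid (Hom C X Y))"
  using ab abelian_group.a_comm_group by blast

lemma Idn_in: "X \<in> Ob C \<Longrightarrow> Idn C X \<in> carrier (Hom C X X)"
  using lin unfolding linear_category_def by simp

lemma Comp_Idn:
  assumes "X \<in> Ob C" "Y \<in> Ob C" "f \<in> carrier (Hom C X Y)"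
  shows "f \<bullet>\<^bsub>C\<^esub> Idn C X = f" "Idn C Y \<bullet>\<^bsub>C\<^esub> f = f"
  using lin assms unfolding linear_category_def by simp_all

lemma Comp_in: "X \<in> Ob C \<Longrightarrow> Y \<in> Ob C \<Longrightarrow> Z \<in> Ob C \<Longrightarrow> f \<in> carrier (Hom C X Y) \<Longrightarrow> g \<in> carrier (Hom C Y Z) \<Longrightarrow>
    g \<bullet>\<^bsub>C\<^esub> f \<in> carrier (Hom C X Z)"
  using lin unfolding linear_category_def by simp

lemma Comp_assoc: "W \<in> Ob C \<Longrightarrow> X \<in> Ob C \<Longrightarrow> Y \<in> Ob C \<Longrightarrow> Z \<in> Ob C \<Longrightarrow> f \<in> carrier (Hom C W X) \<Longrightarrow>
    g \<in> carrier (Hom C X Y) \<Longrightarrow> h \<in> carrier (Hom C Y Z) \<Longrightarrow> h \<bullet>\<^bsub>C\<^esub> (g \<bullet>\<^bsub>C\<^esub> f) = (h \<bullet>\<^bsub>C\<^esub> g) \<bullet>\<^bsub>C\<^esub> f"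
  using lin unfolding linear_category_def by simp

lemma Comp_add:
  assumes "X \<in> Ob C" "Y \<in> Ob C" "Z \<in> Ob C" "f \<in> carrier (Hom C X Y)" "f' \<in> carrier (Hom C X Y)"
    "g \<in> carrier (Hom C Y Z)" "g' \<in> carrier (Hom C Y Z)"
  shows "g \<bullet>\<^bsub>C\<^esub> (f \<oplus>\<^bsub>Hom C X Y\<^esub> f') = (g \<bullet>\<^bsub>C\<^esub> f) \<oplus>\<^bsub>Hom C X Z\<^esub> (g \<bullet>\<^bsub>C\<^esub> f')"
    "(g \<oplus>\<^bsub>Hom C Y Z\<^esub> g') \<bullet>\<^bsub>C\<^esub> f = (g \<bullet>\<^bsub>C\<^esub> f) \<oplus>\<^bsub>Hom C X Z\<^esub> (g' \<bullet>\<^bsub>C\<^esub> f)"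
  using lin assms unfolding linear_category_def by simp_all

lemma Comp_smult:
  assumes "X \<in> Ob C" "Y \<in> Ob C" "Z \<in> Ob C" "c \<in> carrier F" "f \<in> carrier (Hom C X Y)" "g \<in> carrier (Hom C Y Z)"
  shows "g \<bullet>\<^bsub>C\<^esub> (c \<odot>\<^bsub>Hom C X Y\<^esub> f) = c \<odot>\<^bsub>Hom C X Z\<^esub> (g \<bullet>\<^bsub>C\<^esub> f)"
    "(c \<odot>\<^bsub>Hom C Y Z\<^esub> g) \<bullet>\<^bsub>C\<^esub> f = c \<odot>\<^bsub>Hom C X Z\<^esub> (g \<bullet>\<^bsub>C\<^esub> f)"
  using lin assms unfolding linear_category_def by simp_all

lemma arrow_group: "comm_group (arrow_group C)"
proof -
  have g: "group (product_group (Ob C \<times> Ob C) (\<lambda>(W, X). add_monoid (Hom C W X)))"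
    by (rule product_group) (auto dest: cg simp: comm_group_def)
  have "x \<otimes>\<^bsub>arrow_group C\<^esub> y = y \<otimes>\<^bsub>arrow_group C\<^esub> x" if "x \<in> carrier (arrow_group C)" "y \<in> carrier (arrow_group C)" for x y
    using that abelian_groupE(4)[OF ab]
    by (auto simp: arrow_group_def restrict_def fun_eq_iff PiE_iff split: if_splits)
  then show ?thesis using g by (intro group.group_comm_groupI) (simp_all add: arrow_group_def)
qed

lemma arrow_groupD: "\<phi> \<in> carrier (arrow_group C) \<Longrightarrow> W \<in> Ob C \<Longrightarrow> X \<in> Ob C \<Longrightarrow> \<phi> (W, X) \<in> carrier (Hom C W X)"
  by (auto simp: arrow_group_def PiE_iff)

lemma arrow_groupI: "(\<And>W X. W \<in> Ob C \<Longrightarrow> X \<in> Ob C \<Longrightarrow> \<phi> (W, X) \<in> carrier (Hom C W X)) \<Longrightarrow> \<phi> \<in> extensional (Ob C \<times> Ob C) \<Longrightarrow>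
    \<phi> \<in> carrier (arrow_group C)"
  by (auto simp: arrow_group_def PiE_iff)

lemma arrow_group_mult: "W \<in> Ob C \<Longrightarrow> X \<in> Ob C \<Longrightarrow> (\<phi> \<otimes>\<^bsub>arrow_group C\<^esub> \<psi>) (W, X) = \<phi> (W, X) \<oplus>\<^bsub>Hom C W X\<^esub> \<psi> (W, X)"
  by (auto simp: arrow_group_def)

lemma arrow_group_eqI:
  assumes "\<phi> \<in> carrier (arrow_group C)" "\<psi> \<in> carrier (arrow_group C)"
    "\<And>W X. W \<in> Ob C \<Longrightarrow> X \<in> Ob C \<Longrightarrow> \<phi> (W, X) = \<psi> (W, X)"
  shows "\<phi> = \<psi>"
  using assms by (auto simp: arrow_group_def intro!: PiE_ext[of \<phi> "Ob C \<times> Ob C"])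

lemma zero_in_Hom: "X \<in> Ob C \<Longrightarrow> Y \<in> Ob C \<Longrightarrow> \<zero>\<^bsub>Hom C X Y\<^esub> \<in> carrier (Hom C X Y)"
  using abelian_groupE(2)[OF ab] .

lemma zero_add_zero: "X \<in> Ob C \<Longrightarrow> Y \<in> Ob C \<Longrightarrow> \<zero>\<^bsub>Hom C X Y\<^esub> \<oplus>\<^bsub>Hom C X Y\<^esub> \<zero>\<^bsub>Hom C X Y\<^esub> = \<zero>\<^bsub>Hom C X Y\<^esub>"
  using abelian_groupE(5)[OF ab zero_in_Hom] .

lemma act_marr:
  assumes f: "X \<in> Ob C" "Y \<in> Ob C" "f \<in> carrier (Hom C X Y)" and p: "\<phi> \<in> carrier (arrow_group C)"
    and W: "W \<in> Ob C" "Z \<in> Ob C"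
  shows "act (marr C X Y f) (arrow_group C) \<phi> (W, Z) = (if Z = Y then f \<bullet>\<^bsub>C\<^esub> \<phi> (W, X) else \<zero>\<^bsub>Hom C W Z\<^esub>)"
    and "comm_group G \<Longrightarrow> G \<noteq> arrow_group C \<Longrightarrow> x \<in> carrier G \<Longrightarrow> act (marr C X Y f) G x = \<one>\<^bsub>G\<^esub>"
proof -
  let ?e = "\<lambda>G \<phi>. if G = arrow_group C
     then (\<lambda>(W, Z)\<in>Ob C \<times> Ob C. if Z = Y then f \<bullet>\<^bsub>C\<^esub> \<phi> (W, X) else \<zero>\<^bsub>Hom C W Z\<^esub>) else \<one>\<^bsub>G\<^esub>"
  have cl: "?e (arrow_group C) \<phi> \<in> carrier (arrow_group C)" if "\<phi> \<in> carrier (arrow_group C)" for \<phi>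
    using that f by (intro arrow_groupI) (auto intro: Comp_in arrow_groupD zero_in_Hom)
  have e: "?e G \<in> hom G G" if "comm_group G" for G
  proof (cases "G = arrow_group C")
    case True
    interpret comm_group "arrow_group C" by (rule arrow_group)
    show ?thesis
    proof (rule homI)
      fix x y assume "x \<in> carrier G" "y \<in> carrier G"
      then have xy: "x \<in> carrier (arrow_group C)" "y \<in> carrier (arrow_group C)" using True by auto
      show "?e G (x \<otimes>\<^bsub>G\<^esub> y) = ?e G x \<otimes>\<^bsub>G\<^esub> ?e G y"
        unfolding True
      proof (rule arrow_group_eqI[OF cl[OF m_closed[OF xy]] m_closed[OF cl[OF xy(1)] cl[OF xy(2)]]])
        fix W Z assume W: "W \<in> Ob C" "Z \<in> Ob C"
        show "?e (arrow_group C) (x \<otimes>\<^bsub>arrow_group C\<^esub> y) (W, Z) = (?e (arrow_group C) x \<otimes>\<^bsub>arrow_group C\<^esub> ?e (arrow_group C) y) (W, Z)"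
          unfolding arrow_group_mult[OF W]
          using W f arrow_groupD[OF xy(1) W(1) f(1)] arrow_groupD[OF xy(2) W(1) f(1)] arrow_group_mult[OF W(1) f(1), of x y]
          by (simp add: Comp_add zero_add_zero)
      qed
    qed (use cl True in auto)
  next
    case False
    then show ?thesis using that
      by (auto intro!: homI simp: comm_group_def comm_monoid_def monoid.r_one monoid.one_closed)
  qed
  have "act (marr C X Y f) G x = ?e G x" if "comm_group G" "x \<in> carrier G" for G x
    unfolding marr_def using act_mk_endo[of ?e, OF e that] .
  then show "act (marr C X Y f) (arrow_group C) \<phi> (W, Z) = (if Z = Y then f \<bullet>\<^bsub>C\<^esub> \<phi> (W, X) else \<zero>\<^bsub>Hom C W Z\<^esub>)"
    "comm_group G \<Longrightarrow> G \<noteq> arrow_group C \<Longrightarrow> x \<in> carrier G \<Longrightarrow> act (marr C X Y f) G x = \<one>\<^bsub>G\<^esub>"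
    using arrow_group p W by simp_all
qed

lemma marr_eqI:
  assumes "X \<in> Ob C" and e: "\<And>\<phi> W Z. \<phi> \<in> carrier (arrow_group C) \<Longrightarrow> W \<in> Ob C \<Longrightarrow> Z \<in> Ob C \<Longrightarrow>
      act e (arrow_group C) \<phi> (W, Z) = act f (arrow_group C) \<phi> (W, Z)"
    and "\<And>G x. comm_group G \<Longrightarrow> G \<noteq> arrow_group C \<Longrightarrow> x \<in> carrier G \<Longrightarrow> act e G x = act f G x"
  shows "e = f"
proof (rule endo_eqI)
  fix G x assume G: "comm_group G" "x \<in> carrier (G :: ('o \<times> 'o \<Rightarrow> 'a) monoid)"
  show "act e G x = act f G x"
  proof (cases "G = arrow_group C")
    case True
    show ?thesis using G unfolding True by (intro arrow_group_eqI act_closed e) auto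
  qed (use assms(3) G in blast)
qed

lemma marr_comp:
  assumes "X \<in> Ob C" "Y \<in> Ob C" "Z \<in> Ob C" "f \<in> carrier (Hom C X Y)" "g \<in> carrier (Hom C Y Z)"
  shows "marr C X Z (g \<bullet>\<^bsub>C\<^esub> f) = marr C Y Z g * marr C X Y f"
proof (rule marr_eqI[OF assms(1)])
  fix \<phi> W V assume p: "\<phi> \<in> carrier (arrow_group C)" "W \<in> Ob C" "V \<in> Ob C"
  have q: "act (marr C X Y f) (arrow_group C) \<phi> \<in> carrier (arrow_group C)" using p arrow_group by simp
  show "act (marr C X Z (g \<bullet>\<^bsub>C\<^esub> f)) (arrow_group C) \<phi> (W, V) = act (marr C Y Z g * marr C X Y f) (arrow_group C) \<phi> (W, V)"
    using p assms Comp_in[OF assms] arrow_groupD[OF p(1,2) assms(1)]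
    by (simp add: act_times arrow_group act_marr(1)[OF _ _ _ q] act_marr(1)[OF _ _ _ p(1)] Comp_assoc[of W X Y Z])
next
  fix G x assume G: "comm_group G" "G \<noteq> arrow_group C" "x \<in> carrier (G :: ('o \<times> 'o \<Rightarrow> 'a) monoid)"
  interpret comm_group "arrow_group C" by (rule arrow_group)
  interpret G: comm_group G by (rule G)
  note a = act_marr(2)[OF _ _ _ one_closed assms(1,1) G(1,2)]
  show "act (marr C X Z (g \<bullet>\<^bsub>C\<^esub> f)) G x = act (marr C Y Z g * marr C X Y f) G x"
    using assms G Comp_in[OF assms] by (simp add: act_times a G.one_closed)
qed

lemma marr_add:
  assumes "X \<in> Ob C" "Y \<in> Ob C" "f \<in> carrier (Hom C X Y)" "g \<in> carrier (Hom C X Y)"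
  shows "marr C X Y (f \<oplus>\<^bsub>Hom C X Y\<^esub> g) = marr C X Y f + marr C X Y g"
proof (rule marr_eqI[OF assms(1)])
  note fg = abelian_groupE(1)[OF ab[OF assms(1,2)] assms(3,4)]
  {
    fix \<phi> W V assume p: "\<phi> \<in> carrier (arrow_group C)" "W \<in> Ob C" "V \<in> Ob C"
    show "act (marr C X Y (f \<oplus>\<^bsub>Hom C X Y\<^esub> g)) (arrow_group C) \<phi> (W, V) = act (marr C X Y f + marr C X Y g) (arrow_group C) \<phi> (W, V)"
      using p assms fg arrow_groupD[OF p(1,2) assms(1)]
      by (simp add: act_plus arrow_group arrow_group_mult act_marr(1)[OF _ _ _ p(1)] Comp_add zero_add_zero)
  next
    fix G x assume G: "comm_group G" "G \<noteq> arrow_group C" "x \<in> carrier (G :: ('o \<times> 'o \<Rightarrow> 'a) monoid)"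
    interpret comm_group "arrow_group C" by (rule arrow_group)
    interpret G: comm_group G by (rule G)
    note a = act_marr(2)[OF _ _ _ one_closed assms(1,1) G(1,2)]
    show "act (marr C X Y (f \<oplus>\<^bsub>Hom C X Y\<^esub> g)) G x = act (marr C X Y f + marr C X Y g) G x"
      using assms G fg by (simp add: act_plus a G.one_closed)
  }
qed

text \<open>Yoneda: evaluate both on the family that is the identity at (X,X) and zero
  elsewhere.\<close>

lemma marr_inj:
  assumes "X \<in> Ob C" "Y \<in> Ob C" "f \<in> carrier (Hom C X Y)" "g \<in> carrier (Hom C X Y)"
    and e: "marr C X Y f = marr C X Y g"
  shows "f = g"
proof -
  define \<phi> where "\<phi> = (\<lambda>(W, Z)\<in>Ob C \<times> Ob C. if W = X \<and> Z = X then Idn C X else \<zero>\<^bsub>Hom C W Z\<^esub>)"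
  have p: "\<phi> \<in> carrier (arrow_group C)" unfolding \<phi>_def
    by (rule arrow_groupI) (auto intro: Idn_in zero_in_Hom)
  have "f \<bullet>\<^bsub>C\<^esub> Idn C X = g \<bullet>\<^bsub>C\<^esub> Idn C X"
    using act_marr(1)[OF assms(1-3) p assms(1,2)] act_marr(1)[OF assms(1,2,4) p assms(1,2)] e assms(1)
    by (simp add: \<phi>_def)
  then show ?thesis using Comp_Idn assms by simp
qed

lemma marr_zero: "X \<in> Ob C \<Longrightarrow> Y \<in> Ob C \<Longrightarrow> marr C X Y \<zero>\<^bsub>Hom C X Y\<^esub> = 0"
  using marr_add[of X Y "\<zero>\<^bsub>Hom C X Y\<^esub>" "\<zero>\<^bsub>Hom C X Y\<^esub>"] zero_in_Hom zero_add_zero by simp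

lemma marr_minus:
  assumes "X \<in> Ob C" "Y \<in> Ob C" "f \<in> carrier (Hom C X Y)"
  shows "marr C X Y (\<ominus>\<^bsub>Hom C X Y\<^esub> f) = - marr C X Y f" "\<ominus>\<^bsub>Hom C X Y\<^esub> f \<in> carrier (Hom C X Y)"
proof -
  interpret abelian_group "Hom C X Y" by (rule ab[OF assms(1,2)])
  show "\<ominus>\<^bsub>Hom C X Y\<^esub> f \<in> carrier (Hom C X Y)" using assms by simp
  have "marr C X Y (\<ominus>\<^bsub>Hom C X Y\<^esub> f) + marr C X Y f = 0"
    using marr_add[OF assms(1,2), of "\<ominus>\<^bsub>Hom C X Y\<^esub> f" f] assms l_neg marr_zero by simp
  then show "marr C X Y (\<ominus>\<^bsub>Hom C X Y\<^esub> f) = - marr C X Y f" by (simp add: add_eq_0_iff2)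
qed

lemma marr_diff:
  assumes "X \<in> Ob C" "Y \<in> Ob C" "f \<in> carrier (Hom C X Y)" "g \<in> carrier (Hom C X Y)"
  shows "marr C X Y (f \<ominus>\<^bsub>Hom C X Y\<^esub> g) = marr C X Y f - marr C X Y g"
  using marr_add[OF assms(1-3) marr_minus(2)[OF assms(1,2,4)]] marr_minus(1)[OF assms(1,2,4)]
  by (simp add: a_minus_def)

text \<open>Empty unless both ends are objects. This gives \<open>H_obj\<close>, by which
  \<open>abcat\<close> can quantify over all W without a membership condition.\<close>

definition Hm :: "'o \<Rightarrow> 'o \<Rightarrow> ('o \<times> 'o \<Rightarrow> 'a) endo set" where
  "Hm X Y = (if X \<in> Ob C \<and> Y \<in> Ob C then marr C X Y ` carrier (Hom C X Y) else {})"

definition Idm :: "'o \<Rightarrow> ('o \<times> 'o \<Rightarrow> 'a) endo" where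
  "Idm X = marr C X X (Idn C X)"

lemma HmE:
  assumes "x \<in> Hm X Y"
  obtains f where "X \<in> Ob C" "Y \<in> Ob C" "f \<in> carrier (Hom C X Y)" "x = marr C X Y f"
  using assms unfolding Hm_def by (auto split: if_splits)

lemma HmI: "X \<in> Ob C \<Longrightarrow> Y \<in> Ob C \<Longrightarrow> f \<in> carrier (Hom C X Y) \<Longrightarrow> marr C X Y f \<in> Hm X Y"
  unfolding Hm_def by auto

lemma marr_comp_eq0:
  assumes "X \<in> Ob C" "Y \<in> Ob C" "Z \<in> Ob C" "f \<in> carrier (Hom C X Y)" "g \<in> carrier (Hom C Y Z)"
  shows "marr C Y Z g * marr C X Y f = 0 \<longleftrightarrow> g \<bullet>\<^bsub>C\<^esub> f = \<zero>\<^bsub>Hom C X Z\<^esub>"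
  using marr_comp[OF assms] marr_inj[OF assms(1,3) Comp_in[OF assms] zero_in_Hom[OF assms(1,3)]] marr_zero[OF assms(1,3)]
  by metis

lemma marr_comp_eq:
  assumes "X \<in> Ob C" "Y \<in> Ob C" "Z \<in> Ob C" "f \<in> carrier (Hom C X Y)" "g \<in> carrier (Hom C Y Z)" "h \<in> carrier (Hom C X Z)"
  shows "marr C Y Z g * marr C X Y f = marr C X Z h \<longleftrightarrow> g \<bullet>\<^bsub>C\<^esub> f = h"
  using marr_comp[OF assms(1-5)] marr_inj[OF assms(1,3) Comp_in[OF assms(1-5)] assms(6)] by metis

lemma kernel_marr:
  assumes "kernel_of C X Y f K k"
  shows "marr C K X k \<in> Hm K X" "marr C X Y f * marr C K X k = 0"
    "\<And>W g. g \<in> Hm W X \<Longrightarrow> marr C X Y f * g = 0 \<Longrightarrow> \<exists>t\<in>Hm W K. marr C K X k * t = g"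
    "\<And>W g. g \<in> Hm W K \<Longrightarrow> marr C K X k * g = 0 \<Longrightarrow> g = 0"
proof -
  have k: "X \<in> Ob C" "Y \<in> Ob C" "K \<in> Ob C" "f \<in> carrier (Hom C X Y)" "k \<in> carrier (Hom C K X)"
    "f \<bullet>\<^bsub>C\<^esub> k = \<zero>\<^bsub>Hom C K Y\<^esub>"
    and u: "\<And>W g. W \<in> Ob C \<Longrightarrow> g \<in> carrier (Hom C W X) \<Longrightarrow> f \<bullet>\<^bsub>C\<^esub> g = \<zero>\<^bsub>Hom C W Y\<^esub> \<Longrightarrow>
       (\<exists>!t. t \<in> carrier (Hom C W K) \<and> k \<bullet>\<^bsub>C\<^esub> t = g)"
    using assms unfolding kernel_of_def by blast+
  show "marr C K X k \<in> Hm K X" "marr C X Y f * marr C K X k = 0"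
    using k HmI marr_comp_eq0 by simp_all
  fix W g assume g: "g \<in> Hm W X" "marr C X Y f * g = 0"
  from HmE[OF g(1)] obtain h where h: "W \<in> Ob C" "h \<in> carrier (Hom C W X)" "g = marr C W X h" .
  then have "f \<bullet>\<^bsub>C\<^esub> h = \<zero>\<^bsub>Hom C W Y\<^esub>" using g(2) marr_comp_eq0 k by simp
  then obtain t where t: "t \<in> carrier (Hom C W K)" "k \<bullet>\<^bsub>C\<^esub> t = h" using u h by blast
  then have "marr C K X k * marr C W K t = g" using marr_comp_eq h k by simp
  then show "\<exists>t\<in>Hm W K. marr C K X k * t = g" using HmI h k t by blast
next
  have k: "X \<in> Ob C" "Y \<in> Ob C" "K \<in> Ob C" "f \<in> carrier (Hom C X Y)" "k \<in> carrier (Hom C K X)"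
    "f \<bullet>\<^bsub>C\<^esub> k = \<zero>\<^bsub>Hom C K Y\<^esub>"
    and u: "\<And>W g. W \<in> Ob C \<Longrightarrow> g \<in> carrier (Hom C W X) \<Longrightarrow> f \<bullet>\<^bsub>C\<^esub> g = \<zero>\<^bsub>Hom C W Y\<^esub> \<Longrightarrow>
       (\<exists>!t. t \<in> carrier (Hom C W K) \<and> k \<bullet>\<^bsub>C\<^esub> t = g)"
    using assms unfolding kernel_of_def by blast+
  fix W g assume g: "g \<in> Hm W K" "marr C K X k * g = 0"
  from HmE[OF g(1)] obtain h where h: "W \<in> Ob C" "h \<in> carrier (Hom C W K)" "g = marr C W K h" .
  have z: "k \<bullet>\<^bsub>C\<^esub> h = \<zero>\<^bsub>Hom C W X\<^esub>" "k \<bullet>\<^bsub>C\<^esub> \<zero>\<^bsub>Hom C W K\<^esub> = \<zero>\<^bsub>Hom C W X\<^esub>" "f \<bullet>\<^bsub>C\<^esub> \<zero>\<^bsub>Hom C W X\<^esub> = \<zero>\<^bsub>Hom C W Y\<^esub>"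
    using g(2) h k marr_comp_eq0 marr_zero zero_in_Hom
      marr_comp_eq0[OF h(1) k(3,1) zero_in_Hom[OF h(1) k(3)] k(5)] marr_comp_eq0[OF h(1) k(1,2) zero_in_Hom[OF h(1) k(1)] k(4)]
    by simp_all
  then have "h = \<zero>\<^bsub>Hom C W K\<^esub>" using u[OF h(1) zero_in_Hom[OF h(1) k(1)] z(3)] h(2) zero_in_Hom[OF h(1) k(3)] by blast
  then show "g = 0" using h marr_zero k by simp
qed

lemma cokernel_marr:
  assumes "cokernel_of C X Y f Q c"
  shows "marr C Y Q c \<in> Hm Y Q" "marr C Y Q c * marr C X Y f = 0"
    "\<And>W g. g \<in> Hm Y W \<Longrightarrow> g * marr C X Y f = 0 \<Longrightarrow> \<exists>t\<in>Hm Q W. t * marr C Y Q c = g"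
    "\<And>W g. g \<in> Hm Q W \<Longrightarrow> g * marr C Y Q c = 0 \<Longrightarrow> g = 0"
proof -
  have k: "X \<in> Ob C" "Y \<in> Ob C" "Q \<in> Ob C" "f \<in> carrier (Hom C X Y)" "c \<in> carrier (Hom C Y Q)"
    "c \<bullet>\<^bsub>C\<^esub> f = \<zero>\<^bsub>Hom C X Q\<^esub>"
    and u: "\<And>W g. W \<in> Ob C \<Longrightarrow> g \<in> carrier (Hom C Y W) \<Longrightarrow> g \<bullet>\<^bsub>C\<^esub> f = \<zero>\<^bsub>Hom C X W\<^esub> \<Longrightarrow>
       (\<exists>!t. t \<in> carrier (Hom C Q W) \<and> t \<bullet>\<^bsub>C\<^esub> c = g)"
    using assms unfolding cokernel_of_def by blast+
  show "marr C Y Q c \<in> Hm Y Q" "marr C Y Q c * marr C X Y f = 0"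
    using k HmI marr_comp_eq0 by simp_all
  fix W g assume g: "g \<in> Hm Y W" "g * marr C X Y f = 0"
  from HmE[OF g(1)] obtain h where h: "W \<in> Ob C" "h \<in> carrier (Hom C Y W)" "g = marr C Y W h" .
  then have "h \<bullet>\<^bsub>C\<^esub> f = \<zero>\<^bsub>Hom C X W\<^esub>" using g(2) marr_comp_eq0 k by simp
  then obtain t where t: "t \<in> carrier (Hom C Q W)" "t \<bullet>\<^bsub>C\<^esub> c = h" using u h by blast
  then have "marr C Q W t * marr C Y Q c = g" using marr_comp_eq h k by simp
  then show "\<exists>t\<in>Hm Q W. t * marr C Y Q c = g" using HmI h k t by blast
next
  have k: "X \<in> Ob C" "Y \<in> Ob C" "Q \<in> Ob C" "f \<in> carrier (Hom C X Y)" "c \<in> carrier (Hom C Y Q)"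
    "c \<bullet>\<^bsub>C\<^esub> f = \<zero>\<^bsub>Hom C X Q\<^esub>"
    and u: "\<And>W g. W \<in> Ob C \<Longrightarrow> g \<in> carrier (Hom C Y W) \<Longrightarrow> g \<bullet>\<^bsub>C\<^esub> f = \<zero>\<^bsub>Hom C X W\<^esub> \<Longrightarrow>
       (\<exists>!t. t \<in> carrier (Hom C Q W) \<and> t \<bullet>\<^bsub>C\<^esub> c = g)"
    using assms unfolding cokernel_of_def by blast+
  fix W g assume g: "g \<in> Hm Q W" "g * marr C Y Q c = 0"
  from HmE[OF g(1)] obtain h where h: "W \<in> Ob C" "h \<in> carrier (Hom C Q W)" "g = marr C Q W h" .
  have z: "h \<bullet>\<^bsub>C\<^esub> c = \<zero>\<^bsub>Hom C Y W\<^esub>" "\<zero>\<^bsub>Hom C Q W\<^esub> \<bullet>\<^bsub>C\<^esub> c = \<zero>\<^bsub>Hom C Y W\<^esub>" "\<zero>\<^bsub>Hom C Y W\<^esub> \<bullet>\<^bsub>C\<^esub> f = \<zero>\<^bsub>Hom C X W\<^esub>"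
    using g(2) h k marr_comp_eq0 marr_zero zero_in_Hom
      marr_comp_eq0[OF k(2,3) h(1) k(5) zero_in_Hom[OF k(3) h(1)]] marr_comp_eq0[OF k(1,2) h(1) k(4) zero_in_Hom[OF k(2) h(1)]]
    by simp_all
  then have "h = \<zero>\<^bsub>Hom C Q W\<^esub>" using u[OF h(1) zero_in_Hom[OF k(2) h(1)] z(3)] h(2) zero_in_Hom[OF k(3) h(1)] by blast
  then show "g = 0" using h marr_zero k by simp
qed

lemma mono_arrowI:
  assumes "X \<in> Ob C" "Y \<in> Ob C" "f \<in> carrier (Hom C X Y)" and m: "\<forall>W. \<forall>g\<in>Hm W X. marr C X Y f * g = 0 \<longrightarrow> g = 0"
  shows "mono_arrow C X Y f"
  unfolding mono_arrow_def
proof (intro conjI ballI impI)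
  fix W g h assume g: "W \<in> Ob C" "g \<in> carrier (Hom C W X)" "h \<in> carrier (Hom C W X)" "f \<bullet>\<^bsub>C\<^esub> g = f \<bullet>\<^bsub>C\<^esub> h"
  have "marr C X Y f * (marr C W X g - marr C W X h) = 0"
    using marr_comp[OF g(1) assms(1,2) g(2) assms(3)] marr_comp[OF g(1) assms(1,2) g(3) assms(3)] g(4)
    by (simp add: right_diff_distrib)
  moreover have "marr C W X g - marr C W X h \<in> Hm W X"
    using marr_diff[OF g(1) assms(1) g(2,3)] HmI[OF g(1) assms(1)]
      abelian_group.minus_closed[OF ab[OF g(1) assms(1)] g(2,3)] by metis
  ultimately have "marr C W X g = marr C W X h" using m by (metis eq_iff_diff_eq_0)
  then show "g = h" using marr_inj g assms by blast
qed (use assms in auto)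

lemma epi_arrowI:
  assumes "X \<in> Ob C" "Y \<in> Ob C" "f \<in> carrier (Hom C X Y)" and m: "\<forall>W. \<forall>g\<in>Hm Y W. g * marr C X Y f = 0 \<longrightarrow> g = 0"
  shows "epi_arrow C X Y f"
  unfolding epi_arrow_def
proof (intro conjI ballI impI)
  fix W g h assume g: "W \<in> Ob C" "g \<in> carrier (Hom C Y W)" "h \<in> carrier (Hom C Y W)" "g \<bullet>\<^bsub>C\<^esub> f = h \<bullet>\<^bsub>C\<^esub> f"
  have "(marr C Y W g - marr C Y W h) * marr C X Y f = 0"
    using marr_comp[OF assms(1,2) g(1) assms(3) g(2)] marr_comp[OF assms(1,2) g(1) assms(3) g(3)] g(4)
    by (simp add: left_diff_distrib)
  moreover have "marr C Y W g - marr C Y W h \<in> Hm Y W"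
    using marr_diff[OF assms(2) g(1) g(2,3)] HmI[OF assms(2) g(1)]
      abelian_group.minus_closed[OF ab[OF assms(2) g(1)] g(2,3)] by metis
  ultimately have "marr C Y W g = marr C Y W h" using m by (metis eq_iff_diff_eq_0)
  then show "g = h" using marr_inj g assms by blast
qed (use assms in auto)

text \<open>The theory developed in the ring now applies to C; by \<open>marr_inj\<close> its
  equations can be read back as equations between arrows.\<close>

sublocale abcat "Ob C" Hm Idm
proof
  fix f X Y assume f: "f \<in> Hm X Y"
  then show "X \<in> Ob C \<and> Y \<in> Ob C" by (auto elim: HmE)
  show "- f \<in> Hm X Y" using f marr_minus HmI by (metis HmE)
  show "Idm Y * f = f" "f * Idm X = f"
    using f Idn_in Comp_Idn marr_comp unfolding Idm_def by (metis HmE)+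
next
  fix f g X Y assume f: "f \<in> Hm X Y" "g \<in> Hm X Y"
  then show "f + g \<in> Hm X Y" using marr_add HmI abelian_groupE(1)[OF ab] by (metis HmE)
next
  fix f g X Y Z assume f: "g \<in> Hm Y Z" "f \<in> Hm X Y"
  then show "g * f \<in> Hm X Z" using marr_comp HmI Comp_in by (metis HmE)
next
  fix X Y assume "X \<in> Ob C" "Y \<in> Ob C"
  then show "0 \<in> Hm X Y" using marr_zero HmI zero_in_Hom by metis
next
  fix X assume "X \<in> Ob C"
  then show "Idm X \<in> Hm X X" using HmI Idn_in unfolding Idm_def by blast
next
  obtain Z where Z: "zero_object C Z" using abelian unfolding abelian_category_def by blast
  then have "Z \<in> Ob C" "Idn C Z = \<zero>\<^bsub>Hom C Z Z\<^esub>"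
    using Idn_in zero_in_Hom unfolding zero_object_def by blast+
  then show "\<exists>Z\<in>Ob C. Idm Z = 0" unfolding Idm_def using marr_zero by metis
next
  fix X Y assume X: "X \<in> Ob C" "Y \<in> Ob C"
  then obtain S i j p r where "biproduct_of C X Y (S, i, j, p, r)"
    using abelian unfolding abelian_category_def by (metis prod_cases5)
  then have b: "S \<in> Ob C" "i \<in> carrier (Hom C X S)" "j \<in> carrier (Hom C Y S)"
    "p \<in> carrier (Hom C S X)" "r \<in> carrier (Hom C S Y)" "p \<bullet>\<^bsub>C\<^esub> i = Idn C X" "r \<bullet>\<^bsub>C\<^esub> j = Idn C Y"
    "p \<bullet>\<^bsub>C\<^esub> j = \<zero>\<^bsub>Hom C Y X\<^esub>" "r \<bullet>\<^bsub>C\<^esub> i = \<zero>\<^bsub>Hom C X Y\<^esub>" "(i \<bullet>\<^bsub>C\<^esub> p) \<oplus>\<^bsub>Hom C S S\<^esub> (j \<bullet>\<^bsub>C\<^esub> r) = Idn C S"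
    unfolding biproduct_of_def by auto
  have "marr C X S i * marr C S X p + marr C Y S j * marr C S Y r = Idm S"
    using marr_add[OF b(1,1) Comp_in[OF b(1) X(1) b(1) b(4,2)] Comp_in[OF b(1) X(2) b(1) b(5,3)]]
      marr_comp[OF b(1) X(1) b(1) b(4,2)] marr_comp[OF b(1) X(2) b(1) b(5,3)]
    unfolding Idm_def b(10) by simp
  moreover have "marr C S X p * marr C X S i = Idm X" "marr C S Y r * marr C Y S j = Idm Y"
    "marr C S X p * marr C Y S j = 0" "marr C S Y r * marr C X S i = 0"
    using X b Idn_in unfolding Idm_def by (simp_all add: marr_comp_eq marr_comp_eq0)
  ultimately show "\<exists>S i j p r. i \<in> Hm X S \<and> j \<in> Hm Y S \<and> p \<in> Hm S X \<and> r \<in> Hm S Y \<and>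
      p * i = Idm X \<and> r * j = Idm Y \<and> p * j = 0 \<and> r * i = 0 \<and> i * p + j * r = Idm S"
    using HmI X b by (intro exI[of _ S] exI[of _ "marr C X S i"] exI[of _ "marr C Y S j"]
      exI[of _ "marr C S X p"] exI[of _ "marr C S Y r"]) auto
next
  fix f X Y assume "f \<in> Hm X Y"
  then obtain f0 where f0: "X \<in> Ob C" "Y \<in> Ob C" "f0 \<in> carrier (Hom C X Y)" "f = marr C X Y f0" by (rule HmE)
  obtain K k where k: "kernel_of C X Y f0 K k" using abelian f0 unfolding abelian_category_def by blast
  show "\<exists>K k. k \<in> Hm K X \<and> f * k = 0 \<and> (\<forall>W. \<forall>g\<in>Hm W X. f * g = 0 \<longrightarrow> (\<exists>t\<in>Hm W K. k * t = g)) \<and>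
      (\<forall>W. \<forall>g\<in>Hm W K. k * g = 0 \<longrightarrow> g = 0)"
    unfolding f0 using kernel_marr[OF k] by (intro exI[of _ K] exI[of _ "marr C K X k"]) blast
  obtain Q c where c: "cokernel_of C X Y f0 Q c" using abelian f0 unfolding abelian_category_def by blast
  show "\<exists>Q c. c \<in> Hm Y Q \<and> c * f = 0 \<and> (\<forall>W. \<forall>g\<in>Hm Y W. g * f = 0 \<longrightarrow> (\<exists>t\<in>Hm Q W. t * c = g)) \<and>
      (\<forall>W. \<forall>g\<in>Hm Q W. g * c = 0 \<longrightarrow> g = 0)"
    unfolding f0 using cokernel_marr[OF c] by (intro exI[of _ Q] exI[of _ "marr C Y Q c"]) blast
  {
    assume "\<forall>W. \<forall>g\<in>Hm W X. f * g = 0 \<longrightarrow> g = 0"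
    then have "mono_arrow C X Y f0" using mono_arrowI f0 by blast
    then obtain Z g where g: "kernel_of C Y Z g X f0" using abelian f0 unfolding abelian_category_def by blast
    have "marr C Y Z g \<in> Hm Y Z" using g HmI unfolding kernel_of_def by blast
    then show "\<exists>Z g. g \<in> Hm Y Z \<and> g * f = 0 \<and> (\<forall>W. \<forall>x\<in>Hm W Y. g * x = 0 \<longrightarrow> (\<exists>t\<in>Hm W X. f * t = x))"
      unfolding f0 using kernel_marr[OF g] by (intro exI[of _ Z] exI[of _ "marr C Y Z g"]) blast
  next
    assume "\<forall>W. \<forall>g\<in>Hm Y W. g * f = 0 \<longrightarrow> g = 0"
    then have "epi_arrow C X Y f0" using epi_arrowI f0 by blast
    then obtain Z g where g: "cokernel_of C Z X g Y f0" using abelian f0 unfolding abelian_category_def by blast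
    have "marr C Z X g \<in> Hm Z X" using g HmI unfolding cokernel_of_def by blast
    then show "\<exists>Z g. g \<in> Hm Z X \<and> f * g = 0 \<and> (\<forall>W. \<forall>x\<in>Hm X W. x * g = 0 \<longrightarrow> (\<exists>t\<in>Hm Y W. t * f = x))"
      unfolding f0 using cokernel_marr[OF g] by (intro exI[of _ Z] exI[of _ "marr C Z X g"]) blast
  }
qed

end


section \<open>Complexes and roofs over a linear abelian category\<close>

context abcat
begin

text \<open>The image of t is a monomorphism, hence cut out by some g. As g kills t it factors
  through c and kills x, so x lies in the image and lifts to X on a cover.\<close>

lemma coker_exact:
  assumes t: "t \<in> H X K" and c: "c \<in> H K Q" "c * t = 0"
    and u: "\<And>W g. g \<in> H K W \<Longrightarrow> g * t = 0 \<Longrightarrow> \<exists>s\<in>H Q W. s * c = g"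
    and x: "x \<in> H T K" "c * x = 0"
  obtains T' e y where "e \<in> H T' T" "epi T e" "y \<in> H T' X" "x * e = t * y"
proof -
  obtain J q k where k: "q \<in> H X J" "epi J q" "k \<in> H J K" "mono J k" "t = k * q" using image[OF t] .
  obtain Z g where g: "g \<in> H K Z" "g * k = 0" "\<forall>W. \<forall>x\<in>H W K. g * x = 0 \<longrightarrow> (\<exists>t\<in>H W J. k * t = x)"
    using mono_ker[OF k(3)] k(4) unfolding mono_def by blast
  have "g * t = 0" using g(2) k(5) by (metis mult.assoc mult_zero_left)
  then obtain s where "s * c = g" using u[OF g(1)] by blast
  then have "g * x = 0" using x(2) by (metis mult.assoc mult_zero_right)
  then obtain y where y: "y \<in> H T J" "k * y = x" using g(3) x(1) by blast
  obtain T' e z where e: "e \<in> H T' T" "epi T e" "z \<in> H T' X" "q * z = y * e" using cover_lift[OF k(1,2) y(1)] .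
  then have "x * e = t * z" using y(2) k(5) by (metis mult.assoc)
  then show ?thesis using that e by blast
qed

text \<open>K is the object of cycles, L its quotient by boundaries, t the corestricted
  differential. That L is the cokernel of t is recorded through generalized elements, as
  \<open>coker_exact\<close> provides it.\<close>

definition presents_cohomology :: "('o, 'r) cochain \<Rightarrow> int \<Rightarrow> 'o \<Rightarrow> 'r \<Rightarrow> 'o \<Rightarrow> 'r \<Rightarrow> 'r \<Rightarrow> bool" where
  "presents_cohomology X n K k L c t \<longleftrightarrow> k \<in> H K (cobj X n) \<and> diff X n * k = 0 \<and>
     (\<forall>W. \<forall>g\<in>H W (cobj X n). diff X n * g = 0 \<longrightarrow> (\<exists>t\<in>H W K. k * t = g)) \<and>
     mono K k \<and> t \<in> H (cobj X (n - 1)) K \<and> k * t = diff X (n - 1) \<and> c \<in> H K L \<and> c * t = 0 \<and> epi L c \<and>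
     (\<forall>T. \<forall>x\<in>H T K. c * x = 0 \<longrightarrow> (\<exists>T' e y. e \<in> H T' T \<and> epi T e \<and> y \<in> H T' (cobj X (n - 1)) \<and> x * e = t * y))"

lemma presents_cohomologyD:
  assumes "presents_cohomology X n K k L c t"
  shows "k \<in> H K (cobj X n)" "diff X n * k = 0"
    "\<And>W g. g \<in> H W (cobj X n) \<Longrightarrow> diff X n * g = 0 \<Longrightarrow> \<exists>t\<in>H W K. k * t = g"
    "mono K k" "t \<in> H (cobj X (n - 1)) K" "k * t = diff X (n - 1)" "c \<in> H K L" "c * t = 0" "epi L c"
    "\<And>T x. x \<in> H T K \<Longrightarrow> c * x = 0 \<Longrightarrow>
      \<exists>T' e y. e \<in> H T' T \<and> epi T e \<and> y \<in> H T' (cobj X (n - 1)) \<and> x * e = t * y"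
  using assms unfolding presents_cohomology_def by simp_all

end

context lin_abelian
begin

lemma zero_object_iff: "zero_object C Z \<longleftrightarrow> Z \<in> Ob C \<and> Idm Z = 0"
proof
  assume Z: "zero_object C Z"
  then have "Z \<in> Ob C" "Idn C Z = \<zero>\<^bsub>Hom C Z Z\<^esub>"
    using Idn_in zero_in_Hom unfolding zero_object_def by blast+
  then show "Z \<in> Ob C \<and> Idm Z = 0" unfolding Idm_def using marr_zero by metis
next
  assume Z: "Z \<in> Ob C \<and> Idm Z = 0"
  have "f = \<zero>\<^bsub>Hom C Z X\<^esub>" if X: "X \<in> Ob C" "f \<in> carrier (Hom C Z X)" for X f
    using null_source[of Z "marr C Z X f" X] HmI Z X marr_inj[OF _ X(1) X(2) zero_in_Hom] marr_zero by simp
  moreover have "f = \<zero>\<^bsub>Hom C X Z\<^esub>" if X: "X \<in> Ob C" "f \<in> carrier (Hom C X Z)" for X f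
    using null_target[of Z "marr C X Z f" X] HmI Z X marr_inj[OF X(1) _ X(2) zero_in_Hom] marr_zero by simp
  ultimately show "zero_object C Z" unfolding zero_object_def using Z zero_in_Hom by metis
qed

lemma zero_ob_null: "zero_ob C = null"
  unfolding zero_ob_def null_def zero_object_iff ..

section \<open>Passage between the category and the ring\<close>

definition arrow_of :: "'o \<Rightarrow> 'o \<Rightarrow> ('o \<times> 'o \<Rightarrow> 'a) endo \<Rightarrow> 'a" where
  "arrow_of X Y x = inv_into (carrier (Hom C X Y)) (marr C X Y) x"

lemma arrow_of:
  assumes "x \<in> Hm X Y"
  shows "arrow_of X Y x \<in> carrier (Hom C X Y)" "marr C X Y (arrow_of X Y x) = x"
  using assms unfolding arrow_of_def Hm_def by (auto split: if_splits simp: inv_into_into f_inv_into_f)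

lemma arrow_of_marr: "X \<in> Ob C \<Longrightarrow> Y \<in> Ob C \<Longrightarrow> f \<in> carrier (Hom C X Y) \<Longrightarrow> arrow_of X Y (marr C X Y f) = f"
  using arrow_of[OF HmI] marr_inj by blast

definition embed_complex :: "('o, 'a) cochain \<Rightarrow> ('o, ('o \<times> 'o \<Rightarrow> 'a) endo) cochain" where
  "embed_complex X = \<lparr>cobj = cobj X, diff = (\<lambda>n. marr C (cobj X n) (cobj X (n + 1)) (diff X n))\<rparr>"

definition unembed_complex :: "('o, ('o \<times> 'o \<Rightarrow> 'a) endo) cochain \<Rightarrow> ('o, 'a) cochain" where
  "unembed_complex X = \<lparr>cobj = cobj X, diff = (\<lambda>n. arrow_of (cobj X n) (cobj X (n + 1)) (diff X n))\<rparr>"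

definition embed_map :: "('o, 'a) cochain \<Rightarrow> ('o, 'a) cochain \<Rightarrow> (int \<Rightarrow> 'a) \<Rightarrow> int \<Rightarrow> ('o \<times> 'o \<Rightarrow> 'a) endo" where
  "embed_map X Y f = (\<lambda>n. marr C (cobj X n) (cobj Y n) (f n))"

definition unembed_map :: "('o, 'a) cochain \<Rightarrow> ('o, 'a) cochain \<Rightarrow> (int \<Rightarrow> ('o \<times> 'o \<Rightarrow> 'a) endo) \<Rightarrow> int \<Rightarrow> 'a" where
  "unembed_map X Y f = (\<lambda>n. arrow_of (cobj X n) (cobj Y n) (f n))"

lemma embed_complex_simps [simp]: "cobj (embed_complex X) = cobj X" "diff (embed_complex X) n = marr C (cobj X n) (cobj X (n + 1)) (diff X n)"
  by (auto simp: embed_complex_def)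

lemma unembed_complex_simps [simp]: "cobj (unembed_complex X) = cobj X" "diff (unembed_complex X) n = arrow_of (cobj X n) (cobj X (n + 1)) (diff X n)"
  by (auto simp: unembed_complex_def)

lemma bcD:
  assumes "bounded_complex C X"
  shows "cobj X n \<in> Ob C" "diff X n \<in> carrier (Hom C (cobj X n) (cobj X (n + 1)))"
    "diff X (n - 1) \<in> carrier (Hom C (cobj X (n - 1)) (cobj X n))"
proof -
  have *: "\<And>n. diff X n \<in> carrier (Hom C (cobj X n) (cobj X (n + 1)))" using assms unfolding bounded_complex_def by blast
  then show "diff X n \<in> carrier (Hom C (cobj X n) (cobj X (n + 1)))" .
  show "diff X (n - 1) \<in> carrier (Hom C (cobj X (n - 1)) (cobj X n))" using *[of "n - 1"] by simp
  show "cobj X n \<in> Ob C" using assms unfolding bounded_complex_def by blast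
qed

lemma embed_complex_cx:
  assumes X: "bounded_complex C X" shows "abs_complex (embed_complex X)"
proof -
  note b = bcD[OF X]
  have "{n. Idm (cobj X n) \<noteq> 0} = {n. \<not> zero_object C (cobj X n)}" using b by (auto simp: zero_object_iff)
  then have 1: "finite {n. Idm (cobj X n) \<noteq> 0}" using X unfolding bounded_complex_def by simp
  have "diff X (n + 1) \<bullet>\<^bsub>C\<^esub> diff X n = \<zero>\<^bsub>Hom C (cobj X n) (cobj X (n + 2))\<^esub>" for n
    using X unfolding bounded_complex_def by blast
  then have 2: "diff (embed_complex X) (n + 1) * diff (embed_complex X) n = 0" for n
    using marr_comp_eq0[OF b(1) b(1) b(1) b(2)[of n] b(2)[of "n + 1"]] by (simp add: add.assoc)
  show ?thesis unfolding abs_complex_def using 1 2 HmI b by simp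
qed

lemma unembed_complex_bc:
  assumes X: "abs_complex X" shows "bounded_complex C (unembed_complex X)" "embed_complex (unembed_complex X) = X"
proof -
  note x = cxD[OF X]
  have 0: "cobj X n \<in> Ob C" for n using x by blast
  have "{n. Idm (cobj X n) \<noteq> 0} = {n. \<not> zero_object C (cobj X n)}" using 0 by (auto simp: zero_object_iff)
  then have 1: "finite {n. \<not> zero_object C (cobj X n)}" using X unfolding abs_complex_def by simp
  have d: "arrow_of (cobj X n) (cobj X (n + 1)) (diff X n) \<in> carrier (Hom C (cobj X n) (cobj X (n + 1)))"
     "marr C (cobj X n) (cobj X (n + 1)) (arrow_of (cobj X n) (cobj X (n + 1)) (diff X n)) = diff X n" for n
    using arrow_of[OF x(1)] by auto
  have "arrow_of (cobj X (n + 1)) (cobj X (n + 1 + 1)) (diff X (n + 1)) \<bullet>\<^bsub>C\<^esub> arrow_of (cobj X n) (cobj X (n + 1)) (diff X n)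
      = \<zero>\<^bsub>Hom C (cobj X n) (cobj X (n + 1 + 1))\<^esub>" for n
    using marr_comp_eq0[OF 0 0 0 d(1)[of n] d(1)[of "n + 1"]] x(3)[of n] d(2)[of n] d(2)[of "n + 1"] by simp
  then show "bounded_complex C (unembed_complex X)" unfolding bounded_complex_def using 0 1 d by (simp add: add.assoc)
  show "embed_complex (unembed_complex X) = X" unfolding embed_complex_def by (simp add: d)
qed

lemma chain_mapD:
  assumes X: "bounded_complex C X" and Y: "bounded_complex C Y" and f: "chain_map C X Y f"
  shows "f n \<in> carrier (Hom C (cobj X n) (cobj Y n))" "abs_chain_map (embed_complex X) (embed_complex Y) (embed_map X Y f)" "unembed_map X Y (embed_map X Y f) = f"
proof -
  have f': "f n \<in> carrier (Hom C (cobj X n) (cobj Y n))" "f (n + 1) \<bullet>\<^bsub>C\<^esub> diff X n = diff Y n \<bullet>\<^bsub>C\<^esub> f n" for n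
    using f unfolding chain_map_def by auto
  show "f n \<in> carrier (Hom C (cobj X n) (cobj Y n))" by (rule f')
  have "embed_map X Y f (n + 1) * diff (embed_complex X) n = diff (embed_complex Y) n * embed_map X Y f n" for n
    using marr_comp[OF bcD(1)[OF X] bcD(1)[OF X] bcD(1)[OF Y] bcD(2)[OF X] f'(1), of n]
      marr_comp[OF bcD(1)[OF X] bcD(1)[OF Y] bcD(1)[OF Y] f'(1) bcD(2)[OF Y], of n] f'(2)[of n]
    by (simp add: embed_map_def)
  then show "abs_chain_map (embed_complex X) (embed_complex Y) (embed_map X Y f)" unfolding abs_chain_map_def
    using HmI[OF bcD(1)[OF X] bcD(1)[OF Y] f'(1)] by (simp add: embed_map_def)
  show "unembed_map X Y (embed_map X Y f) = f" using arrow_of_marr[OF bcD(1)[OF X] bcD(1)[OF Y] f'(1)] by (simp add: unembed_map_def embed_map_def)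
qed

lemma chain_mapI:
  assumes X: "bounded_complex C X" and Y: "bounded_complex C Y" and f: "abs_chain_map (embed_complex X) (embed_complex Y) f"
  shows "chain_map C X Y (unembed_map X Y f)" "embed_map X Y (unembed_map X Y f) = f"
proof -
  have f': "f n \<in> Hm (cobj X n) (cobj Y n)" for n using cmD(1)[OF f, of n] by simp
  note a = arrow_of[OF f']
  show "embed_map X Y (unembed_map X Y f) = f" using a(2) by (simp add: unembed_map_def embed_map_def)
  have "unembed_map X Y f (n + 1) \<bullet>\<^bsub>C\<^esub> diff X n = diff Y n \<bullet>\<^bsub>C\<^esub> unembed_map X Y f n" for n
  proof (rule marr_inj[OF bcD(1)[OF X] bcD(1)[OF Y]])
    show "unembed_map X Y f (n + 1) \<bullet>\<^bsub>C\<^esub> diff X n \<in> carrier (Hom C (cobj X n) (cobj Y (n + 1)))"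
      "diff Y n \<bullet>\<^bsub>C\<^esub> unembed_map X Y f n \<in> carrier (Hom C (cobj X n) (cobj Y (n + 1)))"
      using Comp_in[OF bcD(1)[OF X] bcD(1)[OF X] bcD(1)[OF Y] bcD(2)[OF X] a(1)[of "n + 1"]]
        Comp_in[OF bcD(1)[OF X] bcD(1)[OF Y] bcD(1)[OF Y] a(1)[of n] bcD(2)[OF Y]] by (simp_all add: unembed_map_def)
    show "marr C (cobj X n) (cobj Y (n + 1)) (unembed_map X Y f (n + 1) \<bullet>\<^bsub>C\<^esub> diff X n) = marr C (cobj X n) (cobj Y (n + 1)) (diff Y n \<bullet>\<^bsub>C\<^esub> unembed_map X Y f n)"
      using marr_comp[OF bcD(1)[OF X] bcD(1)[OF X] bcD(1)[OF Y] bcD(2)[OF X] a(1)[of "n + 1"]]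
        marr_comp[OF bcD(1)[OF X] bcD(1)[OF Y] bcD(1)[OF Y] a(1)[of n] bcD(2)[OF Y]] cmD(2)[OF f, of n] a(2)
      by (simp add: unembed_map_def)
  qed
  then show "chain_map C X Y (unembed_map X Y f)" unfolding chain_map_def using a(1) by (simp add: unembed_map_def)
qed

lemma embed_map_ccomp:
  assumes X: "bounded_complex C X" and Y: "bounded_complex C Y" and Z: "bounded_complex C Z"
    and f: "chain_map C X Y f" and g: "chain_map C Y Z g"
  shows "embed_map X Z (ccomp C g f) = embed_map Y Z g \<star> embed_map X Y f"
  using marr_comp[OF bcD(1)[OF X] bcD(1)[OF Y] bcD(1)[OF Z] chain_mapD(1)[OF X Y f] chain_mapD(1)[OF Y Z g]]
  by (simp add: embed_map_def ccomp_def fun_eq_iff)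

lemma chain_map_ccomp:
  assumes X: "bounded_complex C X" and Y: "bounded_complex C Y" and Z: "bounded_complex C Z"
    and f: "chain_map C X Y f" and g: "chain_map C Y Z g"
  shows "chain_map C X Z (ccomp C g f)"
proof -
  have "abs_chain_map (embed_complex X) (embed_complex Z) (embed_map X Z (ccomp C g f))"
    unfolding embed_map_ccomp[OF assms] by (rule abs_chain_map_comp[OF chain_mapD(2)[OF X Y f] chain_mapD(2)[OF Y Z g]])
  from chain_mapI[OF X Z this] have "chain_map C X Z (unembed_map X Z (embed_map X Z (ccomp C g f)))" by simp
  moreover have "unembed_map X Z (embed_map X Z (ccomp C g f)) = ccomp C g f"
    using arrow_of_marr[OF bcD(1)[OF X] bcD(1)[OF Z] Comp_in[OF bcD(1)[OF X] bcD(1)[OF Y] bcD(1)[OF Z]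
      chain_mapD(1)[OF X Y f] chain_mapD(1)[OF Y Z g]]] by (simp add: unembed_map_def embed_map_def ccomp_def)
  ultimately show ?thesis by simp
qed

lemma homotopic_iff:
  assumes X: "bounded_complex C X" and Y: "bounded_complex C Y" and f: "chain_map C X Y f" and g: "chain_map C X Y g"
  shows "homotopic C X Y f g \<longleftrightarrow> abs_homotopic (embed_complex X) (embed_complex Y) (embed_map X Y f) (embed_map X Y g)"
proof -
  note x = bcD[OF X] and y = bcD[OF Y] and ff = chain_mapD(1)[OF X Y f] and gg = chain_mapD(1)[OF X Y g]
  have key: "f n \<ominus>\<^bsub>Hom C (cobj X n) (cobj Y n)\<^esub> g n =
      (diff Y (n - 1) \<bullet>\<^bsub>C\<^esub> h n) \<oplus>\<^bsub>Hom C (cobj X n) (cobj Y n)\<^esub> (h (n + 1) \<bullet>\<^bsub>C\<^esub> diff X n) \<longleftrightarrow>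
     embed_map X Y f n - embed_map X Y g n = diff (embed_complex Y) (n - 1) * marr C (cobj X n) (cobj Y (n - 1)) (h n) +
       marr C (cobj X (n + 1)) (cobj Y n) (h (n + 1)) * diff (embed_complex X) n"
    if h: "\<And>n. h n \<in> carrier (Hom C (cobj X n) (cobj Y (n - 1)))" for h n
  proof -
    have h1: "h (n + 1) \<in> carrier (Hom C (cobj X (n + 1)) (cobj Y n))" using h[of "n + 1"] by simp
    have dh: "diff Y (n - 1) \<bullet>\<^bsub>C\<^esub> h n \<in> carrier (Hom C (cobj X n) (cobj Y n))"
       "h (n + 1) \<bullet>\<^bsub>C\<^esub> diff X n \<in> carrier (Hom C (cobj X n) (cobj Y n))"
      using Comp_in[OF x(1) y(1) y(1) h y(3)] Comp_in[OF x(1) x(1) y(1) x(2) h1] by auto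
    have "f n \<ominus>\<^bsub>Hom C (cobj X n) (cobj Y n)\<^esub> g n \<in> carrier (Hom C (cobj X n) (cobj Y n))"
      using abelian_group.minus_closed[OF ab[OF x(1) y(1)] ff gg] .
    from marr_inj[OF x(1) y(1) this abelian_groupE(1)[OF ab[OF x(1) y(1)] dh]]
    have "f n \<ominus>\<^bsub>Hom C (cobj X n) (cobj Y n)\<^esub> g n =
      (diff Y (n - 1) \<bullet>\<^bsub>C\<^esub> h n) \<oplus>\<^bsub>Hom C (cobj X n) (cobj Y n)\<^esub> (h (n + 1) \<bullet>\<^bsub>C\<^esub> diff X n) \<longleftrightarrow>
      marr C (cobj X n) (cobj Y n) (f n \<ominus>\<^bsub>Hom C (cobj X n) (cobj Y n)\<^esub> g n) =
      marr C (cobj X n) (cobj Y n) ((diff Y (n - 1) \<bullet>\<^bsub>C\<^esub> h n) \<oplus>\<^bsub>Hom C (cobj X n) (cobj Y n)\<^esub> (h (n + 1) \<bullet>\<^bsub>C\<^esub> diff X n))"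
      by metis
    then show ?thesis
      unfolding marr_diff[OF x(1) y(1) ff gg] marr_add[OF x(1) y(1) dh]
        marr_comp[OF x(1) y(1) y(1) h y(3), of n] marr_comp[OF x(1) x(1) y(1) x(2) h1] by (simp add: embed_map_def)
  qed
  show ?thesis
  proof
    assume "homotopic C X Y f g"
    then obtain h where h: "\<And>n. h n \<in> carrier (Hom C (cobj X n) (cobj Y (n - 1)))"
      "\<And>n. f n \<ominus>\<^bsub>Hom C (cobj X n) (cobj Y n)\<^esub> g n =
      (diff Y (n - 1) \<bullet>\<^bsub>C\<^esub> h n) \<oplus>\<^bsub>Hom C (cobj X n) (cobj Y n)\<^esub> (h (n + 1) \<bullet>\<^bsub>C\<^esub> diff X n)"
      unfolding homotopic_def by blast
    then show "abs_homotopic (embed_complex X) (embed_complex Y) (embed_map X Y f) (embed_map X Y g)" unfolding abs_homotopic_def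
      using key[OF h(1)] HmI[OF x(1) y(1) h(1)]
      by (intro exI[of _ "\<lambda>n. marr C (cobj X n) (cobj Y (n - 1)) (h n)"]) simp
  next
    assume "abs_homotopic (embed_complex X) (embed_complex Y) (embed_map X Y f) (embed_map X Y g)"
    then obtain h where h: "\<And>n. h n \<in> Hm (cobj X n) (cobj Y (n - 1))"
      "\<And>n. embed_map X Y f n - embed_map X Y g n = diff (embed_complex Y) (n - 1) * h n + h (n + 1) * diff (embed_complex X) n"
      unfolding abs_homotopic_def by (auto simp del: embed_complex_simps(2))
    define h0 where "h0 n = arrow_of (cobj X n) (cobj Y (n - 1)) (h n)" for n
    have h0: "h0 n \<in> carrier (Hom C (cobj X n) (cobj Y (n - 1)))" "marr C (cobj X n) (cobj Y (n - 1)) (h0 n) = h n" for n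
      using arrow_of[OF h(1)] by (auto simp: h0_def)
    have "marr C (cobj X (n + 1)) (cobj Y n) (h0 (n + 1)) = h (n + 1)" for n using h0(2)[of "n + 1"] by simp
    then show "homotopic C X Y f g" unfolding homotopic_def using key[OF h0(1)] h(2) h0
      by (intro exI[of _ h0]) simp
  qed
qed

section \<open>Cohomology objects and the two notions of quasi-isomorphism\<close>

lemma cohomologyD:
  assumes "cohomology_of C X n K k L c"
  shows "\<exists>t. presents_cohomology (embed_complex X) n K (marr C K (cobj X n) k) L (marr C K L c) t"
    "k \<in> carrier (Hom C K (cobj X n))" "c \<in> carrier (Hom C K L)" "K \<in> Ob C" "L \<in> Ob C"
proof -
  obtain t where k: "kernel_of C (cobj X n) (cobj X (n + 1)) (diff X n) K k"
    and t: "t \<in> carrier (Hom C (cobj X (n - 1)) K)" "k \<bullet>\<^bsub>C\<^esub> t = diff X (n - 1)"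
    and c: "cokernel_of C (cobj X (n - 1)) K t L c"
    using assms unfolding cohomology_of_def by blast
  note K = kernel_marr[OF k] and Q = cokernel_marr[OF c]
  have ob: "cobj X n \<in> Ob C" "cobj X (n - 1) \<in> Ob C" "K \<in> Ob C" "L \<in> Ob C" "k \<in> carrier (Hom C K (cobj X n))"
     "c \<in> carrier (Hom C K L)"
    using k c unfolding kernel_of_def cokernel_of_def by blast+
  then show "k \<in> carrier (Hom C K (cobj X n))" "c \<in> carrier (Hom C K L)" "K \<in> Ob C" "L \<in> Ob C" by blast+
  have tm: "marr C (cobj X (n - 1)) K t \<in> Hm (cobj X (n - 1)) K" using HmI ob t by blast
  have kt: "marr C K (cobj X n) k * marr C (cobj X (n - 1)) K t = diff (embed_complex X) (n - 1)"
    using marr_comp[OF ob(2,3,1) t(1) ob(5)] t(2) by simp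
  have ex: "\<exists>T' e y. e \<in> Hm T' T \<and> epi T e \<and> y \<in> Hm T' (cobj X (n - 1)) \<and> x * e = marr C (cobj X (n - 1)) K t * y"
    if "x \<in> Hm T K" "marr C K L c * x = 0" for T x
    using coker_exact[OF tm Q(1,2,3) that] by metis
  have u: "\<forall>W. \<forall>g\<in>Hm W (cobj X n). diff (embed_complex X) n * g = 0 \<longrightarrow> (\<exists>t\<in>Hm W K. marr C K (cobj X n) k * t = g)"
    using K(3) by simp
  have d: "diff (embed_complex X) n * marr C K (cobj X n) k = 0" using K(2) by simp
  have "mono K (marr C K (cobj X n) k)" "epi L (marr C K L c)" unfolding mono_def epi_def using K(4) Q(4) by blast+
  then show "\<exists>t. presents_cohomology (embed_complex X) n K (marr C K (cobj X n) k) L (marr C K L c) t"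
    unfolding presents_cohomology_def embed_complex_simps(1) using K(1) u d tm kt Q(1,2) ex
    by (intro exI[of _ "marr C (cobj X (n - 1)) K t"]) blast
qed

text \<open>For surjectivity a cycle of Y is sent to L', moved to L by the inverse isomorphism and
  lifted to a cycle of X on a cover; the remaining difference dies in L', so it is a boundary. For
  injectivity the class of x in L is zero because its image in L' is.\<close>

lemma quasi_isoD:
  assumes X: "bounded_complex C X" and Y: "bounded_complex C Y" and q: "quasi_iso C X Y f"
  shows "abs_qis (embed_complex X) (embed_complex Y) (embed_map X Y f)"
proof -
  have f: "chain_map C X Y f" using q unfolding quasi_iso_def by blast
  note fm = cmD[OF chain_mapD(2)[OF X Y f]]
  have *: "\<exists>K k L c K' k' L' c'. cohomology_of C X n K k L c \<and> cohomology_of C Y n K' k' L' c' \<and>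
       (\<exists>a\<in>carrier (Hom C K K'). k' \<bullet>\<^bsub>C\<^esub> a = f n \<bullet>\<^bsub>C\<^esub> k \<and> (\<exists>h. iso_arrow C L L' h \<and> h \<bullet>\<^bsub>C\<^esub> c = c' \<bullet>\<^bsub>C\<^esub> a))" for n
    using q unfolding quasi_iso_def by blast
  {
    fix n
    from *[of n] obtain K k L c K' k' L' c' a h where coh: "cohomology_of C X n K k L c" "cohomology_of C Y n K' k' L' c'"
      and a: "a \<in> carrier (Hom C K K')" "k' \<bullet>\<^bsub>C\<^esub> a = f n \<bullet>\<^bsub>C\<^esub> k" and h: "iso_arrow C L L' h" "h \<bullet>\<^bsub>C\<^esub> c = c' \<bullet>\<^bsub>C\<^esub> a"
      by blast
    obtain t where co: "presents_cohomology (embed_complex X) n K (marr C K (cobj X n) k) L (marr C K L c) t"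
      using cohomologyD(1)[OF coh(1)] by blast
    note 1 = presents_cohomologyD[OF co, unfolded embed_complex_simps(1)] cohomologyD(2-5)[OF coh(1)]
    obtain t' where co': "presents_cohomology (embed_complex Y) n K' (marr C K' (cobj Y n) k') L' (marr C K' L' c') t'"
      using cohomologyD(1)[OF coh(2)] by blast
    note 2 = presents_cohomologyD[OF co', unfolded embed_complex_simps(1)] cohomologyD(2-5)[OF coh(2)]
    define \<kappa> \<kappa>' \<gamma> \<gamma>' \<alpha> where "\<kappa> = marr C K (cobj X n) k" and "\<kappa>' = marr C K' (cobj Y n) k'"
      and "\<gamma> = marr C K L c" and "\<gamma>' = marr C K' L' c'" and "\<alpha> = marr C K K' a"
    note 1 = 1[folded \<kappa>_def \<gamma>_def] and 2 = 2[folded \<kappa>'_def \<gamma>'_def]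
    obtain h' where h': "h \<in> carrier (Hom C L L')" "h' \<in> carrier (Hom C L' L)" "h' \<bullet>\<^bsub>C\<^esub> h = Idn C L" "h \<bullet>\<^bsub>C\<^esub> h' = Idn C L'"
      using h(1) unfolding iso_arrow_def by blast
    define \<eta> \<eta>' where "\<eta> = marr C L L' h" and "\<eta>' = marr C L' L h'"
    have eta: "\<eta>' \<in> Hm L' L" "\<eta> \<in> Hm L L'" "\<eta>' * \<eta> = Idm L" "\<eta> * \<eta>' = Idm L'"
      unfolding \<eta>_def \<eta>'_def using h' HmI 1(14) 2(14) marr_comp_eq Idn_in unfolding Idm_def by simp_all
    have al: "\<alpha> \<in> Hm K K'" using HmI a 1 2 unfolding \<alpha>_def by blast
    have ka: "\<kappa>' * \<alpha> = embed_map X Y f n * \<kappa>" unfolding \<kappa>_def \<kappa>'_def \<alpha>_def embed_map_def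
      using marr_comp[OF 1(13) 2(13) bcD(1)[OF Y] a(1) 2(11)]
        marr_comp[OF 1(13) bcD(1)[OF X] bcD(1)[OF Y] 1(11) chain_mapD(1)[OF X Y f]] a(2) by simp
    have ec: "\<eta> * \<gamma> = \<gamma>' * \<alpha>" unfolding \<eta>_def \<gamma>_def \<gamma>'_def \<alpha>_def
      using marr_comp[OF 1(13) 1(14) 2(14) 1(12) h'(1)] marr_comp[OF 1(13) 2(13) 2(14) a(1) 2(12)] h(2) by simp
    have s: "\<exists>T' e x z. e \<in> Hm T' T \<and> epi T e \<and> x \<in> Hm T' (cobj (embed_complex X) n) \<and> diff (embed_complex X) n * x = 0 \<and>
        z \<in> Hm T' (cobj (embed_complex Y) (n - 1)) \<and> y * e = embed_map X Y f n * x + diff (embed_complex Y) (n - 1) * z"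
      if y: "y \<in> Hm T (cobj (embed_complex Y) n)" "diff (embed_complex Y) n * y = 0" for T y
    proof -
      obtain y0 where y0: "y0 \<in> Hm T K'" "\<kappa>' * y0 = y" using 2(3) y by (metis embed_complex_simps(1))
      obtain T1 e1 x0 where e1: "e1 \<in> Hm T1 T" "epi T e1" "x0 \<in> Hm T1 K" "\<gamma> * x0 = \<eta>' * (\<gamma>' * y0) * e1"
        using cover_lift[OF 1(7,9) comp_in[OF eta(1) comp_in[OF 2(7) y0(1)]]] .
      have "\<gamma>' * (\<alpha> * x0) = \<eta> * (\<gamma> * x0)" using ec by (metis mult.assoc)
      also have "\<dots> = Idm L' * (\<gamma>' * y0) * e1" unfolding e1(4) eta(4)[symmetric] by (simp add: mult.assoc)
      also have "\<dots> = \<gamma>' * y0 * e1" using idl[OF comp_in[OF 2(7) y0(1)]] by simp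
      finally have "\<gamma>' * (y0 * e1 - \<alpha> * x0) = 0" by (simp add: right_diff_distrib mult.assoc)
      from 2(10)[OF diff_in[OF comp_in[OF y0(1) e1(1)] comp_in[OF al e1(3)]] this]
      obtain T2 e2 z where e2: "e2 \<in> Hm T2 T1" "epi T1 e2" "z \<in> Hm T2 (cobj Y (n - 1))" "(y0 * e1 - \<alpha> * x0) * e2 = t' * z"
        by blast
      have "y * (e1 * e2) = \<kappa>' * ((y0 * e1 - \<alpha> * x0) * e2) + \<kappa>' * \<alpha> * (x0 * e2)"
        using y0(2) by (simp add: algebra_simps) (simp flip: mult.assoc)
      also have "\<dots> = embed_map X Y f n * (\<kappa> * (x0 * e2)) + diff (embed_complex Y) (n - 1) * z"
        unfolding e2(4) ka 2(6)[symmetric] by (simp only: mult.assoc add.commute)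
      finally have "y * (e1 * e2) = embed_map X Y f n * (\<kappa> * (x0 * e2)) + diff (embed_complex Y) (n - 1) * z" .
      moreover have "diff (embed_complex X) n * (\<kappa> * (x0 * e2)) = 0" using 1(2) by (metis mult.assoc mult_zero_left)
      moreover have "\<kappa> * (x0 * e2) \<in> Hm T2 (cobj (embed_complex X) n)" "e1 * e2 \<in> Hm T2 T"
        using comp_in[OF 1(1) comp_in[OF e1(3) e2(1)]] comp_in[OF e1(1) e2(1)] by simp_all
      moreover have "epi T (e1 * e2)" using epi_comp[OF e1(2,1) e2(2)] .
      moreover have "z \<in> Hm T2 (cobj (embed_complex Y) (n - 1))" using e2(3) by simp
      ultimately show ?thesis by blast
    qed
    have i: "\<exists>T' e x'. e \<in> Hm T' T \<and> epi T e \<and> x' \<in> Hm T' (cobj (embed_complex X) (n - 1)) \<and> x * e = diff (embed_complex X) (n - 1) * x'"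
      if x: "x \<in> Hm T (cobj (embed_complex X) n)" "diff (embed_complex X) n * x = 0" "y \<in> Hm T (cobj (embed_complex Y) (n - 1))"
        "embed_map X Y f n * x = diff (embed_complex Y) (n - 1) * y" for T x y
    proof -
      obtain x0 where x0: "x0 \<in> Hm T K" "\<kappa> * x0 = x" using 1(3) x by (metis embed_complex_simps(1))
      have y: "y \<in> Hm T (cobj Y (n - 1))" using x(3) by simp
      have "\<kappa>' * (\<alpha> * x0) = \<kappa>' * (t' * y)" using ka x0(2) x(4) 2(6) by (metis mult.assoc)
      then have "\<alpha> * x0 = t' * y" using mono_cancel[OF 2(4) comp_in[OF al x0(1)] comp_in[OF 2(5) y]] by blast
      then have "\<eta> * (\<gamma> * x0) = 0" using ec 2(8) by (metis mult.assoc mult_zero_left)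
      then have "Idm L * (\<gamma> * x0) = 0" unfolding eta(3)[symmetric] by (simp add: mult.assoc)
      then have "\<gamma> * x0 = 0" using idl[OF comp_in[OF 1(7) x0(1)]] by simp
      from 1(10)[OF x0(1) this] obtain T' e z where "e \<in> Hm T' T" "epi T e" "z \<in> Hm T' (cobj X (n - 1))" "x0 * e = t * z"
        by blast
      then have "x * e = diff (embed_complex X) (n - 1) * z" using x0(2) 1(6) by (metis mult.assoc)
      then show ?thesis using \<open>e \<in> Hm T' T\<close> \<open>epi T e\<close> \<open>z \<in> Hm T' (cobj X (n - 1))\<close>
        by (intro exI[of _ T'] exI[of _ e] exI[of _ z]) auto
    qed
    note s i
  }
  note si = this
  show ?thesis unfolding abs_qis_def
  proof (intro conjI)
    show "abs_chain_map (embed_complex X) (embed_complex Y) (embed_map X Y f)" by (rule chain_mapD(2)[OF X Y f])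
    show "Hsurj (embed_complex X) (embed_complex Y) (embed_map X Y f)" unfolding Hsurj_def by (intro allI impI) (rule si(1))
    show "Hinj (embed_complex X) (embed_complex Y) (embed_map X Y f)" unfolding Hinj_def by (intro allI impI) (rule si(2))
  qed
qed

lemma cohomology_ex:
  assumes X: "bounded_complex C X"
  shows "\<exists>K k L c. cohomology_of C X n K k L c"
proof -
  note x = bcD[OF X]
  obtain K k where k: "kernel_of C (cobj X n) (cobj X (n + 1)) (diff X n) K k"
    using abelian x unfolding abelian_category_def by blast
  have K: "K \<in> Ob C" "k \<in> carrier (Hom C K (cobj X n))" using k unfolding kernel_of_def by blast+
  have "diff (embed_complex X) n * diff (embed_complex X) (n - 1) = 0" using cxD(4)[OF embed_complex_cx[OF X]] .
  moreover have "diff (embed_complex X) (n - 1) \<in> Hm (cobj X (n - 1)) (cobj X n)" using cxD(2)[OF embed_complex_cx[OF X]] by (metis embed_complex_simps(1))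
  ultimately obtain t where t: "t \<in> Hm (cobj X (n - 1)) K" "marr C K (cobj X n) k * t = diff (embed_complex X) (n - 1)"
    using kernel_marr(3)[OF k, of "diff (embed_complex X) (n - 1)"] by auto
  from HmE[OF t(1)] obtain t0 where t0: "t0 \<in> carrier (Hom C (cobj X (n - 1)) K)" "t = marr C (cobj X (n - 1)) K t0" by metis
  have "k \<bullet>\<^bsub>C\<^esub> t0 = diff X (n - 1)"
    using marr_comp_eq[OF x(1) K(1) x(1) t0(1) K(2) x(3)] t(2) t0(2) by simp
  moreover obtain L c where "cokernel_of C (cobj X (n - 1)) K t0 L c"
    using abelian x(1) K(1) t0 unfolding abelian_category_def by blast
  ultimately show ?thesis unfolding cohomology_of_def using k t0(1) by blast
qed

text \<open>The map \<eta> induced between chosen cohomology objects is mono by \<open>Hinj\<close>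
  and epi by \<open>Hsurj\<close>, hence an isomorphism.\<close>

lemma quasi_isoI:
  assumes X: "bounded_complex C X" and Y: "bounded_complex C Y" and f: "chain_map C X Y f"
    and q: "abs_qis (embed_complex X) (embed_complex Y) (embed_map X Y f)"
  shows "quasi_iso C X Y f"
  unfolding quasi_iso_def
proof (intro conjI allI)
  fix n
  note fm = cmD[OF qiD(1)[OF q]]
  obtain K k L c where coh: "cohomology_of C X n K k L c" using cohomology_ex[OF X] by blast
  obtain K' k' L' c' where coh': "cohomology_of C Y n K' k' L' c'" using cohomology_ex[OF Y] by blast
  obtain t where co: "presents_cohomology (embed_complex X) n K (marr C K (cobj X n) k) L (marr C K L c) t"
      using cohomologyD(1)[OF coh] by blast
    note 1 = presents_cohomologyD[OF co, unfolded embed_complex_simps(1)] cohomologyD(2-5)[OF coh]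
  obtain t' where co': "presents_cohomology (embed_complex Y) n K' (marr C K' (cobj Y n) k') L' (marr C K' L' c') t'"
      using cohomologyD(1)[OF coh'] by blast
    note 2 = presents_cohomologyD[OF co', unfolded embed_complex_simps(1)] cohomologyD(2-5)[OF coh']
  define \<kappa> \<kappa>' \<gamma> \<gamma>' where "\<kappa> = marr C K (cobj X n) k" and "\<kappa>' = marr C K' (cobj Y n) k'"
    and "\<gamma> = marr C K L c" and "\<gamma>' = marr C K' L' c'"
  note 1 = 1[folded \<kappa>_def \<gamma>_def] and 2 = 2[folded \<kappa>'_def \<gamma>'_def]
  have fn: "embed_map X Y f n \<in> Hm (cobj X n) (cobj Y n)" "embed_map X Y f (n - 1) \<in> Hm (cobj X (n - 1)) (cobj Y (n - 1))"
    using fm(1)[of n] fm(1)[of "n - 1"] by simp_all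
  have "diff (embed_complex Y) n * (embed_map X Y f n * \<kappa>) = 0" using fm(4)[of n \<kappa>] 1(2) by simp
  then obtain \<alpha> where al: "\<alpha> \<in> Hm K K'" "\<kappa>' * \<alpha> = embed_map X Y f n * \<kappa>" using 2(3)[OF comp_in[OF fn(1) 1(1)]] by blast
  have "\<kappa>' * (\<alpha> * t) = embed_map X Y f n * diff (embed_complex X) (n - 1)" using al(2) 1(6) by (metis mult.assoc)
  also have "\<dots> = \<kappa>' * (t' * embed_map X Y f (n - 1))" using fm(3)[of n] 2(6) by (metis mult.assoc)
  finally have at: "\<alpha> * t = t' * embed_map X Y f (n - 1)"
    using mono_cancel[OF 2(4) comp_in[OF al(1) 1(5)] comp_in[OF 2(5) fn(2)]] by blast
  have ga: "\<gamma>' * \<alpha> \<in> Hm K L'" using comp_in[OF 2(7) al(1)] .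
  obtain \<eta> where eta: "\<eta> \<in> Hm L L'" "\<eta> * \<gamma> = \<gamma>' * \<alpha>"
  proof -
    have "\<gamma>' * \<alpha> * u = 0" if u: "u \<in> Hm U K" "\<gamma> * u = 0" for U u
    proof -
      obtain T' e y where e: "e \<in> Hm T' U" "epi U e" "y \<in> Hm T' (cobj X (n - 1))" "u * e = t * y" using 1(10)[OF u] by blast
      have "\<gamma>' * \<alpha> * u * e = \<gamma>' * (\<alpha> * t) * y" using e(4) by (simp add: mult.assoc)
      also have "\<dots> = 0" unfolding at using 2(8) by (simp flip: mult.assoc)
      finally show ?thesis using epiD[OF e(2) comp_in[OF ga u(1)]] by blast
    qed
    then show ?thesis using descend[OF 1(7,9) ga] that by blast
  qed
  have "mono L \<eta>" unfolding mono_def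
  proof (intro allI ballI impI)
    fix W g assume g: "g \<in> Hm W L" "\<eta> * g = 0"
    obtain T1 e1 x0 where e1: "e1 \<in> Hm T1 W" "epi W e1" "x0 \<in> Hm T1 K" "\<gamma> * x0 = g * e1" using cover_lift[OF 1(7,9) g(1)] .
    have "\<gamma>' * (\<alpha> * x0) = 0" using eta(2) e1(4) g(2) by (metis mult.assoc mult_zero_left)
    then obtain T2 e2 y where e2: "e2 \<in> Hm T2 T1" "epi T1 e2" "y \<in> Hm T2 (cobj Y (n - 1))" "\<alpha> * x0 * e2 = t' * y"
      using 2(10)[OF comp_in[OF al(1) e1(3)]] by blast
    have "embed_map X Y f n * (\<kappa> * (x0 * e2)) = diff (embed_complex Y) (n - 1) * y" using al(2) e2(4) 2(6) by (metis mult.assoc)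
    moreover have "\<kappa> * (x0 * e2) \<in> Hm T2 (cobj (embed_complex X) n)" using comp_in[OF 1(1) comp_in[OF e1(3) e2(1)]] by simp
    moreover have "diff (embed_complex X) n * (\<kappa> * (x0 * e2)) = 0" using 1(2) by (metis mult.assoc mult_zero_left)
    moreover have "y \<in> Hm T2 (cobj (embed_complex Y) (n - 1))" using e2(3) by simp
    ultimately obtain T3 e3 x' where e3: "e3 \<in> Hm T3 T2" "epi T2 e3" "x' \<in> Hm T3 (cobj (embed_complex X) (n - 1))"
        "\<kappa> * (x0 * e2) * e3 = diff (embed_complex X) (n - 1) * x'"
      using HinjD[OF qiD(3)[OF q], of "\<kappa> * (x0 * e2)" T2 n y] by metis
    have x': "x' \<in> Hm T3 (cobj X (n - 1))" using e3(3) by simp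
    have "\<kappa> * (x0 * e2 * e3) = \<kappa> * (t * x')" using e3(4) 1(6) by (metis mult.assoc)
    then have "x0 * e2 * e3 = t * x'"
      using mono_cancel[OF 1(4) comp_in[OF comp_in[OF e1(3) e2(1)] e3(1)] comp_in[OF 1(5) x']] by blast
    then have "\<gamma> * x0 * e2 * e3 = 0" using 1(8) by (metis mult.assoc mult_zero_left)
    then have "g * e1 * e2 * e3 = 0" using e1(4) by simp
    then have "g * e1 * e2 = 0" using epiD[OF e3(2) comp_in[OF comp_in[OF g(1) e1(1)] e2(1)]] by blast
    then have "g * e1 = 0" using epiD[OF e2(2) comp_in[OF g(1) e1(1)]] by blast
    then show "g = 0" using epiD[OF e1(2) g(1)] by blast
  qed
  moreover have "epi L' \<eta>" unfolding epi_def
  proof (intro allI ballI impI)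
    fix W w assume w: "w \<in> Hm L' W" "w * \<eta> = 0"
    \<comment> \<open>Surjectivity is applied to the universal cycle, the inclusion of the cycle
      object K'.\<close>
    have "\<kappa>' \<in> Hm K' (cobj (embed_complex Y) n)" using 2(1) by simp
    from HsurjD[OF qiD(2)[OF q] this 2(2)] obtain T e x z where e: "e \<in> Hm T K'" "epi K' e" "x \<in> Hm T (cobj (embed_complex X) n)"
      "diff (embed_complex X) n * x = 0" "z \<in> Hm T (cobj (embed_complex Y) (n - 1))" "\<kappa>' * e = embed_map X Y f n * x + diff (embed_complex Y) (n - 1) * z" .
    have z: "z \<in> Hm T (cobj Y (n - 1))" using e(5) by simp
    obtain x0 where x0: "x0 \<in> Hm T K" "\<kappa> * x0 = x" using 1(3) e(3,4) by (metis embed_complex_simps(1))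
    have "embed_map X Y f n * x = \<kappa>' * (\<alpha> * x0)" using x0(2) al(2) by (metis mult.assoc)
    then have "\<kappa>' * e = \<kappa>' * (\<alpha> * x0 + t' * z)" unfolding e(6) 2(6)[symmetric] by (simp add: distrib_left mult.assoc)
    then have ee: "e = \<alpha> * x0 + t' * z"
      using mono_cancel[OF 2(4) e(1) add_in[OF comp_in[OF al(1) x0(1)] comp_in[OF 2(5) z]]] by blast
    have "w * \<gamma>' * e = w * (\<gamma>' * \<alpha>) * x0 + w * (\<gamma>' * t') * z" unfolding ee by (simp add: distrib_left mult.assoc)
    also have "\<dots> = 0" unfolding eta(2)[symmetric] 2(8) using w(2) by (simp flip: mult.assoc)
    finally have "w * \<gamma>' = 0" using epiD[OF e(2) comp_in[OF w(1) 2(7)]] by blast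
    then show "w = 0" using epiD[OF 2(9) w(1)] by blast
  qed
  ultimately obtain \<eta>' where eta': "\<eta>' \<in> Hm L' L" "\<eta> * \<eta>' = Idm L'" "\<eta>' * \<eta> = Idm L"
    using mono_epi_iso[OF eta(1)] by blast
  from HmE[OF al(1)] obtain a where a: "a \<in> carrier (Hom C K K')" "\<alpha> = marr C K K' a" by metis
  from HmE[OF eta(1)] obtain h where h: "h \<in> carrier (Hom C L L')" "\<eta> = marr C L L' h" by metis
  from HmE[OF eta'(1)] obtain h' where h': "h' \<in> carrier (Hom C L' L)" "\<eta>' = marr C L' L h'" by metis
  have "iso_arrow C L L' h" unfolding iso_arrow_def
    using h h' eta' 1(14) 2(14) marr_comp_eq Idn_in unfolding Idm_def by auto
  moreover have "h \<bullet>\<^bsub>C\<^esub> c = c' \<bullet>\<^bsub>C\<^esub> a"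
    using eta(2) marr_comp_eq[OF 1(13,14) 2(14) 1(12) h(1) Comp_in[OF 1(13) 2(13,14) a(1) 2(12)]]
      marr_comp[OF 1(13) 2(13,14) a(1) 2(12)] h(2) a(2) unfolding \<gamma>_def \<gamma>'_def by simp
  moreover have "k' \<bullet>\<^bsub>C\<^esub> a = f n \<bullet>\<^bsub>C\<^esub> k"
    using al(2) marr_comp_eq[OF 1(13) 2(13) bcD(1)[OF Y] a(1) 2(11) Comp_in[OF 1(13) bcD(1)[OF X] bcD(1)[OF Y] 1(11) chain_mapD(1)[OF X Y f]]]
      marr_comp[OF 1(13) bcD(1)[OF X] bcD(1)[OF Y] 1(11) chain_mapD(1)[OF X Y f]] a(2) unfolding \<kappa>_def \<kappa>'_def embed_map_def by simp
  ultimately show "\<exists>K k L c K' k' L' c'. cohomology_of C X n K k L c \<and> cohomology_of C Y n K' k' L' c' \<and>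
       (\<exists>a\<in>carrier (Hom C K K'). k' \<bullet>\<^bsub>C\<^esub> a = f n \<bullet>\<^bsub>C\<^esub> k \<and> (\<exists>h. iso_arrow C L L' h \<and> h \<bullet>\<^bsub>C\<^esub> c = c' \<bullet>\<^bsub>C\<^esub> a))"
    using coh coh' a(1) by blast
qed (fact f)

lemma quasi_iso_iff:
  assumes "bounded_complex C X" "bounded_complex C Y" "chain_map C X Y f"
  shows "quasi_iso C X Y f \<longleftrightarrow> abs_qis (embed_complex X) (embed_complex Y) (embed_map X Y f)"
  using quasi_isoD quasi_isoI assms by blast

section \<open>Equality of roofs expressed in the ring\<close>

lemma is_roofD:
  assumes "is_roof C r"
  shows "bounded_complex C (rsrc r)" "bounded_complex C (rmid r)" "bounded_complex C (rtgt r)"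
    "chain_map C (rmid r) (rsrc r) (rden r)" "chain_map C (rmid r) (rtgt r) (rnum r)"
    "roof_data (embed_complex (rsrc r)) (embed_complex (rtgt r)) (embed_complex (rmid r)) (embed_map (rmid r) (rsrc r) (rden r)) (embed_map (rmid r) (rtgt r) (rnum r))"
proof -
  have r: "bounded_complex C (rsrc r)" "bounded_complex C (rmid r)" "bounded_complex C (rtgt r)"
    "quasi_iso C (rmid r) (rsrc r) (rden r)" "chain_map C (rmid r) (rtgt r) (rnum r)"
    using assms unfolding is_roof_def by blast+
  then show "bounded_complex C (rsrc r)" "bounded_complex C (rmid r)" "bounded_complex C (rtgt r)"
    "chain_map C (rmid r) (rsrc r) (rden r)" "chain_map C (rmid r) (rtgt r) (rnum r)"
    unfolding quasi_iso_def by blast+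
  show "roof_data (embed_complex (rsrc r)) (embed_complex (rtgt r)) (embed_complex (rmid r)) (embed_map (rmid r) (rsrc r) (rden r)) (embed_map (rmid r) (rtgt r) (rnum r))"
    unfolding roof_data_def using r embed_complex_cx quasi_isoD chain_mapD(2) by blast
qed

definition roof_rel :: "('o, 'a) roof \<Rightarrow> ('o, 'a) roof \<Rightarrow> bool" where
  "roof_rel r s \<longleftrightarrow> roof_equiv (embed_complex (rsrc r)) (embed_complex (rtgt r)) (embed_complex (rmid r)) (embed_map (rmid r) (rsrc r) (rden r)) (embed_map (rmid r) (rtgt r) (rnum r))
     (embed_complex (rmid s)) (embed_map (rmid s) (rsrc s) (rden s)) (embed_map (rmid s) (rtgt s) (rnum s))"

lemma roof_eq_iff:
  "roof_eq C r s \<longleftrightarrow> is_roof C r \<and> is_roof C s \<and> rsrc r = rsrc s \<and> rtgt r = rtgt s \<and> roof_rel r s"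
proof (cases "is_roof C r \<and> is_roof C s \<and> rsrc r = rsrc s \<and> rtgt r = rtgt s")
  case True
  then have r: "is_roof C r" and s: "is_roof C s" and stalk_at: "rsrc s = rsrc r" "rtgt s = rtgt r" by auto
  note R = is_roofD[OF r] and S = is_roofD[OF s, unfolded stalk_at]
  have "(\<exists>W u w. bounded_complex C W \<and> chain_map C W (rmid r) u \<and> chain_map C W (rmid s) w \<and>
       quasi_iso C W (rsrc r) (ccomp C (rden r) u) \<and>
       homotopic C W (rsrc r) (ccomp C (rden r) u) (ccomp C (rden s) w) \<and>
       homotopic C W (rtgt r) (ccomp C (rnum r) u) (ccomp C (rnum s) w)) \<longleftrightarrow> roof_rel r s" (is "?L \<longleftrightarrow> _")
  proof
    assume ?L
    then obtain W u w where W: "bounded_complex C W" "chain_map C W (rmid r) u" "chain_map C W (rmid s) w"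
       "quasi_iso C W (rsrc r) (ccomp C (rden r) u)"
       "homotopic C W (rsrc r) (ccomp C (rden r) u) (ccomp C (rden s) w)"
       "homotopic C W (rtgt r) (ccomp C (rnum r) u) (ccomp C (rnum s) w)" by blast
    note c = chain_map_ccomp[OF W(1) R(2,1) W(2) R(4)] chain_map_ccomp[OF W(1) S(2,1) W(3) S(4)]
      chain_map_ccomp[OF W(1) R(2,3) W(2) R(5)] chain_map_ccomp[OF W(1) S(2,3) W(3) S(5)]
    note m = embed_map_ccomp[OF W(1) R(2,1) W(2) R(4)] embed_map_ccomp[OF W(1) S(2,1) W(3) S(4)]
      embed_map_ccomp[OF W(1) R(2,3) W(2) R(5)] embed_map_ccomp[OF W(1) S(2,3) W(3) S(5)]
    show "roof_rel r s" unfolding roof_rel_def roof_equiv_def stalk_at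
      by (rule exI[of _ "embed_complex W"], rule exI[of _ "embed_map W (rmid r) u"], rule exI[of _ "embed_map W (rmid s) w"], intro conjI)
        (fact embed_complex_cx[OF W(1)] chain_mapD(2)[OF W(1) R(2) W(2)] chain_mapD(2)[OF W(1) S(2) W(3)]
          quasi_isoD[OF W(1) R(1) W(4), unfolded m] W(5)[unfolded homotopic_iff[OF W(1) R(1) c(1,2)] m]
          W(6)[unfolded homotopic_iff[OF W(1) R(3) c(3,4)] m])+
  next
    assume "roof_rel r s"
    then obtain V u w where V: "abs_complex V" "abs_chain_map V (embed_complex (rmid r)) u" "abs_chain_map V (embed_complex (rmid s)) w"
        "abs_qis V (embed_complex (rsrc r)) (embed_map (rmid r) (rsrc r) (rden r) \<star> u)"
        "abs_homotopic V (embed_complex (rsrc r)) (embed_map (rmid r) (rsrc r) (rden r) \<star> u) (embed_map (rmid s) (rsrc r) (rden s) \<star> w)"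
        "abs_homotopic V (embed_complex (rtgt r)) (embed_map (rmid r) (rtgt r) (rnum r) \<star> u) (embed_map (rmid s) (rtgt r) (rnum s) \<star> w)"
      unfolding roof_rel_def roof_equiv_def stalk_at by (elim exE conjE) (rule that)
    \<comment> \<open>A refinement found in the ring is brought back to C; embedding it again
      returns the original data.\<close>
    let ?W = "unembed_complex V" and ?u = "unembed_map (unembed_complex V) (rmid r) u" and ?w = "unembed_map (unembed_complex V) (rmid s) w"
    note a = unembed_complex_bc[OF V(1)]
    have "abs_chain_map (embed_complex ?W) (embed_complex (rmid r)) u" "abs_chain_map (embed_complex ?W) (embed_complex (rmid s)) w" unfolding a(2) by (rule V)+
    note u = chain_mapI[OF a(1) R(2) this(1)] and w = chain_mapI[OF a(1) S(2) this(2)]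
    note c = chain_map_ccomp[OF a(1) R(2,1) u(1) R(4)] chain_map_ccomp[OF a(1) S(2,1) w(1) S(4)]
      chain_map_ccomp[OF a(1) R(2,3) u(1) R(5)] chain_map_ccomp[OF a(1) S(2,3) w(1) S(5)]
    note m = embed_map_ccomp[OF a(1) R(2,1) u(1) R(4), unfolded u(2)] embed_map_ccomp[OF a(1) S(2,1) w(1) S(4), unfolded w(2)]
      embed_map_ccomp[OF a(1) R(2,3) u(1) R(5), unfolded u(2)] embed_map_ccomp[OF a(1) S(2,3) w(1) S(5), unfolded w(2)]
    have 1: "quasi_iso C ?W (rsrc r) (ccomp C (rden r) ?u)"
      unfolding quasi_iso_iff[OF a(1) R(1) c(1)] m a(2) by (rule V(4))
    have 2: "homotopic C ?W (rsrc r) (ccomp C (rden r) ?u) (ccomp C (rden s) ?w)"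
      unfolding homotopic_iff[OF a(1) R(1) c(1,2)] m a(2) by (rule V(5))
    have 3: "homotopic C ?W (rtgt r) (ccomp C (rnum r) ?u) (ccomp C (rnum s) ?w)"
      unfolding homotopic_iff[OF a(1) R(3) c(3,4)] m a(2) by (rule V(6))
    show ?L
      by (rule exI[of _ ?W], rule exI[of _ ?u], rule exI[of _ ?w], intro conjI) (fact a(1) u(1) w(1) 1 2 3)+
  qed
  then show ?thesis unfolding roof_eq_def using True by simp
qed (auto simp: roof_eq_def)

lemma roof_eq_refl: "is_roof C r \<Longrightarrow> roof_eq C r r"
  unfolding roof_eq_iff roof_rel_def using roof_equiv_refl is_roofD(6) by blast

lemma roof_eq_sym:
  assumes "roof_eq C r s" shows "roof_eq C s r"
proof -
  have a: "is_roof C r" "is_roof C s" "rsrc r = rsrc s" "rtgt r = rtgt s" "roof_rel r s" using assms unfolding roof_eq_iff by auto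
  have "roof_rel s r" using roof_equiv_sym[OF is_roofD(6)[OF a(2)]] a(5) unfolding roof_rel_def a(3,4) .
  then show ?thesis using a unfolding roof_eq_iff by simp
qed

lemma roof_eq_trans:
  assumes "roof_eq C r s" "roof_eq C s t" shows "roof_eq C r t"
proof -
  have a: "is_roof C r" "is_roof C s" "rsrc r = rsrc s" "rtgt r = rtgt s" "roof_rel r s"
     "is_roof C t" "rsrc s = rsrc t" "rtgt s = rtgt t" "roof_rel s t" using assms unfolding roof_eq_iff by auto
  have "roof_rel r t" using roof_equiv_trans[OF is_roofD(6)[OF a(2), unfolded a(7,8)] is_roofD(6)[OF a(1), unfolded a(3,4,7,8)] is_roofD(6)[OF a(6)]]
     a(5,9) unfolding roof_rel_def a(3,4,7,8) .
  then show ?thesis using a unfolding roof_eq_iff by simp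
qed

lemma roof_class_eq:
  assumes "is_roof C r" "is_roof C s"
  shows "roof_class C r = roof_class C s \<longleftrightarrow> roof_eq C r s"
  unfolding roof_class_def using assms roof_eq_refl roof_eq_sym roof_eq_trans by blast

text \<open>The signs introduced by \<open>shift\<close> disappear because all differentials of a
  stalk complex are zero; shifting by k moves the object to degree -k.\<close>

lemma stalk_st:
  assumes "M \<in> Ob C"
  shows "bounded_complex C (stalk C M)" "embed_complex (stalk C M) = stalk_at 0 M"
    "bounded_complex C (shift C (int k) (stalk C M))" "embed_complex (shift C (int k) (stalk C M)) = stalk_at (- int k) M"
proof -
  have ob: "(if n = j then M else null) \<in> Ob C" for n j :: int using assms null by simp
  have z: "marr C X Y \<zero>\<^bsub>Hom C X Y\<^esub> = 0" if "X \<in> Ob C" "Y \<in> Ob C" for X Y using marr_zero that .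
  have s: "cobj (stalk C M) n = (if n = 0 then M else null)"
    "diff (stalk C M) n = \<zero>\<^bsub>Hom C (cobj (stalk C M) n) (cobj (stalk C M) (n + 1))\<^esub>" for n
    by (simp_all add: stalk_def Let_def zero_ob_null)
  have o: "cobj (stalk C M) n \<in> Ob C" for n using ob s by simp
  show 1: "embed_complex (stalk C M) = stalk_at 0 M"
    unfolding embed_complex_def stalk_at_def using z[OF o o] s by (simp add: fun_eq_iff)
  have "unembed_complex (stalk_at 0 M) = stalk C M"
    unfolding unembed_complex_def 1[symmetric] using arrow_of_marr[OF o o zero_in_Hom[OF o o]] s by (simp add: fun_eq_iff)
  then show "bounded_complex C (stalk C M)" using unembed_complex_bc(1)[OF stalk_at_cx[OF assms]] by metis
  let ?S = "shift C (int k) (stalk C M)"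
  have c: "cobj ?S n = (if n = - int k then M else null)" for n by (auto simp: shift_def s)
  have d: "diff ?S n = \<zero>\<^bsub>Hom C (cobj ?S n) (cobj ?S (n + 1))\<^esub>" for n
  proof -
    have "\<ominus>\<^bsub>Hom C X Y\<^esub> \<zero>\<^bsub>Hom C X Y\<^esub> = \<zero>\<^bsub>Hom C X Y\<^esub>" if "X \<in> Ob C" "Y \<in> Ob C" for X Y
      using abelian_group.r_neg[OF ab[OF that] zero_in_Hom[OF that]]
        abelian_groupE(5)[OF ab[OF that] marr_minus(2)[OF that zero_in_Hom[OF that]]] by simp
    from this[OF o o] have "\<ominus>\<^bsub>Hom C (cobj (stalk C M) (n + int k)) (cobj (stalk C M) (n + int k + 1))\<^esub>
       \<zero>\<^bsub>Hom C (cobj (stalk C M) (n + int k)) (cobj (stalk C M) (n + int k + 1))\<^esub> =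
       \<zero>\<^bsub>Hom C (cobj (stalk C M) (n + int k)) (cobj (stalk C M) (n + int k + 1))\<^esub>" .
    then show ?thesis by (simp add: shift_def s(2) algebra_simps)
  qed
  have o: "cobj ?S n \<in> Ob C" for n using ob c by simp
  show 2: "embed_complex ?S = stalk_at (- int k) M"
    unfolding embed_complex_def stalk_at_def using z[OF o o] c d by (simp add: fun_eq_iff)
  have "unembed_complex (stalk_at (- int k) M) = ?S"
    unfolding unembed_complex_def 2[symmetric]
    by (rule cochain.equality) (use arrow_of_marr[OF o o zero_in_Hom[OF o o]] d in \<open>simp_all add: fun_eq_iff\<close>)
  then show "bounded_complex C ?S" using unembed_complex_bc(1)[OF stalk_at_cx[OF assms]] by metis
qed

end


section \<open>The vector space of first extension classes\<close>

context abcat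
begin

text \<open>Converse of \<open>same_ext_class_common_refinement\<close>. Together they turn equality
  of classes into a linear condition over one resolution, from which the compatibilities below
  follow.\<close>

lemma same_ext_class_of_common_refinement:
  assumes s: "ses B P M i \<pi>" "ses B' P' M i' \<pi>'" and b: "b \<in> H B N" "b' \<in> H B' N"
    and s2: "ses B2 P2 M i2 \<pi>2" and r: "refines B P i \<pi> B2 P2 i2 \<pi>2 a c" "refines B' P' i' \<pi>' B2 P2 i2 \<pi>2 a' c'"
    and e: "e \<in> H P2 N" "b * c - b' * c' = e * i2"
  shows "same_ext_class M N B P i \<pi> b B' P' i' \<pi>' b'"
proof -
  have bc: "b * c \<in> H B2 N" "b' * c' \<in> H B2 N"
    using comp_in[OF b(1) refinesD(2)[OF r(1)]] comp_in[OF b(2) refinesD(2)[OF r(2)]] .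
  show ?thesis
    by (rule same_ext_class_trans[OF s(1) b(1) s2 bc(1) s(2) b(2) same_ext_class_refines[OF s(1) s2 r(1) b(1)]
      same_ext_class_trans[OF s2 bc(1) s2 bc(2) s(2) b(2) same_ext_class_of_extension[OF s2 bc e]
        same_ext_class_sym[OF s(2) b(2) s2 bc(2) same_ext_class_refines[OF s(2) s2 r(2) b(2)]]]])
qed

lemma same_ext_class_add:
  assumes s: "ses B P M i \<pi>" "ses B' P' M i' \<pi>'"
    and b: "b1 \<in> H B N" "b1' \<in> H B' N" "b2 \<in> H B N" "b2' \<in> H B' N"
    and e: "same_ext_class M N B P i \<pi> b1 B' P' i' \<pi>' b1'" "same_ext_class M N B P i \<pi> b2 B' P' i' \<pi>' b2'"
  shows "same_ext_class M N B P i \<pi> (b1 + b2) B' P' i' \<pi>' (b1' + b2')"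
proof -
  obtain B2 P2 i2 \<pi>2 a c a' c' where q: "ses B2 P2 M i2 \<pi>2"
    "refines B P i \<pi> B2 P2 i2 \<pi>2 a c" "refines B' P' i' \<pi>' B2 P2 i2 \<pi>2 a' c'"
    using common_refinement[OF s] .
  obtain x where x: "x \<in> H P2 N" "b1 * c - b1' * c' = x * i2"
    using same_ext_class_common_refinement[OF s b(1,2) e(1) q] by blast
  obtain y where y: "y \<in> H P2 N" "b2 * c - b2' * c' = y * i2"
    using same_ext_class_common_refinement[OF s b(3,4) e(2) q] by blast
  have "(b1 + b2) * c - (b1' + b2') * c' = (b1 * c - b1' * c') + (b2 * c - b2' * c')" by (simp add: algebra_simps)
  then have "(b1 + b2) * c - (b1' + b2') * c' = (x + y) * i2" unfolding x y by (simp add: distrib_right)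
  from same_ext_class_of_common_refinement[OF s add_in[OF b(1,3)] add_in[OF b(2,4)] q add_in[OF x(1) y(1)] this]
  show ?thesis .
qed

lemma same_ext_class_post:
  assumes s: "ses B P M i \<pi>" "ses B' P' M i' \<pi>'" and b: "b \<in> H B N" "b' \<in> H B' N" and n: "n \<in> H N L"
    and e: "same_ext_class M N B P i \<pi> b B' P' i' \<pi>' b'"
  shows "same_ext_class M L B P i \<pi> (n * b) B' P' i' \<pi>' (n * b')"
proof -
  obtain B2 P2 i2 \<pi>2 a c a' c' where q: "ses B2 P2 M i2 \<pi>2"
    "refines B P i \<pi> B2 P2 i2 \<pi>2 a c" "refines B' P' i' \<pi>' B2 P2 i2 \<pi>2 a' c'"
    using common_refinement[OF s] .
  obtain x where x: "x \<in> H P2 N" "b * c - b' * c' = x * i2"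
    using same_ext_class_common_refinement[OF s b e q] by blast
  have "n * b * c - n * b' * c' = n * x * i2" using x(2) by (metis mult.assoc right_diff_distrib)
  from same_ext_class_of_common_refinement[OF s comp_in[OF n b(1)] comp_in[OF n b(2)] q comp_in[OF n x(1)] this]
  show ?thesis .
qed

lemma same_ext_class_zero:
  assumes s: "ses B P M i \<pi>" "ses B' P' M i' \<pi>'" and N: "N \<in> Obj"
  shows "same_ext_class M N B P i \<pi> 0 B' P' i' \<pi>' 0"
proof -
  obtain B2 P2 i2 \<pi>2 a c a' c' where q: "ses B2 P2 M i2 \<pi>2"
    "refines B P i \<pi> B2 P2 i2 \<pi>2 a c" "refines B' P' i' \<pi>' B2 P2 i2 \<pi>2 a' c'"
    using common_refinement[OF s] .
  have "0 * c - 0 * c' = 0 * i2" by simp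
  from same_ext_class_of_common_refinement[OF s zero_in[OF sesD(6)[OF s(1)] N] zero_in[OF sesD(6)[OF s(2)] N] q
      zero_in[OF sesD(7)[OF q(1)] N] this]
  show ?thesis .
qed

end

context lin_abelian
begin

definition make_roof :: "nat \<Rightarrow> 'o \<Rightarrow> 'o \<Rightarrow> ('o, ('o \<times> 'o \<Rightarrow> 'a) endo) cochain \<Rightarrow> (int \<Rightarrow> ('o \<times> 'o \<Rightarrow> 'a) endo) \<Rightarrow>
    (int \<Rightarrow> ('o \<times> 'o \<Rightarrow> 'a) endo) \<Rightarrow> ('o, 'a) roof" where
  "make_roof k M N Z s f = \<lparr>rsrc = stalk C M, rmid = unembed_complex Z, rtgt = shift C (int k) (stalk C N),
     rden = unembed_map (unembed_complex Z) (stalk C M) s, rnum = unembed_map (unembed_complex Z) (shift C (int k) (stalk C N)) f\<rparr>"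

lemma make_roof:
  assumes M: "M \<in> Ob C" "N \<in> Ob C" and i: "roof_data (stalk_at 0 M) (stalk_at (- int k) N) Z s f"
  shows "is_roof C (make_roof k M N Z s f)"
    "embed_map (unembed_complex Z) (stalk C M) (unembed_map (unembed_complex Z) (stalk C M) s) = s"
    "embed_map (unembed_complex Z) (shift C (int k) (stalk C N)) (unembed_map (unembed_complex Z) (shift C (int k) (stalk C N)) f) = f"
proof -
  have Z: "abs_complex Z" "abs_qis Z (stalk_at 0 M) s" "abs_chain_map Z (stalk_at (- int k) N) f" using i unfolding roof_data_def by auto
  note z = unembed_complex_bc[OF Z(1)] and m = stalk_st[OF M(1)] and n = stalk_st[OF M(2)]
  have s: "abs_chain_map (embed_complex (unembed_complex Z)) (embed_complex (stalk C M)) s" unfolding z(2) m(2) by (rule qiD(1)[OF Z(2)])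
  have f: "abs_chain_map (embed_complex (unembed_complex Z)) (embed_complex (shift C (int k) (stalk C N))) f" unfolding z(2) n(4) by (rule Z(3))
  note s' = chain_mapI[OF z(1) m(1) s] and f' = chain_mapI[OF z(1) n(3) f]
  show "embed_map (unembed_complex Z) (stalk C M) (unembed_map (unembed_complex Z) (stalk C M) s) = s"
    "embed_map (unembed_complex Z) (shift C (int k) (stalk C N)) (unembed_map (unembed_complex Z) (shift C (int k) (stalk C N)) f) = f" by (fact s' f')+
  have "quasi_iso C (unembed_complex Z) (stalk C M) (unembed_map (unembed_complex Z) (stalk C M) s)"
    unfolding quasi_iso_iff[OF z(1) m(1) s'(1)] s'(2) z(2) m(2) by (rule Z(2))
  then show "is_roof C (make_roof k M N Z s f)" unfolding is_roof_def make_roof_def using z(1) m(1) n(3) f'(1) by simp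
qed

lemma roof_rel_mkr:
  assumes M: "M \<in> Ob C" "N \<in> Ob C" and i: "roof_data (stalk_at 0 M) (stalk_at (- int k) N) Z s f"
    and r: "rsrc r = stalk C M" "rtgt r = shift C (int k) (stalk C N)"
  shows "roof_rel r (make_roof k M N Z s f) \<longleftrightarrow> roof_equiv (stalk_at 0 M) (stalk_at (- int k) N) (embed_complex (rmid r)) (embed_map (rmid r) (rsrc r) (rden r))
      (embed_map (rmid r) (rtgt r) (rnum r)) Z s f"
proof -
  have "abs_complex Z" using i unfolding roof_data_def by auto
  have m: "rmid (make_roof k M N Z s f) = unembed_complex Z" "rsrc (make_roof k M N Z s f) = stalk C M"
    "rtgt (make_roof k M N Z s f) = shift C (int k) (stalk C N)" "rden (make_roof k M N Z s f) = unembed_map (unembed_complex Z) (stalk C M) s"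
    "rnum (make_roof k M N Z s f) = unembed_map (unembed_complex Z) (shift C (int k) (stalk C N)) f" by (simp_all add: make_roof_def)
  show ?thesis unfolding roof_rel_def m make_roof(2,3)[OF assms(1-3)] unembed_complex_bc(2)[OF \<open>abs_complex Z\<close>] r stalk_st(2)[OF M(1)] stalk_st(4)[OF M(2)] ..
qed

lemma carrier_Ext: "carrier (Ext C k M N) =
    {roof_class C r | r. is_roof C r \<and> rsrc r = stalk C M \<and> rtgt r = shift C (int k) (stalk C N)}"
  unfolding Ext_def Db_def by simp

definition zero_roof :: "nat \<Rightarrow> 'o \<Rightarrow> 'o \<Rightarrow> ('o, 'a) roof" where
  "zero_roof k M N = \<lparr>rsrc = stalk C M, rmid = stalk C M, rtgt = shift C (int k) (stalk C N),
     rden = (\<lambda>n. Idn C (cobj (stalk C M) n)),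
     rnum = (\<lambda>n. \<zero>\<^bsub>Hom C (cobj (stalk C M) n) (cobj (shift C (int k) (stalk C N)) n)\<^esub>)\<rparr>"

lemma zero_Ext: "\<zero>\<^bsub>Ext C k M N\<^esub> = roof_class C (zero_roof k M N)"
  unfolding Ext_def Db_def zero_roof_def by simp

lemma zero_roof:
  assumes M: "M \<in> Ob C" "N \<in> Ob C"
  shows "is_roof C (zero_roof k M N)"
    "embed_map (stalk C M) (stalk C M) (\<lambda>n. Idn C (cobj (stalk C M) n)) = (\<lambda>n. Idm (cobj (stalk_at 0 M) n))"
    "embed_map (stalk C M) (shift C (int k) (stalk C N))
       (\<lambda>n. \<zero>\<^bsub>Hom C (cobj (stalk C M) n) (cobj (shift C (int k) (stalk C N)) n)\<^esub>) = (\<lambda>_. 0)"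
proof -
  note m = stalk_st[OF M(1)] and n = stalk_st(3,4)[OF M(2), of k]
  let ?X = "stalk C M" and ?Y = "shift C (int k) (stalk C N)"
  have c: "cobj (stalk_at 0 M) = cobj ?X" unfolding m(2)[symmetric] by simp
  show 1: "embed_map ?X ?X (\<lambda>n. Idn C (cobj ?X n)) = (\<lambda>n. Idm (cobj (stalk_at 0 M) n))"
    by (simp add: embed_map_def Idm_def c)
  show 2: "embed_map ?X ?Y (\<lambda>n. \<zero>\<^bsub>Hom C (cobj ?X n) (cobj ?Y n)\<^esub>) = (\<lambda>_. 0)"
    by (simp add: embed_map_def marr_zero bcD(1)[OF m(1)] bcD(1)[OF n(1)])
  have q: "abs_qis (embed_complex ?X) (embed_complex ?X) (embed_map ?X ?X (\<lambda>n. Idn C (cobj ?X n)))"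
    unfolding 1 m(2) by (rule abs_qis_id[OF stalk_at_cx[OF M(1)]])
  have i: "unembed_map ?X ?X (embed_map ?X ?X (\<lambda>n. Idn C (cobj ?X n))) = (\<lambda>n. Idn C (cobj ?X n))"
    using arrow_of_marr[OF bcD(1)[OF m(1)] bcD(1)[OF m(1)] Idn_in[OF bcD(1)[OF m(1)]]] by (simp add: unembed_map_def embed_map_def)
  have ci: "chain_map C ?X ?X (\<lambda>n. Idn C (cobj ?X n))" using chain_mapI(1)[OF m(1) m(1) qiD(1)[OF q]] unfolding i .
  have "quasi_iso C ?X ?X (\<lambda>n. Idn C (cobj ?X n))" using quasi_isoI[OF m(1) m(1) ci q] .
  moreover have "chain_map C ?X ?Y (\<lambda>n. \<zero>\<^bsub>Hom C (cobj ?X n) (cobj ?Y n)\<^esub>)"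
  proof -
    have cz: "abs_chain_map (embed_complex ?X) (embed_complex ?Y) (\<lambda>_. 0)" unfolding abs_chain_map_def using zero_in bcD(1)[OF m(1)] bcD(1)[OF n(1)] by simp
    have "unembed_map ?X ?Y (\<lambda>_. 0) = (\<lambda>n. \<zero>\<^bsub>Hom C (cobj ?X n) (cobj ?Y n)\<^esub>)"
      using arrow_of_marr[OF bcD(1)[OF m(1)] bcD(1)[OF n(1)] zero_in_Hom[OF bcD(1)[OF m(1)] bcD(1)[OF n(1)]]]
        marr_zero[OF bcD(1)[OF m(1)] bcD(1)[OF n(1)]] by (simp add: unembed_map_def)
    then show ?thesis using chain_mapI(1)[OF m(1) n(1) cz] by simp
  qed
  ultimately show "is_roof C (zero_roof k M N)" unfolding is_roof_def zero_roof_def using m(1) n(1) by simp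
qed

text \<open>A roof M -> N[2] over the ring is brought back to C, where its class is that of the zero
  roof, and the equality is transported to the ring.\<close>

lemma hereditary_her:
  assumes "hereditary C" shows ext2_zero
  unfolding ext2_zero_def
proof (intro allI impI)
  fix M N Z s f assume M: "M \<in> Ob C" "N \<in> Ob C" and i: "roof_data (stalk_at 0 M) (stalk_at (- 2) N) Z s f"
  have i: "roof_data (stalk_at 0 M) (stalk_at (- int 2) N) Z s f" using i by simp
  let ?r = "make_roof 2 M N Z s f" and ?z = "zero_roof 2 M N"
  note r = make_roof[OF M i] and z = zero_roof(1)[OF M, of 2] zero_roof(2)[OF M] zero_roof(3)[OF M, of 2]
  have "roof_class C ?r \<in> carrier (Ext C 2 M N)" unfolding carrier_Ext using r(1) by (auto simp: make_roof_def)
  then have "roof_class C ?r = roof_class C ?z"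
    using assms M unfolding hereditary_def zero_Ext by blast
  then have "roof_rel ?z ?r" using roof_class_eq[OF z(1) r(1)] unfolding roof_eq_iff by simp
  then have "roof_equiv (stalk_at 0 M) (stalk_at (- int 2) N) (stalk_at 0 M) (\<lambda>n. Idm (cobj (stalk_at 0 M) n)) (\<lambda>_. 0) Z s f"
    using roof_rel_mkr[OF M i, of ?z] z(2,3) stalk_st(2)[OF M(1)] by (simp add: zero_roof_def)
  from roof_equiv_sym[OF i this] show "roof_equiv (stalk_at 0 M) (stalk_at (- 2) N) Z s f (stalk_at 0 M) (\<lambda>n. Idm (cobj (stalk_at 0 M) n)) (\<lambda>_. 0)" by simp
qed

definition ext_class :: "'o \<Rightarrow> 'o \<Rightarrow> 'o \<Rightarrow> 'o \<Rightarrow> ('o \<times> 'o \<Rightarrow> 'a) endo \<Rightarrow> ('o \<times> 'o \<Rightarrow> 'a) endo \<Rightarrow>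
    ('o \<times> 'o \<Rightarrow> 'a) endo \<Rightarrow> ('o, 'a) roof set" where
  "ext_class M N B P i \<pi> b = roof_class C (make_roof 1 M N (two_term B P i) (supported_at 0 \<pi>) (supported_at (-1) b))"

lemma two_term_isr1: "ses B P M i \<pi> \<Longrightarrow> b \<in> Hm B N \<Longrightarrow> roof_data (stalk_at 0 M) (stalk_at (- int 1) N) (two_term B P i) (supported_at 0 \<pi>) (supported_at (-1) b)"
  using two_term_isr by simp

lemma ext_class_eq_iff:
  assumes s: "ses B P M i \<pi>" "b \<in> Hm B N" and s': "ses B' P' M i' \<pi>'" "b' \<in> Hm B' N"
  shows "ext_class M N B P i \<pi> b = ext_class M N B' P' i' \<pi>' b' \<longleftrightarrow> same_ext_class M N B P i \<pi> b B' P' i' \<pi>' b'"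
proof -
  have M: "M \<in> Ob C" "N \<in> Ob C" using sesD(8)[OF s(1)] cod_obj[OF s(2)] by auto
  note i = two_term_isr1[OF s] and i' = two_term_isr1[OF s']
  let ?r = "make_roof 1 M N (two_term B P i) (supported_at 0 \<pi>) (supported_at (-1) b)" and ?r' = "make_roof 1 M N (two_term B' P' i') (supported_at 0 \<pi>') (supported_at (-1) b')"
  have q: "rsrc ?r = stalk C M" "rtgt ?r = shift C (int 1) (stalk C N)" "rmid ?r = unembed_complex (two_term B P i)"
    "rden ?r = unembed_map (unembed_complex (two_term B P i)) (stalk C M) (supported_at 0 \<pi>)" "rnum ?r = unembed_map (unembed_complex (two_term B P i)) (shift C (int 1) (stalk C N)) (supported_at (-1) b)"
    "rsrc ?r' = stalk C M" "rtgt ?r' = shift C (int 1) (stalk C N)"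
    by (simp_all add: make_roof_def)
  have "roof_rel ?r ?r' \<longleftrightarrow> same_ext_class M N B P i \<pi> b B' P' i' \<pi>' b'"
    unfolding roof_rel_mkr[OF M i' q(1,2)] q make_roof(2,3)[OF M i] unembed_complex_bc(2)[OF two_term_qi(1)[OF s(1)]] same_ext_class_def by simp
  then show ?thesis unfolding ext_class_def roof_class_eq[OF make_roof(1)[OF M i] make_roof(1)[OF M i']] roof_eq_iff
    using make_roof(1)[OF M i] make_roof(1)[OF M i'] q by simp
qed

lemma ext_class_in:
  assumes s: "ses B P M i \<pi>" "b \<in> Hm B N"
  shows "ext_class M N B P i \<pi> b \<in> carrier (Ext C 1 M N)"
  unfolding carrier_Ext ext_class_def using make_roof(1)[OF sesD(8)[OF s(1)] cod_obj[OF s(2)] two_term_isr1[OF s]]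
  by (auto simp: make_roof_def)

text \<open>The reduction depends on the middle and the denominator of r only and works for all
  numerators at once. This uniformity turns sums of roofs over a common denominator into sums of
  arrows out of B.\<close>

definition reduces :: "'o \<Rightarrow> 'o \<Rightarrow> ('o, 'a) roof \<Rightarrow> 'o \<Rightarrow> 'o \<Rightarrow> ('o \<times> 'o \<Rightarrow> 'a) endo \<Rightarrow> ('o \<times> 'o \<Rightarrow> 'a) endo \<Rightarrow>
    ('o \<times> 'o \<Rightarrow> 'a) endo \<Rightarrow> bool" where
  "reduces M N r B P i \<pi> q \<longleftrightarrow> ses B P M i \<pi> \<and> (\<forall>s. is_roof C s \<longrightarrow> rsrc s = rsrc r \<longrightarrow> rtgt s = rtgt r \<longrightarrow>
     rmid s = rmid r \<longrightarrow> rden s = rden r \<longrightarrow> (\<exists>b\<in>Hm B N. b * q = embed_map (rmid r) (rtgt r) (rnum s) (-1)) \<and>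
     (\<forall>b\<in>Hm B N. b * q = embed_map (rmid r) (rtgt r) (rnum s) (-1) \<longrightarrow> roof_class C s = ext_class M N B P i \<pi> b))"

lemma reducesD:
  assumes "reduces M N r B P i \<pi> q"
  shows "ses B P M i \<pi>"
    "\<And>s. is_roof C s \<Longrightarrow> rsrc s = rsrc r \<Longrightarrow> rtgt s = rtgt r \<Longrightarrow> rmid s = rmid r \<Longrightarrow> rden s = rden r \<Longrightarrow>
       \<exists>b\<in>Hm B N. b * q = embed_map (rmid r) (rtgt r) (rnum s) (-1)"
    "\<And>s b. is_roof C s \<Longrightarrow> rsrc s = rsrc r \<Longrightarrow> rtgt s = rtgt r \<Longrightarrow> rmid s = rmid r \<Longrightarrow> rden s = rden r \<Longrightarrow>
       b \<in> Hm B N \<Longrightarrow> b * q = embed_map (rmid r) (rtgt r) (rnum s) (-1) \<Longrightarrow> roof_class C s = ext_class M N B P i \<pi> b"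
  using assms unfolding reduces_def by simp_all

lemma roof_reduce:
  assumes M: "M \<in> Ob C" "N \<in> Ob C" and r: "is_roof C r" "rsrc r = stalk C M" "rtgt r = shift C (int 1) (stalk C N)"
  obtains B P i \<pi> q where "reduces M N r B P i \<pi> q"
proof -
  note R = is_roofD(6)[OF r(1)] and m = stalk_st(2)[OF M(1)] and n = stalk_st(4)[OF M(2), of 1]
  have q: "abs_complex (embed_complex (rmid r))" "abs_qis (embed_complex (rmid r)) (stalk_at 0 M) (embed_map (rmid r) (rsrc r) (rden r))"
    using R unfolding roof_data_def r(2) m by auto
  obtain B P i \<pi> q where t: "ses B P M i \<pi>" "q \<in> Hm (cobj (embed_complex (rmid r)) (-1)) B" "epi B q"
    "\<And>N f. N \<in> Ob C \<Longrightarrow> abs_chain_map (embed_complex (rmid r)) (stalk_at (-1) N) f \<Longrightarrow> \<exists>b\<in>Hm B N. b * q = f (-1)"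
    "\<And>N f b. abs_chain_map (embed_complex (rmid r)) (stalk_at (-1) N) f \<Longrightarrow> b \<in> Hm B N \<Longrightarrow> b * q = f (-1) \<Longrightarrow>
      roof_equiv (stalk_at 0 M) (stalk_at (-1) N) (embed_complex (rmid r)) (embed_map (rmid r) (rsrc r) (rden r)) f (two_term B P i) (supported_at 0 \<pi>) (supported_at (-1) b)"
    using truncate[OF q] by metis
  have c: "abs_chain_map (embed_complex (rmid r)) (stalk_at (-1) N) (embed_map (rmid r) (rtgt r) (rnum s))"
    if s: "is_roof C s" "rtgt s = rtgt r" "rmid s = rmid r" for s
    using is_roofD(6)[OF s(1)] unfolding roof_data_def s(2,3) r(3) n by simp
  have "reduces M N r B P i \<pi> q" unfolding reduces_def
  proof (intro conjI allI impI ballI)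
    show "ses B P M i \<pi>" by (rule t(1))
  next
    fix s assume s: "is_roof C s" "rsrc s = rsrc r" "rtgt s = rtgt r" "rmid s = rmid r" "rden s = rden r"
    show "\<exists>b\<in>Hm B N. b * q = embed_map (rmid r) (rtgt r) (rnum s) (-1)" using t(4)[OF M(2) c[OF s(1,3,4)]] .
    fix b assume b: "b \<in> Hm B N" "b * q = embed_map (rmid r) (rtgt r) (rnum s) (-1)"
    have "roof_rel s (make_roof 1 M N (two_term B P i) (supported_at 0 \<pi>) (supported_at (-1) b))"
      unfolding roof_rel_mkr[OF M two_term_isr1[OF t(1) b(1)] s(2)[unfolded r(2)] s(3)[unfolded r(3)]]
      unfolding s using t(5)[OF c[OF s(1,3,4)] b] by simp
    moreover have "is_roof C (make_roof 1 M N (two_term B P i) (supported_at 0 \<pi>) (supported_at (-1) b))" by (rule make_roof(1)[OF M two_term_isr1[OF t(1) b(1)]])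
    ultimately show "roof_class C s = ext_class M N B P i \<pi> b"
      unfolding ext_class_def using roof_class_eq[OF s(1)] s(1-3) r(2,3) unfolding roof_eq_iff by (simp add: make_roof_def)
  qed
  then show ?thesis by (rule that)
qed

lemma ext_class_surj:
  assumes M: "M \<in> Ob C" "N \<in> Ob C" and p: "\<phi> \<in> carrier (Ext C 1 M N)"
  obtains B P i \<pi> b where "ses B P M i \<pi>" "b \<in> Hm B N" "\<phi> = ext_class M N B P i \<pi> b"
proof -
  obtain r where r: "is_roof C r" "rsrc r = stalk C M" "rtgt r = shift C (int 1) (stalk C N)" "\<phi> = roof_class C r"
    using p unfolding carrier_Ext by blast
  obtain B P i \<pi> q where "reduces M N r B P i \<pi> q" using roof_reduce[OF M r(1-3)] .
  note t = reducesD[OF this]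
  obtain b where "b \<in> Hm B N" "b * q = embed_map (rmid r) (rtgt r) (rnum r) (-1)" using t(2)[OF r(1)] by blast
  then show ?thesis using that[OF t(1)] t(3)[OF r(1)] r(4) by blast
qed

text \<open>Scalars become composition with a multiple of the identity of N, so the action of the
  field is another instance of multiplication in the ring.\<close>

definition scalar :: "'o \<Rightarrow> 'k \<Rightarrow> ('o \<times> 'o \<Rightarrow> 'a) endo" where
  "scalar N c = marr C N N (c \<odot>\<^bsub>Hom C N N\<^esub> Idn C N)"

lemma smult_in: "X \<in> Ob C \<Longrightarrow> Y \<in> Ob C \<Longrightarrow> c \<in> carrier F \<Longrightarrow> f \<in> carrier (Hom C X Y) \<Longrightarrow>
    c \<odot>\<^bsub>Hom C X Y\<^esub> f \<in> carrier (Hom C X Y)"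
  using vs unfolding vectorspace_def by (blast intro: module.smult_closed)

lemma scalar:
  assumes N: "N \<in> Ob C" and c: "c \<in> carrier F" "d \<in> carrier F"
  shows "scalar N c \<in> Hm N N" "scalar N (c \<oplus>\<^bsub>F\<^esub> d) = scalar N c + scalar N d" "scalar N (c \<otimes>\<^bsub>F\<^esub> d) = scalar N c * scalar N d"
    "scalar N \<one>\<^bsub>F\<^esub> = Idm N"
    "X \<in> Ob C \<Longrightarrow> f \<in> carrier (Hom C X N) \<Longrightarrow> marr C X N (c \<odot>\<^bsub>Hom C X N\<^esub> f) = scalar N c * marr C X N f"
proof -
  interpret vectorspace F "Hom C N N" by (rule vs[OF N N])
  note I = Idn_in[OF N] and s = smult_in[OF N N _ Idn_in[OF N]]
  show "scalar N c \<in> Hm N N" unfolding scalar_def using HmI[OF N N s[OF c(1)]] .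
  show "scalar N (c \<oplus>\<^bsub>F\<^esub> d) = scalar N c + scalar N d"
    unfolding scalar_def smult_l_distr[OF c I] by (rule marr_add[OF N N s[OF c(1)] s[OF c(2)]])
  show "scalar N \<one>\<^bsub>F\<^esub> = Idm N" unfolding scalar_def Idm_def smult_one[OF I] ..
  have "(c \<odot>\<^bsub>Hom C N N\<^esub> Idn C N) \<bullet>\<^bsub>C\<^esub> (d \<odot>\<^bsub>Hom C N N\<^esub> Idn C N) = c \<odot>\<^bsub>Hom C N N\<^esub> (d \<odot>\<^bsub>Hom C N N\<^esub> Idn C N)"
    using Comp_smult(2)[OF N N N c(1) s[OF c(2)] I] Comp_Idn(2)[OF N N s[OF c(2)]] by simp
  then show "scalar N (c \<otimes>\<^bsub>F\<^esub> d) = scalar N c * scalar N d"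
    unfolding scalar_def smult_assoc1[OF c I] using marr_comp[OF N N N s[OF c(2)] s[OF c(1)]] by simp
  assume X: "X \<in> Ob C" and f: "f \<in> carrier (Hom C X N)"
  show "marr C X N (c \<odot>\<^bsub>Hom C X N\<^esub> f) = scalar N c * marr C X N f"
    unfolding scalar_def using marr_comp[OF X N N f s[OF c(1)]] Comp_smult(2)[OF X N N c(1) f I] Comp_Idn(2)[OF X N f] by simp
qed

lemma chain_map_add:
  assumes X: "bounded_complex C X" and Y: "bounded_complex C Y" and f: "chain_map C X Y f" and g: "chain_map C X Y g"
  shows "chain_map C X Y (\<lambda>n. f n \<oplus>\<^bsub>Hom C (cobj X n) (cobj Y n)\<^esub> g n)"
proof -
  note x = bcD[OF X] and y = bcD[OF Y] and ff = chain_mapD(1)[OF X Y f] and gg = chain_mapD(1)[OF X Y g]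
  have "f (n + 1) \<bullet>\<^bsub>C\<^esub> diff X n = diff Y n \<bullet>\<^bsub>C\<^esub> f n" "g (n + 1) \<bullet>\<^bsub>C\<^esub> diff X n = diff Y n \<bullet>\<^bsub>C\<^esub> g n" for n
    using f g unfolding chain_map_def by auto
  then show ?thesis unfolding chain_map_def
    using Comp_add(1)[OF x(1) y(1) y(1) ff gg y(2) y(2)] Comp_add(2)[OF x(1) x(1) y(1) x(2) x(2) ff gg]
      abelian_groupE(1)[OF ab[OF x(1) y(1)] ff gg] by simp
qed

lemma chain_map_smult:
  assumes X: "bounded_complex C X" and Y: "bounded_complex C Y" and f: "chain_map C X Y f" and c: "c \<in> carrier F"
  shows "chain_map C X Y (\<lambda>n. c \<odot>\<^bsub>Hom C (cobj X n) (cobj Y n)\<^esub> f n)"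
proof -
  note x = bcD[OF X] and y = bcD[OF Y] and ff = chain_mapD(1)[OF X Y f]
  have "f (n + 1) \<bullet>\<^bsub>C\<^esub> diff X n = diff Y n \<bullet>\<^bsub>C\<^esub> f n" for n
    using f unfolding chain_map_def by auto
  then show ?thesis unfolding chain_map_def
    using Comp_smult(1)[OF x(1) y(1) y(1) c ff y(2)] Comp_smult(2)[OF x(1) x(1) y(1) c x(2) ff]
      smult_in[OF x(1) y(1) c ff] by simp
qed

lemma shift_cobj: "N \<in> Ob C \<Longrightarrow> cobj (shift C (int 1) (stalk C N)) (-1) = N"
proof -
  assume N: "N \<in> Ob C"
  have "cobj (shift C (int 1) (stalk C N)) = cobj (embed_complex (shift C (int 1) (stalk C N)))" by simp
  then show ?thesis unfolding stalk_st(4)[OF N] by simp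
qed

lemma roof_classD:
  assumes s: "ses B P M i \<pi>" "b \<in> Hm B N" and r: "r \<in> ext_class M N B P i \<pi> b"
  shows "is_roof C r" "rsrc r = stalk C M" "rtgt r = shift C (int 1) (stalk C N)" "roof_class C r = ext_class M N B P i \<pi> b"
proof -
  let ?m = "make_roof 1 M N (two_term B P i) (supported_at 0 \<pi>) (supported_at (-1) b)"
  have e: "roof_eq C ?m r" using r unfolding ext_class_def roof_class_def by simp
  then show r: "is_roof C r" "rsrc r = stalk C M" "rtgt r = shift C (int 1) (stalk C N)"
    unfolding roof_eq_iff by (simp_all add: make_roof_def)
  have "is_roof C ?m" using e unfolding roof_eq_iff by blast
  from roof_class_eq[OF this r(1)] e show "roof_class C r = ext_class M N B P i \<pi> b" unfolding ext_class_def by simp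
qed

lemma make_roof_in_Th:
  assumes s: "ses B P M i \<pi>" "b \<in> Hm B N"
  shows "make_roof 1 M N (two_term B P i) (supported_at 0 \<pi>) (supported_at (-1) b) \<in> ext_class M N B P i \<pi> b"
  unfolding ext_class_def roof_class_def
  using roof_eq_refl[OF make_roof(1)[OF sesD(8)[OF s(1)] cod_obj[OF s(2)] two_term_isr1[OF s]]] by simp

text \<open>\<open>roof_add\<close> is a union over all pairs of representatives with equal middle
  and denominator. Every member of the union is shown to be the same class, and the two-term roofs
  show that the union is not empty.\<close>

lemma ext_class_add:
  assumes s: "ses B P M i \<pi>" and b: "b \<in> Hm B N" "b' \<in> Hm B N"
  shows "ext_class M N B P i \<pi> b \<oplus>\<^bsub>Ext C 1 M N\<^esub> ext_class M N B P i \<pi> b' = ext_class M N B P i \<pi> (b + b')"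
proof -
  have M: "M \<in> Ob C" "N \<in> Ob C" using sesD(8)[OF s] cod_obj[OF b(1)] by auto
  let ?add = "\<lambda>r t :: ('o, 'a) roof. r\<lparr>rnum := (\<lambda>n. rnum r n \<oplus>\<^bsub>Hom C (cobj (rmid r) n) (cobj (rtgt r) n)\<^esub> rnum t n)\<rparr>"
  let ?S = "{roof_class C (?add r t) | r t.
     r \<in> ext_class M N B P i \<pi> b \<and> t \<in> ext_class M N B P i \<pi> b' \<and> rmid r = rmid t \<and> rden r = rden t}"
  have key: "roof_class C (?add r t) = ext_class M N B P i \<pi> (b + b')"
    if rt: "r \<in> ext_class M N B P i \<pi> b" "t \<in> ext_class M N B P i \<pi> b'" "rmid r = rmid t" "rden r = rden t" for r t
  proof -
    note r = roof_classD[OF s b(1) rt(1)] and t = roof_classD[OF s b(2) rt(2)]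
    note R = is_roofD[OF r(1)] and T = is_roofD[OF t(1)]
    let ?a = "?add r t"
    have tn: "chain_map C (rmid r) (rtgt r) (rnum t)" using T(5) t(3) r(3) rt(3) by simp
    have a: "is_roof C ?a" "rsrc ?a = rsrc r" "rtgt ?a = rtgt r" "rmid ?a = rmid r" "rden ?a = rden r"
      using r(1) chain_map_add[OF R(2,3,5) tn] unfolding is_roof_def by simp_all
    \<comment> \<open>r and t share middle and denominator, so one reduction serves r, t and their
      sum.\<close>
    obtain B1 P1 i1 \<pi>1 q where "reduces M N r B1 P1 i1 \<pi>1 q"
      using roof_reduce[OF M r(1-3)] .
    note w = reducesD[OF this]
    have tt: "rsrc t = rsrc r" "rtgt t = rtgt r" "rmid t = rmid r" "rden t = rden r" using r t rt by auto
    obtain b1 where b1: "b1 \<in> Hm B1 N" "b1 * q = embed_map (rmid r) (rtgt r) (rnum r) (-1)" using w(2)[OF r(1)] by blast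
    obtain b2 where b2: "b2 \<in> Hm B1 N" "b2 * q = embed_map (rmid r) (rtgt r) (rnum t) (-1)" using w(2)[OF t(1) tt] by blast
    have "embed_map (rmid r) (rtgt r) (rnum ?a) (-1) = (b1 + b2) * q"
      unfolding distrib_right b1(2) b2(2) embed_map_def
      using marr_add[OF bcD(1)[OF R(2)] bcD(1)[OF R(3)] chain_mapD(1)[OF R(2,3,5)] chain_mapD(1)[OF R(2,3) tn]] by simp
    then have "roof_class C ?a = ext_class M N B1 P1 i1 \<pi>1 (b1 + b2)"
      using w(3)[OF a add_in[OF b1(1) b2(1)]] by simp
    moreover have "ext_class M N B P i \<pi> b = ext_class M N B1 P1 i1 \<pi>1 b1" using w(3)[OF r(1) _ _ _ _ b1] r(4) by simp
    moreover have "ext_class M N B P i \<pi> b' = ext_class M N B1 P1 i1 \<pi>1 b2" using w(3)[OF t(1) tt b2] t(4) by simp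
    ultimately show ?thesis
      using same_ext_class_add[OF s w(1) b(1) b1(1) b(2) b2(1)] ext_class_eq_iff[OF s b(1) w(1) b1(1)] ext_class_eq_iff[OF s b(2) w(1) b2(1)]
        ext_class_eq_iff[OF s add_in[OF b] w(1) add_in[OF b1(1) b2(1)]] by metis
  qed
  have "roof_class C (?add (make_roof 1 M N (two_term B P i) (supported_at 0 \<pi>) (supported_at (-1) b)) (make_roof 1 M N (two_term B P i) (supported_at 0 \<pi>) (supported_at (-1) b'))) \<in> ?S"
    using make_roof_in_Th[OF s b(1)] make_roof_in_Th[OF s b(2)]
    by (intro CollectI exI[of _ "make_roof 1 M N (two_term B P i) (supported_at 0 \<pi>) (supported_at (-1) b)"]
      exI[of _ "make_roof 1 M N (two_term B P i) (supported_at 0 \<pi>) (supported_at (-1) b')"]) (simp add: make_roof_def)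
  then have "?S = {ext_class M N B P i \<pi> (b + b')}" using key by blast
  then have "\<Union>?S = ext_class M N B P i \<pi> (b + b')" by simp
  then show ?thesis unfolding Ext_def Db_def roof_add_def by simp
qed

lemma ext_class_smult:
  assumes s: "ses B P M i \<pi>" and b: "b \<in> Hm B N" and c: "c \<in> carrier F"
  shows "c \<odot>\<^bsub>Ext C 1 M N\<^esub> ext_class M N B P i \<pi> b = ext_class M N B P i \<pi> (scalar N c * b)"
proof -
  have M: "M \<in> Ob C" "N \<in> Ob C" using sesD(8)[OF s] cod_obj[OF b(1)] by auto
  note scN = scalar(1)[OF M(2) c c]
  let ?sm = "\<lambda>r :: ('o, 'a) roof. r\<lparr>rnum := (\<lambda>n. c \<odot>\<^bsub>Hom C (cobj (rmid r) n) (cobj (rtgt r) n)\<^esub> rnum r n)\<rparr>"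
  let ?S = "{roof_class C (?sm r) | r. r \<in> ext_class M N B P i \<pi> b}"
  have key: "roof_class C (?sm r) = ext_class M N B P i \<pi> (scalar N c * b)" if rt: "r \<in> ext_class M N B P i \<pi> b" for r
  proof -
    note r = roof_classD[OF s b rt]
    note R = is_roofD[OF r(1)]
    let ?a = "?sm r"
    have a: "is_roof C ?a" "rsrc ?a = rsrc r" "rtgt ?a = rtgt r" "rmid ?a = rmid r" "rden ?a = rden r"
      using r(1) chain_map_smult[OF R(2,3,5) c] unfolding is_roof_def by simp_all
    obtain B1 P1 i1 \<pi>1 q where "reduces M N r B1 P1 i1 \<pi>1 q"
      using roof_reduce[OF M r(1-3)] .
    note w = reducesD[OF this]
    obtain b1 where b1: "b1 \<in> Hm B1 N" "b1 * q = embed_map (rmid r) (rtgt r) (rnum r) (-1)" using w(2)[OF r(1)] by blast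
    have co: "cobj (rtgt r) (-1) = N" unfolding r(3) by (rule shift_cobj[OF M(2)])
    have "embed_map (rmid r) (rtgt r) (rnum ?a) (-1) = scalar N c * b1 * q"
      unfolding mult.assoc b1(2) embed_map_def
      using scalar(5)[OF M(2) c c bcD(1)[OF R(2)], of "rnum r (-1)" "-1"] chain_mapD(1)[OF R(2,3,5), of "-1"] co by simp
    then have "roof_class C ?a = ext_class M N B1 P1 i1 \<pi>1 (scalar N c * b1)"
      using w(3)[OF a comp_in[OF scN b1(1)]] by simp
    moreover have "ext_class M N B P i \<pi> b = ext_class M N B1 P1 i1 \<pi>1 b1" using w(3)[OF r(1) _ _ _ _ b1] r(4) by simp
    ultimately show ?thesis
      using same_ext_class_post[OF s w(1) b(1) b1(1) scN] ext_class_eq_iff[OF s b w(1) b1(1)]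
        ext_class_eq_iff[OF s comp_in[OF scN b] w(1) comp_in[OF scN b1(1)]] by metis
  qed
  have "roof_class C (?sm (make_roof 1 M N (two_term B P i) (supported_at 0 \<pi>) (supported_at (-1) b))) \<in> ?S"
    using make_roof_in_Th[OF s b] by blast
  then have "?S = {ext_class M N B P i \<pi> (scalar N c * b)}" using key by blast
  then have "\<Union>?S = ext_class M N B P i \<pi> (scalar N c * b)" by simp
  then show ?thesis unfolding Ext_def Db_def roof_smult_def by simp
qed

lemma ext_class_zero:
  assumes s: "ses B P M i \<pi>" and N: "N \<in> Ob C"
  shows "\<zero>\<^bsub>Ext C 1 M N\<^esub> = ext_class M N B P i \<pi> 0"
proof -
  note M = sesD(8)[OF s]
  note z = zero_roof(1)[OF M N, of 1] zero_roof(2)[OF M N] zero_roof(3)[OF M N, of 1]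
  have zr: "rsrc (zero_roof 1 M N) = stalk C M" "rtgt (zero_roof 1 M N) = shift C (int 1) (stalk C N)"
    "rmid (zero_roof 1 M N) = stalk C M" by (simp_all add: zero_roof_def)
  obtain B1 P1 i1 \<pi>1 q where "reduces M N (zero_roof 1 M N) B1 P1 i1 \<pi>1 q"
      using roof_reduce[OF M N z(1) zr(1,2)] .
    note w = reducesD[OF this]
  have 0: "0 \<in> Hm B N" "0 \<in> Hm B1 N" using zero_in N sesD(6)[OF s] sesD(6)[OF w(1)] by auto
  have "0 * q = embed_map (rmid (zero_roof 1 M N)) (rtgt (zero_roof 1 M N)) (rnum (zero_roof 1 M N)) (-1)"
    using fun_cong[OF z(3), of "-1"] by (simp add: zero_roof_def)
  from w(3)[OF z(1) refl refl refl refl 0(2) this]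
  have "\<zero>\<^bsub>Ext C 1 M N\<^esub> = ext_class M N B1 P1 i1 \<pi>1 0" unfolding zero_Ext .
  then show ?thesis using ext_class_eq_iff[OF w(1) 0(2) s 0(1)] same_ext_class_zero[OF w(1) s N] by simp
qed

lemma ext_class_refine:
  assumes s: "ses B P M i \<pi>" "ses B2 P2 M i2 \<pi>2" "refines B P i \<pi> B2 P2 i2 \<pi>2 a c" "b \<in> Hm B N"
  shows "ext_class M N B P i \<pi> b = ext_class M N B2 P2 i2 \<pi>2 (b * c)"
  using ext_class_eq_iff[OF s(1,4,2) comp_in[OF s(4) refinesD(2)[OF s(3)]]] same_ext_class_refines[OF s] by blast

lemma ext_class_common:
  assumes M: "M \<in> Ob C" "N \<in> Ob C" and p: "\<phi> \<in> carrier (Ext C 1 M N)" and s: "ses B0 P0 M i0 \<pi>0"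
  obtains B P i \<pi> a c b where "ses B P M i \<pi>" "refines B0 P0 i0 \<pi>0 B P i \<pi> a c" "b \<in> Hm B N" "\<phi> = ext_class M N B P i \<pi> b"
proof -
  obtain B P i \<pi> b where t: "ses B P M i \<pi>" "b \<in> Hm B N" "\<phi> = ext_class M N B P i \<pi> b" using ext_class_surj[OF M p] .
  obtain B2 P2 i2 \<pi>2 a c a' c' where q: "ses B2 P2 M i2 \<pi>2"
    "refines B0 P0 i0 \<pi>0 B2 P2 i2 \<pi>2 a c" "refines B P i \<pi> B2 P2 i2 \<pi>2 a' c'"
    using common_refinement[OF s t(1)] .
  show ?thesis
    by (rule that[OF q(1,2) comp_in[OF t(2) refinesD(2)[OF q(3)]]]) (use t(3) ext_class_refine[OF t(1) q(1,3) t(2)] in simp)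
qed

lemma ext_class_common3:
  assumes M: "M \<in> Ob C" "N \<in> Ob C"
    and p: "\<phi> \<in> carrier (Ext C 1 M N)" "\<chi> \<in> carrier (Ext C 1 M N)" "\<psi> \<in> carrier (Ext C 1 M N)"
  obtains B P i \<pi> b1 b2 b3 where "ses B P M i \<pi>" "b1 \<in> Hm B N" "b2 \<in> Hm B N" "b3 \<in> Hm B N"
    "\<phi> = ext_class M N B P i \<pi> b1" "\<chi> = ext_class M N B P i \<pi> b2" "\<psi> = ext_class M N B P i \<pi> b3"
proof -
  obtain B P i \<pi> b where t: "ses B P M i \<pi>" "b \<in> Hm B N" "\<phi> = ext_class M N B P i \<pi> b" using ext_class_surj[OF M p(1)] .
  obtain B' P' i' \<pi>' a c b' where u: "ses B' P' M i' \<pi>'" "refines B P i \<pi> B' P' i' \<pi>' a c" "b' \<in> Hm B' N" "\<chi> = ext_class M N B' P' i' \<pi>' b'"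
    using ext_class_common[OF M p(2) t(1)] .
  obtain B2 P2 i2 \<pi>2 a' c' b2 where v: "ses B2 P2 M i2 \<pi>2" "refines B' P' i' \<pi>' B2 P2 i2 \<pi>2 a' c'" "b2 \<in> Hm B2 N" "\<psi> = ext_class M N B2 P2 i2 \<pi>2 b2"
    using ext_class_common[OF M p(3) u(1)] .
  note r = refines_trans[OF u(2) v(2)]
  show ?thesis
    by (rule that[OF v(1) comp_in[OF t(2) refinesD(2)[OF r]] comp_in[OF u(3) refinesD(2)[OF v(2)]] v(3)])
      (use t(3) ext_class_refine[OF t(1) v(1) r t(2)] u(4) ext_class_refine[OF u(1) v(1,2) u(3)] v(4) in simp_all)
qed

text \<open>Three classes can be represented over a single resolution, where the axioms become ring
  identities for arrows out of B. The structure is what ties the dimension in \<open>euler\<close>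
  to a cardinality.\<close>

lemma vectorspace_Ext:
  assumes M: "M \<in> Ob C" "N \<in> Ob C"
  shows "vectorspace F (Ext C 1 M N)"
proof -
  interpret F: field F by (rule fieldF)
  let ?E = "Ext C 1 M N"
  have ab: "abelian_group ?E"
  proof (rule abelian_groupI)
    obtain B i where s: "ses B M M i (Idm M)" using ses_of_epi[OF id_in[OF M(1)] epi_id[OF M(1)]] .
    show "\<zero>\<^bsub>?E\<^esub> \<in> carrier ?E" unfolding ext_class_zero[OF s M(2)] by (rule ext_class_in[OF s zero_in[OF sesD(6)[OF s] M(2)]])
  next
    fix x y z assume p: "x \<in> carrier ?E" "y \<in> carrier ?E" "z \<in> carrier ?E"
    obtain B P i \<pi> b1 b2 b3 where t: "ses B P M i \<pi>" "b1 \<in> Hm B N" "b2 \<in> Hm B N" "b3 \<in> Hm B N"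
      "x = ext_class M N B P i \<pi> b1" "y = ext_class M N B P i \<pi> b2" "z = ext_class M N B P i \<pi> b3" using ext_class_common3[OF M p] .
    show "x \<oplus>\<^bsub>?E\<^esub> y \<oplus>\<^bsub>?E\<^esub> z = x \<oplus>\<^bsub>?E\<^esub> (y \<oplus>\<^bsub>?E\<^esub> z)"
      unfolding t(5-7) ext_class_add[OF t(1-3)] ext_class_add[OF t(1,3,4)] ext_class_add[OF t(1) add_in[OF t(2,3)] t(4)]
        ext_class_add[OF t(1,2) add_in[OF t(3,4)]] add.assoc ..
  next
    fix x y assume p: "x \<in> carrier ?E" "y \<in> carrier ?E"
    obtain B P i \<pi> b1 b2 b3 where t: "ses B P M i \<pi>" "b1 \<in> Hm B N" "b2 \<in> Hm B N" "b3 \<in> Hm B N"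
      "x = ext_class M N B P i \<pi> b1" "y = ext_class M N B P i \<pi> b2" "y = ext_class M N B P i \<pi> b3" using ext_class_common3[OF M p p(2)] .
    show "x \<oplus>\<^bsub>?E\<^esub> y \<in> carrier ?E" unfolding t(5,6) ext_class_add[OF t(1-3)] by (rule ext_class_in[OF t(1) add_in[OF t(2,3)]])
    show "x \<oplus>\<^bsub>?E\<^esub> y = y \<oplus>\<^bsub>?E\<^esub> x" unfolding t(5,6) ext_class_add[OF t(1-3)] ext_class_add[OF t(1,3,2)] by (simp add: add.commute)
  next
    fix x assume p: "x \<in> carrier ?E"
    obtain B P i \<pi> b where t: "ses B P M i \<pi>" "b \<in> Hm B N" "x = ext_class M N B P i \<pi> b" using ext_class_surj[OF M p] .
    have 0: "0 \<in> Hm B N" by (rule zero_in[OF sesD(6)[OF t(1)] M(2)])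
    show "\<zero>\<^bsub>?E\<^esub> \<oplus>\<^bsub>?E\<^esub> x = x" unfolding ext_class_zero[OF t(1) M(2)] t(3) ext_class_add[OF t(1) 0 t(2)] by simp
    have "ext_class M N B P i \<pi> (- b) \<oplus>\<^bsub>?E\<^esub> x = \<zero>\<^bsub>?E\<^esub>"
      unfolding ext_class_zero[OF t(1) M(2)] t(3) ext_class_add[OF t(1) minus_in[OF t(2)] t(2)] by simp
    then show "\<exists>y\<in>carrier ?E. y \<oplus>\<^bsub>?E\<^esub> x = \<zero>\<^bsub>?E\<^esub>" using ext_class_in[OF t(1) minus_in[OF t(2)]] by blast
  qed
  have "module F ?E"
  proof (rule moduleI[OF F.is_cring ab])
    fix c x assume c: "c \<in> carrier F" and p: "x \<in> carrier ?E"
    obtain B P i \<pi> b where t: "ses B P M i \<pi>" "b \<in> Hm B N" "x = ext_class M N B P i \<pi> b" using ext_class_surj[OF M p] .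
    show "c \<odot>\<^bsub>?E\<^esub> x \<in> carrier ?E" unfolding t(3) ext_class_smult[OF t(1,2) c]
      by (rule ext_class_in[OF t(1) comp_in[OF scalar(1)[OF M(2) c c] t(2)]])
  next
    fix c d x assume c: "c \<in> carrier F" "d \<in> carrier F" and p: "x \<in> carrier ?E"
    obtain B P i \<pi> b where t: "ses B P M i \<pi>" "b \<in> Hm B N" "x = ext_class M N B P i \<pi> b" using ext_class_surj[OF M p] .
    note s = scalar[OF M(2) c] and cd = comp_in[OF scalar(1)[OF M(2) c(1) c(1)] t(2)] comp_in[OF scalar(1)[OF M(2) c(2) c(2)] t(2)]
    show "(c \<oplus>\<^bsub>F\<^esub> d) \<odot>\<^bsub>?E\<^esub> x = c \<odot>\<^bsub>?E\<^esub> x \<oplus>\<^bsub>?E\<^esub> d \<odot>\<^bsub>?E\<^esub> x"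
      unfolding t(3) ext_class_smult[OF t(1,2) c(1)] ext_class_smult[OF t(1,2) c(2)] ext_class_smult[OF t(1,2) F.add.m_closed[OF c]]
        ext_class_add[OF t(1) cd] s(2) distrib_right ..
    show "c \<otimes>\<^bsub>F\<^esub> d \<odot>\<^bsub>?E\<^esub> x = c \<odot>\<^bsub>?E\<^esub> (d \<odot>\<^bsub>?E\<^esub> x)"
      unfolding t(3) ext_class_smult[OF t(1,2) c(2)] ext_class_smult[OF t(1,2) F.m_closed[OF c]] ext_class_smult[OF t(1) cd(2) c(1)] s(3) mult.assoc ..
  next
    fix c x y assume c: "c \<in> carrier F" and p: "x \<in> carrier ?E" "y \<in> carrier ?E"
    obtain B P i \<pi> b1 b2 b3 where t: "ses B P M i \<pi>" "b1 \<in> Hm B N" "b2 \<in> Hm B N" "b3 \<in> Hm B N"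
      "x = ext_class M N B P i \<pi> b1" "y = ext_class M N B P i \<pi> b2" "y = ext_class M N B P i \<pi> b3" using ext_class_common3[OF M p p(2)] .
    note s = scalar(1)[OF M(2) c c]
    show "c \<odot>\<^bsub>?E\<^esub> (x \<oplus>\<^bsub>?E\<^esub> y) = c \<odot>\<^bsub>?E\<^esub> x \<oplus>\<^bsub>?E\<^esub> c \<odot>\<^bsub>?E\<^esub> y"
      unfolding t(5,6) ext_class_add[OF t(1-3)] ext_class_smult[OF t(1,2) c] ext_class_smult[OF t(1,3) c] ext_class_smult[OF t(1) add_in[OF t(2,3)] c]
        ext_class_add[OF t(1) comp_in[OF s t(2)] comp_in[OF s t(3)]] distrib_left ..
  next
    fix x assume p: "x \<in> carrier ?E"
    obtain B P i \<pi> b where t: "ses B P M i \<pi>" "b \<in> Hm B N" "x = ext_class M N B P i \<pi> b" using ext_class_surj[OF M p] .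
    show "\<one>\<^bsub>F\<^esub> \<odot>\<^bsub>?E\<^esub> x = x" unfolding t(3) ext_class_smult[OF t(1,2) F.one_closed] scalar(4)[OF M(2) F.one_closed F.one_closed] idl[OF t(2)] ..
  qed
  then show ?thesis unfolding vectorspace_def using fieldF by blast
qed

text \<open>Cardinality form of the exact sequence 0 -> Hom(M,N) -> Hom(P,N) -> Hom(B,N) ->
  Ext^1(M,N) -> 0, whose last map is onto because the resolution is fine.\<close>

lemma card_Ext:
  assumes f: "fine M N B P i \<pi>" and N: "N \<in> Ob C" and fin: "\<And>X Y. finite (Hm X Y)"
  shows "card (carrier (Ext C 1 M N)) * card (Hm P N) = card (Hm B N) * card (Hm M N)"
proof -
  note s = fineD(1)[OF f] and t = sesD[OF fineD(1)[OF f]]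
  have im: "ext_class M N B P i \<pi> ` Hm B N = carrier (Ext C 1 M N)"
  proof (intro equalityI subsetI)
    fix x assume "x \<in> ext_class M N B P i \<pi> ` Hm B N"
    then show "x \<in> carrier (Ext C 1 M N)" using ext_class_in[OF s] by blast
  next
    fix x assume "x \<in> carrier (Ext C 1 M N)"
    then obtain B' P' i' \<pi>' b' where b': "ses B' P' M i' \<pi>'" "b' \<in> Hm B' N" "x = ext_class M N B' P' i' \<pi>' b'"
      using ext_class_surj[OF t(8) N] by metis
    obtain b where b: "b \<in> Hm B N" "same_ext_class M N B P i \<pi> b B' P' i' \<pi>' b'" using fineD(2)[OF f b'(1,2)] by blast
    then have "x = ext_class M N B P i \<pi> b" using ext_class_eq_iff[OF s b(1) b'(1,2)] b'(3) by simp
    then show "x \<in> ext_class M N B P i \<pi> ` Hm B N" using b(1) by blast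
  qed
  let ?J = "(\<lambda>e. e * i) ` Hm P N"
  have J: "card (Hm P N) = card ?J * card (Hm M N)"
  proof (rule card_fibres[OF fin])
    fix y assume "y \<in> ?J"
    then obtain e0 where e0: "e0 \<in> Hm P N" "y = e0 * i" by blast
    have "{e \<in> Hm P N. e * i = y} = (\<lambda>m. e0 + m * \<pi>) ` Hm M N"
    proof (intro equalityI subsetI)
      fix e assume e: "e \<in> {e \<in> Hm P N. e * i = y}"
      then have "(e - e0) * i = 0" using e0 by (simp add: left_diff_distrib)
      then obtain m where "m \<in> Hm M N" "m * \<pi> = e - e0" using ses_descend[OF s, of "e - e0"] e e0 diff_in by blast
      then show "e \<in> (\<lambda>m. e0 + m * \<pi>) ` Hm M N" by (intro image_eqI[of _ _ m]) auto
    next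
      fix e assume "e \<in> (\<lambda>m. e0 + m * \<pi>) ` Hm M N"
      then obtain m where m: "m \<in> Hm M N" "e = e0 + m * \<pi>" by blast
      have "m * \<pi> * i = 0" using t(5) by (simp add: mult.assoc)
      then show "e \<in> {e \<in> Hm P N. e * i = y}" using m e0 add_in[OF e0(1) comp_in[OF m(1) t(2)]] by (simp add: distrib_right)
    qed
    moreover have "inj_on (\<lambda>m. e0 + m * \<pi>) (Hm M N)" using epi_cancel[OF t(4)] by (auto simp: inj_on_def)
    ultimately show "card {e \<in> Hm P N. e * i = y} = card (Hm M N)" by (simp add: card_image)
  qed
  have "card (Hm B N) = card (ext_class M N B P i \<pi> ` Hm B N) * card ?J"
  proof (rule card_fibres[OF fin])
    fix y assume "y \<in> ext_class M N B P i \<pi> ` Hm B N"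
    then obtain b0 where b0: "b0 \<in> Hm B N" "y = ext_class M N B P i \<pi> b0" by blast
    have "{b \<in> Hm B N. ext_class M N B P i \<pi> b = y} = (\<lambda>j. b0 + j) ` ?J"
    proof (intro equalityI subsetI)
      fix b assume "b \<in> {b \<in> Hm B N. ext_class M N B P i \<pi> b = y}"
      then have b: "b \<in> Hm B N" "same_ext_class M N B P i \<pi> b B P i \<pi> b0" using ext_class_eq_iff[OF s _ s b0(1)] b0(2) by auto
      obtain e where e: "e \<in> Hm P N" "b - b0 = e * i" using same_ext_class_extension[OF s b(1) b0(1) b(2)] by blast
      then have "b = b0 + e * i" by (metis add.commute diff_add_cancel)
      then show "b \<in> (\<lambda>j. b0 + j) ` ?J" using e(1) by blast
    next
      fix b assume "b \<in> (\<lambda>j. b0 + j) ` ?J"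
      then obtain e where e: "e \<in> Hm P N" "b = b0 + e * i" by blast
      have b: "b \<in> Hm B N" unfolding e(2) by (rule add_in[OF b0(1) comp_in[OF e(1) t(1)]])
      have "b - b0 = e * i" using e(2) by simp
      from same_ext_class_of_extension[OF s b b0(1) e(1) this] show "b \<in> {b \<in> Hm B N. ext_class M N B P i \<pi> b = y}"
        using ext_class_eq_iff[OF s b s b0(1)] b0(2) b by simp
    qed
    moreover have "inj_on (\<lambda>j. b0 + j) ?J" by (auto simp: inj_on_def)
    ultimately show "card {b \<in> Hm B N. ext_class M N B P i \<pi> b = y} = card ?J" by (simp add: card_image)
  qed
  then show ?thesis unfolding J im by simp
qed

lemma fine_of_finite_Ext:
  assumes M: "M \<in> Ob C" "N \<in> Ob C" and fin: "finite (carrier (Ext C 1 M N))"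
  obtains B P i \<pi> where "fine M N B P i \<pi>"
proof -
  let ?Q = "\<lambda>\<phi> (B, P, i, \<pi>, b). ses B P M i \<pi> \<and> b \<in> Hm B N \<and> \<phi> = ext_class M N B P i \<pi> b"
  have "\<forall>\<phi>\<in>carrier (Ext C 1 M N). \<exists>x. ?Q \<phi> x"
  proof
    fix \<phi> assume "\<phi> \<in> carrier (Ext C 1 M N)"
    then obtain B P i \<pi> b where "ses B P M i \<pi>" "b \<in> Hm B N" "\<phi> = ext_class M N B P i \<pi> b" using ext_class_surj[OF M] by metis
    then show "\<exists>x. ?Q \<phi> x" by (intro exI[of _ "(B, P, i, \<pi>, b)"]) simp
  qed
  then obtain d where d: "\<forall>\<phi>\<in>carrier (Ext C 1 M N). ?Q \<phi> (d \<phi>)" using bchoice[of _ ?Q] by blast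
  show ?thesis
  proof (rule fine_exists[of "d ` carrier (Ext C 1 M N)" M N])
    show "finite (d ` carrier (Ext C 1 M N))" using fin by simp
    fix B P i \<pi> b assume "(B, P, i, \<pi>, b) \<in> d ` carrier (Ext C 1 M N)"
    then show "ses B P M i \<pi> \<and> b \<in> Hm B N" using d by force
  next
    fix B P i \<pi> b assume s: "ses B P M i \<pi>" "b \<in> Hm B N"
    note p = ext_class_in[OF s]
    obtain B' P' i' \<pi>' b' where x: "d (ext_class M N B P i \<pi> b) = (B', P', i', \<pi>', b')" by (metis prod_cases5)
    then have q: "ses B' P' M i' \<pi>'" "b' \<in> Hm B' N" "ext_class M N B P i \<pi> b = ext_class M N B' P' i' \<pi>' b'" using d p by force+
    have "(B', P', i', \<pi>', b') \<in> d ` carrier (Ext C 1 M N)" using p x by force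
    then show "\<exists>B' P' i' \<pi>' b'. (B', P', i', \<pi>', b') \<in> d ` carrier (Ext C 1 M N) \<and> same_ext_class M N B P i \<pi> b B' P' i' \<pi>' b'"
      using q(3) ext_class_eq_iff[OF s q(1,2)] by blast
  qed (use M that in auto)
qed

end

section \<open>From dimensions to cardinalities and back\<close>

lemma (in vectorspace) card_carrier:
  assumes fd: "fin_dim" and fin: "finite (carrier K)"
  shows "finite (carrier V)" "card (carrier V) = card (carrier K) ^ dim"
proof -
  obtain A where A: "finite A" "basis A" using finite_basis_exists[OF fd] by blast
  then have "A \<subseteq> carrier V" unfolding basis_def by blast
  note crit = basis_criterion[OF A(1) this, THEN iffD1, OF A(2)]
  have bb: "bij_betw (\<lambda>v. THE a. a \<in> A \<rightarrow>\<^sub>E carrier K \<and> lincomb a A = v) (carrier V) (A \<rightarrow>\<^sub>E carrier K)"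
  proof (rule bij_betwI[where g = "\<lambda>a. lincomb a A"])
    have 1: "(THE a. a \<in> A \<rightarrow>\<^sub>E carrier K \<and> lincomb a A = v) \<in> A \<rightarrow>\<^sub>E carrier K \<and>
        lincomb (THE a. a \<in> A \<rightarrow>\<^sub>E carrier K \<and> lincomb a A = v) A = v" if "v \<in> carrier V" for v
      using theI'[of "\<lambda>a. a \<in> A \<rightarrow>\<^sub>E carrier K \<and> lincomb a A = v"] crit that by blast
    show "(\<lambda>v. THE a. a \<in> A \<rightarrow>\<^sub>E carrier K \<and> lincomb a A = v) \<in> carrier V \<rightarrow> A \<rightarrow>\<^sub>E carrier K" using 1 by blast
    show lc: "(\<lambda>a. lincomb a A) \<in> (A \<rightarrow>\<^sub>E carrier K) \<rightarrow> carrier V"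
      using lincomb_closed[OF \<open>A \<subseteq> carrier V\<close>] by (auto simp: PiE_def)
    show "lincomb (THE a. a \<in> A \<rightarrow>\<^sub>E carrier K \<and> lincomb a A = v) A = v" if "v \<in> carrier V" for v using 1[OF that] by blast
    show "(THE b. b \<in> A \<rightarrow>\<^sub>E carrier K \<and> lincomb b A = lincomb a A) = a" if "a \<in> A \<rightarrow>\<^sub>E carrier K" for a
      using that crit lc by (intro the1_equality) blast+
  qed
  show "finite (carrier V)" using bij_betw_finite[OF bb] finite_PiE[OF A(1), of "\<lambda>_. carrier K"] fin by blast
  show "card (carrier V) = card (carrier K) ^ dim"
    using bij_betw_same_card[OF bb] card_PiE[OF A(1), of "\<lambda>_. carrier K"] dim_basis[OF A] by simp
qed

locale hall_category = lin_abelian +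
  assumes finF: "finite (carrier F)" and fty: "finitary F C" and hered: "hereditary C"
begin

lemma ext2_zero: ext2_zero using hereditary_her[OF hered] .

lemma Hm_card:
  assumes M: "M \<in> Ob C" "N \<in> Ob C"
  shows "finite (Hm M N)" "card (Hm M N) = card (carrier F) ^ vectorspace.dim F (Hom C M N)"
proof -
  have fd: "vectorspace.fin_dim F (Hom C M N)" using fty M unfolding finitary_def by blast
  note c = vectorspace.card_carrier[OF vs[OF M] fd finF]
  have "inj_on (marr C M N) (carrier (Hom C M N))" by (rule inj_onI) (rule marr_inj[OF M])
  then show "finite (Hm M N)" "card (Hm M N) = card (carrier F) ^ vectorspace.dim F (Hom C M N)"
    using c M by (simp_all add: Hm_def card_image)
qed

lemma finite_Hm: "finite (Hm M N)"
proof (cases "M \<in> Ob C \<and> N \<in> Ob C")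
  case False
  then have "Hm M N = {}" unfolding Hm_def by auto
  then show ?thesis by simp
qed (use Hm_card in blast)

lemma Ext_card:
  assumes M: "M \<in> Ob C" "N \<in> Ob C"
  shows "finite (carrier (Ext C 1 M N))" "card (carrier (Ext C 1 M N)) = card (carrier F) ^ vectorspace.dim F (Ext C 1 M N)"
proof -
  have fd: "vectorspace.fin_dim F (Ext C 1 M N)" using fty M unfolding finitary_def by blast
  show "finite (carrier (Ext C 1 M N))" "card (carrier (Ext C 1 M N)) = card (carrier F) ^ vectorspace.dim F (Ext C 1 M N)"
    by (rule vectorspace.card_carrier[OF vectorspace_Ext[OF M] fd finF])+
qed

lemma card_F: "card (carrier F) \<ge> 2"
proof -
  interpret F: field F by (rule fieldF)
  have "card {\<zero>\<^bsub>F\<^esub>, \<one>\<^bsub>F\<^esub>} \<le> card (carrier F)" by (rule card_mono[OF finF]) auto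
  then show ?thesis using F.one_not_zero by auto
qed

lemma Hm_pos: "M \<in> Ob C \<Longrightarrow> N \<in> Ob C \<Longrightarrow> card (Hm M N) > 0"
  using Hm_card card_F by simp

text \<open>By \<open>card_Ext\<close> the ratio on the right equals |Hom(M,N)| / |Ext^1(M,N)|. In
  this form the exponential of the Euler form no longer mentions M, only the terms of its
  resolution.\<close>

lemma euler_fine:
  assumes f: "fine M N B P i \<pi>" and N: "N \<in> Ob C"
  shows "real (card (carrier F)) powi euler F C M N = real (card (Hm P N)) / real (card (Hm B N))"
proof -
  note t = sesD[OF fineD(1)[OF f]]
  have q: "real (card (carrier F)) \<noteq> 0" using card_F by simp
  have "real (card (carrier (Ext C 1 M N))) * card (Hm P N) = real (card (Hm B N)) * card (Hm M N)"
    using card_Ext[OF f N finite_Hm] by (metis of_nat_mult)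
  moreover have "real (card (carrier (Ext C 1 M N))) \<noteq> 0" "real (card (Hm B N)) \<noteq> 0"
    using Ext_card[OF t(8) N] card_F Hm_pos[OF t(6) N] by simp_all
  ultimately have "real (card (Hm P N)) / real (card (Hm B N)) = real (card (Hm M N)) / real (card (carrier (Ext C 1 M N)))"
    by (simp add: field_simps)
  also have "\<dots> = real (card (carrier F)) powi euler F C M N"
    using q Ext_card(2)[OF t(8) N] Hm_card(2)[OF t(8) N] by (simp add: euler_def power_int_diff)
  finally show ?thesis by simp
qed

lemma fine_ex:
  assumes "M \<in> Ob C" "N \<in> Ob C"
  obtains B P i \<pi> where "fine M N B P i \<pi>"
  using fine_of_finite_Ext[OF assms Ext_card(1)[OF assms]] .

text \<open>As q is at least 2, identities between powers of q become identities between
  integers.\<close>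

lemma powi_inj: "real (card (carrier F)) powi a = real (card (carrier F)) powi b \<Longrightarrow> a = b"
  using card_F power_int_strict_increasing[of a b "real (card (carrier F))"]
    power_int_strict_increasing[of b a "real (card (carrier F))"] by (cases a b rule: linorder_cases) auto

lemma euler_add_right:
  assumes M: "M \<in> Ob C" and s: "ses N' N N'' \<nu> n"
  shows "euler F C M N = euler F C M N' + euler F C M N''"
proof -
  note m = sesD[OF s]
  \<comment> \<open>A single resolution of M fine for N', N and N'' is assembled from three separate
    ones.\<close>
  obtain B1 P1 i1 \<pi>1 where 1: "fine M N' B1 P1 i1 \<pi>1" using fine_ex[OF M m(6)] .
  obtain B2 P2 i2 \<pi>2 where 2: "fine M N B2 P2 i2 \<pi>2" using fine_ex[OF M m(7)] .
  obtain B3 P3 i3 \<pi>3 where 3: "fine M N'' B3 P3 i3 \<pi>3" using fine_ex[OF M m(8)] .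
  obtain B4 P4 i4 \<pi>4 where 4: "fine M N' B4 P4 i4 \<pi>4" "fine M N B4 P4 i4 \<pi>4"
    by (rule fine_common[OF 1 2])
  obtain B P i \<pi> where g: "fine M N' B P i \<pi>" "fine M N'' B P i \<pi>"
      "\<forall>L. fine M L B4 P4 i4 \<pi>4 \<longrightarrow> fine M L B P i \<pi>"
    by (rule fine_common[OF 4(1) 3]) blast
  note f = g(1,2) g(3)[rule_format, OF 4(2)]
  note t = sesD[OF fineD(1)[OF f(1)]]
  have "real (card (Hm P N)) * card (Hm B N') * card (Hm B N'') = real (card (Hm B N)) * card (Hm P N') * card (Hm P N'')"
    using additive_right[OF ext2_zero s f(1,3) finite_Hm] by (metis of_nat_mult)
  moreover have "real (card (Hm B X)) > 0" if "X \<in> Ob C" for X using Hm_pos[OF t(6) that] by simp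
  ultimately have "real (card (carrier F)) powi euler F C M N =
     real (card (carrier F)) powi euler F C M N' * real (card (carrier F)) powi euler F C M N''"
    unfolding euler_fine[OF f(1) m(6)] euler_fine[OF f(2) m(8)] euler_fine[OF f(3) m(7)]
    using m(6-8) by (simp add: field_simps less_imp_neq[THEN not_sym])
  also have "\<dots> = real (card (carrier F)) powi (euler F C M N' + euler F C M N'')"
    using card_F by (simp add: power_int_add)
  finally show ?thesis by (rule powi_inj)
qed

text \<open>P' is the middle term for M' and the kernel term for M'', so the three ratios from
  \<open>euler_fine\<close> telescope.\<close>

lemma euler_add_left:
  assumes N: "N \<in> Ob C" and s: "ses M' M M'' \<mu> \<rho>"
  shows "euler F C M N = euler F C M' N + euler F C M'' N"
proof -
  note m = sesD[OF s]
  obtain B1 P1 i1 \<pi>1 where 1: "fine M N B1 P1 i1 \<pi>1" using fine_ex[OF m(7) N] .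
  obtain B2 P2 i2 \<pi>2 where 2: "fine M'' N B2 P2 i2 \<pi>2" using fine_ex[OF m(8) N] .
  obtain B P P' i \<pi> k i' \<pi>' where f: "fine M N B P i \<pi>" "fine M'' N P' P k (\<rho> * \<pi>)" "fine M' N B P' i' \<pi>'"
    using additive_left[OF ext2_zero s 1 2] .
  note t = sesD[OF fineD(1)[OF f(1)]] and u = sesD[OF fineD(1)[OF f(2)]]
  have "real (card (carrier F)) powi euler F C M N =
     real (card (carrier F)) powi euler F C M' N * real (card (carrier F)) powi euler F C M'' N"
    unfolding euler_fine[OF f(1) N] euler_fine[OF f(2) N] euler_fine[OF f(3) N]
    using Hm_pos[OF t(6) N] Hm_pos[OF u(6) N] by simp
  also have "\<dots> = real (card (carrier F)) powi (euler F C M' N + euler F C M'' N)"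
    using card_F by (simp add: power_int_add)
  finally show ?thesis by (rule powi_inj)
qed

end


section \<open>The Euler characteristic of a complex\<close>

text \<open>The sign (-1)^n for an integer n of either sign, in any abelian group.\<close>

definition ssgn :: "int \<Rightarrow> 'x::ab_group_add \<Rightarrow> 'x" where
  "ssgn n x = (if even n then x else - x)"

lemma ssgn_simps: "ssgn n (x + y) = ssgn n x + ssgn n y" "ssgn n (x - y) = ssgn n x - ssgn n y"
    "ssgn n (- x) = - ssgn n x" "ssgn n 0 = 0" "ssgn (n + 1) x = - ssgn n x" "ssgn (n - 1) x = - ssgn n x"
  by (auto simp: ssgn_def)

context lin_abelian
begin

definition rels :: "('o \<Rightarrow>\<^sub>0 int) set" where
  "rels = generate (free_Abelian_group (Ob C)) (K_relations C)"

abbreviation cl :: "'o \<Rightarrow> 'o \<Rightarrow>\<^sub>0 int" where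
  "cl X \<equiv> Poly_Mapping.single X 1"

lemma short_exact_ob:
  assumes "short_exact C X Y Z f g"
  shows "X \<in> Ob C" "Y \<in> Ob C" "Z \<in> Ob C"
  using assms unfolding short_exact_def kernel_of_def by auto

lemma K_relations_sub: "K_relations C \<subseteq> carrier (free_Abelian_group (Ob C))"
proof
  fix r assume "r \<in> K_relations C"
  then obtain X Y Z f g where r: "r = cl Y - cl X - cl Z" "short_exact C X Y Z f g" unfolding K_relations_def by blast
  have "Poly_Mapping.keys (cl Y - cl X - cl Z) \<subseteq> Poly_Mapping.keys (cl Y) \<union> Poly_Mapping.keys (cl X) \<union> Poly_Mapping.keys (cl Z)"
    using keys_diff[of "cl Y - cl X" "cl Z"] keys_diff[of "cl Y" "cl X"] by blast
  then show "r \<in> carrier (free_Abelian_group (Ob C))" using short_exact_ob[OF r(2)] unfolding r(1) by auto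
qed

lemma rels_subgroup: "subgroup rels (free_Abelian_group (Ob C))"
  unfolding rels_def by (rule group.generate_is_subgroup[OF group_free_Abelian_group K_relations_sub])

lemma rels_keys: "x \<in> rels \<Longrightarrow> Poly_Mapping.keys x \<subseteq> Ob C"
  using subgroup.subset[OF rels_subgroup] by (metis carrier_free_Abelian_group_iff subsetD)

lemma rels_0: "0 \<in> rels"
  using subgroup.one_closed[OF rels_subgroup] by simp

lemma rels_add: "x \<in> rels \<Longrightarrow> y \<in> rels \<Longrightarrow> x + y \<in> rels"
  using subgroup.m_closed[OF rels_subgroup] by simp

lemma rels_minus: "x \<in> rels \<Longrightarrow> - x \<in> rels"
  using subgroup.m_inv_closed[OF rels_subgroup] rels_keys by fastforce

text \<open>Equality in the Grothendieck group at the level of representatives; the passage to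
  \<open>K0\<close> is made later by \<open>K0_class\<close>.\<close>

definition keq :: "('o \<Rightarrow>\<^sub>0 int) \<Rightarrow> ('o \<Rightarrow>\<^sub>0 int) \<Rightarrow> bool"  (infix \<open>\<doteq>\<close> 50) where
  "x \<doteq> y \<longleftrightarrow> x - y \<in> rels"

lemma keq_refl: "x \<doteq> x"
  unfolding keq_def using rels_0 by simp

lemma keq_sym: "x \<doteq> y \<Longrightarrow> y \<doteq> x"
  unfolding keq_def using rels_minus[of "x - y"] by simp

lemma keq_trans: "x \<doteq> y \<Longrightarrow> y \<doteq> z \<Longrightarrow> x \<doteq> z"
  unfolding keq_def using rels_add[of "x - y" "y - z"] by simp

lemma keq_add: "x \<doteq> y \<Longrightarrow> x' \<doteq> y' \<Longrightarrow> x + x' \<doteq> y + y'"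
  unfolding keq_def using rels_add[of "x - y" "x' - y'"] by (simp add: algebra_simps)

lemma keq_minus: "x \<doteq> y \<Longrightarrow> - x \<doteq> - y"
  unfolding keq_def using rels_minus[of "x - y"] by simp

lemma keq_diff: "x \<doteq> y \<Longrightarrow> x' \<doteq> y' \<Longrightarrow> x - x' \<doteq> y - y'"
  using keq_add[OF _ keq_minus] by fastforce

lemma keq_ssgn: "x \<doteq> y \<Longrightarrow> ssgn n x \<doteq> ssgn n y"
  unfolding ssgn_def using keq_minus by simp

lemma keq_sum: "(\<And>n. n \<in> A \<Longrightarrow> f n \<doteq> g n) \<Longrightarrow> sum f A \<doteq> sum g A"
  by (induction A rule: infinite_finite_induct) (simp_all add: keq_refl keq_add)

lemma ses_short_exact:
  assumes s: "ses B P M (marr C B P i) (marr C P M \<pi>)" and i: "i \<in> carrier (Hom C B P)" "\<pi> \<in> carrier (Hom C P M)"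
  shows "short_exact C B P M i \<pi>"
proof -
  note t = sesD[OF s]
  have z: "\<pi> \<bullet>\<^bsub>C\<^esub> i = \<zero>\<^bsub>Hom C B M\<^esub>" using marr_comp_eq0[OF t(6-8) i] t(5) by simp
  have "kernel_of C P M \<pi> B i" unfolding kernel_of_def
  proof (intro conjI ballI impI)
    fix W g assume g: "W \<in> Ob C" "g \<in> carrier (Hom C W P)" "\<pi> \<bullet>\<^bsub>C\<^esub> g = \<zero>\<^bsub>Hom C W M\<^esub>"
    have "marr C P M \<pi> * marr C W P g = 0" using marr_comp_eq0[OF g(1) t(7,8) g(2) i(2)] g(3) by simp
    then obtain u where u: "u \<in> Hm W B" "marr C B P i * u = marr C W P g" using t(9)[OF HmI[OF g(1) t(7) g(2)]] by blast
    from HmE[OF u(1)] obtain u0 where u0: "u0 \<in> carrier (Hom C W B)" "u = marr C W B u0" by metis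
    have "i \<bullet>\<^bsub>C\<^esub> u0 = g" using marr_comp_eq[OF g(1) t(6,7) u0(1) i(1) g(2)] u(2) u0(2) by simp
    moreover have "v = u0" if v: "v \<in> carrier (Hom C W B)" "i \<bullet>\<^bsub>C\<^esub> v = g" for v
    proof -
      have "marr C B P i * marr C W B v = marr C B P i * u" using marr_comp_eq[OF g(1) t(6,7) v(1) i(1) g(2)] v(2) u(2) by simp
      then have "marr C W B v = u" using mono_cancel[OF t(3) HmI[OF g(1) t(6) v(1)] u(1)] by blast
      then show ?thesis using marr_inj[OF g(1) t(6) v(1) u0(1)] u0(2) by simp
    qed
    ultimately show "\<exists>!t. t \<in> carrier (Hom C W B) \<and> i \<bullet>\<^bsub>C\<^esub> t = g" using u0(1) by blast
  qed (use t i z in auto)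
  moreover have "cokernel_of C B P i M \<pi>" unfolding cokernel_of_def
  proof (intro conjI ballI impI)
    fix W g assume g: "W \<in> Ob C" "g \<in> carrier (Hom C P W)" "g \<bullet>\<^bsub>C\<^esub> i = \<zero>\<^bsub>Hom C B W\<^esub>"
    have "marr C P W g * marr C B P i = 0" using marr_comp_eq0[OF t(6,7) g(1) i(1) g(2)] g(3) by simp
    then obtain u where u: "u \<in> Hm M W" "u * marr C P M \<pi> = marr C P W g" using ses_descend[OF s HmI[OF t(7) g(1,2)]] by blast
    from HmE[OF u(1)] obtain u0 where u0: "u0 \<in> carrier (Hom C M W)" "u = marr C M W u0" by metis
    have "u0 \<bullet>\<^bsub>C\<^esub> \<pi> = g" using marr_comp_eq[OF t(7,8) g(1) i(2) u0(1) g(2)] u(2) u0(2) by simp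
    moreover have "v = u0" if v: "v \<in> carrier (Hom C M W)" "v \<bullet>\<^bsub>C\<^esub> \<pi> = g" for v
    proof -
      have "marr C M W v * marr C P M \<pi> = u * marr C P M \<pi>" using marr_comp_eq[OF t(7,8) g(1) i(2) v(1) g(2)] v(2) u(2) by simp
      then have "marr C M W v = u" using epi_cancel[OF t(4) HmI[OF t(8) g(1) v(1)] u(1)] by blast
      then show ?thesis using marr_inj[OF t(8) g(1) v(1) u0(1)] u0(2) by simp
    qed
    ultimately show "\<exists>!t. t \<in> carrier (Hom C M W) \<and> t \<bullet>\<^bsub>C\<^esub> \<pi> = g" using u0(1) by blast
  qed (use t i z in auto)
  ultimately show ?thesis unfolding short_exact_def by blast
qed

lemma short_exact_ses:
  assumes s: "short_exact C X Y Z f g"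
  shows "ses X Y Z (marr C X Y f) (marr C Y Z g)"
proof -
  have k: "kernel_of C Y Z g X f" and c: "cokernel_of C X Y f Z g" using s unfolding short_exact_def by auto
  note k = kernel_marr[OF k] and c = cokernel_marr[OF c]
  show ?thesis unfolding ses_def mono_def epi_def using k c by blast
qed

lemma keq_ses:
  assumes s: "ses B P M i \<pi>" shows "cl P \<doteq> cl B + cl M"
proof -
  from HmE[OF sesD(1)[OF s]] obtain i0 where i: "i0 \<in> carrier (Hom C B P)" "i = marr C B P i0" by metis
  from HmE[OF sesD(2)[OF s]] obtain p0 where p: "p0 \<in> carrier (Hom C P M)" "\<pi> = marr C P M p0" by metis
  have "short_exact C B P M i0 p0" using ses_short_exact[OF s[unfolded i(2) p(2)] i(1) p(1)] .
  then have "cl P - cl B - cl M \<in> K_relations C" unfolding K_relations_def by blast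
  then have "cl P - cl B - cl M \<in> rels" unfolding rels_def by (rule generate.incl)
  then show ?thesis unfolding keq_def by (simp add: algebra_simps)
qed

text \<open>For a zero object the sequence Z -> Z -> Z is short exact, and its relation reads [Z] =
  2 [Z].\<close>

lemma keq_null:
  assumes Z: "Z \<in> Ob C" "Idm Z = 0" shows "cl Z \<doteq> 0"
proof -
  have "ses Z Z Z (Idm Z) (Idm Z)" unfolding ses_def
    using id_in[OF Z(1)] mono_id[OF Z(1)] epi_id[OF Z(1)] Z(2) null_target[OF Z(2)] by fastforce
  from keq_ses[OF this] have "0 - cl Z \<in> rels" unfolding keq_def by (simp add: algebra_simps)
  then show ?thesis unfolding keq_def using rels_minus by fastforce
qed

text \<open>An isomorphism is an epimorphism with zero kernel, hence the second arrow of a short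
  exact sequence.\<close>

lemma keq_isomorphic:
  assumes "isomorphic C M M'" shows "cl M \<doteq> cl M'"
proof -
  obtain f g where f: "M \<in> Ob C" "M' \<in> Ob C" "f \<in> carrier (Hom C M M')" "g \<in> carrier (Hom C M' M)"
     "g \<bullet>\<^bsub>C\<^esub> f = Idn C M" "f \<bullet>\<^bsub>C\<^esub> g = Idn C M'"
    using assms unfolding isomorphic_def iso_arrow_def by blast
  have a: "marr C M' M g * marr C M M' f = Idm M" "marr C M M' f * marr C M' M g = Idm M'"
    unfolding Idm_def using f marr_comp_eq Idn_in by simp_all
  note F = HmI[OF f(1,2,3)]
  have e: "epi M' (marr C M M' f)" using epi_right_factor[OF epi_id[OF f(2)]] a(2) by metis
  from ses_of_epi[OF F e] obtain B i where s: "ses B M M' i (marr C M M' f)" .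
  note t = sesD[OF s]
  have "Idm M * i = 0" unfolding a(1)[symmetric] using t(5) by (simp add: mult.assoc)
  then have "i = 0" using idl[OF t(1)] by simp
  then have "Idm B = 0" using monoD[OF t(3) id_in[OF t(6)]] by simp
  from keq_trans[OF keq_ses[OF s] keq_add[OF keq_null[OF t(6) this] keq_refl]] show ?thesis by simp
qed

definition bounded_family :: "(int \<Rightarrow> 'o) \<Rightarrow> bool" where
  "bounded_family c \<longleftrightarrow> (\<forall>n. c n \<in> Ob C) \<and> finite {n. Idm (c n) \<noteq> 0}"

definition euler_char :: "(int \<Rightarrow> 'o) \<Rightarrow> 'o \<Rightarrow>\<^sub>0 int" where
  "euler_char c = (\<Sum>n\<in>{n. Idm (c n) \<noteq> 0}. ssgn n (cl (c n)))"

text \<open>A zero object has class zero only modulo the relations, so enlarging the range changes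
  the sum in the free group but not its class.\<close>

lemma euler_char_superset:
  assumes c: "bounded_family c" and A: "finite A" "{n. Idm (c n) \<noteq> 0} \<subseteq> A"
  shows "euler_char c \<doteq> (\<Sum>n\<in>A. ssgn n (cl (c n)))"
proof -
  let ?S = "{n. Idm (c n) \<noteq> 0}"
  have "(\<Sum>n\<in>A - ?S. ssgn n (cl (c n))) \<doteq> (\<Sum>n\<in>A - ?S. 0)"
  proof (rule keq_sum)
    fix n assume "n \<in> A - ?S"
    then have "cl (c n) \<doteq> 0" using keq_null c unfolding bounded_family_def by simp
    from keq_ssgn[OF this, of n] show "ssgn n (cl (c n)) \<doteq> 0" by (simp add: ssgn_simps)
  qed
  from keq_add[OF this keq_refl[of "euler_char c"]]
  have "(\<Sum>n\<in>A. ssgn n (cl (c n))) \<doteq> euler_char c" unfolding euler_char_def using sum.subset_diff[OF A(2,1), of "\<lambda>n. ssgn n (cl (c n))"] by simp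
  then show ?thesis by (rule keq_sym)
qed

lemma euler_char_add:
  assumes c: "bounded_family c" and d: "bounded_family d" and e: "bounded_family e" and k: "\<And>n. cl (e n) \<doteq> cl (c n) + cl (d n)"
  shows "euler_char e \<doteq> euler_char c + euler_char d"
proof -
  let ?A = "{n. Idm (c n) \<noteq> 0} \<union> {n. Idm (d n) \<noteq> 0} \<union> {n. Idm (e n) \<noteq> 0}"
  have A: "finite ?A" using c d e unfolding bounded_family_def by simp
  have "euler_char e \<doteq> (\<Sum>n\<in>?A. ssgn n (cl (e n)))" by (rule euler_char_superset[OF e A]) auto
  moreover have "(\<Sum>n\<in>?A. ssgn n (cl (e n))) \<doteq> (\<Sum>n\<in>?A. ssgn n (cl (c n)) + ssgn n (cl (d n)))"
    using keq_ssgn[OF k] by (intro keq_sum) (simp flip: ssgn_simps(1))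
  moreover have "(\<Sum>n\<in>?A. ssgn n (cl (c n)) + ssgn n (cl (d n))) \<doteq> euler_char c + euler_char d"
    unfolding sum.distrib by (intro keq_add keq_sym[OF euler_char_superset[OF c A]] keq_sym[OF euler_char_superset[OF d A]]) auto
  ultimately show ?thesis using keq_trans by blast
qed

lemma bounded_family_shift: "bounded_family c \<Longrightarrow> bounded_family (\<lambda>n. c (n + k))"
proof -
  assume c: "bounded_family c"
  have "{n. Idm (c (n + k)) \<noteq> 0} = (\<lambda>n. n - k) ` {n. Idm (c n) \<noteq> 0}"
    by (auto simp: image_iff) (metis add_diff_cancel)
  then show ?thesis using c unfolding bounded_family_def by simp
qed

lemma euler_char_shift: "euler_char (\<lambda>n. c (n + k)) = ssgn k (euler_char c)"
proof -
  have "euler_char (\<lambda>n. c (n + k)) = (\<Sum>n\<in>{n. Idm (c n) \<noteq> 0}. ssgn (n - k) (cl (c n)))"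
    unfolding euler_char_def by (rule sum.reindex_bij_witness[of _ "\<lambda>n. n - k" "\<lambda>n. n + k"]) auto
  also have "\<dots> = (\<Sum>n\<in>{n. Idm (c n) \<noteq> 0}. ssgn k (ssgn n (cl (c n))))"
    by (rule sum.cong) (auto simp: ssgn_def)
  also have "\<dots> = ssgn k (euler_char c)" unfolding euler_char_def by (simp add: ssgn_def sum_negf)
  finally show ?thesis .
qed

lemma bounded_family_cx: "abs_complex X \<Longrightarrow> bounded_family (cobj X)"
  using cxD(5) unfolding bounded_family_def abs_complex_def by blast

lemma bounded_family_bc: "bounded_complex C X \<Longrightarrow> bounded_family (cobj X)"
  using bounded_family_cx[OF embed_complex_cx] by simp

text \<open>The cycle objects fit into short exact sequences K_n -> W^n -> K_(n+1), so the
  alternating sum telescopes to two cycle objects at the ends, which are zero.\<close>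

lemma euler_char_acyclic:
  assumes W: "abs_complex W" and ex: "\<And>n T c. c \<in> Hm T (cobj W n) \<Longrightarrow> diff W n * c = 0 \<Longrightarrow>
      \<exists>T' e c'. e \<in> Hm T' T \<and> epi T e \<and> c' \<in> Hm T' (cobj W (n - 1)) \<and> c * e = diff W (n - 1) * c'"
  shows "euler_char (cobj W) \<doteq> 0"
proof -
  note x = cxD[OF W]
  define isk where "isk n K k \<longleftrightarrow> k \<in> Hm K (cobj W n) \<and> diff W n * k = 0 \<and> mono K k \<and>
    (\<forall>T g. g \<in> Hm T (cobj W n) \<longrightarrow> diff W n * g = 0 \<longrightarrow> (\<exists>t\<in>Hm T K. k * t = g))" for n K k
  have "\<exists>K k. isk n K k" for n
  proof -
    obtain K k where "k \<in> Hm K (cobj W n)" "diff W n * k = 0" "mono K k"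
      "\<And>T g. g \<in> Hm T (cobj W n) \<Longrightarrow> diff W n * g = 0 \<Longrightarrow> \<exists>t\<in>Hm T K. k * t = g"
      using ker_obtain[OF x(1)[of n]] by metis
    then show ?thesis unfolding isk_def by blast
  qed
  then obtain K k where "\<And>n. isk n (K n) (k n)" by metis
  then have k: "k n \<in> Hm (K n) (cobj W n)" "diff W n * k n = 0" "mono (K n) (k n)"
    "g \<in> Hm T (cobj W n) \<Longrightarrow> diff W n * g = 0 \<Longrightarrow> \<exists>t\<in>Hm T (K n). k n * t = g" for n T g
    unfolding isk_def by blast+
  have q: "\<exists>q. ses (K n) (cobj W n) (K (n + 1)) (k n) q" for n
  proof -
    obtain q where q: "q \<in> Hm (cobj W n) (K (n + 1))" "k (n + 1) * q = diff W n" using k(4)[OF x(1) x(3)] by blast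
    \<comment> \<open>Acyclicity is applied to the universal cycle \<open>k (n + 1)\<close>.\<close>
    have "epi (K (n + 1)) q"
    proof -
      obtain T e c' where e: "e \<in> Hm T (K (n + 1))" "epi (K (n + 1)) e" "c' \<in> Hm T (cobj W (n + 1 - 1))"
         "k (n + 1) * e = diff W (n + 1 - 1) * c'" using ex[OF k(1,2), of "n + 1"] by blast
      have c': "c' \<in> Hm T (cobj W n)" using e(3) by simp
      have "k (n + 1) * e = k (n + 1) * (q * c')" using e(4) q(2) by (simp add: mult.assoc[symmetric])
      then have "e = q * c'" using mono_cancel[OF k(3) e(1) comp_in[OF q(1) c']] by blast
      then show ?thesis using epi_right_factor[OF e(2)] by blast
    qed
    moreover have "k (n + 1) * (q * k n) = 0" using q(2) k(2) by (simp flip: mult.assoc)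
    then have "q * k n = 0" using monoD[OF k(3) comp_in[OF q(1) k(1)]] by blast
    moreover have "\<exists>t\<in>Hm T (K n). k n * t = g" if g: "g \<in> Hm T (cobj W n)" "q * g = 0" for T g
      using k(4)[OF g(1)] q(2) g(2) by (metis mult.assoc mult_zero_right)
    ultimately have "ses (K n) (cobj W n) (K (n + 1)) (k n) q" unfolding ses_def using k q(1) by blast
    then show ?thesis by blast
  qed
  have Kn: "cl (cobj W n) \<doteq> cl (K n) + cl (K (n + 1))" for n using q keq_ses by blast
  have Ko: "K n \<in> Ob C" for n using k(1) dom_obj by blast
  have fin: "finite {n. Idm (cobj W n) \<noteq> 0}" using W unfolding abs_complex_def by blast
  obtain a b where ab: "a \<le> b" "{n. Idm (cobj W n) \<noteq> 0} \<subseteq> {a..b}"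
  proof -
    let ?S = "insert 0 {n. Idm (cobj W n) \<noteq> 0}"
    have "Min ?S \<le> 0" "0 \<le> Max ?S" "?S \<subseteq> {Min ?S..Max ?S}" using fin by auto
    then show ?thesis using that[of "Min ?S" "Max ?S"] by (meson order_trans insert_subset)
  qed
  have nl: "Idm (cobj W n) = 0" if "n < a \<or> n > b" for n using ab(2) that by fastforce
  \<comment> \<open>K_a is a quotient of W^(a-1) and K_(b+1) a subobject of W^(b+1); both terms of W
    are zero by choice of the interval.\<close>
  have "Idm (K a) = 0"
  proof -
    from q[of "a - 1"] obtain q where "ses (K (a - 1)) (cobj W (a - 1)) (K a) (k (a - 1)) q" by auto
    note u = sesD[OF this]
    have "q = 0" using null_source[OF nl[of "a - 1"] u(2)] by simp
    then show ?thesis using epiD[OF u(4) id_in[OF Ko]] by simp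
  qed
  moreover have "Idm (K (b + 1)) = 0"
  proof -
    have "k (b + 1) = 0" using k(1)[of "b + 1"] null_target[OF nl[of "b + 1"]] by simp
    then show ?thesis using monoD[OF k(3)[of "b + 1"] id_in[OF Ko]] by simp
  qed
  ultimately have K0: "cl (K a) \<doteq> 0" "cl (K (b + 1)) \<doteq> 0" using keq_null Ko by auto
  have tel: "(\<Sum>n\<in>{a..b}. ssgn n (cl (K n)) + ssgn n (cl (K (n + 1)))) = ssgn a (cl (K a)) - ssgn (b + 1) (cl (K (b + 1)))"
    using ab(1)
  proof (induction b rule: int_ge_induct)
    case base
    show ?case by (simp add: ssgn_simps)
  next
    case (step i)
    have "{a..i + 1} = insert (i + 1) {a..i}" using step(1) by auto
    then show ?case using step by (simp add: ssgn_simps) (simp add: ssgn_def)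
  qed
  have 1: "euler_char (cobj W) \<doteq> (\<Sum>n\<in>{a..b}. ssgn n (cl (cobj W n)))" by (rule euler_char_superset[OF bounded_family_cx[OF W] _ ab(2)]) simp
  have 2: "(\<Sum>n\<in>{a..b}. ssgn n (cl (cobj W n))) \<doteq> (\<Sum>n\<in>{a..b}. ssgn n (cl (K n)) + ssgn n (cl (K (n + 1))))"
    using keq_ssgn[OF Kn] by (intro keq_sum) (simp flip: ssgn_simps(1))
  have "ssgn a (cl (K a)) - ssgn (b + 1) (cl (K (b + 1))) \<doteq> ssgn a 0 - ssgn (b + 1) 0"
    by (intro keq_diff keq_ssgn K0)
  then have 3: "ssgn a (cl (K a)) - ssgn (b + 1) (cl (K (b + 1))) \<doteq> 0" by (simp only: ssgn_simps(4) diff_zero)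
  show ?thesis by (rule keq_trans[OF keq_trans[OF 1 2[unfolded tel]] 3])
qed

section \<open>Products and mapping cones\<close>

definition is_product :: "'o \<Rightarrow> 'o \<Rightarrow> 'o \<Rightarrow> ('o \<times> 'o \<Rightarrow> 'a) endo \<Rightarrow> ('o \<times> 'o \<Rightarrow> 'a) endo \<Rightarrow> bool" where
  "is_product A B S a b \<longleftrightarrow> a \<in> Hm S A \<and> b \<in> Hm S B \<and>
    (\<forall>T x y. x \<in> Hm T A \<longrightarrow> y \<in> Hm T B \<longrightarrow> (\<exists>t\<in>Hm T S. a * t = x \<and> b * t = y)) \<and>
    (\<forall>T t. t \<in> Hm T S \<longrightarrow> a * t = 0 \<longrightarrow> b * t = 0 \<longrightarrow> t = 0)"

lemma product2:
  assumes "A \<in> Ob C" "B \<in> Ob C"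
  shows "\<exists>S a b. is_product A B S a b"
proof -
  obtain S a b c where p: "is_product3 A B null S a b c" using product3[OF assms null(1)] by blast
  have c: "a \<in> Hm S A" "b \<in> Hm S B" "c \<in> Hm S null" using p unfolding is_product3_def by auto
  have "\<exists>t\<in>Hm T S. a * t = x \<and> b * t = y" if "x \<in> Hm T A" "y \<in> Hm T B" for T x y
    using p that zero_in[OF dom_obj[OF that(1)] null(1)] unfolding is_product3_def by blast
  moreover have "t = 0" if "t \<in> Hm T S" "a * t = 0" "b * t = 0" for T t
    using p that into_null[OF comp_in[OF c(3) that(1)]] unfolding is_product3_def by simp
  ultimately have "is_product A B S a b" unfolding is_product_def using c by simp
  then show ?thesis by blast
qed

text \<open>The projection a is split epi, and its kernel is the arrow (0, id) from B.\<close>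

lemma keq_product:
  assumes a: "a \<in> Hm S A" "b \<in> Hm S B"
    and t: "\<And>T x y. x \<in> Hm T A \<Longrightarrow> y \<in> Hm T B \<Longrightarrow> \<exists>t\<in>Hm T S. a * t = x \<and> b * t = y"
    and j: "\<And>T t. t \<in> Hm T S \<Longrightarrow> a * t = 0 \<Longrightarrow> b * t = 0 \<Longrightarrow> t = 0"
  shows "cl S \<doteq> cl A + cl B"
proof -
  have ob: "A \<in> Ob C" "B \<in> Ob C" "S \<in> Ob C" using H_obj a by auto
  obtain i where i: "i \<in> Hm B S" "a * i = 0" "b * i = Idm B" using t[OF zero_in[OF ob(2,1)] id_in[OF ob(2)]] by blast
  obtain i' where i': "i' \<in> Hm A S" "a * i' = Idm A" using t[OF id_in[OF ob(1)] zero_in[OF ob(1,2)]] by blast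
  have 1: "mono B i" by (rule mono_left_factor[OF mono_id[OF ob(2)] i(3)[symmetric]])
  have 2: "epi A a" by (rule epi_right_factor[OF epi_id[OF ob(1)] i'(2)[symmetric]])
  have 3: "\<exists>t\<in>Hm W B. i * t = g" if g: "g \<in> Hm W S" "a * g = 0" for W g
  proof -
    have "a * (i * (b * g) - g) = 0" "b * (i * (b * g) - g) = 0"
      using i(2,3) g(2) idl[OF comp_in[OF a(2) g(1)]] by (simp_all add: right_diff_distrib flip: mult.assoc)
    from j[OF diff_in[OF comp_in[OF i(1) comp_in[OF a(2) g(1)]] g(1)] this] have "i * (b * g) = g" by simp
    then show ?thesis using comp_in[OF a(2) g(1)] by blast
  qed
  have "ses B S A i a" unfolding ses_def using i(1,2) a(1) 1 2 3 by simp
  from keq_ses[OF this] show ?thesis by (simp add: add.commute)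
qed

text \<open>The mapping cone of a quasi-isomorphism is acyclic.\<close>

lemma euler_char_qi:
  assumes X: "abs_complex X" and Y: "abs_complex Y" and f: "abs_qis X Y f"
  shows "euler_char (cobj X) \<doteq> euler_char (cobj Y)"
proof -
  note x = cxD[OF X] and y = cxD[OF Y] and fm = cmD[OF qiD(1)[OF f]]
  have "\<forall>n. \<exists>S a b. is_product (cobj X (n + 1)) (cobj Y n) S a b" using product2 x(5) y(5) by blast
  then obtain S a b where ip: "\<And>n. is_product (cobj X (n + 1)) (cobj Y n) (S n) (a n) (b n)" by metis
  have pr: "a n \<in> Hm (S n) (cobj X (n + 1))" "b n \<in> Hm (S n) (cobj Y n)" for n
    using ip[of n] unfolding is_product_def by auto
  have tup: "\<exists>t\<in>Hm T (S n). a n * t = x \<and> b n * t = y"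
    if "x \<in> Hm T (cobj X (n + 1))" "y \<in> Hm T (cobj Y n)" for n T x y
    using ip[of n] that unfolding is_product_def by simp
  have jm: "t = 0" if "t \<in> Hm T (S n)" "a n * t = 0" "b n * t = 0" for n T t
    using ip[of n] that unfolding is_product_def by simp
  have So: "S n \<in> Ob C" for n using pr(1) dom_obj by blast
  \<comment> \<open>Cone differential on X^(n+1) and Y^n: (x, y) goes to (- d x, f x + d y).\<close>
  have "\<exists>t. t \<in> Hm (S n) (S (n + 1)) \<and> a (n + 1) * t = - (diff X (n + 1) * a n) \<and>
      b (n + 1) * t = f (n + 1) * a n + diff Y n * b n" for n
  proof -
    have "- (diff X (n + 1) * a n) \<in> Hm (S n) (cobj X (n + 1 + 1))" using minus_in[OF comp_in[OF x(1) pr(1)]] .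
    moreover have "f (n + 1) * a n + diff Y n * b n \<in> Hm (S n) (cobj Y (n + 1))"
      using add_in[OF comp_in[OF fm(1) pr(1)] comp_in[OF y(1) pr(2)]] .
    ultimately show ?thesis using tup by blast
  qed
  then obtain D where D: "\<And>n. D n \<in> Hm (S n) (S (n + 1))" "\<And>n. a (n + 1) * D n = - (diff X (n + 1) * a n)"
      "\<And>n. b (n + 1) * D n = f (n + 1) * a n + diff Y n * b n" by metis
  have D': "a (n + 1) * (D n * t) = - (diff X (n + 1) * (a n * t))"
      "b (n + 1) * (D n * t) = f (n + 1) * (a n * t) + diff Y n * (b n * t)" for n t
    using arg_cong[OF D(2)[of n], of "\<lambda>u. u * t"] arg_cong[OF D(3)[of n], of "\<lambda>u. u * t"] by (simp_all add: algebra_simps)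
  define W where "W = \<lparr>cobj = S, diff = D\<rparr>"
  have W: "cobj W = S" "diff W = D" by (simp_all add: W_def)
  have DD: "D (n + 1) * D n = 0" for n
  proof (rule jm[of _ "S n" "n + 1 + 1"])
    show "D (n + 1) * D n \<in> Hm (S n) (S (n + 1 + 1))" using comp_in[OF D(1) D(1)] .
    have "diff X (n + 1 + 1) * (diff X (n + 1) * a n) = 0" using x(3)[of "n + 1"] by (simp flip: mult.assoc)
    then show "a (n + 1 + 1) * (D (n + 1) * D n) = 0" unfolding D' D by simp
    have "diff Y (n + 1) * (diff Y n * b n) = 0" using y(3)[of n] by (simp flip: mult.assoc)
    then show "b (n + 1 + 1) * (D (n + 1) * D n) = 0"
      unfolding D' D using fm(4)[of "n + 1" "a n"] by (simp add: distrib_left)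
  qed
  have fsS: "bounded_family S"
  proof -
    have "Idm (S n) = 0" if "Idm (cobj X (n + 1)) = 0" "Idm (cobj Y n) = 0" for n
      using jm[OF id_in[OF So[of n]]] null_target[OF that(1) comp_in[OF pr(1) id_in[OF So]]]
        null_target[OF that(2) comp_in[OF pr(2) id_in[OF So]]] by blast
    then have "{n. Idm (S n) \<noteq> 0} \<subseteq> {n. Idm (cobj X (n + 1)) \<noteq> 0} \<union> {n. Idm (cobj Y n) \<noteq> 0}" by blast
    then show ?thesis using So bounded_family_shift[OF bounded_family_cx[OF X], of 1] bounded_family_cx[OF Y] finite_subset unfolding bounded_family_def by blast
  qed
  have cW: "abs_complex W" unfolding abs_complex_def W using D(1) DD fsS unfolding bounded_family_def by blast
  have 1: "euler_char S \<doteq> 0" unfolding W(1)[symmetric]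
  proof (rule euler_char_acyclic[OF cW])
    fix n T c assume c: "c \<in> Hm T (cobj W n)" "diff W n * c = 0"
    then have cS: "c \<in> Hm T (S n)" "D n * c = 0" by (simp_all add: W)
    have k: "diff X (n + 1) * (a n * c) = 0" "f (n + 1) * (a n * c) + diff Y n * (b n * c) = 0"
      using D'(1,2)[of n c] cS(2) by simp_all
    have embed_complex: "a n * c \<in> Hm T (cobj X (n + 1))" and bc: "b n * c \<in> Hm T (cobj Y n)" using comp_in pr cS by blast+
    have bc': "- (b n * c) \<in> Hm T (cobj Y (n + 1 - 1))" using minus_in[OF bc] by simp
    have "f (n + 1) * (a n * c) = diff Y (n + 1 - 1) * (- (b n * c))" using k(2) by (simp add: add_eq_0_iff2)
    from HinjD[OF qiD(3)[OF f] embed_complex k(1) bc' this] obtain T1 e1 x1 where e1: "e1 \<in> Hm T1 T" "epi T e1"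
      "x1 \<in> Hm T1 (cobj X (n + 1 - 1))" "a n * c * e1 = diff X (n + 1 - 1) * x1" .
    have x1: "x1 \<in> Hm T1 (cobj X n)" "a n * c * e1 = diff X n * x1" using e1(3,4) by simp_all
    \<comment> \<open>For a cycle (x, y) of the cone, x = d x1 on a cover. Then f x1 + y is a cycle
      of Y; writing it as f x2 plus a boundary corrects x1 by x2, as in the homotopy fibre
      product.\<close>
    let ?y = "f n * x1 + b n * c * e1"
    have yt: "?y \<in> Hm T1 (cobj Y n)" using add_in[OF comp_in[OF fm(1) x1(1)] comp_in[OF bc e1(1)]] .
    have "diff Y n * ?y = f (n + 1) * (a n * c * e1) + diff Y n * (b n * c) * e1"
      unfolding x1(2) using fm(4)[of n x1] by (simp add: distrib_left mult.assoc)
    also have "\<dots> = (f (n + 1) * (a n * c) + diff Y n * (b n * c)) * e1" by (simp add: distrib_right mult.assoc)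
    finally have "diff Y n * ?y = 0" using k(2) by simp
    from HsurjD[OF qiD(2)[OF f] yt this] obtain T2 e2 x2 y2 where e2: "e2 \<in> Hm T2 T1" "epi T1 e2"
      "x2 \<in> Hm T2 (cobj X n)" "diff X n * x2 = 0" "y2 \<in> Hm T2 (cobj Y (n - 1))" "?y * e2 = f n * x2 + diff Y (n - 1) * y2" .
    have "- (x1 * e2 - x2) \<in> Hm T2 (cobj X (n - 1 + 1))" using minus_in[OF diff_in[OF comp_in[OF x1(1) e2(1)] e2(3)]] by simp
    then obtain t where t: "t \<in> Hm T2 (S (n - 1))" "a (n - 1) * t = - (x1 * e2 - x2)" "b (n - 1) * t = y2"
      using tup[OF _ e2(5)] by blast
    have E: "a n * (D (n - 1) * t) = diff X n * (x1 * e2 - x2)"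
        "b n * (D (n - 1) * t) = - (f n * (x1 * e2 - x2)) + diff Y (n - 1) * y2"
      using D'[of "n - 1" t] unfolding t diff_add_cancel by (simp_all add: right_diff_distrib)
    have Dt: "D (n - 1) * t \<in> Hm T2 (S n)" using comp_in[OF D(1)[of "n - 1", unfolded diff_add_cancel] t(1)] .
    have ce: "c * (e1 * e2) \<in> Hm T2 (S n)" using comp_in[OF cS(1) comp_in[OF e1(1) e2(1)]] .
    have "a n * (c * (e1 * e2) - D (n - 1) * t) = 0"
      using x1(2) e2(4) unfolding right_diff_distrib E by (simp flip: mult.assoc)
    moreover have "b n * (c * (e1 * e2) - D (n - 1) * t) = 0"
      using e2(6) unfolding right_diff_distrib E by (simp add: algebra_simps)
    ultimately have "c * (e1 * e2) - D (n - 1) * t = 0" using jm[OF diff_in[OF ce Dt]] by blast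
    then have "c * (e1 * e2) = diff W (n - 1) * t" by (simp add: W)
    moreover have "e1 * e2 \<in> Hm T2 T" "epi T (e1 * e2)" using comp_in[OF e1(1) e2(1)] epi_comp[OF e1(2,1) e2(2)] .
    moreover have "t \<in> Hm T2 (cobj W (n - 1))" using t(1) by (simp add: W)
    ultimately show "\<exists>T' e c'. e \<in> Hm T' T \<and> epi T e \<and> c' \<in> Hm T' (cobj W (n - 1)) \<and> c * e = diff W (n - 1) * c'" by blast
  qed
  have 2: "euler_char S \<doteq> euler_char (\<lambda>n. cobj X (n + 1)) + euler_char (cobj Y)"
    by (rule euler_char_add[OF bounded_family_shift[OF bounded_family_cx[OF X]] bounded_family_cx[OF Y] fsS]) (rule keq_product[OF pr tup jm])
  have "euler_char (\<lambda>n. cobj X (n + 1)) + euler_char (cobj Y) \<doteq> 0" by (rule keq_trans[OF keq_sym[OF 2] 1])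
  then have "- euler_char (cobj X) + euler_char (cobj Y) \<doteq> 0" using euler_char_shift[of "cobj X" 1] by (simp add: ssgn_def)
  from keq_sym[OF keq_add[OF this keq_refl[of "euler_char (cobj X)"]]] show ?thesis by simp
qed

section \<open>Isomorphisms of the derived category preserve the Euler characteristic\<close>

definition idr_roof :: "('o, 'a) cochain \<Rightarrow> ('o, 'a) roof" where
  "idr_roof X = \<lparr>rsrc = X, rmid = X, rtgt = X, rden = (\<lambda>n. Idn C (cobj X n)), rnum = (\<lambda>n. Idn C (cobj X n))\<rparr>"

lemma idr_roof:
  assumes X: "bounded_complex C X"
  shows "is_roof C (idr_roof X)" "abs_qis (embed_complex X) (embed_complex X) (embed_map X X (\<lambda>n. Idn C (cobj X n)))"
proof -
  note x = bcD[OF X]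
  have m: "embed_map X X (\<lambda>n. Idn C (cobj X n)) = (\<lambda>n. Idm (cobj (embed_complex X) n))" by (simp add: embed_map_def Idm_def)
  show q: "abs_qis (embed_complex X) (embed_complex X) (embed_map X X (\<lambda>n. Idn C (cobj X n)))" unfolding m by (rule abs_qis_id[OF embed_complex_cx[OF X]])
  have i: "unembed_map X X (embed_map X X (\<lambda>n. Idn C (cobj X n))) = (\<lambda>n. Idn C (cobj X n))"
    using arrow_of_marr[OF x(1) x(1) Idn_in[OF x(1)]] by (simp add: unembed_map_def embed_map_def)
  have ci: "chain_map C X X (\<lambda>n. Idn C (cobj X n))" using chain_mapI(1)[OF X X qiD(1)[OF q]] unfolding i .
  show "is_roof C (idr_roof X)" unfolding is_roof_def idr_roof_def using X ci quasi_isoI[OF X X ci q] by simp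
qed

text \<open>The composite roof is equivalent to the identity roof, so its numerator s h is bijective
  on cohomology. Surjectivity passes to the numerator of s. Injectivity passes to h, then across the
  square that defines the composite to the numerator of r.\<close>

lemma split_roof:
  assumes U: "bounded_complex C U" and e: "roof_comp C \<psi> \<phi> = Idn (Db C) U"
    and f: "\<And>r. r \<in> \<phi> \<Longrightarrow> is_roof C r \<and> rsrc r = U \<and> rtgt r = V" and g: "\<And>r. r \<in> \<psi> \<Longrightarrow> is_roof C r \<and> rsrc r = V \<and> rtgt r = U"
  shows "\<exists>r\<in>\<phi>. Hinj (embed_complex (rmid r)) (embed_complex V) (embed_map (rmid r) V (rnum r))"
    "\<exists>s\<in>\<psi>. Hsurj (embed_complex (rmid s)) (embed_complex U) (embed_map (rmid s) U (rnum s))"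
proof -
  note I = idr_roof[OF U]
  have "Idn (Db C) U = roof_class C (idr_roof U)" by (simp add: Db_def idr_roof_def)
  then have "idr_roof U \<in> roof_comp C \<psi> \<phi>" using e roof_eq_refl[OF I(1)] unfolding roof_class_def by simp
  then obtain r s W t h where rs: "r \<in> \<phi>" "s \<in> \<psi>" and W: "bounded_complex C W"
    "quasi_iso C W (rmid r) t" "chain_map C W (rmid s) h" "homotopic C W (rtgt r) (ccomp C (rnum r) t) (ccomp C (rden s) h)"
    and q: "roof_eq C \<lparr>rsrc = rsrc r, rmid = W, rtgt = rtgt s, rden = ccomp C (rden r) t, rnum = ccomp C (rnum s) h\<rparr> (idr_roof U)"
    unfolding roof_comp_def roof_class_def by blast
  have r: "is_roof C r" "rsrc r = U" "rtgt r = V" and s: "is_roof C s" "rsrc s = V" "rtgt s = U" using f[OF rs(1)] g[OF rs(2)] by auto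
  note R = is_roofD[OF r(1), unfolded r(2,3)] and S = is_roofD[OF s(1), unfolded s(2,3)]
  have two_term: "chain_map C W (rmid r) t" using W(2) unfolding quasi_iso_def by blast
  let ?c = "\<lparr>rsrc = U, rmid = W, rtgt = U, rden = ccomp C (rden r) t, rnum = ccomp C (rnum s) h\<rparr>"
  have "roof_eq C (idr_roof U) ?c" using roof_eq_sym[OF q] r(2) s(3) by simp
  then have c: "is_roof C ?c" "roof_rel (idr_roof U) ?c" unfolding roof_eq_iff by auto
  note m = embed_map_ccomp[OF W(1) S(2,3) W(3) S(5)]
  have "roof_equiv (embed_complex U) (embed_complex U) (embed_complex U) (embed_map U U (\<lambda>n. Idn C (cobj U n))) (embed_map U U (\<lambda>n. Idn C (cobj U n)))
      (embed_complex W) (embed_map W U (ccomp C (rden r) t)) (embed_map W U (ccomp C (rnum s) h))"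
    using c(2) unfolding roof_rel_def idr_roof_def by simp
  note rqc = roof_equiv_Hinj[OF _ _ this] roof_equiv_Hsurj[OF _ _ this]
  have i1: "roof_data (embed_complex U) (embed_complex U) (embed_complex U) (embed_map U U (\<lambda>n. Idn C (cobj U n))) (embed_map U U (\<lambda>n. Idn C (cobj U n)))"
    using is_roofD(6)[OF I(1)] by (simp add: idr_roof_def)
  have i2: "roof_data (embed_complex U) (embed_complex U) (embed_complex W) (embed_map W U (ccomp C (rden r) t)) (embed_map W U (ccomp C (rnum s) h))"
    using is_roofD(6)[OF c(1)] by simp
  have hi: "Hinj (embed_complex W) (embed_complex U) (embed_map (rmid s) U (rnum s) \<star> embed_map W (rmid s) h)"
    using rqc(1)[OF i1 i2 qiD(3)[OF I(2)]] unfolding m .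
  have hs: "Hsurj (embed_complex W) (embed_complex U) (embed_map (rmid s) U (rnum s) \<star> embed_map W (rmid s) h)"
    using rqc(2)[OF i1 i2 qiD(2)[OF I(2)]] unfolding m .
  have hc: "abs_chain_map (embed_complex W) (embed_complex (rmid s)) (embed_map W (rmid s) h)" by (rule chain_mapD(2)[OF W(1) S(2) W(3)])
  have scalar: "abs_chain_map (embed_complex (rmid s)) (embed_complex U) (embed_map (rmid s) U (rnum s))" by (rule chain_mapD(2)[OF S(2,3,5)])
  have "Hsurj (embed_complex (rmid s)) (embed_complex U) (embed_map (rmid s) U (rnum s))" by (rule Hsurj_left_factor[OF hc hs])
  then show "\<exists>s\<in>\<psi>. Hsurj (embed_complex (rmid s)) (embed_complex U) (embed_map (rmid s) U (rnum s))" using rs(2) by blast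
  have "Hinj (embed_complex W) (embed_complex (rmid s)) (embed_map W (rmid s) h)" by (rule Hinj_right_factor[OF scalar hi])
  moreover have dq: "abs_qis (embed_complex (rmid s)) (embed_complex V) (embed_map (rmid s) V (rden s))" using S(6) unfolding roof_data_def by blast
  ultimately have "Hinj (embed_complex W) (embed_complex V) (embed_map (rmid s) V (rden s) \<star> embed_map W (rmid s) h)"
    using Hinj_comp[OF hc _ qiD(1,3)[OF dq]] by (metis dq qiD(3))
  moreover have "abs_homotopic (embed_complex W) (embed_complex V) (embed_map (rmid r) V (rnum r) \<star> embed_map W (rmid r) t) (embed_map (rmid s) V (rden s) \<star> embed_map W (rmid s) h)"
    using W(4)[unfolded r(3) homotopic_iff[OF W(1) R(3) chain_map_ccomp[OF W(1) R(2,3) two_term R(5)] chain_map_ccomp[OF W(1) S(2,1) W(3) S(4)]]]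
    unfolding embed_map_ccomp[OF W(1) R(2,3) two_term R(5)] embed_map_ccomp[OF W(1) S(2,1) W(3) S(4)] .
  ultimately have hr: "Hinj (embed_complex W) (embed_complex V) (embed_map (rmid r) V (rnum r) \<star> embed_map W (rmid r) t)" using Hinj_hty abs_homotopic_sym by blast
  note tq = quasi_isoD[OF W(1) R(2) W(2)]
  have "Hinj (embed_complex (rmid r)) (embed_complex V) (embed_map (rmid r) V (rnum r))"
    by (rule Hinj_left_factor[OF chain_mapD(2)[OF R(2,3,5)] qiD(1)[OF tq] qiD(2)[OF tq] hr])
  then show "\<exists>r\<in>\<phi>. Hinj (embed_complex (rmid r)) (embed_complex V) (embed_map (rmid r) V (rnum r))" using rs(1) by blast
qed

lemma carrier_Hom_Db:
  assumes "\<phi> \<in> carrier (Hom (Db C) U V)" and r: "r \<in> \<phi>"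
  shows "is_roof C r" "rsrc r = U" "rtgt r = V" "s \<in> \<phi> \<Longrightarrow> roof_rel r s"
proof -
  obtain r0 where r0: "is_roof C r0" "rsrc r0 = U" "rtgt r0 = V" "\<phi> = roof_class C r0" using assms(1) by (auto simp: Db_def)
  have e: "roof_eq C r0 r" using r unfolding r0(4) roof_class_def by simp
  then show "is_roof C r" "rsrc r = U" "rtgt r = V" using r0 unfolding roof_eq_iff by auto
  assume "s \<in> \<phi>"
  then have "roof_eq C r0 s" unfolding r0(4) roof_class_def by simp
  from roof_eq_trans[OF roof_eq_sym[OF e] this] show "roof_rel r s" unfolding roof_eq_iff by blast
qed

text \<open>Injectivity comes from one composite and surjectivity from the other, a priori for
  different representatives. Both are properties of the class, so a single representative has a
  quasi-isomorphism as numerator.\<close>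

lemma euler_char_isomorphic_Db:
  assumes "isomorphic (Db C) U V"
  shows "euler_char (cobj U) \<doteq> euler_char (cobj V)"
proof -
  have UV: "bounded_complex C U" "bounded_complex C V" using assms unfolding isomorphic_def by (simp_all add: Db_def)
  obtain \<phi> \<psi> where f: "\<phi> \<in> carrier (Hom (Db C) U V)" and g: "\<psi> \<in> carrier (Hom (Db C) V U)"
    and e: "\<psi> \<bullet>\<^bsub>Db C\<^esub> \<phi> = Idn (Db C) U" "\<phi> \<bullet>\<^bsub>Db C\<^esub> \<psi> = Idn (Db C) V"
    using assms unfolding isomorphic_def iso_arrow_def by blast
  have e: "roof_comp C \<psi> \<phi> = Idn (Db C) U" "roof_comp C \<phi> \<psi> = Idn (Db C) V" using e by (simp_all add: Db_def)
  have F: "is_roof C r \<and> rsrc r = U \<and> rtgt r = V" if "r \<in> \<phi>" for r using carrier_Hom_Db[OF f that] by blast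
  have G: "is_roof C r \<and> rsrc r = V \<and> rtgt r = U" if "r \<in> \<psi>" for r using carrier_Hom_Db[OF g that] by blast
  obtain r where r: "r \<in> \<phi>" "Hinj (embed_complex (rmid r)) (embed_complex V) (embed_map (rmid r) V (rnum r))"
    using split_roof(1)[OF UV(1) e(1) F G] by blast
  obtain r' where r': "r' \<in> \<phi>" "Hsurj (embed_complex (rmid r')) (embed_complex V) (embed_map (rmid r') V (rnum r'))"
    using split_roof(2)[OF UV(2) e(2) G F] by blast
  note R = carrier_Hom_Db[OF f r(1)] and R' = carrier_Hom_Db[OF f r'(1)]
  note i = is_roofD(6)[OF R(1), unfolded R(2,3)] is_roofD(6)[OF R'(1), unfolded R'(2,3)]
  have "roof_equiv (embed_complex U) (embed_complex V) (embed_complex (rmid r')) (embed_map (rmid r') U (rden r')) (embed_map (rmid r') V (rnum r'))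
     (embed_complex (rmid r)) (embed_map (rmid r) U (rden r)) (embed_map (rmid r) V (rnum r))"
    using R'(4)[OF r(1)] unfolding roof_rel_def R(2,3) R'(2,3) .
  from roof_equiv_Hsurj[OF i(2,1) this r'(2)] have "abs_qis (embed_complex (rmid r)) (embed_complex V) (embed_map (rmid r) V (rnum r))"
    using r(2) i(1) unfolding abs_qis_def roof_data_def by blast
  moreover have "abs_qis (embed_complex (rmid r)) (embed_complex U) (embed_map (rmid r) U (rden r))" "abs_complex (embed_complex (rmid r))" using i(1) unfolding roof_data_def by blast+
  ultimately have "euler_char (cobj (embed_complex (rmid r))) \<doteq> euler_char (cobj (embed_complex V))" "euler_char (cobj (embed_complex (rmid r))) \<doteq> euler_char (cobj (embed_complex U))"
    using euler_char_qi[OF _ embed_complex_cx[OF UV(1)]] euler_char_qi[OF _ embed_complex_cx[OF UV(2)]] by blast+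
  from keq_trans[OF keq_sym[OF this(2)] this(1)] show ?thesis by simp
qed

section \<open>Euler characteristics of sums, stalks and Hall triangles\<close>

lemma keq_dsum:
  assumes X: "X \<in> Ob C" "Y \<in> Ob C"
  shows "dsum C X Y \<in> Ob C" "cl (dsum C X Y) \<doteq> cl X + cl Y"
proof -
  obtain b where b: "biproduct_of C X Y b" using abelian X unfolding abelian_category_def by blast
  have "biproduct_of C X Y (biprod C X Y)" unfolding biprod_def using someI[of "biproduct_of C X Y", OF b] .
  then obtain S i j p r where "biprod C X Y = (S, i, j, p, r)" and b: "biproduct_of C X Y (S, i, j, p, r)" by (metis prod_cases5)
  then have d: "dsum C X Y = S" by (simp add: dsum_def)
  have b: "S \<in> Ob C" "i \<in> carrier (Hom C X S)" "j \<in> carrier (Hom C Y S)"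
    "p \<in> carrier (Hom C S X)" "r \<in> carrier (Hom C S Y)" "p \<bullet>\<^bsub>C\<^esub> i = Idn C X" "r \<bullet>\<^bsub>C\<^esub> j = Idn C Y"
    "p \<bullet>\<^bsub>C\<^esub> j = \<zero>\<^bsub>Hom C Y X\<^esub>" "r \<bullet>\<^bsub>C\<^esub> i = \<zero>\<^bsub>Hom C X Y\<^esub>" "(i \<bullet>\<^bsub>C\<^esub> p) \<oplus>\<^bsub>Hom C S S\<^esub> (j \<bullet>\<^bsub>C\<^esub> r) = Idn C S"
    using b unfolding biproduct_of_def by auto
  show "dsum C X Y \<in> Ob C" using d b(1) by simp
  have m: "marr C X S i * marr C S X p + marr C Y S j * marr C S Y r = Idm S"
    using marr_add[OF b(1,1) Comp_in[OF b(1) X(1) b(1) b(4,2)] Comp_in[OF b(1) X(2) b(1) b(5,3)]]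
      marr_comp[OF b(1) X(1) b(1) b(4,2)] marr_comp[OF b(1) X(2) b(1) b(5,3)]
    unfolding Idm_def b(10) by simp
  have n: "marr C S X p * marr C X S i = Idm X" "marr C S Y r * marr C Y S j = Idm Y"
    "marr C S X p * marr C Y S j = 0" "marr C S Y r * marr C X S i = 0"
    using X b Idn_in unfolding Idm_def by (simp_all add: marr_comp_eq marr_comp_eq0)
  note h = HmI[OF X(1) b(1,2)] HmI[OF X(2) b(1,3)] HmI[OF b(1) X(1) b(4)] HmI[OF b(1) X(2) b(5)]
  have "cl S \<doteq> cl X + cl Y"
  proof (rule keq_product[OF h(3,4)])
    fix T x y assume xy: "x \<in> Hm T X" "y \<in> Hm T Y"
    have "marr C S X p * (marr C X S i * x + marr C Y S j * y) = x" "marr C S Y r * (marr C X S i * x + marr C Y S j * y) = y"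
      using n idl[OF xy(1)] idl[OF xy(2)] by (simp_all add: distrib_left flip: mult.assoc)
    then show "\<exists>t\<in>Hm T S. marr C S X p * t = x \<and> marr C S Y r * t = y"
      using add_in[OF comp_in[OF h(1) xy(1)] comp_in[OF h(2) xy(2)]] by blast
  next
    fix T t assume t: "t \<in> Hm T S" "marr C S X p * t = 0" "marr C S Y r * t = 0"
    have "Idm S * t = 0" unfolding m[symmetric] using t(2,3) by (simp add: distrib_right mult.assoc)
    then show "t = 0" using idl[OF t(1)] by simp
  qed
  then show "cl (dsum C X Y) \<doteq> cl X + cl Y" unfolding d .
qed

lemma bounded_family_dsum:
  assumes "bounded_family c" "bounded_family d" shows "bounded_family (\<lambda>n. dsum C (c n) (d n))"
proof -
  have ob: "c n \<in> Ob C" "d n \<in> Ob C" for n using assms unfolding bounded_family_def by auto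
  have "Idm (dsum C X Y) = 0" if X: "X \<in> Ob C" "Y \<in> Ob C" "Idm X = 0" "Idm Y = 0" for X Y
  proof -
    obtain b where b: "biproduct_of C X Y b" using abelian X unfolding abelian_category_def by blast
    have "biproduct_of C X Y (biprod C X Y)" unfolding biprod_def using someI[of "biproduct_of C X Y", OF b] .
    then obtain S i j p r where "biprod C X Y = (S, i, j, p, r)" and b: "biproduct_of C X Y (S, i, j, p, r)" by (metis prod_cases5)
    then have d: "dsum C X Y = S" by (simp add: dsum_def)
    have b: "S \<in> Ob C" "i \<in> carrier (Hom C X S)" "j \<in> carrier (Hom C Y S)"
      "p \<in> carrier (Hom C S X)" "r \<in> carrier (Hom C S Y)" "(i \<bullet>\<^bsub>C\<^esub> p) \<oplus>\<^bsub>Hom C S S\<^esub> (j \<bullet>\<^bsub>C\<^esub> r) = Idn C S"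
      using b unfolding biproduct_of_def by auto
    have "marr C X S i * marr C S X p + marr C Y S j * marr C S Y r = Idm S"
      using marr_add[OF b(1,1) Comp_in[OF b(1) X(1) b(1) b(4,2)] Comp_in[OF b(1) X(2) b(1) b(5,3)]]
        marr_comp[OF b(1) X(1) b(1) b(4,2)] marr_comp[OF b(1) X(2) b(1) b(5,3)]
      unfolding Idm_def b(6) by simp
    moreover have "marr C X S i = 0" "marr C Y S j = 0"
      using null_source[OF X(3) HmI[OF X(1) b(1,2)]] null_source[OF X(4) HmI[OF X(2) b(1,3)]] by auto
    ultimately show ?thesis using d by simp
  qed
  then have "{n. Idm (dsum C (c n) (d n)) \<noteq> 0} \<subseteq> {n. Idm (c n) \<noteq> 0} \<union> {n. Idm (d n) \<noteq> 0}" using ob by blast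
  then show ?thesis using assms keq_dsum(1)[OF ob] finite_subset unfolding bounded_family_def by blast
qed

lemma euler_char_dsum: "bounded_family c \<Longrightarrow> bounded_family d \<Longrightarrow> euler_char (\<lambda>n. dsum C (c n) (d n)) \<doteq> euler_char c + euler_char d"
  by (rule euler_char_add[OF _ _ bounded_family_dsum keq_dsum(2)]) (simp_all add: bounded_family_def)

lemma bounded_family_stalk: "M \<in> Ob C \<Longrightarrow> bounded_family (cobj (stalk C M))"
  using bounded_family_bc[OF stalk_st(1)] .

lemma euler_char_stalk:
  assumes M: "M \<in> Ob C" shows "euler_char (cobj (stalk C M)) \<doteq> cl M"
proof -
  have c: "cobj (stalk C M) n = (if n = 0 then M else null)" for n by (simp add: stalk_def Let_def zero_ob_null)
  have "euler_char (cobj (stalk C M)) \<doteq> (\<Sum>n\<in>{0}. ssgn n (cl (cobj (stalk C M) n)))"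
    by (rule euler_char_superset[OF bounded_family_stalk[OF M]]) (auto simp: c null split: if_splits)
  then show ?thesis by (simp add: c ssgn_def)
qed

lemma cobj_shift: "cobj (shift C k X) = (\<lambda>n. cobj X (n + k))"
  by (simp add: shift_def)

lemma cobj_csum: "cobj (csum C X Y) = (\<lambda>n. dsum C (cobj X n) (cobj Y n))"
  by (simp add: csum_def Let_def)

lemma cobj_cone: "cobj (cone C X Y f) = (\<lambda>n. dsum C (cobj X (n + 1)) (cobj Y n))"
  by (simp add: cone_def Let_def)

text \<open>A nonzero Hall number provides a roof X <- Z -> Y[1] with cone isomorphic to L[1].
  Counting terms gives -[L] = -[Z] - [Y], and Z is quasi-isomorphic to X.\<close>

lemma hall_nonzero:
  assumes h: "hall C X Y L \<noteq> 0" and Y: "bounded_family (cobj Y)"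
  shows "euler_char (cobj L) \<doteq> euler_char (cobj X) + euler_char (cobj Y)"
proof -
  have "ext1_cone C X Y L \<noteq> {}" using h unfolding hall_def by auto
  then obtain \<phi> where p: "\<phi> \<in> carrier (Hom (Db C) X (shift C 1 Y))" "cone_is_iso_to C \<phi> (shift C 1 L)"
    unfolding ext1_cone_def by blast
  then obtain r where r: "r \<in> \<phi>" "isomorphic (Db C) (cone C (rmid r) (rtgt r) (rnum r)) (shift C 1 L)"
    unfolding cone_is_iso_to_def by blast
  note R = carrier_Hom_Db(1-3)[OF p(1) r(1)]
  note S = is_roofD[OF R(1), unfolded R(2,3)]
  have q: "abs_qis (embed_complex (rmid r)) (embed_complex X) (embed_map (rmid r) X (rden r))" using S(6) unfolding roof_data_def by blast
  have 1: "euler_char (cobj (rmid r)) \<doteq> euler_char (cobj X)" using euler_char_qi[OF embed_complex_cx[OF S(2)] embed_complex_cx[OF S(1)] q] by simp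
  have 2: "euler_char (cobj (cone C (rmid r) (rtgt r) (rnum r))) \<doteq> euler_char (\<lambda>n. cobj (rmid r) (n + 1)) + euler_char (\<lambda>n. cobj Y (n + 1))"
    unfolding cobj_cone R(3) cobj_shift by (rule euler_char_dsum[OF bounded_family_shift[OF bounded_family_bc[OF S(2)]] bounded_family_shift[OF Y]])
  have "euler_char (cobj (shift C 1 L)) \<doteq> euler_char (\<lambda>n. cobj (rmid r) (n + 1)) + euler_char (\<lambda>n. cobj Y (n + 1))"
    by (rule keq_trans[OF keq_sym[OF euler_char_isomorphic_Db[OF r(2)]] 2])
  then have "- euler_char (cobj L) \<doteq> - euler_char (cobj (rmid r)) - euler_char (cobj Y)"
    unfolding cobj_shift euler_char_shift by (simp add: ssgn_def)
  from keq_minus[OF this] have "euler_char (cobj L) \<doteq> euler_char (cobj (rmid r)) + euler_char (cobj Y)" by (simp add: add.commute)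
  from keq_trans[OF this keq_add[OF 1 keq_refl]] show ?thesis .
qed

text \<open>\<open>hall_nonzero\<close> for the i-th factor; the shifts [1] and [-1] both turn into
  a minus sign.\<close>

lemma hall_weight_nonzero:
  assumes w: "hall_weight C m A B J M \<noteq> 0" and i: "i < m"
    and ob: "\<And>i. i < m \<Longrightarrow> A i \<in> Ob C" "\<And>i. i < m \<Longrightarrow> B i \<in> Ob C" "\<And>i. i < m \<Longrightarrow> J i \<in> Ob C" "\<And>i. i < m \<Longrightarrow> M i \<in> Ob C"
  shows "cl (M i) \<doteq> cl (A i) + cl (B i) - cl (J i) - cl (J ((i + m - 1) mod m))"
proof -
  let ?j = "(i + m - 1) mod m"
  have j: "?j < m" using i by simp
  let ?X = "csum C (shift C 1 (stalk C (J i))) (stalk C (A i))" and ?Y = "csum C (stalk C (B i)) (shift C (-1) (stalk C (J ?j)))"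
  have "hall C ?X ?Y (stalk C (M i)) / real (aut_card C (J i)) \<noteq> 0"
    using prod_zero[of "{..<m}" "\<lambda>i. hall C (csum C (shift C 1 (stalk C (J i))) (stalk C (A i)))
            (csum C (stalk C (B i)) (shift C (-1) (stalk C (J ((i + m - 1) mod m))))) (stalk C (M i)) / real (aut_card C (J i))"]
      w i unfolding hall_weight_def by blast
  then have h: "hall C ?X ?Y (stalk C (M i)) \<noteq> 0" by force
  note s = bounded_family_stalk[OF ob(1)[OF i]] bounded_family_stalk[OF ob(2)[OF i]] bounded_family_shift[OF bounded_family_stalk[OF ob(3)[OF i]]] bounded_family_shift[OF bounded_family_stalk[OF ob(3)[OF j]]]
  have "bounded_family (cobj ?Y)" unfolding cobj_csum cobj_shift by (rule bounded_family_dsum[OF s(2,4)])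
  from hall_nonzero[OF h this] have 1: "euler_char (cobj (stalk C (M i))) \<doteq> euler_char (cobj ?X) + euler_char (cobj ?Y)" .
  have 2: "euler_char (cobj ?X) \<doteq> - euler_char (cobj (stalk C (J i))) + euler_char (cobj (stalk C (A i)))"
    using euler_char_dsum[OF s(3,1), of 1] unfolding cobj_csum cobj_shift euler_char_shift by (simp add: ssgn_def)
  have 3: "euler_char (cobj ?Y) \<doteq> euler_char (cobj (stalk C (B i))) + - euler_char (cobj (stalk C (J ?j)))"
    using euler_char_dsum[OF s(2,4), of "-1"] unfolding cobj_csum cobj_shift euler_char_shift by (simp add: ssgn_def)
  have 4: "(- euler_char (cobj (stalk C (J i))) + euler_char (cobj (stalk C (A i)))) +
      (euler_char (cobj (stalk C (B i))) + - euler_char (cobj (stalk C (J ?j)))) \<doteq> (- cl (J i) + cl (A i)) + (cl (B i) + - cl (J ?j))"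
    by (intro keq_add keq_minus euler_char_stalk ob i j)
  have "cl (M i) \<doteq> (- cl (J i) + cl (A i)) + (cl (B i) + - cl (J ?j))"
    by (rule keq_trans[OF keq_sym[OF euler_char_stalk[OF ob(4)[OF i]]] keq_trans[OF keq_trans[OF 1 keq_add[OF 2 3]] 4]])
  moreover have "(- x + y) + (z + - w) = y + z - x - w" for x y z w :: "'o \<Rightarrow>\<^sub>0 int" by (simp add: algebra_simps)
  ultimately show ?thesis by (simp only:)
qed

end



section \<open>The exponent identity\<close>

text \<open>Here \<open>a\<close> and \<open>b\<close> stand for the alternating sums of the families \<open>A\<close> and \<open>B\<close>, and \<open>k\<^sub>i\<close> for the class
  of \<open>I\<^sub>i\<^sub>-\<^sub>1\<close>. If the Hall number does not vanish, then \<open>M\<close> and its alternating sums \<open>\<mu>\<close> are given by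
  the formulas below, and \<open>e\<close> is the exponent of the embedding. For odd \<open>m\<close>, twice a family is the sum of
  two successive alternating sums, which reduces everything to the sums \<open>P\<close>, \<open>P1\<close> and \<open>Pm\<close>.\<close>

lemma exponent_identity:
  fixes R :: "'x::ab_group_add \<Rightarrow> 'x \<Rightarrow> real" and a b k A B :: "nat \<Rightarrow> 'x" and m :: nat
  defines "S \<equiv> \<lambda>x y. R x y + R y x"
    and "e \<equiv> \<lambda>x X. 1 / 4 * (\<Sum>i=1..m-1. R (x i) (x (Suc i))) - 1 / 4 * R (x 1) (x 0) + (\<Sum>i<m. R (X i) (x i - X i))"
    and "\<mu> \<equiv> \<lambda>i. a i + b i - (k i + k i)" and "M \<equiv> \<lambda>i. A i + B i - k (Suc i) - k i"
  assumes R: "\<And>x y z. R (x + y) z = R x z + R y z" "\<And>x y z. R x (y + z) = R x y + R x z" and m: "m > 0"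
    and per: "a m = a 0" "a (Suc m) = a 1" "b m = b 0" "b (Suc m) = b 1" "k m = k 0" "k (Suc m) = k 1"
    and half: "\<And>i. A i + A i = a i + a (Suc i)" "\<And>i. B i + B i = b i + b (Suc i)"
  shows "e a A + e b B + ((\<Sum>i<m. R (A i) (B i)) - 1 / 2 * (\<Sum>i<m. S (a (Suc i)) (B i - B (Suc i)))
       + 1 / 4 * (\<Sum>i=1..m-1. S (a (Suc i)) (b i)) - 1 / 4 * S (a 0) (b 1))
     + (1 / 2 * S (k 0) (a 1 + b 1) - 1 / 2 * (\<Sum>i=1..m-1. S (k (Suc i)) (a i + b i))
       + (\<Sum>i<m. R (M i - M (Suc i)) (k (Suc i))) + (\<Sum>i=1..m-1. R (k i) (k (Suc i))) - R (k 1) (k 0))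
     = e \<mu> M + (\<Sum>i<m. R (a i) (B i))"
proof -
  have R0: "R 0 z = 0" "R z 0 = 0" for z using R(1)[of 0 0 z] R(2)[of z 0 0] by simp_all
  have Rm: "R (- x) z = - R x z" "R z (- x) = - R z x" for x z
    using R(1)[of x "- x" z] R(2)[of z x "- x"] R0 by simp_all
  have Rd: "R (x - y) z = R x z - R y z" "R z (x - y) = R z x - R z y" for x y z
    using R(1)[of x "- y" z] R(2)[of z x "- y"] Rm by simp_all
  have RA: "R (A i) z = (R (a i) z + R (a (Suc i)) z) / 2" "R z (A i) = (R z (a i) + R z (a (Suc i))) / 2" for i z
    using R(1)[of "A i" "A i" z] R(2)[of z "A i" "A i"] half(1)[of i] R by simp_all
  have RB: "R (B i) z = (R (b i) z + R (b (Suc i)) z) / 2" "R z (B i) = (R z (b i) + R z (b (Suc i))) / 2" for i z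
    using R(1)[of "B i" "B i" z] R(2)[of z "B i" "B i"] half(2)[of i] R by simp_all
  \<comment> \<open>Sums over 1..m-1 become cyclic sums minus the term at 0. These extra terms and
    the explicit boundary terms are balanced in the last step.\<close>
  have s1: "(\<Sum>i=1..m-1. f i) = (\<Sum>i<m. f i) - f 0" for f :: "nat \<Rightarrow> real"
  proof -
    have "{..<m} = insert 0 {1..m-1}" using m by auto
    then show ?thesis by simp
  qed
  have cyc: "(\<Sum>i<m. f (Suc i)) = (\<Sum>i<m. f i)" if "f m = f 0" for f :: "nat \<Rightarrow> real"
    using sum.lessThan_Suc_shift[of f m] that by simp
  \<comment> \<open>The cyclic sums with no shift, with a shift on the left and with a shift on the
    right. A shift by two against a shift by one reduces to these by periodicity.\<close>
  define P P1 Pm where "P x y = (\<Sum>i<m. R (x i) (y i))" and "P1 x y = (\<Sum>i<m. R (x (Suc i)) (y i))"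
    and "Pm x y = (\<Sum>i<m. R (x i) (y (Suc i)))" for x y :: "nat \<Rightarrow> 'x"
  have sh: "(\<Sum>i<m. R (x (Suc i)) (y (Suc i))) = P x y" "(\<Sum>i<m. R (x (Suc (Suc i))) (y (Suc i))) = P1 x y"
    "(\<Sum>i<m. R (x (Suc i)) (y (Suc (Suc i)))) = Pm x y"
    if "x m = x 0" "x (Suc m) = x 1" "y m = y 0" "y (Suc m) = y 1" for x y
    using that cyc[of "\<lambda>i. R (x i) (y i)"] cyc[of "\<lambda>i. R (x (Suc i)) (y i)"] cyc[of "\<lambda>i. R (x i) (y (Suc i))"]
    by (simp_all add: P_def P1_def Pm_def)
  \<comment> \<open>Since 2 X_i = x_i + x_(i+1), the term R (X_i) (x_i - X_i) is a quarter of R at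
    x_i + x_(i+1) and x_i - x_(i+1). Summed over a cycle this is (P1 - Pm) / 4, which trades the Pm
    / 4 already present for P1 / 4.\<close>
  have ev: "e x X = (P1 x x - R (x 1) (x 0) - R (x 0) (x 1)) / 4"
    if X: "\<And>i. X i + X i = x i + x (Suc i)" and p: "x m = x 0" "x (Suc m) = x 1" for x X
  proof -
    have RX: "R (X i) z = (R (x i) z + R (x (Suc i)) z) / 2" "R z (X i) = (R z (x i) + R z (x (Suc i))) / 2" for i z
      using R(1)[of "X i" "X i" z] R(2)[of z "X i" "X i"] X[of i] R by simp_all
    have "(\<Sum>i<m. R (X i) (x i - X i)) = (\<Sum>i<m. (R (x i) (x i) - R (x i) (x (Suc i)) + R (x (Suc i)) (x i) - R (x (Suc i)) (x (Suc i))) / 4)"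
      by (rule sum.cong) (simp_all add: RX Rd field_simps)
    also have "\<dots> = (P1 x x - Pm x x) / 4"
      using sh(1)[OF p p] by (simp add: sum.distrib sum_subtractf P_def P1_def Pm_def flip: sum_divide_distrib)
    finally show ?thesis unfolding e_def s1 by (simp add: Pm_def field_simps)
  qed
  have mu: "\<mu> m = \<mu> 0" "\<mu> (Suc m) = \<mu> 1" using per by (simp_all add: \<mu>_def)
  \<comment> \<open>M and \<mu> satisfy the same relation as A with a and B with b, so
    \<open>ev\<close> applies to all three families.\<close>
  have M2: "M i + M i = \<mu> i + \<mu> (Suc i)" for i
    using half[of i] by (simp add: M_def \<mu>_def algebra_simps)
  note sab = sh[OF per(1-4)] and sba = sh[OF per(3,4,1,2)] and sak = sh[OF per(1,2,5,6)] and sbk = sh[OF per(3-6)] and skk = sh[OF per(5,6,5,6)]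
    and ska = sh[OF per(5,6,1,2)] and skb = sh[OF per(5,6,3,4)]
  have 1: "(\<Sum>i<m. R (A i) (B i)) = (P a b + Pm a b + P1 a b + P a b) / 4"
  proof -
    have "(\<Sum>i<m. R (A i) (B i)) = (\<Sum>i<m. (R (a i) (b i) + R (a i) (b (Suc i)) + R (a (Suc i)) (b i) + R (a (Suc i)) (b (Suc i))) / 4)"
      by (rule sum.cong) (simp_all add: RA RB field_simps)
    then show ?thesis using sab(1) by (simp add: sum.distrib P_def P1_def Pm_def flip: sum_divide_distrib)
  qed
  have 2: "(\<Sum>i<m. S (a (Suc i)) (B i - B (Suc i))) = (P1 a b - Pm a b + Pm b a - P1 b a) / 2"
  proof -
    have "(\<Sum>i<m. S (a (Suc i)) (B i - B (Suc i))) = (\<Sum>i<m. (R (a (Suc i)) (b i) - R (a (Suc i)) (b (Suc (Suc i)))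
        + R (b i) (a (Suc i)) - R (b (Suc (Suc i))) (a (Suc i))) / 2)"
      by (rule sum.cong) (simp_all add: S_def RB Rd field_simps)
    then show ?thesis using sab(3) sba(2) by (simp add: sum.distrib sum_subtractf P_def P1_def Pm_def flip: sum_divide_distrib)
  qed
  have 3: "(\<Sum>i<m. S (a (Suc i)) (b i)) = P1 a b + Pm b a" by (simp add: S_def sum.distrib P1_def Pm_def)
  have 4: "(\<Sum>i<m. S (k (Suc i)) (a i + b i)) = P1 k a + P1 k b + Pm a k + Pm b k"
    by (simp add: S_def R sum.distrib P1_def Pm_def)
  have 5: "(\<Sum>i<m. R (M i - M (Suc i)) (k (Suc i))) = (Pm a k - P1 a k + Pm b k - P1 b k) / 2 - Pm k k + P1 k k"
  proof -
    have "(\<Sum>i<m. R (M i - M (Suc i)) (k (Suc i))) = (\<Sum>i<m. (R (a i) (k (Suc i)) - R (a (Suc (Suc i))) (k (Suc i))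
       + R (b i) (k (Suc i)) - R (b (Suc (Suc i))) (k (Suc i))) / 2 - R (k i) (k (Suc i)) + R (k (Suc (Suc i))) (k (Suc i)))"
      by (rule sum.cong) (simp_all add: M_def R Rd RA RB field_simps)
    then show ?thesis using sak(2) sbk(2) skk(2)
      by (simp add: sum.distrib sum_subtractf P_def P1_def Pm_def flip: sum_divide_distrib)
  qed
  have 6: "(\<Sum>i<m. R (a i) (B i)) = (P a b + Pm a b) / 2"
    by (simp add: RB sum.distrib P_def Pm_def flip: sum_divide_distrib)
  have 7: "P1 \<mu> \<mu> = P1 a a + P1 a b + P1 b a + P1 b b - 2 * (P1 a k + P1 b k) - 2 * (P1 k a + P1 k b) + 4 * P1 k k"
    by (simp add: P1_def \<mu>_def R Rd sum.distrib sum_subtractf sum_distrib_left)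
  have 8: "(\<Sum>i<m. R (k i) (k (Suc i))) = Pm k k" by (simp add: Pm_def)
  have 9: "R (\<mu> 1) (\<mu> 0) = R (a 1) (a 0) + R (a 1) (b 0) + R (b 1) (a 0) + R (b 1) (b 0) - 2 * (R (a 1) (k 0) + R (b 1) (k 0))
      - 2 * (R (k 1) (a 0) + R (k 1) (b 0)) + 4 * R (k 1) (k 0)"
    "R (\<mu> 0) (\<mu> 1) = R (a 0) (a 1) + R (a 0) (b 1) + R (b 0) (a 1) + R (b 0) (b 1) - 2 * (R (a 0) (k 1) + R (b 0) (k 1))
      - 2 * (R (k 0) (a 1) + R (k 0) (b 1)) + 4 * R (k 0) (k 1)"
    by (simp_all add: \<mu>_def R Rd)
  show ?thesis
    unfolding ev[OF half(1) per(1,2)] ev[OF half(2) per(3,4)] ev[OF M2 mu] s1 1 2 3 4 5 6 7 8 9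
    by (simp add: S_def R field_simps)
qed

section \<open>Algebras with structure constants\<close>

text \<open>A nonzero factor preserves the support, so the identity holds also for infinite
  supports, where both sums are 0 by convention.\<close>

lemma Sum_any_cmult:
  fixes f :: "'i \<Rightarrow> real"
  shows "K * Sum_any f = Sum_any (\<lambda>i. K * f i)"
proof (cases "K = 0")
  case False
  then have "{i. K * f i \<noteq> 0} = {i. f i \<noteq> 0}" by simp
  then show ?thesis unfolding Sum_any.expand_set by (simp add: sum_distrib_left)
qed (simp add: Sum_any.expand_set)

text \<open>The map is the linear extension of sending b to w b times the basis vector at e b. The
  conditions on structure constants give the coefficients of a product of image vectors on the image
  of B and off it; nonzero weights and injectivity of e make the map injective.\<close>

lemma based_algebra_embedding:
  fixes w :: "'b \<Rightarrow> complex"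
  assumes e: "inj_on e B" "e ` B \<subseteq> B'" and w: "\<And>b. b \<in> B \<Longrightarrow> w b \<noteq> 0"
    and u: "u \<in> B" "e u = u'" "w u = 1"
    and s: "\<And>b b' d. b \<in> B \<Longrightarrow> b' \<in> B \<Longrightarrow> d \<in> B \<Longrightarrow> w b * w b' * s' (e b) (e b') (e d) = w d * s b b' d"
    and s0: "\<And>b b' d. b \<in> B \<Longrightarrow> b' \<in> B \<Longrightarrow> d \<in> B' - e ` B \<Longrightarrow> s' (e b) (e b') d = 0"
  shows "\<exists>\<phi>. algebra_embedding (based_algebra B s u) (based_algebra B' s' u') \<phi> \<and>
    (\<forall>b\<in>B. \<phi> (basis_vec b) = (\<lambda>d. w b * basis_vec (e b) d))"
proof -
  define \<phi> where "\<phi> f d = (if d \<in> e ` B then w (inv_into B e d) * f (inv_into B e d) else 0)" for f d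
  have v: "\<phi> f (e b) = w b * f b" if "b \<in> B" for f b using that e(1) by (simp add: \<phi>_def)
  have v0: "\<phi> f d = 0" if "d \<notin> e ` B" for f d using that by (simp add: \<phi>_def)
  have supp: "{d. \<phi> f d \<noteq> 0} = e ` {b. f b \<noteq> 0}" if "{b. f b \<noteq> 0} \<subseteq> B" for f
  proof (intro equalityI subsetI)
    fix d assume d: "d \<in> {d. \<phi> f d \<noteq> 0}"
    then obtain b where "b \<in> B" "d = e b" using v0 by blast
    then show "d \<in> e ` {b. f b \<noteq> 0}" using d v by auto
  next
    fix d assume "d \<in> e ` {b. f b \<noteq> 0}"
    then show "d \<in> {d. \<phi> f d \<noteq> 0}" using v w that by fastforce
  qed
  have basis: "\<phi> (basis_vec b) = (\<lambda>d. w b * basis_vec (e b) d)" if b: "b \<in> B" for b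
  proof
    fix d show "\<phi> (basis_vec b) d = w b * basis_vec (e b) d"
    proof (cases "d \<in> e ` B")
      case True
      then obtain c where "c \<in> B" "d = e c" by blast
      then show ?thesis using v b inj_on_eq_iff[OF e(1)] by (simp add: basis_vec_def)
    qed (use b v0 in \<open>auto simp: basis_vec_def\<close>)
  qed
  have mult: "\<phi> (f \<otimes>\<^bsub>based_algebra B s u\<^esub> g) = \<phi> f \<otimes>\<^bsub>based_algebra B' s' u'\<^esub> \<phi> g"
    if f: "{b. f b \<noteq> 0} \<subseteq> B" and g: "{b. g b \<noteq> 0} \<subseteq> B" for f g
  proof
    fix d
    have "(\<Sum>c\<in>{d. \<phi> f d \<noteq> 0}. \<Sum>c'\<in>{d. \<phi> g d \<noteq> 0}. \<phi> f c * \<phi> g c' * s' c c' d)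
        = (\<Sum>b\<in>{b. f b \<noteq> 0}. \<Sum>b'\<in>{b. g b \<noteq> 0}. \<phi> f (e b) * \<phi> g (e b') * s' (e b) (e b') d)"
      unfolding supp[OF f] supp[OF g] sum.reindex[OF inj_on_subset[OF e(1) f]] sum.reindex[OF inj_on_subset[OF e(1) g]] comp_def ..
    also have "\<dots> = (\<Sum>b\<in>{b. f b \<noteq> 0}. \<Sum>b'\<in>{b. g b \<noteq> 0}. f b * g b' * (w b * w b' * s' (e b) (e b') d))"
      by (intro sum.cong refl) (use f g in \<open>simp add: v subset_iff mult_ac\<close>)
    finally have R: "(\<phi> f \<otimes>\<^bsub>based_algebra B' s' u'\<^esub> \<phi> g) d = (if d \<in> B' then
        (\<Sum>b\<in>{b. f b \<noteq> 0}. \<Sum>b'\<in>{b. g b \<noteq> 0}. f b * g b' * (w b * w b' * s' (e b) (e b') d)) else 0)"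
      by (simp add: based_algebra_def)
    show "\<phi> (f \<otimes>\<^bsub>based_algebra B s u\<^esub> g) d = (\<phi> f \<otimes>\<^bsub>based_algebra B' s' u'\<^esub> \<phi> g) d"
    proof (cases "d \<in> e ` B")
      case True
      then obtain c where c: "c \<in> B" "d = e c" by blast
      have "\<phi> (f \<otimes>\<^bsub>based_algebra B s u\<^esub> g) d = w c * (\<Sum>b\<in>{b. f b \<noteq> 0}. \<Sum>b'\<in>{b. g b \<noteq> 0}. f b * g b' * s b b' c)"
        using c v by (simp add: based_algebra_def)
      also have "\<dots> = (\<Sum>b\<in>{b. f b \<noteq> 0}. \<Sum>b'\<in>{b. g b \<noteq> 0}. f b * g b' * (w b * w b' * s' (e b) (e b') d))"
        unfolding sum_distrib_left
      proof (intro sum.cong refl)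
        fix b b' assume "b \<in> {b. f b \<noteq> 0}" "b' \<in> {b. g b \<noteq> 0}"
        then have "w b * w b' * s' (e b) (e b') d = w c * s b b' c" using s c f g by blast
        then show "w c * (f b * g b' * s b b' c) = f b * g b' * (w b * w b' * s' (e b) (e b') d)" by simp
      qed
      finally show ?thesis using R c e(2) by auto
    next
      case False
      have "(\<Sum>b\<in>{b. f b \<noteq> 0}. \<Sum>b'\<in>{b. g b \<noteq> 0}. f b * g b' * (w b * w b' * s' (e b) (e b') d)) = 0" if "d \<in> B'"
      proof (intro sum.neutral ballI)
        fix b b' assume "b \<in> {b. f b \<noteq> 0}" "b' \<in> {b. g b \<noteq> 0}"
        then have "s' (e b) (e b') d = 0" using s0 f g False that by blast
        then show "f b * g b' * (w b * w b' * s' (e b) (e b') d) = 0" by simp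
      qed
      then show ?thesis using R v0[OF False] by simp
    qed
  qed
  have "algebra_embedding (based_algebra B s u) (based_algebra B' s' u') \<phi>" unfolding algebra_embedding_def
  proof (intro conjI ring_hom_memI allI ballI)
    fix f assume f: "f \<in> carrier (based_algebra B s u)"
    then have f': "finite {b. f b \<noteq> 0}" "{b. f b \<noteq> 0} \<subseteq> B" by (simp_all add: based_algebra_def)
    show "\<phi> f \<in> carrier (based_algebra B' s' u')" using f' supp[OF f'(2)] e(2) by (simp add: based_algebra_def) blast
    show "\<phi> (c \<odot>\<^bsub>based_algebra B s u\<^esub> f) = c \<odot>\<^bsub>based_algebra B' s' u'\<^esub> \<phi> f" for c
      by (rule ext) (simp add: based_algebra_def \<phi>_def)
    fix g assume g: "g \<in> carrier (based_algebra B s u)"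
    then have g': "finite {b. g b \<noteq> 0}" "{b. g b \<noteq> 0} \<subseteq> B" by (simp_all add: based_algebra_def)
    show "\<phi> (f \<otimes>\<^bsub>based_algebra B s u\<^esub> g) = \<phi> f \<otimes>\<^bsub>based_algebra B' s' u'\<^esub> \<phi> g" by (rule mult[OF f'(2) g'(2)])
    show "\<phi> (f \<oplus>\<^bsub>based_algebra B s u\<^esub> g) = \<phi> f \<oplus>\<^bsub>based_algebra B' s' u'\<^esub> \<phi> g"
      by (rule ext) (simp add: based_algebra_def \<phi>_def algebra_simps)
  next
    show "\<phi> \<one>\<^bsub>based_algebra B s u\<^esub> = \<one>\<^bsub>based_algebra B' s' u'\<^esub>" using basis[OF u(1)] u by (simp add: based_algebra_def)
    show "inj_on \<phi> (carrier (based_algebra B s u))"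
    proof (intro inj_onI ext)
      fix f g b assume fg: "f \<in> carrier (based_algebra B s u)" "g \<in> carrier (based_algebra B s u)" "\<phi> f = \<phi> g"
      show "f b = g b"
      proof (cases "b \<in> B")
        case True
        then show ?thesis using v[OF True, of f] v[OF True, of g] fg(3) w by simp
      next
        case False
        then have "f b = 0" "g b = 0" using fg(1,2) unfolding based_algebra_def by auto
        then show ?thesis by simp
      qed
    qed
  qed
  then show ?thesis using basis by blast
qed



section \<open>The Grothendieck group\<close>

context lin_abelian
begin

abbreviation supp_Ob :: "('o \<Rightarrow>\<^sub>0 int) \<Rightarrow> bool" where
  "supp_Ob x \<equiv> Poly_Mapping.keys x \<subseteq> Ob C"

lemma supp_Ob_simps: "supp_Ob 0" "supp_Ob x \<Longrightarrow> supp_Ob (- x)" "supp_Ob x \<Longrightarrow> supp_Ob y \<Longrightarrow> supp_Ob (x + y)" "supp_Ob x \<Longrightarrow> supp_Ob y \<Longrightarrow> supp_Ob (x - y)"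
    "X \<in> Ob C \<Longrightarrow> supp_Ob (cl X)" "supp_Ob x \<Longrightarrow> supp_Ob (ssgn n x)" "(\<And>k. k \<in> A \<Longrightarrow> supp_Ob (f k)) \<Longrightarrow> supp_Ob (sum f A)"
  using keys_add[of x y] keys_diff[of x y]
    by (auto simp: ssgn_def) (metis (no_types, lifting) UN_E keys_sum subset_iff)

text \<open>The coset of x; \<open>hat_cls\<close>, \<open>K_quot_simps\<close> and
  \<open>K0_simps\<close> compute everything in \<open>K0\<close> through it.\<close>

definition K0_class :: "('o \<Rightarrow>\<^sub>0 int) \<Rightarrow> ('o \<Rightarrow>\<^sub>0 int) set" where
  "K0_class x = {y. y \<doteq> x}"

lemma coset_cls: "rels #>\<^bsub>free_Abelian_group (Ob C)\<^esub> x = K0_class x"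
proof -
  have "y \<in> K0_class x \<longleftrightarrow> (\<exists>r\<in>rels. y = r + x)" for y
    unfolding K0_class_def keq_def by (auto intro: bexI[of _ "y - x"])
  then show ?thesis by (auto simp: r_coset_def)
qed

lemma hat_cls: "hat C M = K0_class (cl M)"
  unfolding hat_def coset_cls[symmetric] rels_def ..

lemma K0_class_eq_iff: "K0_class x = K0_class y \<longleftrightarrow> x \<doteq> y"
proof
  assume "K0_class x = K0_class y"
  then show "x \<doteq> y" using keq_refl[of x] unfolding K0_class_def by blast
next
  assume "x \<doteq> y"
  then show "K0_class x = K0_class y" unfolding K0_class_def using keq_trans[of _ x y] keq_trans[of _ y x] keq_sym[of x y] by auto
qed

lemma K0_class_eqI: "x \<doteq> y \<Longrightarrow> K0_class x = K0_class y"
  by (simp only: K0_class_eq_iff)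

lemma K_quot_simps: "carrier (K_quot C) = K0_class ` {x. supp_Ob x}" "\<one>\<^bsub>K_quot C\<^esub> = K0_class 0"
    "K0_class x \<otimes>\<^bsub>K_quot C\<^esub> K0_class y = K0_class (x + y)"
proof -
  show "carrier (K_quot C) = K0_class ` {x. supp_Ob x}"
    unfolding K_quot_def FactGroup_def RCOSETS_def rels_def[symmetric] coset_cls by (auto simp: free_Abelian_group_def)
  have "rels = K0_class 0" by (simp add: K0_class_def keq_def)
  then show "\<one>\<^bsub>K_quot C\<^esub> = K0_class 0" by (simp add: K_quot_def FactGroup_def rels_def)
  have "z \<in> K0_class (x + y) \<longleftrightarrow> (\<exists>x'\<in>K0_class x. \<exists>y'\<in>K0_class y. z = x' + y')" for z
  proof
    assume "z \<in> K0_class (x + y)"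
    then have "z - y \<in> K0_class x" "y \<in> K0_class y" unfolding K0_class_def by (simp_all add: keq_def algebra_simps rels_0)
    then show "\<exists>x'\<in>K0_class x. \<exists>y'\<in>K0_class y. z = x' + y'" by (intro bexI[of _ "z - y"] bexI[of _ y]) simp_all
  qed (auto simp: K0_class_def intro: keq_add)
  then show "K0_class x \<otimes>\<^bsub>K_quot C\<^esub> K0_class y = K0_class (x + y)"
    by (auto simp: K_quot_def FactGroup_def set_mult_def)
qed

lemma group_K_quot: "group (K_quot C)"
proof (rule groupI)
  fix x y z assume "x \<in> carrier (K_quot C)" "y \<in> carrier (K_quot C)" "z \<in> carrier (K_quot C)"
  then show "x \<otimes>\<^bsub>K_quot C\<^esub> y \<otimes>\<^bsub>K_quot C\<^esub> z = x \<otimes>\<^bsub>K_quot C\<^esub> (y \<otimes>\<^bsub>K_quot C\<^esub> z)"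
    by (auto simp: K_quot_simps add.assoc)
next
  fix x assume "x \<in> carrier (K_quot C)"
  then obtain x' where x: "x = K0_class x'" "supp_Ob x'" by (auto simp: K_quot_simps)
  then show "\<exists>y\<in>carrier (K_quot C). y \<otimes>\<^bsub>K_quot C\<^esub> x = \<one>\<^bsub>K_quot C\<^esub>"
    by (intro bexI[of _ "K0_class (- x')"]) (auto simp: K_quot_simps)
qed (auto simp: K_quot_simps supp_Ob_simps intro!: imageI)

lemma K0_simps: "carrier (K0 C) = K0_class ` {x. supp_Ob x}" "\<zero>\<^bsub>K0 C\<^esub> = K0_class 0" "K0_class x \<oplus>\<^bsub>K0 C\<^esub> K0_class y = K0_class (x + y)"
  by (simp_all add: K0_def K_quot_simps)

lemma abelian_group_K0: "abelian_group (K0 C)"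
proof (rule abelian_groupI)
  fix x assume "x \<in> carrier (K0 C)"
  then obtain x' where x: "x = K0_class x'" "supp_Ob x'" by (auto simp: K0_simps)
  then show "\<exists>y\<in>carrier (K0 C). y \<oplus>\<^bsub>K0 C\<^esub> x = \<zero>\<^bsub>K0 C\<^esub>"
    by (intro bexI[of _ "K0_class (- x')"]) (auto simp: K0_simps)
next
  fix x y assume "x \<in> carrier (K0 C)" "y \<in> carrier (K0 C)"
  then show "x \<oplus>\<^bsub>K0 C\<^esub> y = y \<oplus>\<^bsub>K0 C\<^esub> x" by (auto simp only: K0_simps add.commute)
qed (auto simp: K0_simps supp_Ob_simps add.assoc intro!: imageI)

lemma K0_minus: "supp_Ob x \<Longrightarrow> \<ominus>\<^bsub>K0 C\<^esub> K0_class x = K0_class (- x)" "supp_Ob x \<Longrightarrow> supp_Ob y \<Longrightarrow> K0_class x \<ominus>\<^bsub>K0 C\<^esub> K0_class y = K0_class (x - y)"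
proof -
  have m: "\<ominus>\<^bsub>K0 C\<^esub> K0_class x = K0_class (- x)" if "supp_Ob x" for x
    by (rule abelian_group.minus_equality[OF abelian_group_K0]) (use that in \<open>auto simp: K0_simps\<close>)
  show "supp_Ob x \<Longrightarrow> \<ominus>\<^bsub>K0 C\<^esub> K0_class x = K0_class (- x)" by (rule m)
  show "supp_Ob x \<Longrightarrow> supp_Ob y \<Longrightarrow> K0_class x \<ominus>\<^bsub>K0 C\<^esub> K0_class y = K0_class (x - y)" by (simp add: a_minus_def m K0_simps)
qed

text \<open>The module action is a power in the quotient group; the multiples 1, -1 and 2 are the
  ones that occur.\<close>

lemma K0_smult: assumes "supp_Ob x"
  shows "(-1) ^ k \<odot>\<^bsub>K0 C\<^esub> K0_class x = K0_class (ssgn (int k) x)" "2 \<odot>\<^bsub>K0 C\<^esub> K0_class x = K0_class (x + x)"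
proof -
  have s: "n \<odot>\<^bsub>K0 C\<^esub> K0_class x = K0_class x [^]\<^bsub>K_quot C\<^esub> n" for n by (simp add: K0_def)
  interpret Q: group "K_quot C" by (rule group_K_quot)
  have c: "K0_class x \<in> carrier (K_quot C)" using assms by (auto simp: K_quot_simps)
  have "inv\<^bsub>K_quot C\<^esub> K0_class x = K0_class (- x)"
    by (rule Q.inv_equality) (use assms c in \<open>auto simp: K_quot_simps\<close>)
  then show "(-1) ^ k \<odot>\<^bsub>K0 C\<^esub> K0_class x = K0_class (ssgn (int k) x)"
    using Q.int_pow_1[OF c] Q.int_pow_neg[OF c, of 1] unfolding s by (cases "even k") (simp_all add: ssgn_def)
  have "K0_class x [^]\<^bsub>K_quot C\<^esub> (2::int) = K0_class x [^]\<^bsub>K_quot C\<^esub> (2::nat)" using int_pow_int[of "K_quot C" "K0_class x" 2] by simp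
  then show "2 \<odot>\<^bsub>K0 C\<^esub> K0_class x = K0_class (x + x)" unfolding s by (simp add: numeral_2_eq_2 K_quot_simps)
qed

lemma K0_finsum:
  assumes "finite A" "\<And>k. k \<in> A \<Longrightarrow> supp_Ob (f k)"
  shows "(\<Oplus>\<^bsub>K0 C\<^esub>k\<in>A. K0_class (f k)) = K0_class (sum f A)"
  using assms
proof (induction A rule: finite_induct)
  case empty
  interpret K: abelian_group "K0 C" by (rule abelian_group_K0)
  show ?case by (simp add: K0_simps)
next
  case (insert a A)
  interpret K: abelian_group "K0 C" by (rule abelian_group_K0)
  have "(\<lambda>k. K0_class (f k)) \<in> A \<rightarrow> carrier (K0 C)" "K0_class (f a) \<in> carrier (K0 C)" using insert.prems by (auto simp: K0_simps)
  from K.finsum_insert[OF insert.hyps(1,2) this] insert show ?case by (simp add: K0_simps)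
qed

text \<open>A representative in the free abelian group of the class \<open>alt_sum\<close>.\<close>

definition asum :: "nat \<Rightarrow> (nat \<Rightarrow> 'o) \<Rightarrow> nat \<Rightarrow> nat \<Rightarrow> 'o \<Rightarrow>\<^sub>0 int" where
  "asum m M i k0 = (\<Sum>k\<in>{k0..<m}. ssgn (int k) (cl (M ((i + k) mod m))))"

lemma supp_Ob_asum:
  assumes "\<And>i. i < m \<Longrightarrow> M i \<in> Ob C" shows "supp_Ob (asum m M i k0)"
  unfolding asum_def
proof (intro supp_Ob_simps)
  fix k assume "k \<in> {k0..<m}"
  then have "(i + k) mod m < m" by simp
  then show "M ((i + k) mod m) \<in> Ob C" by (rule assms)
qed

lemma alt_sum_cls:
  assumes "\<And>i. i < m \<Longrightarrow> M i \<in> Ob C"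
  shows "alt_sum C m M i k0 = K0_class (asum m M i k0)"
proof -
  interpret K: abelian_group "K0 C" by (rule abelian_group_K0)
  have ob: "M ((i + k) mod m) \<in> Ob C" if "k \<in> {k0..<m}" for k
    using assms[of "(i + k) mod m"] that by simp
  have f: "supp_Ob (ssgn (int k) (cl (M ((i + k) mod m))))" if "k \<in> {k0..<m}" for k
    by (intro supp_Ob_simps ob that)
  have "alt_sum C m M i k0 = (\<Oplus>\<^bsub>K0 C\<^esub>k\<in>{k0..<m}. K0_class (ssgn (int k) (cl (M ((i + k) mod m)))))"
    unfolding alt_sum_def
  proof (rule K.finsum_cong'[OF refl])
    show "(\<lambda>k. K0_class (ssgn (int k) (cl (M ((i + k) mod m))))) \<in> {k0..<m} \<rightarrow> carrier (K0 C)"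
      using f by (auto simp: K0_simps)
    show "(-1) ^ k \<odot>\<^bsub>K0 C\<^esub> hat C (M ((i + k) mod m)) = K0_class (ssgn (int k) (cl (M ((i + k) mod m))))" if "k \<in> {k0..<m}" for k
      unfolding hat_cls by (rule K0_smult(1)[OF supp_Ob_simps(5)[OF ob[OF that]]])
  qed
  also have "\<dots> = K0_class (asum m M i k0)" unfolding asum_def by (rule K0_finsum[OF _ f]) simp_all
  finally show ?thesis .
qed

text \<open>The sum telescopes to the first term minus the one at k = m. For odd m the latter
  returns to M_i with sign -1, which doubles M_i.\<close>

lemma asum_add:
  assumes m: "odd m"
  shows "asum m M i 0 + asum m M (Suc i) 0 = cl (M (i mod m)) + cl (M (i mod m))"
proof -
  let ?f = "\<lambda>k. ssgn (int k) (cl (M ((i + k) mod m)))"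
  have "asum m M (Suc i) 0 = (\<Sum>k<m. - ?f (Suc k))"
    unfolding asum_def atLeast0LessThan by (rule sum.cong) (simp_all add: ssgn_def)
  then have "asum m M i 0 + asum m M (Suc i) 0 = (\<Sum>k<m. ?f k - ?f (Suc k))"
    unfolding asum_def atLeast0LessThan by (simp add: sum_subtractf sum_negf)
  also have "\<dots> = ?f 0 - ?f m" by (rule sum_lessThan_telescope')
  finally show ?thesis using m by (simp add: ssgn_def)
qed

lemma asum_periodic: "asum m M (i + m) k0 = asum m M i k0" "asum m M (i mod m) k0 = asum m M i k0"
proof -
  have "(i + m + k) mod m = (i + k) mod m" for k by (metis add.assoc add.commute mod_add_self2)
  then show "asum m M (i + m) k0 = asum m M i k0" by (simp add: asum_def)
  show "asum m M (i mod m) k0 = asum m M i k0" by (simp add: asum_def mod_add_left_eq)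
qed

lemma asum_1:
  assumes "m > 0" shows "asum m M i 1 = asum m M i 0 - cl (M (i mod m))"
proof -
  have "{0..<m} = insert 0 {1..<m}" using assms by auto
  then show ?thesis by (simp add: asum_def ssgn_def)
qed

text \<open>The terms J_i and J_(i-1) contribute two successive alternating sums, which
  \<open>asum_add\<close> collapses to twice J_(i-1).\<close>

lemma asum_keq:
  assumes m: "odd m"
    and M: "\<And>i. i < m \<Longrightarrow> cl (M i) \<doteq> cl (A i) + cl (B i) - cl (J i) - cl (J ((i + m - 1) mod m))"
  shows "asum m M i 0 \<doteq> asum m A i 0 + asum m B i 0 - (cl (J ((i + m - 1) mod m)) + cl (J ((i + m - 1) mod m)))"
proof -
  have m0: "m > 0" using m by (cases m) simp_all
  have e: "((i + k) mod m + m - 1) mod m = (i + m - 1 + k) mod m" for k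
  proof -
    have "((i + k) mod m + m - 1) mod m = ((i + k) mod m + (m - 1)) mod m" using m0 by simp
    also have "\<dots> = (i + k + (m - 1)) mod m" by (rule mod_add_left_eq)
    finally show ?thesis using m0 by (simp add: algebra_simps)
  qed
  have "asum m M i 0 \<doteq> (\<Sum>k\<in>{0..<m}. ssgn (int k) (cl (A ((i + k) mod m)) + cl (B ((i + k) mod m)) - cl (J ((i + k) mod m))
      - cl (J (((i + k) mod m + m - 1) mod m))))"
    unfolding asum_def by (intro keq_sum keq_ssgn M) simp
  also have "(\<Sum>k\<in>{0..<m}. ssgn (int k) (cl (A ((i + k) mod m)) + cl (B ((i + k) mod m)) - cl (J ((i + k) mod m))
      - cl (J (((i + k) mod m + m - 1) mod m)))) = asum m A i 0 + asum m B i 0 - (asum m J (i + m - 1) 0 + asum m J (Suc (i + m - 1)) 0)"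
  proof -
    have "(\<Sum>k\<in>{0..<m}. ssgn (int k) (cl (J (((i + k) mod m + m - 1) mod m)))) = asum m J (i + m - 1) 0"
      unfolding asum_def e ..
    moreover have "asum m J (Suc (i + m - 1)) 0 = asum m J i 0" using m0 asum_periodic(1)[of m J i 0] by simp
    ultimately show ?thesis by (simp only: ssgn_simps sum.distrib sum_subtractf) (simp add: asum_def)
  qed
  finally show ?thesis unfolding asum_add[OF m] .
qed

end


section \<open>The Euler form on the Grothendieck group\<close>

context hall_category
begin

lemma euler_free_superset:
  assumes "finite S" "finite T" "Poly_Mapping.keys x \<subseteq> S" "Poly_Mapping.keys y \<subseteq> T"
  shows "euler_free F C x y = (\<Sum>M\<in>S. \<Sum>N\<in>T. Poly_Mapping.lookup x M * Poly_Mapping.lookup y N * euler F C M N)"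
proof -
  have "(\<Sum>N\<in>Poly_Mapping.keys y. Poly_Mapping.lookup x M * Poly_Mapping.lookup y N * euler F C M N)
      = (\<Sum>N\<in>T. Poly_Mapping.lookup x M * Poly_Mapping.lookup y N * euler F C M N)" for M
    using assms by (intro sum.mono_neutral_left) (auto simp: in_keys_iff)
  then have "euler_free F C x y = (\<Sum>M\<in>Poly_Mapping.keys x. \<Sum>N\<in>T. Poly_Mapping.lookup x M * Poly_Mapping.lookup y N * euler F C M N)"
    unfolding euler_free_def by simp
  also have "\<dots> = (\<Sum>M\<in>S. \<Sum>N\<in>T. Poly_Mapping.lookup x M * Poly_Mapping.lookup y N * euler F C M N)"
    using assms by (intro sum.mono_neutral_left) (auto simp: in_keys_iff)
  finally show ?thesis .
qed

lemma euler_free_add: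
  shows "euler_free F C (x + y) z = euler_free F C x z + euler_free F C y z"
    and "euler_free F C x (y + z) = euler_free F C x y + euler_free F C x z"
proof -
  let ?S = "Poly_Mapping.keys x \<union> Poly_Mapping.keys y" and ?T = "Poly_Mapping.keys y \<union> Poly_Mapping.keys z"
  have s: "finite ?S" "Poly_Mapping.keys (x + y) \<subseteq> ?S" and t: "finite ?T" "Poly_Mapping.keys (y + z) \<subseteq> ?T"
    by (simp_all add: keys_add)
  show "euler_free F C (x + y) z = euler_free F C x z + euler_free F C y z"
    using s by (simp add: euler_free_superset[of ?S "Poly_Mapping.keys z"] lookup_add distrib_left distrib_right sum.distrib)
  show "euler_free F C x (y + z) = euler_free F C x y + euler_free F C x z"
    using t by (simp add: euler_free_superset[of "Poly_Mapping.keys x" ?T] lookup_add distrib_left distrib_right sum.distrib)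
qed

lemma euler_free_0: "euler_free F C 0 z = 0" "euler_free F C z 0 = 0"
  by (simp_all add: euler_free_def)

lemma euler_free_minus: "euler_free F C (- x) z = - euler_free F C x z" "euler_free F C z (- x) = - euler_free F C z x"
  using euler_free_add(1)[of x "- x" z] euler_free_add(2)[of z x "- x"] euler_free_0 by simp_all

lemma euler_free_diff:
  "euler_free F C (x - y) z = euler_free F C x z - euler_free F C y z"
  "euler_free F C z (x - y) = euler_free F C z x - euler_free F C z y"
  using euler_free_add(1)[of x "- y" z] euler_free_add(2)[of z x "- y"] euler_free_minus by simp_all

lemma euler_free_cl:
  "euler_free F C (cl X) y = (\<Sum>N\<in>Poly_Mapping.keys y. Poly_Mapping.lookup y N * euler F C X N)"
  "euler_free F C y (cl X) = (\<Sum>M\<in>Poly_Mapping.keys y. Poly_Mapping.lookup y M * euler F C M X)"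
  by (simp_all add: euler_free_def)

text \<open>Induction over the generated subgroup; on a generator the value is zero by additivity on
  short exact sequences in either variable.\<close>

lemma euler_free_rels:
  assumes r: "r \<in> rels" and y: "supp_Ob y"
  shows "euler_free F C r y = 0 \<and> euler_free F C y r = 0"
  using r unfolding rels_def
proof (induction r rule: generate.induct)
  case one then show ?case by (simp add: euler_free_0)
next
  have K: "euler_free F C r y = 0 \<and> euler_free F C y r = 0" if "r \<in> K_relations C" for r
  proof -
    from that obtain X Y Z f g where r: "r = cl Y - cl X - cl Z" and s: "short_exact C X Y Z f g" unfolding K_relations_def by blast
    note e = short_exact_ses[OF s]
    have "euler_free F C (cl Y) y = euler_free F C (cl X) y + euler_free F C (cl Z) y"
      unfolding euler_free_cl sum.distrib[symmetric] distrib_left[symmetric]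
      by (rule sum.cong) (use y euler_add_left[OF _ e] in auto)
    moreover have "euler_free F C y (cl Y) = euler_free F C y (cl X) + euler_free F C y (cl Z)"
      unfolding euler_free_cl sum.distrib[symmetric] distrib_left[symmetric]
      by (rule sum.cong) (use y euler_add_right[OF _ e] in auto)
    ultimately show ?thesis unfolding r by (simp add: euler_free_diff)
  qed
  case (incl h) then show ?case by (rule K)
  case (inv h)
  then have "supp_Ob h" using subsetD[OF K_relations_sub] by simp
  then show ?case using K[OF inv] by (simp add: euler_free_minus)
next
  case (eng h1 h2) then show ?case by (simp add: euler_free_add)
qed

lemma euler_free_keq:
  assumes "x \<doteq> x'" "y \<doteq> y'" "supp_Ob x" "supp_Ob y"
  shows "euler_free F C x' y' = euler_free F C x y"
proof -
  have "x' - x \<in> rels" "y' - y \<in> rels" using keq_sym[OF assms(1)] keq_sym[OF assms(2)] unfolding keq_def by auto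
  note r = this
  have "supp_Ob (y' - y + y)" using supp_Ob_simps(3)[OF rels_keys[OF r(2)] assms(4)] .
  then have "euler_free F C (x' - x) y' = 0" "euler_free F C x (y' - y) = 0"
    using euler_free_rels[OF r(1), of y'] euler_free_rels[OF r(2) assms(3)] by simp_all
  then show ?thesis by (simp add: euler_free_diff)
qed

text \<open>The definite description in \<open>eulerK\<close> denotes because
  \<open>euler_free\<close> is constant on classes, by \<open>euler_free_keq\<close>.\<close>

lemma eulerK_cls:
  assumes "supp_Ob x" "supp_Ob y" shows "eulerK F C (K0_class x) (K0_class y) = euler_free F C x y"
  unfolding eulerK_def
proof (rule the_equality)
  show "\<forall>x'\<in>K0_class x. \<forall>y'\<in>K0_class y. euler_free F C x' y' = euler_free F C x y"
    using euler_free_keq[OF keq_sym keq_sym assms] unfolding K0_class_def by blast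
  fix n assume "\<forall>x'\<in>K0_class x. \<forall>y'\<in>K0_class y. euler_free F C x' y' = n"
  then show "n = euler_free F C x y" using keq_refl unfolding K0_class_def by auto
qed

abbreviation eulerR where
  "eulerR x y \<equiv> real_of_int (euler_free F C x y)"

text \<open>The divisor 4 comes from one half in each argument.\<close>

lemma sym_half_cls: "supp_Ob x \<Longrightarrow> supp_Ob y \<Longrightarrow> sym_half F C (Half (K0_class x)) (Half (K0_class y)) = (eulerR x y + eulerR y x) / 4"
  by (simp add: sym_half_def euler_half_def eulerK_cls)

lemma emb_cls: "supp_Ob x \<Longrightarrow> emb C (K0_class x) = Half (K0_class (x + x))"
  by (simp add: emb_def K0_smult)

lemma halfK0_simps: "Half (K0_class x) \<oplus>\<^bsub>halfK0 C\<^esub> Half (K0_class y) = Half (K0_class (x + y))" "\<zero>\<^bsub>halfK0 C\<^esub> = Half (K0_class 0)"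
    "carrier (halfK0 C) = Half ` K0_class ` {x. supp_Ob x}"
  by (simp_all add: halfK0_def K0_simps)

text \<open>Arbitrary representatives x and X are allowed because those of M will be expressed
  through A, B and J. The inner sum starting at k = 1 is x_i - X_i.\<close>

lemma e_exp_cls:
  assumes m: "m > 0" and x: "\<And>i. supp_Ob (x i)" "\<And>i. K0_class (x i) = alt_sum C m M i 0"
    and X: "\<And>i. supp_Ob (X i)" "\<And>i. i < m \<Longrightarrow> K0_class (X i) = hat C (M i)"
    and M: "\<And>i. i < m \<Longrightarrow> M i \<in> Ob C"
  shows "e_exp F C m M = 1 / 4 * (\<Sum>i=1..m-1. eulerR (x i) (x (Suc i))) - 1 / 4 * eulerR (x 1) (x 0) + (\<Sum>i<m. eulerR (X i) (x i - X i))"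
proof -
  have s: "{0..m - 1} = {..<m}" using m by auto
  have a: "alt_sum C m M i k = K0_class (asum m M i k)" for i k by (rule alt_sum_cls) (rule M)
  have 1: "eulerK F C (hat C (M i)) (alt_sum C m M i 1) = euler_free F C (X i) (x i - X i)" if i: "i < m" for i
  proof -
    have "alt_sum C m M i 1 = K0_class (x i - X i)" unfolding a asum_1[OF m] mod_less[OF i]
    proof (rule K0_class_eqI[OF keq_diff])
      show "asum m M i 0 \<doteq> x i" unfolding K0_class_eq_iff[symmetric] x(2) a ..
      show "cl (M i) \<doteq> X i" unfolding K0_class_eq_iff[symmetric] X(2)[OF i] hat_cls ..
    qed
    then show ?thesis unfolding X(2)[OF i, symmetric] by (simp only: eulerK_cls[OF X(1) supp_Ob_simps(4)[OF x(1) X(1)]])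
  qed
  have 2: "eulerK F C (alt_sum C m M i 0) (alt_sum C m M j 0) = euler_free F C (x i) (x j)" for i j
    unfolding x(2)[symmetric] by (rule eulerK_cls[OF x(1) x(1)])
  show ?thesis unfolding e_exp_def s by (simp add: 1[unfolded One_nat_def] 2)
qed

section \<open>The embedding\<close>

text \<open>The exponent of K_i in the image of u_M: \<open>Half\<close> of minus an alternating sum
  stands for -1/2 times that sum.\<close>

definition twist :: "nat \<Rightarrow> (nat \<Rightarrow> _) \<Rightarrow> nat \<Rightarrow> _" where
  "twist m M i = Half (\<ominus>\<^bsub>K0 C\<^esub> alt_sum C m M (i + 1) 0)"

text \<open>\<^const>\<open>e_exp\<close> is the exponent only for \<open>m > 1\<close>; its formula does not give \<open>0\<close> at \<open>m = 1\<close>.\<close>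

definition twist_exp :: "nat \<Rightarrow> (nat \<Rightarrow> _) \<Rightarrow> real" where
  "twist_exp m M = (if m = 1 then 0 else e_exp F C m M)"

section \<open>A single term of the product with nonzero Hall weight\<close>

context
  fixes m :: nat and A B J M :: "nat \<Rightarrow> _"
  assumes m: "odd m" and w: "hall_weight C m A B J M \<noteq> 0"
    and A: "\<And>i. i < m \<Longrightarrow> A i \<in> Ob C" and B: "\<And>i. i < m \<Longrightarrow> B i \<in> Ob C"
    and J: "\<And>i. i < m \<Longrightarrow> J i \<in> Ob C" and M: "\<And>i. i < m \<Longrightarrow> M i \<in> Ob C"
begin

lemma twist_cls:
  assumes X: "\<And>i. i < m \<Longrightarrow> X i \<in> Ob C"
  shows "twist m X i = Half (K0_class (- asum m X (Suc i) 0))"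
proof -
  have "alt_sum C m X (i + 1) 0 = K0_class (asum m X (Suc i) 0)" using alt_sum_cls[of m X "Suc i" 0] X by simp
  then show ?thesis unfolding twist_def using K0_minus(1)[OF supp_Ob_asum[of m X]] X by simp
qed

lemma alt_sum_hall:
  "alt_sum C m M i 0 = K0_class (asum m A i 0 + asum m B i 0 - (cl (J ((i + m - 1) mod m)) + cl (J ((i + m - 1) mod m))))"
proof -
  have "cl (M i) \<doteq> cl (A i) + cl (B i) - cl (J i) - cl (J ((i + m - 1) mod m))" if "i < m" for i
    by (rule hall_weight_nonzero[OF w that A B J M])
  from K0_class_eqI[OF asum_keq[OF m, of M A B J i, OF this]] show ?thesis using alt_sum_cls[of m M i 0] M by simp
qed

lemma pred_mod: "(i mod m + m - 1) mod m = (i + m - 1) mod m"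
proof -
  have "m > 0" using m by (cases m) simp_all
  then have "(i mod m + m - 1) mod m = (i mod m + (m - 1)) mod m" by simp
  also have "\<dots> = (i + (m - 1)) mod m" by (rule mod_add_left_eq)
  finally show ?thesis using \<open>m > 0\<close> by simp
qed

lemma hat_hall:
  "hat C (M (i mod m)) = K0_class (cl (A (i mod m)) + cl (B (i mod m)) - cl (J (i mod m)) - cl (J ((i + m - 1) mod m)))"
proof -
  have "i mod m < m" using m by (cases m) simp_all
  from K0_class_eqI[OF hall_weight_nonzero[OF w this A B J M]] show ?thesis unfolding hat_cls pred_mod .
qed

text \<open>In the alternating sum of M at i + 1 the families A and B enter as they are and J_i
  enters with coefficient -2; after multiplication by -1/2 this is the exponent on the left.\<close>

lemma twist_hall:
  assumes i: "i < m"
  shows "emb C (hat C (J i)) \<oplus>\<^bsub>halfK0 C\<^esub> twist m A i \<oplus>\<^bsub>halfK0 C\<^esub> twist m B i = twist m M i"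
proof -
  have fj: "supp_Ob (cl (J i))" by (rule supp_Ob_simps(5)[OF J[OF i]])
  have fa: "supp_Ob (asum m A (Suc i) 0)" "supp_Ob (asum m B (Suc i) 0)" by (rule supp_Ob_asum, rule A B, assumption)+
  have "twist m M i = Half (\<ominus>\<^bsub>K0 C\<^esub> K0_class (asum m A (Suc i) 0 + asum m B (Suc i) 0 - (cl (J i) + cl (J i))))"
    using alt_sum_hall[of "Suc i"] i by (simp add: twist_def)
  also have "\<dots> = Half (K0_class (- (asum m A (Suc i) 0 + asum m B (Suc i) 0 - (cl (J i) + cl (J i)))))"
    by (subst K0_minus(1)) (intro supp_Ob_simps fj fa, rule refl)
  finally have 1: "twist m M i = \<dots>" .
  have 2: "emb C (hat C (J i)) = Half (K0_class (cl (J i) + cl (J i)))" unfolding hat_cls by (rule emb_cls[OF fj])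
  have 3: "twist m A i = Half (K0_class (- asum m A (Suc i) 0))" "twist m B i = Half (K0_class (- asum m B (Suc i) 0))"
    by (rule twist_cls, rule A B, assumption)+
  show ?thesis unfolding 1 2 3 halfK0_simps by (simp add: algebra_simps)
qed

lemma exponent_hall:
  assumes \<alpha>: "\<And>i. i < m \<Longrightarrow> \<alpha> i = twist m A i" and \<beta>: "\<And>i. i < m \<Longrightarrow> \<beta> i = twist m B i"
  shows "twist_exp m A + twist_exp m B + (a0_exp F C m A \<alpha> B \<beta> + c_exp F C m \<alpha> \<beta> J M)
    = twist_exp m M + real_of_int (\<Sum>i<m. eulerK F C (alt_sum C m A i 0) (hat C (B i)))"
proof -
  have m0: "m > 0" using m by (cases m) simp_all
  \<comment> \<open>Families on all natural numbers of period m, in the form of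
    \<open>exponent_identity\<close>; k_i is the class of J_(i-1), hence the occurrences of
    \<open>k (Suc i)\<close> for J_i.\<close>
  define a b k X Y where "a i = asum m A i 0" and "b i = asum m B i 0" and "k i = cl (J ((i + m - 1) mod m))"
    and "X i = cl (A (i mod m))" and "Y i = cl (B (i mod m))" for i
  define \<mu> N where "\<mu> i = a i + b i - (k i + k i)" and "N i = X i + Y i - k (Suc i) - k i" for i
  have kS: "k (Suc i) = cl (J (i mod m))" for i by (simp add: k_def)
  have supp_Ob: "supp_Ob (a i)" "supp_Ob (b i)" "supp_Ob (k i)" "supp_Ob (X i)" "supp_Ob (Y i)" for i
    unfolding a_def b_def k_def X_def Y_def by (rule supp_Ob_asum A B supp_Ob_simps(5) J mod_less_divisor m0 | assumption)+
  note fr = supp_Ob supp_Ob_simps(1-4)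
  have fre2: "supp_Ob (\<mu> i)" "supp_Ob (N i)" for i unfolding \<mu>_def N_def by (intro fr)+
  have hA: "hat C (A (i mod m)) = K0_class (X i)" and hB: "hat C (B (i mod m)) = K0_class (Y i)"
    and hJ: "hat C (J (i mod m)) = K0_class (k (Suc i))" and hM: "hat C (M (i mod m)) = K0_class (N i)" for i
    unfolding hat_hall unfolding hat_cls by (simp_all add: X_def Y_def kS N_def k_def)
  have hA': "hat C (A i) = K0_class (X i)" and hB': "hat C (B i) = K0_class (Y i)" and hJ': "hat C (J i) = K0_class (k (Suc i))"
    and hM': "hat C (M i) = K0_class (N i)" if "i < m" for i
    using hA[of i] hB[of i] hJ[of i] hM[of i] that by simp_all
  have tA: "\<alpha> i = Half (K0_class (- a (Suc i)))" and tB: "\<beta> i = Half (K0_class (- b (Suc i)))" if "i < m" for i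
    unfolding \<alpha>[OF that] \<beta>[OF that] a_def b_def by (rule twist_cls, rule A B, assumption)+
  have sA: "alt_sum C m A i 0 = K0_class (a i)" and sB: "alt_sum C m B i 0 = K0_class (b i)" for i
    unfolding a_def b_def by (rule alt_sum_cls, rule A B, assumption)+
  have sM: "alt_sum C m M i 0 = K0_class (\<mu> i)" for i
    unfolding alt_sum_hall \<mu>_def a_def b_def k_def ..
  have dh: "real_of_int (\<Sum>i<m. eulerK F C (alt_sum C m A i 0) (hat C (B i))) = (\<Sum>i<m. eulerR (a i) (Y i))"
    unfolding of_int_sum by (rule sum.cong) (simp_all add: sA hB' eulerK_cls fr)
  have A1: "(\<Sum>i<m. real_of_int (eulerK F C (hat C (A i)) (hat C (B i)))) = (\<Sum>i<m. eulerR (X i) (Y i))"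
    by (rule sum.cong) (simp_all add: hA' hB' eulerK_cls fr)
  have R: "eulerR (x + y) z = eulerR x z + eulerR y z" "eulerR x (y + z) = eulerR x y + eulerR x z" "eulerR (- x) z = - eulerR x z" "eulerR z (- x) = - eulerR z x" for x y z
    by (simp_all add: euler_free_add euler_free_minus)
  \<comment> \<open>An embedded class y appears as the half of y + y. This turns the factor 1/4 of
    two genuine halves into 1/2.\<close>
  have sym: "sym_half F C (Half (K0_class (- x))) (Half (K0_class (y + y))) = - ((eulerR x y + eulerR y x) / 2)"
    "sym_half F C (Half (K0_class (y + y))) (Half (K0_class (- x + - z))) = - ((eulerR y (x + z) + eulerR (x + z) y) / 2)"
    "sym_half F C (Half (K0_class (- x))) (Half (K0_class (- y))) = (eulerR x y + eulerR y x) / 4"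
    if "supp_Ob x" "supp_Ob y" "supp_Ob z" for x y z
    by (simp_all only: sym_half_cls fr that R) (simp_all add: field_simps)
  have A2: "(\<Sum>i<m. sym_half F C (\<alpha> i) (emb C (hat C (B i) \<ominus>\<^bsub>K0 C\<^esub> hat C (B ((i + 1) mod m)))))
      = - 1 / 2 * (\<Sum>i<m. eulerR (a (Suc i)) (Y i - Y (Suc i)) + eulerR (Y i - Y (Suc i)) (a (Suc i)))"
    unfolding sum_distrib_left
  proof (rule sum.cong[OF refl])
    fix i assume "i \<in> {..<m}" then have i: "i < m" by simp
    have "emb C (hat C (B i) \<ominus>\<^bsub>K0 C\<^esub> hat C (B ((i + 1) mod m))) = Half (K0_class ((Y i - Y (Suc i)) + (Y i - Y (Suc i))))"
      unfolding hB hB'[OF i] K0_minus(2)[OF fr(5,5)] emb_cls[OF supp_Ob_simps(4)[OF fr(5,5)]] by simp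
    then show "sym_half F C (\<alpha> i) (emb C (hat C (B i) \<ominus>\<^bsub>K0 C\<^esub> hat C (B ((i + 1) mod m))))
      = - 1 / 2 * (eulerR (a (Suc i)) (Y i - Y (Suc i)) + eulerR (Y i - Y (Suc i)) (a (Suc i)))"
      unfolding tA[OF i] using sym(1)[OF fr(1) supp_Ob_simps(4)[OF fr(5,5)] fr(6)] by simp
  qed
  have AB: "sym_half F C (\<alpha> i) (\<beta> j) = 1 / 4 * (eulerR (a (Suc i)) (b (Suc j)) + eulerR (b (Suc j)) (a (Suc i)))" if "i < m" "j < m" for i j
    unfolding tA[OF that(1)] tB[OF that(2)] using sym(3)[OF fr(1,2,6)] by simp
  have JA: "sym_half F C (emb C (hat C (J i))) (\<alpha> j \<oplus>\<^bsub>halfK0 C\<^esub> \<beta> j)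
      = - 1 / 2 * (eulerR (k (Suc i)) (a (Suc j) + b (Suc j)) + eulerR (a (Suc j) + b (Suc j)) (k (Suc i)))" if "i < m" "j < m" for i j
    unfolding tA[OF that(2)] tB[OF that(2)] hJ'[OF that(1)] emb_cls[OF fr(3)] halfK0_simps using sym(2)[OF fr(1,3,2)] by simp
  have C3: "(\<Sum>i<m. real_of_int (eulerK F C (hat C (M i) \<ominus>\<^bsub>K0 C\<^esub> hat C (M ((i + 1) mod m))) (hat C (J i))))
      = (\<Sum>i<m. eulerR (N i - N (Suc i)) (k (Suc i)))"
    by (rule sum.cong) (simp_all add: hM[of "Suc _"] hM' hJ' K0_minus(2) fre2 eulerK_cls fr)
  have JJ: "real_of_int (eulerK F C (hat C (J i)) (hat C (J j))) = eulerR (k (Suc i)) (k (Suc j))" if "i < m" "j < m" for i j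
    by (simp add: that hJ' eulerK_cls fr)
  have km: "k m = k 0" unfolding k_def by (simp only: pred_mod[of m, symmetric] mod_self)
  have per: "a m = a 0" "a (Suc m) = a 1" "b m = b 0" "b (Suc m) = b 1" "k m = k 0" "k (Suc m) = k 1"
    using asum_periodic(1)[of m A 0 0] asum_periodic(1)[of m A 1 0] asum_periodic(1)[of m B 0 0] asum_periodic(1)[of m B 1 0] m0
    by (simp_all add: a_def b_def km) (simp add: k_def)
  show ?thesis
  proof (cases "m = 1")
    \<comment> \<open>For m = 1 the cyclic differences vanish and, by the convention on sums, the
      remaining terms cancel the boundary terms; both sides are the Euler form of A_0 and
      B_0.\<close>
    case True
    have "N 1 = N 0" "Y 1 = Y 0" "k 1 = k 0" unfolding N_def X_def Y_def k_def True by simp_all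
    moreover have "a 0 = X 0" unfolding a_def X_def True by (simp add: asum_def ssgn_def)
    ultimately show ?thesis using A2 C3 A1 dh
      by (simp add: True twist_exp_def a0_exp_def c_exp_def conv_sum_def euler_free_0)
  next
    case False
    have c: "conv_sum m f = (\<Sum>i=1..m-1. f i)" for f using False by (simp add: conv_sum_def)
    \<comment> \<open>The boundary terms carry the index m - 1, whose successor m returns to
      0.\<close>
    have k0: "k (Suc (m - 1)) = k 0" "a (Suc (m - 1)) = a 0" using per m0 by simp_all
    have a0: "a0_exp F C m A \<alpha> B \<beta> = (\<Sum>i<m. eulerR (X i) (Y i))
        - 1 / 2 * (\<Sum>i<m. eulerR (a (Suc i)) (Y i - Y (Suc i)) + eulerR (Y i - Y (Suc i)) (a (Suc i)))
        + 1 / 4 * (\<Sum>i=1..m-1. eulerR (a (Suc i)) (b i) + eulerR (b i) (a (Suc i))) - 1 / 4 * (eulerR (a 0) (b 1) + eulerR (b 1) (a 0))"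
    proof -
      have 1: "(\<Sum>i=1..m-1. sym_half F C (\<alpha> (i mod m)) (\<beta> ((i - 1) mod m)))
          = 1 / 4 * (\<Sum>i=1..m-1. eulerR (a (Suc i)) (b i) + eulerR (b i) (a (Suc i)))"
        unfolding sum_distrib_left by (rule sum.cong) (auto simp: AB)
      have 2: "sym_half F C (\<alpha> (m - 1)) (\<beta> 0) = 1 / 4 * (eulerR (a 0) (b 1) + eulerR (b 1) (a 0))"
        using AB[of "m - 1" 0] m0 unfolding k0 by simp
      show ?thesis unfolding a0_exp_def c A1 A2 1 2 by simp
    qed
    have c0: "c_exp F C m \<alpha> \<beta> J M = 1 / 2 * (eulerR (k 0) (a 1 + b 1) + eulerR (a 1 + b 1) (k 0))
        - 1 / 2 * (\<Sum>i=1..m-1. eulerR (k (Suc i)) (a i + b i) + eulerR (a i + b i) (k (Suc i)))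
        + (\<Sum>i<m. eulerR (N i - N (Suc i)) (k (Suc i))) + (\<Sum>i=1..m-1. eulerR (k i) (k (Suc i))) - eulerR (k 1) (k 0)"
    proof -
      have 1: "(\<Sum>i=1..m-1. sym_half F C (emb C (hat C (J (i mod m)))) (\<alpha> ((i - 1) mod m) \<oplus>\<^bsub>halfK0 C\<^esub> \<beta> ((i - 1) mod m)))
          = - 1 / 2 * (\<Sum>i=1..m-1. eulerR (k (Suc i)) (a i + b i) + eulerR (a i + b i) (k (Suc i)))"
        unfolding sum_distrib_left by (rule sum.cong) (auto simp: JA)
      have 2: "(\<Sum>i=1..m-1. real_of_int (eulerK F C (hat C (J ((i - 1) mod m))) (hat C (J (i mod m)))))
          = (\<Sum>i=1..m-1. eulerR (k i) (k (Suc i)))"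
      proof (rule sum.cong[OF refl])
        fix i assume "i \<in> {1..m-1}"
        then have "0 < i" "i < m" using m0 by auto
        then show "real_of_int (eulerK F C (hat C (J ((i - 1) mod m))) (hat C (J (i mod m)))) = eulerR (k i) (k (Suc i))"
          using JJ[of "i - 1" i] by simp
      qed
      have 3: "sym_half F C (emb C (hat C (J (m - 1)))) (\<alpha> 0 \<oplus>\<^bsub>halfK0 C\<^esub> \<beta> 0) = - 1 / 2 * (eulerR (k 0) (a 1 + b 1) + eulerR (a 1 + b 1) (k 0))"
        using JA[of "m - 1" 0] m0 unfolding k0 by simp
      have 4: "real_of_int (eulerK F C (hat C (J 0)) (hat C (J (m - 1)))) = eulerR (k 1) (k 0)"
        using JJ[of 0 "m - 1"] m0 unfolding k0 by simp
      show ?thesis unfolding c_exp_def c C3 1 2 3 4 by simp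
    qed
    have half: "X i + X i = a i + a (Suc i)" "Y i + Y i = b i + b (Suc i)" for i
      unfolding X_def Y_def a_def b_def by (rule asum_add[OF m, symmetric])+
    have eA: "twist_exp m A = 1 / 4 * (\<Sum>i=1..m-1. eulerR (a i) (a (Suc i))) - 1 / 4 * eulerR (a 1) (a 0) + (\<Sum>i<m. eulerR (X i) (a i - X i))"
      unfolding twist_exp_def using False e_exp_cls[of m a A X] m0 fr sA hA' A by simp
    have eB: "twist_exp m B = 1 / 4 * (\<Sum>i=1..m-1. eulerR (b i) (b (Suc i))) - 1 / 4 * eulerR (b 1) (b 0) + (\<Sum>i<m. eulerR (Y i) (b i - Y i))"
      unfolding twist_exp_def using False e_exp_cls[of m b B Y] m0 fr sB hB' B by simp
    have eM: "twist_exp m M = 1 / 4 * (\<Sum>i=1..m-1. eulerR (\<mu> i) (\<mu> (Suc i))) - 1 / 4 * eulerR (\<mu> 1) (\<mu> 0) + (\<Sum>i<m. eulerR (N i) (\<mu> i - N i))"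
      unfolding twist_exp_def using False e_exp_cls[of m \<mu> M N] m0 fre2 sM hM' M by simp
    show ?thesis unfolding eA eB eM a0 c0 dh
      using exponent_identity[where R = eulerR and m = m and a = a and b = b and k = k and A = X and B = Y, OF R(1,2) m0 per half]
      unfolding \<mu>_def N_def by (simp only: add.assoc)
  qed
qed

end

section \<open>Structure constants and independence of representatives\<close>

lemma rep_iso_class:
  assumes M: "M \<in> Ob C" shows "isomorphic C M (rep (iso_class C M))"
proof -
  note l = lin[unfolded linear_category_def, THEN conjunct2]
  have "Idn C M \<in> carrier (Hom C M M)" "Idn C M \<bullet>\<^bsub>C\<^esub> Idn C M = Idn C M"
    using l[THEN conjunct1] l[THEN conjunct2, THEN conjunct1] M by blast+
  then have "isomorphic C M M" using M unfolding isomorphic_def iso_arrow_def by blast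
  then show ?thesis unfolding rep_def iso_class_def mem_Collect_eq by (rule someI)
qed

lemma rep_iso_tuples:
  assumes "T \<in> iso_tuples C m" "i < m" shows "(rep \<circ> T) i \<in> Ob C"
proof -
  have "T i \<in> Iso C" using PiE_mem[OF assms(1)[unfolded iso_tuples_def]] assms(2) by simp
  then obtain X where X: "X \<in> Ob C" "T i = iso_class C X" unfolding Iso_def by blast
  from rep_iso_class[OF X(1)] X(2) show ?thesis unfolding isomorphic_def by simp
qed

definition twist_tuple :: "nat \<Rightarrow> (nat \<Rightarrow> _ set) \<Rightarrow> nat \<Rightarrow> _" where
  "twist_tuple m T = (\<lambda>i\<in>{..<m}. twist m (rep \<circ> T) i)"

definition twist_weight :: "nat \<Rightarrow> (nat \<Rightarrow> _ set) \<Rightarrow> real" where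
  "twist_weight m T = vv F powr twist_exp m (rep \<circ> T)"

text \<open>Compared term by term in I. If the Hall weight vanishes, both terms are 0; otherwise
  \<open>twist_hall\<close> forces \<gamma> to be the twist of M and \<open>exponent_hall\<close>
  matches the powers of v.\<close>

lemma coeff_twist:
  assumes m: "odd m" and A: "A \<in> iso_tuples C m" and B: "B \<in> iso_tuples C m" and M: "M \<in> iso_tuples C m"
    and \<gamma>: "\<gamma> \<in> extensional {..<m}"
  shows "twist_weight m A * twist_weight m B * DHe_coeff F C m (A, twist_tuple m A) (B, twist_tuple m B) (M, \<gamma>)
    = (if \<gamma> = twist_tuple m M then twist_weight m M * DH_coeff F C m A B M else 0)"
proof -
  define a0 where "a0 = a0_exp F C m (rep \<circ> A) (twist_tuple m A) (rep \<circ> B) (twist_tuple m B)"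
  define c where "c I = c_exp F C m (twist_tuple m A) (twist_tuple m B) (rep \<circ> I) (rep \<circ> M)" for I
  define w where "w I = hall_weight C m (rep \<circ> A) (rep \<circ> B) (rep \<circ> I) (rep \<circ> M)" for I
  define s where "s = real_of_int (\<Sum>i<m. eulerK F C (alt_sum C m (rep \<circ> A) i 0) (hat C (rep (B i))))"
  let ?P = "\<lambda>I. \<forall>i<m. \<gamma> i = emb C (hat C (rep (I i))) \<oplus>\<^bsub>halfK0 C\<^esub> twist_tuple m A i \<oplus>\<^bsub>halfK0 C\<^esub> twist_tuple m B i"
  note h = rep_iso_tuples[OF A] rep_iso_tuples[OF B] rep_iso_tuples rep_iso_tuples[OF M]
  have t: "twist_tuple m T i = twist m (rep \<circ> T) i" if "i < m" for T i using that by (simp add: twist_tuple_def)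
  have \<gamma>': "\<gamma> = twist_tuple m M \<longleftrightarrow> (\<forall>i<m. \<gamma> i = twist m (rep \<circ> M) i)"
  proof
    assume r: "\<forall>i<m. \<gamma> i = twist m (rep \<circ> M) i"
    show "\<gamma> = twist_tuple m M"
      by (rule extensionalityI[OF \<gamma>, of "twist_tuple m M"]) (use r in \<open>auto simp: twist_tuple_def\<close>)
  qed (simp add: t)
  have "twist_weight m A * twist_weight m B * (vv F powr a0 * (if I \<in> iso_tuples C m \<and> ?P I then vv F powr c I * w I else 0))
      = (if \<gamma> = twist_tuple m M then twist_weight m M * (vv F powr s * (if I \<in> iso_tuples C m then w I else 0)) else 0)" for I
  proof (cases "I \<in> iso_tuples C m \<and> w I \<noteq> 0")
    case True
    then have I: "I \<in> iso_tuples C m" and wI: "hall_weight C m (rep \<circ> A) (rep \<circ> B) (rep \<circ> I) (rep \<circ> M) \<noteq> 0"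
      unfolding w_def by auto
    have "emb C (hat C (rep (I i))) \<oplus>\<^bsub>halfK0 C\<^esub> twist_tuple m A i \<oplus>\<^bsub>halfK0 C\<^esub> twist_tuple m B i = twist m (rep \<circ> M) i" if i: "i < m" for i
    proof -
      have "emb C (hat C ((rep \<circ> I) i)) \<oplus>\<^bsub>halfK0 C\<^esub> twist m (rep \<circ> A) i \<oplus>\<^bsub>halfK0 C\<^esub> twist m (rep \<circ> B) i = twist m (rep \<circ> M) i"
        by (rule twist_hall[OF m wI]) (erule h(1,2,4) | erule h(3)[OF I] | rule i)+
      then show ?thesis unfolding t[OF i] by (simp only: comp_apply)
    qed
    then have P: "?P I \<longleftrightarrow> \<gamma> = twist_tuple m M" unfolding \<gamma>' by simp
    have "twist_exp m (rep \<circ> A) + twist_exp m (rep \<circ> B) + (a0 + c I)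
        = twist_exp m (rep \<circ> M) + real_of_int (\<Sum>i<m. eulerK F C (alt_sum C m (rep \<circ> A) i 0) (hat C ((rep \<circ> B) i)))"
      unfolding a0_def c_def by (rule exponent_hall[OF m wI]) (erule h(1,2,4) | erule h(3)[OF I] | erule t)+
    then have "twist_exp m (rep \<circ> A) + twist_exp m (rep \<circ> B) + (a0 + c I) = twist_exp m (rep \<circ> M) + s"
      unfolding s_def by (simp only: comp_apply)
    then have "twist_weight m A * twist_weight m B * (vv F powr a0 * vv F powr c I) = twist_weight m M * vv F powr s"
      unfolding twist_weight_def powr_add[symmetric] by simp
    then show ?thesis unfolding P using I by (simp add: mult.assoc[symmetric])
  qed auto
  then have e: "Sum_any (\<lambda>I. twist_weight m A * twist_weight m B * (vv F powr a0 * (if I \<in> iso_tuples C m \<and> ?P I then vv F powr c I * w I else 0)))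
      = Sum_any (\<lambda>I. if \<gamma> = twist_tuple m M then twist_weight m M * (vv F powr s * (if I \<in> iso_tuples C m then w I else 0)) else 0)"
    by simp
  have D: "DHe_coeff F C m (A, twist_tuple m A) (B, twist_tuple m B) (M, \<gamma>)
      = vv F powr a0 * Sum_any (\<lambda>I. if I \<in> iso_tuples C m \<and> ?P I then vv F powr c I * w I else 0)"
    unfolding DHe_coeff_def a0_def c_def w_def prod.case ..
  have "twist_weight m A * twist_weight m B * DHe_coeff F C m (A, twist_tuple m A) (B, twist_tuple m B) (M, \<gamma>)
      = Sum_any (\<lambda>I. if \<gamma> = twist_tuple m M then twist_weight m M * (vv F powr s * (if I \<in> iso_tuples C m then w I else 0)) else 0)"
    unfolding D e[symmetric] by (simp only: Sum_any_cmult)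
  also have "\<dots> = (if \<gamma> = twist_tuple m M then twist_weight m M * DH_coeff F C m A B M else 0)"
    by (cases "\<gamma> = twist_tuple m M") (simp_all only: DH_coeff_def s_def[symmetric] w_def[symmetric] Sum_any_cmult[symmetric] if_True if_False simp_thms Sum_any.neutral)
  finally show ?thesis .
qed

text \<open>The representative chosen by \<open>rep\<close> may differ from M_i, but it is
  isomorphic to it and so has the same class.\<close>

lemma hat_class_tuple:
  assumes "\<And>i. i < m \<Longrightarrow> M i \<in> Ob C" "i < m"
  shows "hat C ((rep \<circ> class_tuple C m M) i) = hat C (M i)"
  using keq_isomorphic[OF rep_iso_class[OF assms(1)[OF assms(2)]]] assms(2)
  by (simp add: class_tuple_def hat_cls K0_class_eq_iff keq_sym)

lemma alt_sum_class_tuple: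
  assumes M: "\<And>i. i < m \<Longrightarrow> M i \<in> Ob C"
  shows "alt_sum C m (rep \<circ> class_tuple C m M) i k0 = alt_sum C m M i k0"
proof -
  have k: "cl ((rep \<circ> class_tuple C m M) j) \<doteq> cl (M j)" if "j < m" for j
    unfolding K0_class_eq_iff[symmetric] hat_cls[symmetric] by (rule hat_class_tuple[OF M that])
  have "(rep \<circ> class_tuple C m M) j \<in> Ob C" if "j < m" for j
    using rep_iso_class[OF M[OF that]] that by (simp add: class_tuple_def isomorphic_def)
  then have "alt_sum C m (rep \<circ> class_tuple C m M) i k0 = K0_class (asum m (rep \<circ> class_tuple C m M) i k0)"
    by (rule alt_sum_cls)
  also have "\<dots> = K0_class (asum m M i k0)" unfolding asum_def by (intro K0_class_eqI keq_sum keq_ssgn k) simp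
  also have "\<dots> = alt_sum C m M i k0" by (rule alt_sum_cls[symmetric]) (rule M)
  finally show ?thesis .
qed

lemma twist_exp_class_tuple:
  assumes "\<And>i. i < m \<Longrightarrow> M i \<in> Ob C" "m > 0"
  shows "twist_exp m (rep \<circ> class_tuple C m M) = twist_exp m M"
proof -
  have a: "alt_sum C m (rep \<circ> class_tuple C m M) i k0 = alt_sum C m M i k0" for i k0
    by (rule alt_sum_class_tuple) (rule assms(1))
  have h: "hat C ((rep \<circ> class_tuple C m M) i) = hat C (M i)" if "i < m" for i
    by (rule hat_class_tuple[OF _ that]) (rule assms(1))
  have "(\<Sum>i=0..m-1. real_of_int (eulerK F C (hat C ((rep \<circ> class_tuple C m M) i)) (alt_sum C m M i 1)))
      = (\<Sum>i=0..m-1. real_of_int (eulerK F C (hat C (M i)) (alt_sum C m M i 1)))"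
  proof (rule sum.cong[OF refl])
    fix i assume "i \<in> {0..m-1}"
    then have "i < m" using assms(2) by auto
    then show "real_of_int (eulerK F C (hat C ((rep \<circ> class_tuple C m M) i)) (alt_sum C m M i 1))
        = real_of_int (eulerK F C (hat C (M i)) (alt_sum C m M i 1))" by (simp only: h)
  qed
  then show ?thesis unfolding twist_exp_def e_exp_def a by simp
qed

text \<open>Preservation of the unit: zero objects have class 0, so neither a K-factor nor a power
  of v appears.\<close>

lemma twist_zero:
  shows "twist m (\<lambda>_. zero_ob C) i = \<zero>\<^bsub>halfK0 C\<^esub>" and "twist_exp m (\<lambda>_. zero_ob C) = 0"
proof -
  have z: "asum m (\<lambda>_. null) i k \<doteq> 0" for i k
  proof -
    have "asum m (\<lambda>_. null) i k \<doteq> (\<Sum>k\<in>{k..<m}. ssgn (int k) 0)"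
      unfolding asum_def by (intro keq_sum keq_ssgn keq_null null)
    then show ?thesis by (simp add: ssgn_simps)
  qed
  have a: "alt_sum C m (\<lambda>_. null) i k = K0_class 0" for i k
    using alt_sum_cls[of m "\<lambda>_. null" i k] null(1) K0_class_eqI[OF z] by simp
  have h: "hat C null = K0_class 0" unfolding hat_cls by (rule K0_class_eqI[OF keq_null[OF null]])
  show "twist m (\<lambda>_. zero_ob C) i = \<zero>\<^bsub>halfK0 C\<^esub>" unfolding twist_def zero_ob_null a halfK0_simps by (simp add: K0_minus)
  show "twist_exp m (\<lambda>_. zero_ob C) = 0" unfolding twist_exp_def e_exp_def zero_ob_null a h by (simp add: eulerK_cls euler_free_0)
qed

text \<open>The image of a basis vector keeps the tuple of isomorphism classes as its first
  component, so distinct basis vectors have distinct images, and the weights are positive; this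
  gives injectivity.\<close>

theorem twist_embedding:
  assumes m: "odd m"
  shows "\<exists>\<phi>. algebra_embedding (DH F C m) (DHe F C m) \<phi> \<and> (\<forall>M. (\<forall>i<m. M i \<in> Ob C) \<longrightarrow>
    \<phi> (u_basis C m M) = (\<lambda>d. complex_of_real (vv F powr twist_exp m M) * uK_basis C m M (twist m M) d))"
proof -
  have m0: "m > 0" using m by (cases m) simp_all
  let ?B = "iso_tuples C m" and ?e = "\<lambda>T. (T, twist_tuple m T)" and ?w = "\<lambda>T. complex_of_real (twist_weight m T)"
  let ?B' = "?B \<times> (\<Pi>\<^sub>E i\<in>{..<m}. carrier (halfK0 C))" and ?u = "class_tuple C m (\<lambda>_. zero_ob C)"
  have tt: "twist_tuple m (class_tuple C m M) = (\<lambda>i\<in>{..<m}. twist m M i)" if "\<And>i. i < m \<Longrightarrow> M i \<in> Ob C" for M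
    unfolding twist_tuple_def twist_def using alt_sum_class_tuple[of m M] that by (intro restrict_ext) simp
  have three_term: "twist_weight m (class_tuple C m M) = vv F powr twist_exp m M" if "\<And>i. i < m \<Longrightarrow> M i \<in> Ob C" for M
    unfolding twist_weight_def using twist_exp_class_tuple[of m M] that m0 by simp
  have cB: "class_tuple C m M \<in> ?B" if "\<And>i. i < m \<Longrightarrow> M i \<in> Ob C" for M
    using that by (simp add: class_tuple_def iso_tuples_def Iso_def)
  have v: "vv F > 0" using card_F by (simp add: vv_def)
  have z: "zero_ob C \<in> Ob C" unfolding zero_ob_null by (rule null)
  have "\<exists>\<phi>. algebra_embedding (DH F C m) (DHe F C m) \<phi> \<and> (\<forall>b\<in>?B. \<phi> (basis_vec b) = (\<lambda>d. ?w b * basis_vec (?e b) d))"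
    unfolding DH_def DHe_def
  proof (rule based_algebra_embedding)
    show "inj_on ?e ?B" by (rule inj_onI) simp
    show "?e ` ?B \<subseteq> ?B'"
    proof
      fix x assume "x \<in> ?e ` ?B"
      then obtain T where T: "T \<in> ?B" "x = ?e T" by blast
      have "twist m (rep \<circ> T) i \<in> carrier (halfK0 C)" if "i < m" for i
      proof -
        have f: "supp_Ob (asum m (rep \<circ> T) (i + 1) 0)" by (rule supp_Ob_asum) (rule rep_iso_tuples[OF T(1)])
        have "alt_sum C m (rep \<circ> T) (i + 1) 0 = K0_class (asum m (rep \<circ> T) (i + 1) 0)"
          by (rule alt_sum_cls) (rule rep_iso_tuples[OF T(1)])
        then show ?thesis unfolding twist_def using K0_minus(1)[OF f] supp_Ob_simps(2)[OF f] by (auto simp: halfK0_simps)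
      qed
      then show "x \<in> ?B'" using T by (auto simp: twist_tuple_def)
    qed
    show "?w b \<noteq> 0" for b using v by (simp add: twist_weight_def)
    show "?u \<in> ?B" by (rule cB) (rule z)
    show "?e ?u = (?u, \<lambda>i\<in>{..<m}. \<zero>\<^bsub>halfK0 C\<^esub>)" using tt[of "\<lambda>_. zero_ob C"] z twist_zero(1)[of m] by simp
    show "?w ?u = 1" using three_term[of "\<lambda>_. zero_ob C"] z twist_zero(2)[of m] v by simp
    fix A B assume AB: "A \<in> ?B" "B \<in> ?B"
    show "?w A * ?w B * complex_of_real (DHe_coeff F C m (?e A) (?e B) (?e D)) = ?w D * complex_of_real (DH_coeff F C m A B D)"
      if D: "D \<in> ?B" for D
      using coeff_twist[OF m AB D, of "twist_tuple m D"] unfolding of_real_mult[symmetric] by (simp add: twist_tuple_def)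
    \<comment> \<open>Off the image \<open>coeff_twist\<close> gives 0 for the weighted coefficient,
      and the positive weights cancel.\<close>
    show "complex_of_real (DHe_coeff F C m (?e A) (?e B) d) = 0" if d: "d \<in> ?B' - ?e ` ?B" for d
    proof -
      obtain D \<gamma> where D: "d = (D, \<gamma>)" "D \<in> ?B" "\<gamma> \<in> extensional {..<m}" using d by (auto simp: PiE_def)
      have "\<gamma> \<noteq> twist_tuple m D" using d D by auto
      then have "twist_weight m A * twist_weight m B * DHe_coeff F C m (?e A) (?e B) d = 0"
        using coeff_twist[OF m AB D(2,3)] unfolding D(1) by simp
      then show ?thesis using v by (simp add: twist_weight_def)
    qed
  qed
  then obtain \<phi> where \<phi>: "algebra_embedding (DH F C m) (DHe F C m) \<phi>" "\<And>b. b \<in> ?B \<Longrightarrow> \<phi> (basis_vec b) = (\<lambda>d. ?w b * basis_vec (?e b) d)"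
    by blast
  have "\<phi> (u_basis C m M) = (\<lambda>d. complex_of_real (vv F powr twist_exp m M) * uK_basis C m M (twist m M) d)"
    if "\<forall>i<m. M i \<in> Ob C" for M
    using \<phi>(2)[OF cB[of M]] tt[of M] three_term[of M] that unfolding u_basis_def uK_basis_def by simp
  with \<phi>(1) show ?thesis by blast
qed

end

theorem theorem3p1:
  fixes F :: "'k ring" and C :: "('o, 'a, 'k) lincat" and m :: nat
  assumes "odd m"
    and "field F" and "finite (carrier F)"
    and "linear_category F C" and "abelian_category C"
    and "finitary F C" and "hereditary C"
  shows "\<exists>\<phi>. algebra_embedding (DH F C m) (DHe F C m) \<phi> \<and>
    (\<forall>M. (\<forall>i<m. M i \<in> Ob C) \<longrightarrow>
      (m = 1 \<longrightarrow> \<phi> (u_basis C m M) = uK_basis C m M (\<lambda>i. Half (\<ominus>\<^bsub>K0 C\<^esub> hat C (M 0)))) \<and>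
      (m > 1 \<longrightarrow> \<phi> (u_basis C m M) =
         complex_of_real (vv F powr e_exp F C m M) \<odot>\<^bsub>DHe F C m\<^esub>
           uK_basis C m M (\<lambda>i. Half (\<ominus>\<^bsub>K0 C\<^esub> alt_sum C m M (i + 1) 0))))"
proof -
  interpret field F by fact
  interpret hall_category F C by unfold_locales fact+
  obtain \<phi> where \<phi>: "algebra_embedding (DH F C m) (DHe F C m) \<phi>"
    "\<And>M. \<forall>i<m. M i \<in> Ob C \<Longrightarrow> \<phi> (u_basis C m M) = (\<lambda>d. complex_of_real (vv F powr twist_exp m M) * uK_basis C m M (twist m M) d)"
    using twist_embedding[OF assms(1)] by blast
  have s: "c \<odot>\<^bsub>DHe F C m\<^esub> f = (\<lambda>d. c * f d)" for c f by (simp add: DHe_def based_algebra_def)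
  have v: "vv F > 0" using card_F by (simp add: vv_def)
  \<comment> \<open>For m = 1 the alternating sum has the single term M_0.\<close>
  have t: "uK_basis C m M (twist m M) = uK_basis C m M (\<lambda>i. Half (\<ominus>\<^bsub>K0 C\<^esub> hat C (M 0)))"
    if "m = 1" "\<forall>i<m. M i \<in> Ob C" for M
  proof -
    have "alt_sum C m M (i + 1) 0 = hat C (M 0)" for i
      using alt_sum_cls[of m M "i + 1" 0] that by (simp add: asum_def ssgn_def hat_cls)
    then show ?thesis by (simp add: uK_basis_def twist_def)
  qed
  have "\<phi> (u_basis C m M) = uK_basis C m M (\<lambda>i. Half (\<ominus>\<^bsub>K0 C\<^esub> hat C (M 0)))" if "\<forall>i<m. M i \<in> Ob C" "m = 1" for M
    using \<phi>(2)[OF that(1)] v unfolding t[OF that(2,1)] by (simp add: twist_exp_def that(2))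
  moreover have "\<phi> (u_basis C m M) = complex_of_real (vv F powr e_exp F C m M) \<odot>\<^bsub>DHe F C m\<^esub>
      uK_basis C m M (\<lambda>i. Half (\<ominus>\<^bsub>K0 C\<^esub> alt_sum C m M (i + 1) 0))" if "\<forall>i<m. M i \<in> Ob C" "m > 1" for M
    using \<phi>(2)[OF that(1)] that(2) unfolding s twist_def by (simp add: twist_exp_def)
  ultimately show ?thesis using \<phi>(1) by blast
qed

end
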